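(* Let $\ell\ge0$, $|q|<1$, $\gamma\in\mathbb Z$, and let ${}^\vee\mathbf Q_\gamma$ be the dual Baxter operator acting on symmetric polynomials in $\ell+1$ variables by $$({}^\vee\mathbf Q_\gamma\cdot P)(x)=\int_Td^\times y\;\prod_{i=1}^{\ell+1}(x_iy_i)^\gamma\prod_{i,j=1}^{\ell+1}\Gamma_q(x_iy_j)\;\Delta^\vee_q(y)\,P(y^{-1}),\qquad 0<|x_i|<1 .$$ (i) The action of the dual Baxter operator on the $q$-Whittaker polynomials $P^{qW}_\lambda(x)$, $\lambda=(\lambda_1\ge\dots\ge\lambda_{\ell+1}\ge0)$ a partition, is $${}^\vee\mathbf Q_\gamma\cdot P^{qW}_\lambda(x)=\mathbf L^\vee_\gamma(\lambda)\,P^{qW}_\lambda(x),\qquad \mathbf L^\vee_\gamma(\lambda_1,\dots,\lambda_{\ell+1})=\frac{1}{(\lambda_{\ell+1}-\gamma)_q!},\qquad\text{when }\gamma\le\lambda_{\ell+1},$$ and $${}^\vee\mathbf Q_\gamma\cdot P^{qW}_\lambda(x)=0\qquad\text{when }\gamma>\lambda_{\ell+1}.$$ (ii) The dual Baxter operator satisfies the difference equation $$\bigl\{1-q^{-\gamma}H_1^\vee\bigr\}\circ{}^\vee\mathbf Q_\gamma={}^\vee\mathbf Q_{\gamma+1},\qquad H_1^\vee=\sum_{i=1}^{\ell+1}\ \prod_{j\ne i}\frac{x_j}{x_j-x_i}\;T_{q,x_i}.$$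
   Context: Notation: $\Gamma_q(x)=\prod_{j\ge0}\frac1{1-xq^j}$; $(n)_q!=\prod_{i=1}^n(1-q^{n+1-i})$ for $n\ge0$; $\Delta_q(\lambda)=\prod_{i=1}^{\ell}(\lambda_i-\lambda_{i+1})_q!$; $T_{q,x_i}$ replaces $x_i$ by $qx_i$. $T=\{y\in\mathbb C^{\ell+1}:|y_i|=1\}$ is the torus with Haar measure $d^\times y=\prod_{i=1}^{\ell+1}\frac1{2\pi\sqrt{-1}}\,d\log y_i$, $y^{-1}=(y_1^{-1},\dots,y_{\ell+1}^{-1})$, and $\Delta_q^\vee(y)=\prod_{i\ne j}\frac1{\Gamma_q(y_i^{-1}y_j)}$, $1\le i,j\le\ell+1$. $q$-Whittaker polynomials: $P^{qW}_\lambda(x)=\Delta_q(\lambda)^{-1}P_\lambda(x;q,t=0)$, where $P_\lambda(x;q,t)$ are the Macdonald polynomials in $x_1,\dots,x_{\ell+1}$, i.e. $P_\lambda=m_\lambda+\sum_{\mu<\lambda}u_{\lambda\mu}m_\mu$ ($m_\mu$ monomial symmetric functions, $<$ dominance order), orthogonal (as symmetric functions in infinitely many variables, before setting $x_i=0$ for $i>\ell+1$) for $\langle p_\lambda,p_\mu\rangle_{q,t}=\delta_{\lambda\mu}z_\lambda\prod_{i:\lambda_i>0}\frac{1-q^{\lambda_i}}{1-t^{\lambda_i}}$, where $p_\lambda$ are products of power sums, $z_\lambda=\prod_{n\ge1}n^{m_n}m_n!$, $m_n=|\{k:\lambda_k=n\}|$.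
   Formalization: The eigenvalue in (i) is corrected to (ℓ+1)! Γ_q(q)^ℓ L^∨_γ(λ), since Δ_q^∨ is not normalized (for ℓ=1, q=0, λ=0, γ=0 the integral is 2, not 1); (ii) is stated for q≠0 and pairwise distinct x_i, where q^{-γ}, T_{q,x_i} and the coefficients of H_1^∨ are defined. *)

theory Defs
  imports "HOL-Analysis.Analysis"
begin

text \<open>
  All indices are shifted by one: variables are \<open>x 0, x 1, \<dots>\<close>, the rank is \<open>l + 1\<close>, and the
  parts of a partition are \<open>lam 0 \<ge> lam 1 \<ge> \<dots>\<close>, so the last of \<open>l + 1\<close> parts is \<open>lam l\<close>.
\<close>

section \<open>Symmetric functions in infinitely many variables\<close>

definition is_partition :: "(nat \<Rightarrow> nat) \<Rightarrow> bool" where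
  "is_partition lam \<longleftrightarrow> antimono lam \<and> finite {i. lam i \<noteq> 0}"

definition part_size :: "(nat \<Rightarrow> nat) \<Rightarrow> nat" where
  "part_size lam = (\<Sum>i | lam i \<noteq> 0. lam i)"

definition dominance_less :: "(nat \<Rightarrow> nat) \<Rightarrow> (nat \<Rightarrow> nat) \<Rightarrow> bool" where
  "dominance_less \<mu> lam \<longleftrightarrow>
     \<mu> \<noteq> lam \<and> part_size \<mu> = part_size lam \<and> (\<forall>k. (\<Sum>i<k. \<mu> i) \<le> (\<Sum>i<k. lam i))"

text \<open>
  A symmetric function over \<open>\<complex>\<close> in infinitely many variables is represented by its values on the
  finitely supported sequences. As \<open>\<complex>\<close> is infinite, these values determine all its restrictions
  to finitely many variables, hence the symmetric function. The infinite sums below have only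
  finitely many nonzero terms at such sequences; values elsewhere are irrelevant.
\<close>

definition fin_supp :: "(nat \<Rightarrow> complex) \<Rightarrow> bool" where
  "fin_supp x \<longleftrightarrow> finite {i. x i \<noteq> 0}"

text \<open>The sum ranges over the distinct rearrangements of \<open>\<mu>\<close>, each counted once.\<close>

definition monomial_sf :: "(nat \<Rightarrow> nat) \<Rightarrow> (nat \<Rightarrow> complex) \<Rightarrow> complex" where
  "monomial_sf \<mu> x =
     (\<Sum>\<^sub>\<infinity>\<alpha>\<in>{\<alpha>. \<exists>\<pi>. bij \<pi> \<and> \<alpha> = \<mu> \<circ> \<pi>}. \<Prod>i | \<alpha> i \<noteq> 0. x i ^ \<alpha> i)"

definition power_sum :: "nat \<Rightarrow> (nat \<Rightarrow> complex) \<Rightarrow> complex" where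
  "power_sum n x = (\<Sum>\<^sub>\<infinity>i. x i ^ n)"

definition power_sum_part :: "(nat \<Rightarrow> nat) \<Rightarrow> (nat \<Rightarrow> complex) \<Rightarrow> complex" where
  "power_sum_part lam x = (\<Prod>i | lam i \<noteq> 0. power_sum (lam i) x)"

definition z_part :: "(nat \<Rightarrow> nat) \<Rightarrow> nat" where
  "z_part lam = (\<Prod>n\<in>range lam - {0}. n ^ card {k. lam k = n} * fact (card {k. lam k = n}))"

definition power_sum_expansion ::
    "((nat \<Rightarrow> complex) \<Rightarrow> complex) \<Rightarrow> ((nat \<Rightarrow> nat) \<Rightarrow> complex) \<Rightarrow> bool" where
  "power_sum_expansion f c \<longleftrightarrow>
     finite {lam. c lam \<noteq> 0} \<and> (\<forall>lam. c lam \<noteq> 0 \<longrightarrow> is_partition lam) \<and>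
     (\<forall>x. fin_supp x \<longrightarrow> f x = (\<Sum>lam | c lam \<noteq> 0. c lam * power_sum_part lam x))"

text \<open>Well defined on symmetric functions, since the power sum products form a basis.\<close>

definition power_sum_coeff ::
    "((nat \<Rightarrow> complex) \<Rightarrow> complex) \<Rightarrow> (nat \<Rightarrow> nat) \<Rightarrow> complex" where
  "power_sum_coeff f = (THE c. power_sum_expansion f c)"

text \<open>
  The bilinear form with \<open>\<langle>p\<^sub>\<lambda>, p\<^sub>\<mu>\<rangle> = \<delta>\<^sub>\<lambda>\<^sub>\<mu> z\<^sub>\<lambda> \<Prod>\<^sub>i (1 - q^\<lambda>\<^sub>i) / (1 - t^\<lambda>\<^sub>i)\<close>.
\<close>

definition macdonald_inner ::
    "complex \<Rightarrow> complex \<Rightarrow> ((nat \<Rightarrow> complex) \<Rightarrow> complex) \<Rightarrow> ((nat \<Rightarrow> complex) \<Rightarrow> complex) \<Rightarrow> complex" where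
  "macdonald_inner q t f g =
     (\<Sum>lam | power_sum_coeff f lam \<noteq> 0.
        power_sum_coeff f lam * power_sum_coeff g lam * of_nat (z_part lam) *
        (\<Prod>i | lam i \<noteq> 0. (1 - q ^ lam i) / (1 - t ^ lam i)))"

text \<open>
  \<open>P\<close> is the family of Macdonald symmetric functions with numerical parameters \<open>q\<close>, \<open>t\<close>.
  For \<open>\<bar>q\<bar> < 1\<close> and \<open>t = 0\<close> it exists and is unique (on finitely supported sequences), and it is
  the specialization at \<open>t = 0\<close> of the family over the field of rational functions in \<open>q\<close>, \<open>t\<close>:
  the latter has squared norms that are finite and nonzero there.
\<close>

definition macdonald_family ::
    "complex \<Rightarrow> complex \<Rightarrow> ((nat \<Rightarrow> nat) \<Rightarrow> (nat \<Rightarrow> complex) \<Rightarrow> complex) \<Rightarrow> bool" where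
  "macdonald_family q t P \<longleftrightarrow>
     (\<forall>lam. is_partition lam \<longrightarrow>
        (\<exists>u. \<forall>x. fin_supp x \<longrightarrow>
           P lam x = monomial_sf lam x +
             (\<Sum>\<mu> | is_partition \<mu> \<and> dominance_less \<mu> lam. u \<mu> * monomial_sf \<mu> x))) \<and>
     (\<forall>lam \<mu>. is_partition lam \<longrightarrow> is_partition \<mu> \<longrightarrow> lam \<noteq> \<mu> \<longrightarrow>
        macdonald_inner q t (P lam) (P \<mu>) = 0)"


section \<open>The q-Whittaker polynomials\<close>

definition q_fact :: "complex \<Rightarrow> nat \<Rightarrow> complex" where
  "q_fact q n = (\<Prod>i = 1..n. 1 - q ^ (n + 1 - i))"

definition Delta_q :: "nat \<Rightarrow> complex \<Rightarrow> (nat \<Rightarrow> nat) \<Rightarrow> complex" where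
  "Delta_q l q lam = (\<Prod>i<l. q_fact q (lam i - lam (Suc i)))"

text \<open>
  For a family \<open>P\<close> of Macdonald functions at \<open>t = 0\<close> and a partition with at most \<open>l + 1\<close> parts;
  the polynomial in \<open>l + 1\<close> variables is obtained by setting the variables beyond \<open>x l\<close> to zero.
\<close>

definition q_whittaker ::
    "nat \<Rightarrow> complex \<Rightarrow> ((nat \<Rightarrow> nat) \<Rightarrow> (nat \<Rightarrow> complex) \<Rightarrow> complex) \<Rightarrow>
     (nat \<Rightarrow> nat) \<Rightarrow> (nat \<Rightarrow> complex) \<Rightarrow> complex" where
  "q_whittaker l q P lam x = P lam (\<lambda>i. if i \<le> l then x i else 0) / Delta_q l q lam"


section \<open>The dual Baxter operator\<close>

definition symmetric_poly :: "nat \<Rightarrow> ((nat \<Rightarrow> complex) \<Rightarrow> complex) \<Rightarrow> bool" where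
  "symmetric_poly l F \<longleftrightarrow>
     (\<exists>A c. finite A \<and> (\<forall>x. F x = (\<Sum>\<alpha>\<in>A. c \<alpha> * (\<Prod>i\<le>l. x i ^ (\<alpha> i :: nat))))) \<and>
     (\<forall>\<pi> x. \<pi> permutes {..l} \<longrightarrow> F (x \<circ> \<pi>) = F x)"

text \<open>
  At a pole \<open>x q^j = 1\<close> the product evaluates to \<open>0\<close>, so that its reciprocal has the correct
  value \<open>0\<close> there.
\<close>

definition Gamma_q :: "complex \<Rightarrow> complex \<Rightarrow> complex" where
  "Gamma_q q x = (\<Prod>j. 1 / (1 - x * q ^ j))"

text \<open>
  On the unit circle, \<open>d log y / (2 \<pi> \<i>) = d\<theta> / (2 \<pi>)\<close> for \<open>y = exp (\<i> \<theta>)\<close>.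
\<close>

definition circle_haar :: "complex measure" where
  "circle_haar = distr (uniform_measure lborel {0..<2 * pi}) borel cis"

definition torus_haar :: "nat \<Rightarrow> (nat \<Rightarrow> complex) measure" where
  "torus_haar l = PiM {..l} (\<lambda>_. circle_haar)"

definition Delta_dual :: "nat \<Rightarrow> complex \<Rightarrow> (nat \<Rightarrow> complex) \<Rightarrow> complex" where
  "Delta_dual l q y = (\<Prod>i\<le>l. \<Prod>j\<in>{..l} - {i}. 1 / Gamma_q q (inverse (y i) * y j))"

text \<open>
  The weight \<open>Delta_dual\<close> is not normalized: its integral over the torus is
  \<open>(l + 1)! * Gamma_q q q ^ l\<close> rather than \<open>1\<close>. This factor multiplies every eigenvalue of the
  operator.
\<close>

definition dual_baxter ::
    "nat \<Rightarrow> complex \<Rightarrow> int \<Rightarrow> ((nat \<Rightarrow> complex) \<Rightarrow> complex) \<Rightarrow> (nat \<Rightarrow> complex) \<Rightarrow> complex" where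
  "dual_baxter l q \<gamma> F x =
     (LINT y|torus_haar l.
        (\<Prod>i\<le>l. (x i * y i) powi \<gamma>) * (\<Prod>i\<le>l. \<Prod>j\<le>l. Gamma_q q (x i * y j)) *
        Delta_dual l q y * F (\<lambda>i. inverse (y i)))"

definition L_dual :: "nat \<Rightarrow> complex \<Rightarrow> int \<Rightarrow> (nat \<Rightarrow> nat) \<Rightarrow> complex" where
  "L_dual l q \<gamma> lam = 1 / q_fact q (nat (int (lam l) - \<gamma>))"

definition H1_dual ::
    "nat \<Rightarrow> complex \<Rightarrow> ((nat \<Rightarrow> complex) \<Rightarrow> complex) \<Rightarrow> (nat \<Rightarrow> complex) \<Rightarrow> complex" where
  "H1_dual l q F x =
     (\<Sum>i\<le>l. (\<Prod>j\<in>{..l} - {i}. x j / (x j - x i)) * F (x(i := q * x i)))"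

end

theory Submission
  imports Defs "HOL-Complex_Analysis.Complex_Analysis" "HOL-Probability.Probability"
begin

text \<open>
Write \<open>\<langle>f, h\<rangle>\<close> for the integral over the torus of \<open>f(y) h(y\<^sup>-\<^sup>1)\<close> against the weight
\<open>\<Delta>(y) = \<Prod>\<^sub>i\<^sub>\<noteq>\<^sub>j (y\<^sub>j / y\<^sub>i; q)\<^sub>\<infinity>\<close>. The eigenvalues of the Baxter operator come from three facts about
the Macdonald functions \<open>P\<^sub>\<nu>\<close> at \<open>t = 0\<close>.

The Cauchy identity. The kernel \<open>\<Prod> \<Gamma>\<^sub>q(x\<^sub>i y\<^sub>j)\<close> is the reproducing kernel of the inner product
that defines \<open>P\<^sub>\<nu>\<close>, hence equals \<open>\<Sum>\<^sub>\<nu> P\<^sub>\<nu>(x) P\<^sub>\<nu>(y) / N\<^sub>\<nu>\<close> with \<open>N\<^sub>\<nu> = \<langle>P\<^sub>\<nu>, P\<^sub>\<nu>\<rangle>\<^sub>q\<^sub>,\<^sub>0\<close>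
(\<open>cauchy_identity\<close>). Expanding the product directly, it also equals
\<open>\<Sum>\<^sub>\<kappa> m\<^sub>\<kappa>(x) g\<^sub>\<kappa>(y)\<close>, where \<open>g\<^sub>\<kappa>\<close> is the product of the complete q-functions \<open>g\<^sub>a\<close> over the parts
\<open>a\<close> of \<open>\<kappa>\<close> (\<open>Kp_monomial\<close>).

Orthogonality on the torus. Comparing the two expansions of the kernel, triangularity of the matrix
\<open>\<langle>P\<^sub>\<nu>, P\<^sub>\<lambda>\<rangle>\<close> follows from triangularity of \<open>\<langle>g\<^sub>\<kappa>, m\<^sub>\<mu>\<rangle>\<close> with respect to dominance; since the pairing
is symmetric, the former matrix is then diagonal. Triangularity of \<open>\<langle>g\<^sub>\<kappa>, m\<^sub>\<mu>\<rangle>\<close> rests on the expansion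
\<open>gp_Dl_expansion\<close>, obtained by partial fractions of the generating function of \<open>g\<^sub>a\<close>:
\<open>g\<^sub>a(y) \<Delta>(y)\<close> is a sum over \<open>j\<close> of \<open>y\<^sub>j\<^sup>a\<close>, times an entire function of the ratios \<open>y\<^sub>j / y\<^sub>i\<close>, times the
weight of the remaining variables. Multiplying by \<open>g\<^sub>a\<close> for the \<open>k\<close> largest parts \<open>a\<close> of \<open>\<kappa>\<close> therefore
produces a sum of functions each of which has, in some group of \<open>k\<close> variables, degree at least the
sum of these parts, and a function of positive degree in a group of variables integrates to zero by the
mean value property. Taking \<open>k = 1\<close> repeatedly, and evaluating the mean value at the centre of the
disc, gives the diagonal entries \<open>\<langle>g\<^sub>\<lambda>, m\<^sub>\<lambda>\<rangle>\<close> (\<open>gp_integral_diag\<close>), and these give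
\<open>\<langle>P\<^sub>\<lambda>, P\<^sub>\<lambda>\<rangle> = N\<^sub>\<lambda> (l + 1)! \<Gamma>\<^sub>q(q)\<^sup>l / (\<lambda>\<^sub>l; q)!\<close>, where \<open>\<lambda>\<^sub>l\<close> is the last of the \<open>l + 1\<close> parts and
\<open>(n; q)!\<close> stands for \<open>(1 - q) \<dots> (1 - q\<^sup>n)\<close>.

Shift of the index. Multiplication by the product of all \<open>l + 1\<close> variables adds a full column to
the partition (\<open>Y_pv\<close>); this follows from torus orthogonality, which is invariant under this
multiplication. So the factor \<open>\<Prod> (x\<^sub>i y\<^sub>i)\<^sup>\<gamma>\<close> only shifts partitions by \<open>\<gamma>\<close>. In the integral of the
Cauchy series against \<open>P\<^sub>\<lambda>(y\<^sup>-\<^sup>1)\<close> a single term survives, the one of \<open>\<lambda> - \<gamma>\<close>, and the factor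
\<open>N\<^sub>\<lambda>\<^sub>-\<^sub>\<gamma>\<close> cancels; if \<open>\<lambda> - \<gamma>\<close> has a negative part, no term survives.

The difference equation holds already under the integral sign. Replacing \<open>x\<^sub>i\<close> by \<open>q x\<^sub>i\<close> multiplies
the integrand by \<open>q\<^sup>\<gamma> \<Prod>\<^sub>j (1 - x\<^sub>i y\<^sub>j)\<close>, and the Lagrange type identity
\<open>\<Sum>\<^sub>i \<Prod>\<^sub>j\<^sub>\<noteq>\<^sub>i x\<^sub>j / (x\<^sub>j - x\<^sub>i) \<Prod>\<^sub>j (1 - x\<^sub>i y\<^sub>j) = 1 - \<Prod> x\<^sub>i \<Prod> y\<^sub>j\<close> (\<open>sum_lag_prod\<close>) leaves exactly the factor
that raises \<open>\<gamma>\<close> by one.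
\<close>

section \<open>The infinite q-Pochhammer symbol\<close>

locale q_disc =
  fixes q :: complex
  assumes norm_q: "norm q < 1"
begin

text \<open>
The symbol \<open>(z; q)\<^sub>\<infinity>\<close>, which is the reciprocal of \<open>\<Gamma>\<^sub>q(z)\<close> but entire in \<open>z\<close>.
\<close>

definition einf :: "complex \<Rightarrow> complex" where
  "einf z = (\<Prod>j. 1 - z * q ^ j)"

text \<open>
The finite symbol \<open>(z; q)\<^sub>n\<close>.
\<close>

definition qpoch :: "complex \<Rightarrow> nat \<Rightarrow> complex" where
  "qpoch z n = (\<Prod>j<n. 1 - z * q ^ j)"

text \<open>
The symbol \<open>(q; q)\<^sub>n\<close>, which equals \<open>q_fact q n\<close>.
\<close>

definition qp :: "nat \<Rightarrow> complex" where
  "qp n = qpoch q n"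

lemma q_power_neq_1: "1 - q ^ n \<noteq> 0" if "n > 0"
proof -
  have "norm (q ^ n) < 1" using norm_q that by (simp add: norm_power power_less_one_iff)
  then show ?thesis by auto
qed

lemma qp_0 [simp]: "qp 0 = 1" by (simp add: qp_def qpoch_def)

lemma qp_Suc: "qp (Suc n) = qp n * (1 - q ^ Suc n)"
  by (simp add: qp_def qpoch_def)

lemma qp_nonzero [simp]: "qp n \<noteq> 0"
  by (induction n) (use q_power_neq_1 in \<open>auto simp: qp_Suc simp del: power_Suc\<close>)

lemma q_fact_eq_qp: "q_fact q n = qp n"
proof -
  have "q_fact q n = (\<Prod>i=1..n. 1 - q ^ i)"
    unfolding q_fact_def by (rule prod.atLeastAtMost_rev[THEN trans]) auto
  also have "\<dots> = (\<Prod>j<n. 1 - q ^ Suc j)"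
    by (rule prod.reindex_bij_witness[of _ Suc "\<lambda>i. i - 1"]) auto
  finally show ?thesis by (simp add: qp_def qpoch_def)
qed

lemma summable_norm_zq: "summable (\<lambda>j. norm (z * q ^ j))"
  using norm_q by (auto simp: norm_mult norm_power intro!: summable_mult summable_geometric)

lemma convergent_prod_factors: "convergent_prod (\<lambda>j. 1 - z * q ^ j)"
proof -
  have "summable (\<lambda>j. norm ((1 - z * q ^ j) - 1))"
    using summable_norm_zq[of z] by simp
  then show ?thesis
    by (intro abs_convergent_prod_imp_convergent_prod) (simp add: abs_convergent_prod_conv_summable)
qed

lemma einf_0 [simp]: "einf 0 = 1" by (simp add: einf_def)

lemma qpoch_tendsto_einf: "qpoch z \<longlonglongrightarrow> einf z"
proof -
  have "(\<lambda>j. 1 - z * q ^ j) has_prod einf z"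
    unfolding einf_def using convergent_prod_factors by (rule convergent_prod_has_prod)
  then have "(\<lambda>n. \<Prod>j\<le>n. 1 - z * q ^ j) \<longlonglongrightarrow> einf z"
    by (rule has_prod_imp_tendsto)
  then have "(\<lambda>n. qpoch z (Suc n)) \<longlonglongrightarrow> einf z"
    by (simp add: qpoch_def lessThan_Suc_atMost)
  then show ?thesis by (rule LIMSEQ_imp_Suc)
qed

lemma einf_zero_iff: "einf z = 0 \<longleftrightarrow> (\<exists>j. z * q ^ j = 1)"
  using has_prod_eq_0_iff[OF convergent_prod_has_prod[OF convergent_prod_factors[of z]]]
  by (auto simp: einf_def image_iff)

lemma einf_nonzero: "norm z < 1 \<Longrightarrow> einf z \<noteq> 0"
proof
  assume z: "norm z < 1" and "einf z = 0"
  then obtain j where "z * q ^ j = 1" by (auto simp: einf_zero_iff)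
  then have "norm z * norm q ^ j = 1" by (metis norm_mult norm_power norm_one)
  moreover have "norm q ^ j \<le> 1" using norm_q by (simp add: power_le_one)
  then have "norm z * norm q ^ j \<le> norm z" by (simp add: mult_left_le)
  ultimately show False using z by linarith
qed

lemma einf_split: "einf z = qpoch z k * einf (q ^ k * z)"
proof -
  have "(\<lambda>n. qpoch z (n + k)) \<longlonglongrightarrow> einf z"
    using qpoch_tendsto_einf by (rule LIMSEQ_ignore_initial_segment)
  moreover have "qpoch z (n + k) = qpoch z k * qpoch (q ^ k * z) n" for n
    by (induction n) (auto simp: qpoch_def power_add mult_ac)
  ultimately have "(\<lambda>n. qpoch z k * qpoch (q ^ k * z) n) \<longlonglongrightarrow> einf z" by simp
  moreover have "(\<lambda>n. qpoch z k * qpoch (q ^ k * z) n) \<longlonglongrightarrow> qpoch z k * einf (q ^ k * z)"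
    by (intro tendsto_intros qpoch_tendsto_einf)
  ultimately show ?thesis by (rule LIMSEQ_unique)
qed

lemma qpoch_Suc_shift: "qpoch z (Suc k) = (1 - z) * qpoch (q * z) k"
  unfolding qpoch_def by (subst prod.lessThan_Suc_shift) (simp add: mult_ac)

lemma einf_rec: "einf z = (1 - z) * einf (q * z)"
  using einf_split[of z 1] by (simp add: qpoch_def)

lemma einf_split_Suc: "einf z = (1 - z) * qpoch (q * z) k * einf (q ^ Suc k * z)"
  using einf_split[of z "Suc k"] by (simp add: qpoch_Suc_shift)

lemma einf_one [simp]: "einf 1 = 0" by (subst einf_rec) simp

text \<open>
At a pole both sides are \<open>0\<close>: the infinite product of reciprocals has a factor \<open>1 / 0 = 0\<close>.
\<close>

lemma inverse_Gamma_q: "1 / Gamma_q q z = einf z"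
proof (cases "\<exists>j. z * q ^ j = 1")
  case True
  then obtain j where j: "z * q ^ j = 1" by blast
  have "convergent_prod (\<lambda>j. inverse (1 - z * q ^ j))"
    using convergent_prod_factors by (rule convergent_prod_inverse)
  then have hp: "(\<lambda>j. 1 / (1 - z * q ^ j)) has_prod Gamma_q q z"
    unfolding Gamma_q_def by (simp add: divide_inverse convergent_prod_has_prod)
  have "1 / (1 - z * q ^ j) = 0" using j by simp
  then have "Gamma_q q z = 0" using has_prod_eq_0_iff[OF hp] by (metis rangeI)
  then show ?thesis using True einf_zero_iff by simp
next
  case False
  have "Gamma_q q z = inverse (einf z)"
  proof -
    have "(\<lambda>j. 1 - z * q ^ j) has_prod einf z"
      unfolding einf_def using convergent_prod_factors by (rule convergent_prod_has_prod)
    then have "(\<lambda>j. inverse (1 - z * q ^ j)) has_prod inverse (einf z)"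
      by (rule has_prod_inverse)
    then show ?thesis unfolding Gamma_q_def
      by (simp add: divide_inverse has_prod_unique[symmetric])
  qed
  then show ?thesis by (simp add: divide_inverse)
qed

lemma Gamma_q_eq: "Gamma_q q z = 1 / einf z"
  unfolding inverse_Gamma_q[of z, symmetric] by simp

lemma inverse_qp_bounded: obtains B where "B > 0" "\<And>k. norm (1 / qp k) \<le> B"
proof -
  have "(\<lambda>k. 1 / qp k) \<longlonglongrightarrow> 1 / einf q"
    using qpoch_tendsto_einf[of q] einf_nonzero[of q] norm_q unfolding qp_def
    by (intro tendsto_divide tendsto_const) auto
  then have "Bseq (\<lambda>k. 1 / qp k)" by (intro convergent_imp_Bseq convergentI)
  then obtain B where "B > 0" "\<forall>k. norm (1 / qp k) \<le> B" by (rule BseqE)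
  then show ?thesis using that by blast
qed

lemma euler_summable: "norm z < 1 \<Longrightarrow> summable (\<lambda>k. norm (z ^ k / qp k))"
proof -
  assume z: "norm z < 1"
  obtain B where B: "B > 0" "\<And>k. norm (1 / qp k) \<le> B" using inverse_qp_bounded by blast
  have le: "norm (norm (z ^ k / qp k)) \<le> B * norm z ^ k" for k
  proof -
    have "norm (norm (z ^ k / qp k)) = norm (1 / qp k) * norm z ^ k"
      by (simp add: norm_divide norm_power)
    also have "\<dots> \<le> B * norm z ^ k" using B(2)[of k] by (intro mult_right_mono) auto
    finally show ?thesis .
  qed
  have "summable (\<lambda>k. B * norm z ^ k)"
    using z by (intro summable_mult summable_geometric) simp
  then show "summable (\<lambda>k. norm (z ^ k / qp k))"
    by (rule summable_comparison_test') (rule le)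
qed

text \<open>
The series of Euler's identity \<open>\<Sum> z\<^sup>k / (q; q)\<^sub>k = 1 / (z; q)\<^sub>\<infinity>\<close>.
\<close>

definition euler :: "complex \<Rightarrow> complex" where "euler z = (\<Sum>k. z ^ k / qp k)"

lemma euler_sums: "norm z < 1 \<Longrightarrow> (\<lambda>k. z ^ k / qp k) sums euler z"
  unfolding euler_def by (rule summable_sums[OF summable_norm_cancel[OF euler_summable]])

lemma euler_holomorphic: "euler holomorphic_on ball 0 1"
  by (rule power_series_holomorphic[of 0 1 "\<lambda>k. 1 / qp k"]) (use euler_sums in \<open>auto simp: dist_norm\<close>)

lemma norm_q_mult: "norm z < 1 \<Longrightarrow> norm (q * z) < 1"
  using norm_q mult_left_le_one_le[of "norm z" "norm q"] by (simp add: norm_mult)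

lemma norm_q_power_mult: "norm z < 1 \<Longrightarrow> norm (q ^ n * z) < 1"
  by (induction n) (auto simp: mult.assoc intro: norm_q_mult)

lemma euler_rec: "norm z < 1 \<Longrightarrow> euler z * (1 - z) = euler (q * z)"
proof -
  assume z: "norm z < 1"
  have s1: "(\<lambda>k. z ^ Suc k / qp (Suc k)) sums (euler z - 1)"
    using sums_split_initial_segment[OF euler_sums[OF z], of 1] by simp
  have s2: "(\<lambda>k. z * (z ^ k / qp k)) sums (z * euler z)"
    using euler_sums[OF z] by (rule sums_mult)
  have "(\<lambda>k. z ^ Suc k / qp (Suc k) - z * (z ^ k / qp k)) sums (euler z - 1 - z * euler z)"
    using s1 s2 by (rule sums_diff)
  moreover have "z ^ Suc k / qp (Suc k) - z * (z ^ k / qp k) = (q * z) ^ Suc k / qp (Suc k)" for k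
    using qp_nonzero[of k] q_power_neq_1[of "Suc k"]
    by (simp add: qp_Suc power_mult_distrib divide_simps del: power_Suc qp_nonzero) (simp add: algebra_simps)
  ultimately have "(\<lambda>k. (q * z) ^ Suc k / qp (Suc k)) sums (euler z - 1 - z * euler z)" by simp
  moreover have "(\<lambda>k. (q * z) ^ Suc k / qp (Suc k)) sums (euler (q * z) - 1)"
    using sums_split_initial_segment[OF euler_sums[OF norm_q_mult[OF z]], of 1] by simp
  ultimately have "euler z - 1 - z * euler z = euler (q * z) - 1" by (rule sums_unique2)
  then show ?thesis by (simp add: algebra_simps)
qed

lemma euler_0 [simp]: "euler 0 = 1"
proof -
  have "(\<lambda>k. 0 ^ k / qp k) sums (0 ^ 0 / qp 0)"
    by (rule sums_single[of 0 "\<lambda>k. 0 ^ k / qp k", THEN sums_cong[THEN iffD1, rotated]]) auto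
  then show ?thesis using euler_sums[of 0] by (auto dest: sums_unique2)
qed

text \<open>
By the recursion for the series, \<open>euler z * qpoch z n\<close> equals \<open>euler (q ^ n * z)\<close>, which tends to
\<open>euler 0 = 1\<close>.
\<close>

lemma euler_einf: "norm z < 1 \<Longrightarrow> euler z * einf z = 1"
proof -
  assume z: "norm z < 1"
  have eq: "euler z * qpoch z n = euler (q ^ n * z)" for n
  proof (induction n)
    case (Suc n)
    have "euler z * qpoch z (Suc n) = euler (q ^ n * z) * (1 - q ^ n * z)"
      using Suc by (simp add: qpoch_def mult_ac)
    also have "\<dots> = euler (q ^ Suc n * z)"
      using euler_rec[OF norm_q_power_mult[OF z]] by (simp add: mult_ac)
    finally show ?case .
  qed (simp add: qpoch_def)
  have "isCont euler 0"
    using holomorphic_on_imp_continuous_on[OF euler_holomorphic]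
    by (auto simp: continuous_on_eq_continuous_at)
  moreover have "(\<lambda>n. q ^ n * z) \<longlonglongrightarrow> 0"
    using tendsto_mult_left_zero[OF LIMSEQ_power_zero[OF norm_q]] by simp
  ultimately have "(\<lambda>n. euler (q ^ n * z)) \<longlonglongrightarrow> euler 0"
    by (rule isCont_tendsto_compose)
  moreover have "(\<lambda>n. euler z * qpoch z n) \<longlonglongrightarrow> euler z * einf z"
    by (intro tendsto_intros qpoch_tendsto_einf)
  ultimately show ?thesis unfolding eq euler_0 by (rule LIMSEQ_unique[symmetric])
qed

lemma Gamma_q_eq_euler: "norm z < 1 \<Longrightarrow> Gamma_q q z = euler z"
  using euler_einf[of z] einf_nonzero[of z] by (simp add: Gamma_q_eq field_simps)

lemma Gamma_q_sums: "norm z < 1 \<Longrightarrow> (\<lambda>k. z ^ k / qp k) sums Gamma_q q z"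
  using euler_sums Gamma_q_eq_euler by simp

text \<open>
Inside the unit disc the function is the reciprocal of a power series without zeros; the functional
equation extends holomorphy to discs of any radius.
\<close>

lemma einf_holomorphic: "einf holomorphic_on UNIV"
proof -
  have 1: "einf holomorphic_on ball 0 1"
  proof -
    have "euler z \<noteq> 0" if "z \<in> ball 0 1" for z
      using euler_einf[of z] that by (auto simp: dist_norm)
    then have "(\<lambda>z. 1 / euler z) holomorphic_on ball 0 1"
      by (intro holomorphic_intros euler_holomorphic)
    moreover have "1 / euler z = einf z" if "z \<in> ball 0 1" for z
    proof -
      have "euler z * einf z = 1" using euler_einf[of z] that by (auto simp: dist_norm)
      then show ?thesis by (metis nonzero_eq_divide_eq mult.commute mult_zero_left zero_neq_one)
    qed
    ultimately show ?thesis by (rule holomorphic_transform)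
  qed
  have "einf holomorphic_on ball 0 R" if "R > 0" for R
  proof -
    have "(\<lambda>n. norm q ^ n * R) \<longlonglongrightarrow> 0"
      using norm_q by (intro tendsto_mult_left_zero LIMSEQ_power_zero) auto
    then have "eventually (\<lambda>n. norm q ^ n * R < 1) sequentially"
      by (rule order_tendstoD) auto
    then obtain n where n: "norm q ^ n * R < 1" by (auto simp: eventually_sequentially)
    have im: "(\<lambda>z. q ^ n * z) ` ball 0 R \<subseteq> ball 0 1"
    proof clarsimp
      fix z :: complex assume "norm z < R"
      then have "norm q ^ n * norm z \<le> norm q ^ n * R" by (intro mult_left_mono) auto
      then show "norm (q ^ n * z) < 1" using n by (simp add: norm_mult norm_power)
    qed
    have "(\<lambda>z. qpoch z n * (einf \<circ> (\<lambda>z. q ^ n * z)) z) holomorphic_on ball 0 R"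
      unfolding qpoch_def
      by (intro holomorphic_intros holomorphic_on_compose[OF _ holomorphic_on_subset[OF 1 im]])
    then show ?thesis by (rule holomorphic_transform) (simp add: einf_split[symmetric])
  qed
  moreover have "z \<in> ball 0 (norm z + 1)" for z :: complex by (simp add: dist_norm)
  ultimately have "einf field_differentiable (at z)" for z
    by (metis holomorphic_on_imp_differentiable_at open_ball norm_ge_zero add_nonneg_pos zero_less_one)
  then show ?thesis by (simp add: holomorphic_on_def field_differentiable_at_within)
qed

lemma einf_continuous: "continuous_on A einf"
  by (metis einf_holomorphic holomorphic_on_imp_continuous_on continuous_on_subset subset_UNIV)

lemma einf_measurable [measurable]: "einf \<in> borel_measurable borel"
  by (intro borel_measurable_continuous_onI einf_continuous)

end

section \<open>Integration over the torus\<close>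

lemma sets_circle_haar [simp, measurable_cong]: "sets circle_haar = sets borel"
  by (simp add: circle_haar_def)

lemma space_circle_haar [simp]: "space circle_haar = UNIV"
  by (simp add: circle_haar_def)

lemma cis_measurable [measurable]: "cis \<in> borel_measurable borel"
  by (intro borel_measurable_continuous_onI continuous_intros)

lemma emeasure_arc: "emeasure lborel {0..<2 * pi} = ennreal (2 * pi)"
  by simp

lemma prob_space_circle: "prob_space circle_haar"
  unfolding circle_haar_def
  by (intro prob_space.prob_space_distr prob_space_uniform_measure) (auto simp: emeasure_arc)

interpretation circle: prob_space circle_haar by (rule prob_space_circle)

lemma emeasure_circle:
  assumes [measurable]: "A \<in> sets borel"
  shows "emeasure circle_haar A = emeasure lborel ({0..<2 * pi} \<inter> cis -` A) / ennreal (2 * pi)"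
proof -
  have [measurable]: "cis -` A \<in> sets borel"
    using measurable_sets[OF cis_measurable assms] by simp
  show ?thesis unfolding circle_haar_def
    by (subst emeasure_distr) (auto simp: emeasure_arc)
qed

lemma emeasure_lborel_shift:
  fixes X :: "real set"
  assumes "X \<in> sets borel"
  shows "emeasure lborel ((\<lambda>t. s + t) -` X) = emeasure lborel X"
  by (subst (2) lborel_distr_plus[of s, symmetric], subst emeasure_distr) (use assms in auto)

lemma emeasure_lborel_reflect:
  fixes X :: "real set"
  assumes "X \<in> sets borel"
  shows "emeasure lborel (uminus -` X) = emeasure lborel X"
  by (subst (2) lborel_distr_uminus[symmetric], subst emeasure_distr) (use assms in auto)

lemma emeasure_periodic:
  fixes E :: "real set"
  assumes [measurable]: "E \<in> sets borel" and per: "\<And>t. t + 2 * pi \<in> E \<longleftrightarrow> t \<in> E"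
    and s: "0 \<le> s" "s < 2 * pi"
  shows "emeasure lborel (E \<inter> {s..<s + 2 * pi}) = emeasure lborel (E \<inter> {0..<2 * pi})"
proof -
  have "emeasure lborel (E \<inter> {s..<s + 2 * pi}) =
      emeasure lborel (E \<inter> {s..<2 * pi}) + emeasure lborel (E \<inter> {2 * pi..<s + 2 * pi})"
    by (subst plus_emeasure) (use s in \<open>auto intro!: arg_cong[of _ _ "emeasure lborel"]\<close>)
  also have "emeasure lborel (E \<inter> {2 * pi..<s + 2 * pi}) =
      emeasure lborel ((\<lambda>t. 2 * pi + t) -` (E \<inter> {2 * pi..<s + 2 * pi}))"
    by (subst emeasure_lborel_shift) auto
  also have "(\<lambda>t. 2 * pi + t) -` (E \<inter> {2 * pi..<s + 2 * pi}) = E \<inter> {0..<s}"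
    using per by (auto simp: add.commute)
  also have "emeasure lborel (E \<inter> {s..<2 * pi}) + emeasure lborel (E \<inter> {0..<s}) =
      emeasure lborel (E \<inter> {0..<2 * pi})"
    by (subst plus_emeasure) (use s in \<open>auto intro!: arg_cong[of _ _ "emeasure lborel"]\<close>)
  finally show ?thesis .
qed

lemma cis_periodic: "cis (t + 2 * pi) = cis t"
  by (simp add: cis_mult[symmetric])

text \<open>
In the parameter a rotation is a translation modulo \<open>2 * pi\<close>, and the measure of a
\<open>2 * pi\<close>-periodic set in a period interval does not depend on the interval.
\<close>

lemma circle_rotate:
  assumes "norm c = 1"
  shows "distr circle_haar borel (\<lambda>z. c * z) = circle_haar"
proof (rule measure_eqI)
  fix A assume "A \<in> sets (distr circle_haar borel (\<lambda>z. c * z))"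
  then have A [measurable]: "A \<in> sets borel" by simp
  define s where "s = Arg2pi c"
  have s: "0 \<le> s" "s < 2 * pi" "c = cis s"
    using Arg2pi[of c] assms by (auto simp: s_def cis_conv_exp is_Arg_def)
  define E where "E = cis -` A"
  have E [measurable]: "E \<in> sets borel"
    using measurable_sets[OF cis_measurable A] by (simp add: E_def)
  have "emeasure (distr circle_haar borel (\<lambda>z. c * z)) A = emeasure circle_haar ((\<lambda>z. c * z) -` A)"
    by (subst emeasure_distr) auto
  also have "\<dots> = emeasure lborel ({0..<2 * pi} \<inter> cis -` ((\<lambda>z. c * z) -` A)) / ennreal (2 * pi)"
  proof (rule emeasure_circle)
    have "(\<lambda>z. c * z) \<in> borel_measurable borel" by measurable
    from measurable_sets[OF this A] show "(\<lambda>z. c * z) -` A \<in> sets borel" by simp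
  qed
  also have "{0..<2 * pi} \<inter> cis -` ((\<lambda>z. c * z) -` A) = (\<lambda>t. s + t) -` (E \<inter> {s..<s + 2 * pi})"
    by (auto simp: s(3) cis_mult E_def)
  also have "emeasure lborel \<dots> = emeasure lborel (E \<inter> {s..<s + 2 * pi})"
    by (rule emeasure_lborel_shift) measurable
  also have "\<dots> = emeasure lborel (E \<inter> {0..<2 * pi})"
    by (rule emeasure_periodic) (auto simp: s E_def cis_periodic measurable_sets[OF cis_measurable A, simplified])
  also have "\<dots> / ennreal (2 * pi) = emeasure circle_haar A"
    by (subst emeasure_circle) (auto simp: E_def Int_commute)
  finally show "emeasure (distr circle_haar borel (\<lambda>z. c * z)) A = emeasure circle_haar A" .
qed simp

lemma circle_inverse: "distr circle_haar borel inverse = circle_haar"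
proof (rule measure_eqI)
  fix A assume "A \<in> sets (distr circle_haar borel inverse)"
  then have A [measurable]: "A \<in> sets borel" by simp
  define E where "E = cis -` A"
  have E [measurable]: "E \<in> sets borel"
    using measurable_sets[OF cis_measurable A] by (simp add: E_def)
  have "emeasure (distr circle_haar borel inverse) A = emeasure circle_haar (inverse -` A)"
    by (subst emeasure_distr) auto
  also have "\<dots> = emeasure lborel ({0..<2 * pi} \<inter> cis -` (inverse -` A)) / ennreal (2 * pi)"
  proof (rule emeasure_circle)
    have "inverse \<in> borel_measurable (borel :: complex measure)" by measurable
    from measurable_sets[OF this A] show "inverse -` A \<in> sets borel" by simp
  qed
  also have "{0..<2 * pi} \<inter> cis -` (inverse -` A) = uminus -` (E \<inter> {- (2 * pi)<..0})"
    by (auto simp: E_def cis_inverse)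
  also have "emeasure lborel \<dots> = emeasure lborel (E \<inter> {- (2 * pi)<..0})"
    by (rule emeasure_lborel_reflect) measurable
  also have "\<dots> = emeasure lborel ((\<lambda>t. - (2 * pi) + t) -` (E \<inter> {- (2 * pi)<..0}))"
    by (rule emeasure_lborel_shift[symmetric]) measurable
  also have "(\<lambda>t. - (2 * pi) + t) -` (E \<inter> {- (2 * pi)<..0}) = E \<inter> {0<..2 * pi}"
    using cis_periodic[of "_ - 2 * pi"] by (auto simp: E_def)
  also have "emeasure lborel (E \<inter> {0<..2 * pi}) = emeasure lborel (E \<inter> {0..<2 * pi})"
  proof (rule emeasure_eq_AE)
    have "AE t in lborel. t \<noteq> 0" "AE t in lborel. t \<noteq> 2 * pi"
      by (rule AE_lborel_singleton)+
    then show "AE x in lborel. (x \<in> E \<inter> {0<..2 * pi}) = (x \<in> E \<inter> {0..<2 * pi})"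
      by eventually_elim auto
  qed measurable
  also have "\<dots> / ennreal (2 * pi) = emeasure circle_haar A"
    by (subst emeasure_circle) (auto simp: E_def Int_commute)
  finally show "emeasure (distr circle_haar borel inverse) A = emeasure circle_haar A" .
qed simp

lemma AE_circle_norm: "AE z in circle_haar. norm z = 1"
  unfolding circle_haar_def by (subst AE_distr_iff) auto

lemma circle_integral:
  fixes f :: "complex \<Rightarrow> complex"
  assumes f: "continuous_on UNIV f" and I: "((\<lambda>t. f (cis t)) has_integral I) {0..2 * pi}"
  shows "integral\<^sup>L circle_haar f = I / (2 * pi)"
proof -
  have [measurable]: "f \<in> borel_measurable borel" by (intro borel_measurable_continuous_onI f)
  have cont: "continuous_on A (\<lambda>t. f (cis t))" for A
    by (intro continuous_on_compose2[OF f] continuous_intros) auto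
  have si: "set_integrable lborel {0..2 * pi} (\<lambda>t. f (cis t))"
    unfolding set_integrable_def by (intro borel_integrable_compact cont) auto
  have "uniform_measure lborel {0..<2 * pi} = density lborel (\<lambda>t. ennreal (indicator {0..<2 * pi} t / (2 * pi)))"
    unfolding uniform_measure_def emeasure_arc
    by (intro arg_cong[of _ _ "density lborel"] ext) (auto simp: indicator_def divide_ennreal[symmetric] split: if_splits)
  then have "integral\<^sup>L circle_haar f =
      integral\<^sup>L (density lborel (\<lambda>t. ennreal (indicator {0..<2 * pi} t / (2 * pi)))) (\<lambda>t. f (cis t))"
    unfolding circle_haar_def by (subst integral_distr) auto
  also have "\<dots> = (LINT t|lborel. (indicator {0..<2 * pi} t / (2 * pi)) *\<^sub>R f (cis t))"
    by (subst integral_density) auto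
  also have "\<dots> = (LINT t|lborel. (1 / (2 * pi)) *\<^sub>R (indicator {0..2 * pi} t *\<^sub>R f (cis t)))"
  proof (rule integral_cong_AE)
    show "AE t in lborel. (indicator {0..<2 * pi} t / (2 * pi)) *\<^sub>R f (cis t) =
        (1 / (2 * pi)) *\<^sub>R (indicator {0..2 * pi} t *\<^sub>R f (cis t))"
      using AE_lborel_singleton[of "2 * pi"] by eventually_elim (auto simp: indicator_def)
  qed measurable
  also have "\<dots> = (1 / (2 * pi)) *\<^sub>R (LINT t:{0..2 * pi}|lborel. f (cis t))"
    unfolding set_lebesgue_integral_def by (rule integral_scaleR_right)
  also have "(LINT t:{0..2 * pi}|lborel. f (cis t)) = I"
    using set_borel_integral_eq_integral(2)[OF si] integral_unique[OF I] by simp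
  finally show ?thesis by (simp add: scaleR_conv_of_real)
qed

text \<open>
The mean value property, as Cauchy's integral formula at the centre of the unit circle.
\<close>

lemma circle_mean:
  assumes "h holomorphic_on UNIV"
  shows "integral\<^sup>L circle_haar h = h 0"
proof -
  have cont: "continuous_on UNIV h" using assms by (rule holomorphic_on_imp_continuous_on)
  have "((\<lambda>u. h u / (u - 0)) has_contour_integral 2 * of_real pi * \<i> * h 0) (circlepath 0 1)"
    by (rule Cauchy_integral_circlepath_simple) (use assms holomorphic_on_subset in auto)
  then have "((\<lambda>t. h (0 + 1 * cis t) / (0 + 1 * cis t - 0) * 1 * \<i> * cis t) has_integral 2 * of_real pi * \<i> * h 0) {0..2 * pi}"
    unfolding circlepath_def by (subst (asm) has_contour_integral_part_circlepath_iff) auto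
  then have "((\<lambda>t. \<i> * h (cis t)) has_integral \<i> * (2 * of_real pi * h 0)) {0..2 * pi}"
    by (simp add: mult_ac)
  then have "((\<lambda>t. (- \<i>) * (\<i> * h (cis t))) has_integral (- \<i>) * (\<i> * (2 * of_real pi * h 0))) {0..2 * pi}"
    by (rule has_integral_mult_right)
  then have "((\<lambda>t. h (cis t)) has_integral (2 * of_real pi * h 0)) {0..2 * pi}"
    by (simp flip: mult.assoc)
  from circle_integral[OF cont this] show ?thesis by simp
qed

lemma circle_integrable:
  fixes f :: "complex \<Rightarrow> complex"
  assumes "f \<in> borel_measurable borel" "\<And>z. norm z = 1 \<Longrightarrow> norm (f z) \<le> B"
  shows "integrable circle_haar f"
  by (rule circle.integrable_const_bound[of _ B])
     (use AE_circle_norm assms in \<open>auto elim!: eventually_mono\<close>)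

lemma circle_powi: "(LINT z|circle_haar. z powi m) = (if m = 0 then 1 else 0)"
proof (cases "m \<ge> 0")
  case True
  then have eq: "z powi m = z ^ nat m" for z :: complex by (simp add: power_int_def)
  show ?thesis unfolding eq using True
    by (subst circle_mean) (auto intro!: holomorphic_intros simp: power_0_left)
next
  case False
  then have eq: "z powi m = inverse z ^ nat (- m)" for z :: complex by (simp add: power_int_def)
  have "(LINT z|circle_haar. z powi m) = (LINT z|distr circle_haar borel inverse. z ^ nat (- m))"
    unfolding eq by (subst integral_distr) auto
  also have "\<dots> = 0" unfolding circle_inverse using False
    by (subst circle_mean) (auto intro!: holomorphic_intros simp: power_0_left)
  finally show ?thesis using False by simp
qed

definition tor :: "nat set \<Rightarrow> (nat \<Rightarrow> complex) measure" where
  "tor I = PiM I (\<lambda>_. circle_haar)"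

lemma torus_haar_eq: "torus_haar l = tor {..l}"
  by (simp add: torus_haar_def tor_def)

interpretation circle_prod: product_sigma_finite "\<lambda>_::nat. circle_haar"
  by (rule product_sigma_finite.intro) (rule circle.sigma_finite_measure_axioms)

lemma prob_space_tor: "prob_space (tor I)"
  unfolding tor_def by (rule prob_space_PiM) (rule prob_space_circle)

lemma space_tor: "space (tor I) = extensional I"
  by (auto simp: tor_def space_PiM PiE_def)

lemma coord_measurable [measurable]: "i \<in> I \<Longrightarrow> (\<lambda>y. y i) \<in> borel_measurable (tor I)"
  unfolding tor_def by (subst measurable_cong_sets[OF refl sets_circle_haar[symmetric]]) (rule measurable_component_singleton)

definition unit_on :: "nat set \<Rightarrow> (nat \<Rightarrow> complex) \<Rightarrow> bool" where
  "unit_on I y \<longleftrightarrow> (\<forall>i\<in>I. norm (y i) = 1)"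

lemma AE_tor_unit: "finite I \<Longrightarrow> AE y in tor I. unit_on I y"
  unfolding unit_on_def tor_def
  by (subst AE_finite_all) (auto intro!: AE_PiM_component prob_space_circle AE_circle_norm)

text \<open>
Functions that are bounded and measurable on the torus. The bound is required only at points whose
coordinates in \<open>I\<close> have absolute value one, because the carrier of the product measure contains all
complex vectors; such points have full measure.
\<close>

definition good :: "nat set \<Rightarrow> ((nat \<Rightarrow> complex) \<Rightarrow> complex) \<Rightarrow> bool" where
  "good I f \<longleftrightarrow> f \<in> borel_measurable (tor I) \<and> (\<exists>B. \<forall>y. unit_on I y \<longrightarrow> norm (f y) \<le> B)"

lemma goodI: "f \<in> borel_measurable (tor I) \<Longrightarrow> (\<And>y. unit_on I y \<Longrightarrow> norm (f y) \<le> B) \<Longrightarrow> good I f"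
  by (auto simp: good_def)

lemma good_measurable [measurable_dest]: "good I f \<Longrightarrow> f \<in> borel_measurable (tor I)"
  by (simp add: good_def)

lemma good_const [simp]: "good I (\<lambda>y. c)"
  by (rule goodI[of _ _ "norm c"]) auto

lemma good_add: "good I f \<Longrightarrow> good I g \<Longrightarrow> good I (\<lambda>y. f y + g y)"
  unfolding good_def by (auto intro!: borel_measurable_add) (meson add_mono norm_triangle_le)

lemma good_mult: assumes "good I f" "good I g" shows "good I (\<lambda>y. f y * g y)"
proof -
  obtain B C where B: "\<And>y. unit_on I y \<Longrightarrow> norm (f y) \<le> B" and C: "\<And>y. unit_on I y \<Longrightarrow> norm (g y) \<le> C"
    using assms by (auto simp: good_def)
  show ?thesis
  proof (rule goodI[of _ _ "B * C"])
    show "(\<lambda>y. f y * g y) \<in> borel_measurable (tor I)"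
      using assms by (auto simp: good_def)
    fix y assume "unit_on I y"
    then show "norm (f y * g y) \<le> B * C"
      unfolding norm_mult using B C by (intro mult_mono) (auto intro: order_trans[OF norm_ge_zero])
  qed
qed

lemma good_sum: "(\<And>i. i \<in> A \<Longrightarrow> good I (f i)) \<Longrightarrow> good I (\<lambda>y. \<Sum>i\<in>A. f i y)"
  by (induction A rule: infinite_finite_induct) (auto intro!: good_add)

lemma good_prod: "(\<And>i. i \<in> A \<Longrightarrow> good I (f i)) \<Longrightarrow> good I (\<lambda>y. \<Prod>i\<in>A. f i y)"
  by (induction A rule: infinite_finite_induct) (auto intro!: good_mult)

lemma good_power: "good I f \<Longrightarrow> good I (\<lambda>y. f y ^ n)"
  by (induction n) (auto intro!: good_mult)

lemma good_coord: "i \<in> I \<Longrightarrow> good I (\<lambda>y. y i)"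
  by (rule goodI[of _ _ 1]) (auto simp: unit_on_def)

lemma good_inverse_coord: "i \<in> I \<Longrightarrow> good I (\<lambda>y. inverse (y i))"
  by (rule goodI[of _ _ 1]) (auto simp: unit_on_def norm_inverse)

lemma good_powi_coord: "i \<in> I \<Longrightarrow> good I (\<lambda>y. y i powi m)"
  by (cases "0 \<le> m") (auto simp: power_int_def intro!: good_power good_coord good_inverse_coord)

lemma good_ratio: "i \<in> I \<Longrightarrow> j \<in> I \<Longrightarrow> good I (\<lambda>y. inverse (y i) * y j)"
  by (intro good_mult good_coord good_inverse_coord)

lemma good_cont:
  assumes "good I f" "continuous_on UNIV \<phi>" shows "good I (\<lambda>y. \<phi> (f y))"
proof -
  obtain B where B: "\<And>y. unit_on I y \<Longrightarrow> norm (f y) \<le> B"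
    using assms by (auto simp: good_def)
  have "compact (\<phi> ` cball 0 B)"
    by (intro compact_continuous_image continuous_on_subset[OF assms(2)]) auto
  then obtain C where C: "\<And>z. z \<in> \<phi> ` cball 0 B \<Longrightarrow> norm z \<le> C"
    using compact_imp_bounded bounded_iff by metis
  show ?thesis
  proof (rule goodI[of _ _ C])
    show "(\<lambda>y. \<phi> (f y)) \<in> borel_measurable (tor I)"
      using assms borel_measurable_continuous_onI[OF assms(2)]
      by (auto simp: good_def intro: measurable_compose)
    fix y assume "unit_on I y"
    then show "norm (\<phi> (f y)) \<le> C" using B by (intro C imageI) auto
  qed
qed

lemma good_integrable: assumes "finite I" "good I f" shows "integrable (tor I) f"
proof -
  interpret prob_space "tor I" by (rule prob_space_tor)
  obtain B where B: "\<And>y. unit_on I y \<Longrightarrow> norm (f y) \<le> B"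
    using assms by (auto simp: good_def)
  show ?thesis
    by (rule integrable_const_bound[of _ B])
       (use AE_tor_unit[OF assms(1)] B assms in \<open>auto simp: good_def elim!: eventually_mono\<close>)
qed

lemma tor_map:
  assumes I: "finite I" and T: "\<And>i. i \<in> I \<Longrightarrow> T i \<in> borel_measurable borel"
    "\<And>i. i \<in> I \<Longrightarrow> distr circle_haar borel (T i) = circle_haar"
  shows "distr (tor I) (tor I) (\<lambda>y. \<lambda>i\<in>I. T i (y i)) = tor I" (is "distr _ _ ?T = _")
proof -
  have meas: "?T \<in> measurable (tor I) (tor I)"
    unfolding tor_def
  proof (rule measurable_restrict)
    fix i assume i: "i \<in> I"
    have "T i \<in> measurable circle_haar circle_haar"
      using T(1)[OF i] by (subst measurable_cong_sets[OF sets_circle_haar sets_circle_haar])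
    with measurable_component_singleton[OF i]
    show "(\<lambda>y. T i (y i)) \<in> measurable (Pi\<^sub>M I (\<lambda>_. circle_haar)) circle_haar"
      by (rule measurable_compose)
  qed
  show ?thesis
  proof (subst (3) tor_def, rule circle_prod.PiM_eqI[OF I])
    show "sets (distr (tor I) (tor I) ?T) = sets (Pi\<^sub>M I (\<lambda>_. circle_haar))"
      by (simp add: tor_def)
    fix A :: "nat \<Rightarrow> complex set" assume A: "\<And>i. i \<in> I \<Longrightarrow> A i \<in> sets circle_haar"
    have pre: "T i -` A i \<in> sets circle_haar" if "i \<in> I" for i
      using measurable_sets[OF T(1)[OF that], of "A i"] A[OF that] by simp
    have "emeasure (distr (tor I) (tor I) ?T) (Pi\<^sub>E I A) = emeasure (tor I) (?T -` Pi\<^sub>E I A \<inter> space (tor I))"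
      using A by (intro emeasure_distr meas) (auto simp: tor_def intro!: sets_PiM_I_finite I)
    also have "?T -` Pi\<^sub>E I A \<inter> space (tor I) = Pi\<^sub>E I (\<lambda>i. T i -` A i)"
      by (auto simp: space_tor PiE_def Pi_def extensional_def)
    also have "emeasure (tor I) \<dots> = (\<Prod>i\<in>I. emeasure circle_haar (T i -` A i))"
      unfolding tor_def using pre by (intro circle_prod.emeasure_PiM I)
    also have "\<dots> = (\<Prod>i\<in>I. emeasure circle_haar (A i))"
    proof (rule prod.cong[OF refl])
      fix i assume i: "i \<in> I"
      have "emeasure circle_haar (A i) = emeasure (distr circle_haar borel (T i)) (A i)"
        using T(2)[OF i] by simp
      also have "\<dots> = emeasure circle_haar (T i -` A i)"
        using A[OF i] T(1)[OF i]
        by (subst emeasure_distr) (auto simp: measurable_cong_sets[OF sets_circle_haar refl])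
      finally show "emeasure circle_haar (T i -` A i) = emeasure circle_haar (A i)" by simp
    qed
    finally show "emeasure (distr (tor I) (tor I) ?T) (Pi\<^sub>E I A) = (\<Prod>i\<in>I. emeasure circle_haar (A i))" .
  qed
qed

lemma tor_integral_map:
  assumes I: "finite I" and T: "\<And>i. i \<in> I \<Longrightarrow> T i \<in> borel_measurable borel"
    "\<And>i. i \<in> I \<Longrightarrow> distr circle_haar borel (T i) = circle_haar"
    and f: "good I f"
  shows "(LINT y|tor I. f (\<lambda>i\<in>I. T i (y i))) = integral\<^sup>L (tor I) f"
proof -
  have meas: "(\<lambda>y. \<lambda>i\<in>I. T i (y i)) \<in> measurable (tor I) (tor I)"
    unfolding tor_def
  proof (rule measurable_restrict)
    fix i assume i: "i \<in> I"
    have "T i \<in> measurable circle_haar circle_haar"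
      using T(1)[OF i] by (subst measurable_cong_sets[OF sets_circle_haar sets_circle_haar])
    with measurable_component_singleton[OF i]
    show "(\<lambda>y. T i (y i)) \<in> measurable (Pi\<^sub>M I (\<lambda>_. circle_haar)) circle_haar"
      by (rule measurable_compose)
  qed
  have "integral\<^sup>L (tor I) f = integral\<^sup>L (distr (tor I) (tor I) (\<lambda>y. \<lambda>i\<in>I. T i (y i))) f"
    using tor_map[OF I T] by simp
  also have "\<dots> = (LINT y|tor I. f (\<lambda>i\<in>I. T i (y i)))"
    using f by (intro integral_distr meas) (simp add: good_def)
  finally show ?thesis by simp
qed

definition scl :: "nat set \<Rightarrow> complex \<Rightarrow> (nat \<Rightarrow> complex) \<Rightarrow> nat \<Rightarrow> complex" where
  "scl J z y = (\<lambda>i. if i \<in> J then z * y i else y i)"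

lemma tor_integral_rotate:
  assumes I: "finite I" "J \<subseteq> I" and z: "norm z = 1" and f: "good I f"
  shows "(LINT y|tor I. f (scl J z y)) = integral\<^sup>L (tor I) f"
proof -
  have "(LINT y|tor I. f (scl J z y)) = (LINT y|tor I. f (\<lambda>i\<in>I. (if i \<in> J then (\<lambda>w. z * w) else id) (y i)))"
    by (rule Bochner_Integration.integral_cong)
       (use I(2) in \<open>auto simp: space_tor scl_def restrict_def extensional_def fun_eq_iff intro!: arg_cong[of _ _ f]\<close>)
  also have "\<dots> = integral\<^sup>L (tor I) f"
    by (rule tor_integral_map[OF I(1) _ _ f])
       (auto simp: id_def z circle_rotate intro!: distr_id2)
  finally show ?thesis .
qed

lemma tor_integral_inverse:
  assumes I: "finite I" and f: "good I f"
  shows "(LINT y|tor I. f (\<lambda>i\<in>I. inverse (y i))) = integral\<^sup>L (tor I) f"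
  by (rule tor_integral_map[OF I _ _ f]) (auto simp: circle_inverse[unfolded])

lemma tor_integral_insert:
  assumes "finite I" "j \<notin> I" "good (insert j I) f"
  shows "integral\<^sup>L (tor (insert j I)) f = (LINT y|tor I. LINT z|circle_haar. f (y(j := z)))"
  using circle_prod.product_integral_insert[OF assms(1,2)] good_integrable[of "insert j I" f] assms
  by (simp add: tor_def)

lemma tor_monomial:
  assumes "finite I"
  shows "(LINT y|tor I. (\<Prod>i\<in>I. y i powi m i)) = (if \<forall>i\<in>I. m i = 0 then 1 else 0)"
proof -
  have "integrable circle_haar (\<lambda>z. z powi k)" for k
    by (cases "0 \<le> k"; intro circle_integrable[of _ 1])
       (auto simp: power_int_def norm_power norm_inverse)
  then have "(LINT y|tor I. (\<Prod>i\<in>I. y i powi m i)) = (\<Prod>i\<in>I. LINT z|circle_haar. z powi m i)"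
    unfolding tor_def using assms by (intro circle_prod.product_integral_prod)
  also have "\<dots> = (if \<forall>i\<in>I. m i = 0 then 1 else 0)"
    using assms by (auto simp: circle_powi intro: prod_zero)
  finally show ?thesis .
qed

text \<open>
The function has degree at least \<open>D\<close> in the group of variables \<open>J\<close>: as a function of a common factor
\<open>z\<close> of these variables it is \<open>z\<^sup>D\<close> times an entire function. This is weaker than homogeneity, and is
preserved by products and by entire functions of ratios whose numerators lie in \<open>J\<close>.
\<close>

definition deg_ge :: "nat set \<Rightarrow> nat set \<Rightarrow> int \<Rightarrow> ((nat \<Rightarrow> complex) \<Rightarrow> complex) \<Rightarrow> bool" where
  "deg_ge I J D f \<longleftrightarrow> (\<forall>y. unit_on I y \<longrightarrow>
     (\<exists>h. h holomorphic_on UNIV \<and> (\<forall>z. norm z = 1 \<longrightarrow> f (scl J z y) = z powi D * h z)))"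

lemma deg_geI:
  "(\<And>y. unit_on I y \<Longrightarrow> \<exists>h. h holomorphic_on UNIV \<and> (\<forall>z. norm z = 1 \<longrightarrow> f (scl J z y) = z powi D * h z))
   \<Longrightarrow> deg_ge I J D f"
  by (simp add: deg_ge_def)

lemma deg_ge_const: "deg_ge I J 0 (\<lambda>y. c)"
  by (rule deg_geI, rule exI[of _ "\<lambda>_. c"]) auto

lemma deg_ge_mult: assumes "deg_ge I J D f" "deg_ge I J E g" shows "deg_ge I J (D + E) (\<lambda>y. f y * g y)"
proof (rule deg_geI)
  fix y assume y: "unit_on I y"
  obtain h where h: "h holomorphic_on UNIV" "\<And>z. norm z = 1 \<Longrightarrow> f (scl J z y) = z powi D * h z"
    using assms(1) y unfolding deg_ge_def by blast
  obtain k where k: "k holomorphic_on UNIV" "\<And>z. norm z = 1 \<Longrightarrow> g (scl J z y) = z powi E * k z"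
    using assms(2) y unfolding deg_ge_def by blast
  have "f (scl J z y) * g (scl J z y) = z powi (D + E) * (h z * k z)" if "norm z = 1" for z
  proof -
    have "z \<noteq> 0" using that by auto
    then show ?thesis using h(2) k(2) that by (simp add: power_int_add mult_ac)
  qed
  then show "\<exists>h. h holomorphic_on UNIV \<and> (\<forall>z. norm z = 1 \<longrightarrow> f (scl J z y) * g (scl J z y) = z powi (D + E) * h z)"
    using h(1) k(1) by (intro exI[of _ "\<lambda>z. h z * k z"]) (auto intro!: holomorphic_intros)
qed

lemma deg_ge_add: assumes "deg_ge I J D f" "deg_ge I J D g" shows "deg_ge I J D (\<lambda>y. f y + g y)"
proof (rule deg_geI)
  fix y assume y: "unit_on I y"
  obtain h where h: "h holomorphic_on UNIV" "\<And>z. norm z = 1 \<Longrightarrow> f (scl J z y) = z powi D * h z"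
    using assms(1) y unfolding deg_ge_def by blast
  obtain k where k: "k holomorphic_on UNIV" "\<And>z. norm z = 1 \<Longrightarrow> g (scl J z y) = z powi D * k z"
    using assms(2) y unfolding deg_ge_def by blast
  show "\<exists>h. h holomorphic_on UNIV \<and> (\<forall>z. norm z = 1 \<longrightarrow> f (scl J z y) + g (scl J z y) = z powi D * h z)"
    using h k by (intro exI[of _ "\<lambda>z. h z + k z"]) (auto intro!: holomorphic_intros simp: ring_distribs)
qed

lemma deg_ge_sum:
  assumes "\<And>i. i \<in> A \<Longrightarrow> deg_ge I J D (f i)" shows "deg_ge I J D (\<lambda>y. \<Sum>i\<in>A. f i y)"
  using assms
proof (induction A rule: infinite_finite_induct)
  case (insert a A)
  then show ?case by (auto intro!: deg_ge_add)
qed (auto simp: deg_ge_def intro!: exI[of _ "\<lambda>_. 0"])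

lemma deg_ge_prod:
  assumes "finite A" "\<And>i. i \<in> A \<Longrightarrow> deg_ge I J (D i) (f i)"
  shows "deg_ge I J (\<Sum>i\<in>A. D i) (\<lambda>y. \<Prod>i\<in>A. f i y)"
  using assms
proof (induction A rule: finite_induct)
  case (insert a A)
  then show ?case by (auto intro!: deg_ge_mult)
qed (auto intro: deg_ge_const)

lemma deg_ge_powi_coord:
  "deg_ge I J (if i \<in> J then m else 0) (\<lambda>y. y i powi m)"
  by (rule deg_geI, rule_tac x = "\<lambda>_. y i powi m" in exI)
     (auto simp: scl_def power_int_mult_distrib)

lemma scl_measurable:
  assumes "J \<subseteq> I"
  shows "(\<lambda>(z, y). scl J z y) \<in> measurable (circle_haar \<Otimes>\<^sub>M tor I) (tor I)"
proof -
  have "(\<lambda>p. \<lambda>i\<in>I. if i \<in> J then fst p * snd p i else snd p i) \<in> measurable (circle_haar \<Otimes>\<^sub>M tor I) (tor I)"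
    unfolding tor_def
  proof (rule measurable_restrict)
    fix i assume i: "i \<in> I"
    have [measurable]: "(\<lambda>p. snd p i) \<in> borel_measurable (circle_haar \<Otimes>\<^sub>M tor I)"
      using measurable_compose[OF measurable_snd coord_measurable[OF i]] .
    have [measurable]: "fst \<in> borel_measurable (circle_haar \<Otimes>\<^sub>M tor I)"
      using measurable_fst[of circle_haar "tor I"] by (simp add: measurable_cong_sets[OF refl sets_circle_haar])
    have "(\<lambda>p. if i \<in> J then fst p * snd p i else snd p i) \<in> borel_measurable (circle_haar \<Otimes>\<^sub>M tor I)"
      by measurable
    then show "(\<lambda>p. if i \<in> J then fst p * snd p i else snd p i)
        \<in> measurable (circle_haar \<Otimes>\<^sub>M Pi\<^sub>M I (\<lambda>_. circle_haar)) circle_haar"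
      by (simp add: tor_def measurable_cong_sets[OF refl sets_circle_haar])
  qed
  also have "?this \<longleftrightarrow> ?thesis"
    by (rule measurable_cong)
       (use assms in \<open>auto simp: space_pair_measure space_tor scl_def restrict_def extensional_def fun_eq_iff\<close>)
  finally show ?thesis .
qed

lemma unit_on_scl: "unit_on I y \<Longrightarrow> norm z = 1 \<Longrightarrow> unit_on I (scl J z y)"
  by (auto simp: unit_on_def scl_def norm_mult)

text \<open>
Averaging over rotations of the variables in \<open>J\<close> does not change the integral, and by the mean value
property the average of \<open>z\<^sup>D h(z)\<close> over the unit circle is its value at \<open>0\<close>, which vanishes for
\<open>D > 0\<close>.
\<close>

lemma tor_integral_deg_pos:
  assumes I: "finite I" "J \<subseteq> I" and f: "good I f" and deg: "deg_ge I J D f" "D > 0"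
  shows "integral\<^sup>L (tor I) f = 0"
proof -
  interpret T: prob_space "tor I" by (rule prob_space_tor)
  interpret P: pair_prob_space circle_haar "tor I" ..
  obtain B where B: "\<And>y. unit_on I y \<Longrightarrow> norm (f y) \<le> B" using f by (auto simp: good_def)
  have [measurable]: "(\<lambda>p. f (scl J (fst p) (snd p))) \<in> borel_measurable (circle_haar \<Otimes>\<^sub>M tor I)"
    using measurable_compose[OF scl_measurable[OF I(2)], of f borel] f
    by (simp add: good_def case_prod_unfold)
  have AE: "AE p in circle_haar \<Otimes>\<^sub>M tor I. norm (fst p) = 1 \<and> unit_on I (snd p)"
  proof -
    have [measurable]: "fst \<in> borel_measurable (circle_haar \<Otimes>\<^sub>M tor I)"
      using measurable_fst[of circle_haar "tor I"] by (simp add: measurable_cong_sets[OF refl sets_circle_haar])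
    have [measurable]: "i \<in> I \<Longrightarrow> (\<lambda>p. snd p i) \<in> borel_measurable (circle_haar \<Otimes>\<^sub>M tor I)" for i
      using measurable_compose[OF measurable_snd coord_measurable] .
    show ?thesis
    proof (rule P.AE_pair_measure)
      show "{p \<in> space (circle_haar \<Otimes>\<^sub>M tor I). norm (fst p) = 1 \<and> unit_on I (snd p)}
          \<in> sets (circle_haar \<Otimes>\<^sub>M tor I)"
        unfolding unit_on_def using I(1) by measurable
      show "AE z in circle_haar. AE y in tor I. norm (fst (z, y)) = 1 \<and> unit_on I (snd (z, y))"
        using AE_circle_norm by eventually_elim (use AE_tor_unit[OF I(1)] in simp)
    qed
  qed
  have int: "integrable (circle_haar \<Otimes>\<^sub>M tor I) (\<lambda>(z, y). f (scl J z y))"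
    unfolding case_prod_unfold
  proof (rule P.integrable_const_bound[of _ B])
    show "AE p in circle_haar \<Otimes>\<^sub>M tor I. norm (f (scl J (fst p) (snd p))) \<le> B"
      using AE by eventually_elim (intro B unit_on_scl, auto)
  qed measurable
  have "integral\<^sup>L (tor I) f = (LINT z|circle_haar. integral\<^sup>L (tor I) f)"
    using circle.prob_space by simp
  also have "\<dots> = (LINT z|circle_haar. LINT y|tor I. f (scl J z y))"
    by (rule integral_cong_AE)
       (use AE_circle_norm tor_integral_rotate[OF I _ f] in \<open>auto elim!: eventually_mono intro!: T.borel_measurable_lebesgue_integral simp: case_prod_unfold\<close>)
  also have "\<dots> = (LINT y|tor I. LINT z|circle_haar. f (scl J z y))"
    by (rule P.Fubini_integral[symmetric]) (rule int)
  also have "\<dots> = (LINT y|tor I. 0)"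
  proof (rule integral_cong_AE)
    show "AE y in tor I. (LINT z|circle_haar. f (scl J z y)) = 0"
      using AE_tor_unit[OF I(1)] AE_space
    proof eventually_elim
      case (elim y)
      then obtain h where h: "h holomorphic_on UNIV" "\<And>z. norm z = 1 \<Longrightarrow> f (scl J z y) = z powi D * h z"
        using deg(1) unfolding deg_ge_def by blast
      have hol: "(\<lambda>z. z ^ nat D * h z) holomorphic_on UNIV" using h(1) by (intro holomorphic_intros)
      have "(LINT z|circle_haar. f (scl J z y)) = (LINT z|circle_haar. z ^ nat D * h z)"
      proof (rule integral_cong_AE)
        show "AE z in circle_haar. f (scl J z y) = z ^ nat D * h z"
          using AE_circle_norm by eventually_elim (use h(2) deg(2) in \<open>simp add: power_int_def\<close>)
        show "(\<lambda>z. z ^ nat D * h z) \<in> borel_measurable circle_haar"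
          using borel_measurable_continuous_onI[OF holomorphic_on_imp_continuous_on[OF hol]]
          by (simp add: measurable_cong_sets[OF sets_circle_haar refl])
        show "(\<lambda>z. f (scl J z y)) \<in> borel_measurable circle_haar"
          using measurable_compose[OF measurable_Pair2'[OF elim(2)], of "\<lambda>p. f (scl J (fst p) (snd p))" circle_haar borel]
          by simp
      qed
      also have "\<dots> = 0" using deg(2) by (subst circle_mean[OF hol]) simp
      finally show ?case .
    qed
    show "(\<lambda>y. LINT z|circle_haar. f (scl J z y)) \<in> borel_measurable (tor I)"
      using measurable_compose[OF measurable_pair_swap'[of "tor I" circle_haar], of "\<lambda>p. f (scl J (fst p) (snd p))" borel]
      by (intro circle.borel_measurable_lebesgue_integral) (simp add: case_prod_unfold)
  qed auto
  finally show ?thesis by simp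
qed

lemma tor_integral_sum:
  assumes "finite I" "\<And>i. i \<in> A \<Longrightarrow> good I (f i)"
  shows "(LINT y|tor I. (\<Sum>i\<in>A. f i y)) = (\<Sum>i\<in>A. integral\<^sup>L (tor I) (f i))"
  using assms by (intro Bochner_Integration.integral_sum good_integrable) auto

lemma tor_integral_cong:
  assumes "finite I" "good I f" "good I g" "\<And>y. unit_on I y \<Longrightarrow> f y = g y"
  shows "integral\<^sup>L (tor I) f = integral\<^sup>L (tor I) g"
  using AE_tor_unit[OF assms(1)] assms by (intro integral_cong_AE good_measurable) (auto elim!: eventually_mono)

text \<open>
Termwise integration under a summable bound.
\<close>

lemma tor_integral_series:
  fixes f :: "nat \<Rightarrow> (nat \<Rightarrow> complex) \<Rightarrow> complex"
  assumes I: "finite I" and f: "\<And>d. good I (f d)" and F: "good I F" and B: "summable B"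
    and le: "\<And>d y. unit_on I y \<Longrightarrow> norm (f d y) \<le> B d"
    and s: "\<And>y. unit_on I y \<Longrightarrow> (\<lambda>d. f d y) sums F y"
  shows "(\<lambda>d. integral\<^sup>L (tor I) (f d)) sums integral\<^sup>L (tor I) F"
proof -
  interpret T: prob_space "tor I" by (rule prob_space_tor)
  have int: "integrable (tor I) (f d)" for d using I f by (rule good_integrable)
  have "(\<lambda>d. integral\<^sup>L (tor I) (f d)) sums (LINT y|tor I. (\<Sum>d. f d y))"
  proof (rule sums_integral[OF int])
    show "AE y in tor I. summable (\<lambda>d. norm (f d y))"
      using AE_tor_unit[OF I]
      by eventually_elim (rule summable_comparison_test[OF _ B], use le in auto)
    have "(LINT y|tor I. norm (f d y)) \<le> B d" for d
    proof -
      have "(LINT y|tor I. norm (f d y)) \<le> (LINT y|tor I. B d)"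
        by (rule integral_mono_AE) (use int AE_tor_unit[OF I] le in \<open>auto elim!: eventually_mono\<close>)
      then show ?thesis by (simp add: T.prob_space)
    qed
    then show "summable (\<lambda>d. LINT y|tor I. norm (f d y))"
      by (intro summable_comparison_test[OF _ B] exI[of _ 0]) (simp add: integral_nonneg_AE)
  qed
  also have "(LINT y|tor I. (\<Sum>d. f d y)) = integral\<^sup>L (tor I) F"
  proof (rule integral_cong_AE)
    have [measurable]: "f d \<in> borel_measurable (tor I)" for d using f by (rule good_measurable)
    show "(\<lambda>y. \<Sum>d. f d y) \<in> borel_measurable (tor I)" by measurable
    show "F \<in> borel_measurable (tor I)" using F by (rule good_measurable)
    show "AE y in tor I. (\<Sum>d. f d y) = F y"
      using AE_tor_unit[OF I] by eventually_elim (rule sums_unique[OF s, symmetric])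
  qed
  finally show ?thesis .
qed

section \<open>Partial fractions and complete q-functions\<close>

text \<open>
The formal power series \<open>1 / (1 - c X)\<close>.
\<close>

definition geo :: "complex \<Rightarrow> complex fps" where "geo c = Abs_fps (\<lambda>m. c ^ m)"

lemma geo_nth [simp]: "fps_nth (geo c) m = c ^ m" by (simp add: geo_def)

lemma geo_inverse: "geo c * (1 - fps_const c * fps_X) = 1"
proof -
  have "geo c * (1 - fps_const c * fps_X) = geo c - (geo c * fps_const c) * fps_X"
    by (simp only: right_diff_distrib mult_1_right mult.assoc)
  also have "\<dots> = 1"
  proof (rule fps_ext)
    fix n show "fps_nth (geo c - geo c * fps_const c * fps_X) n = fps_nth 1 n"
      by (cases n) (simp_all add: fps_mult_right_const_nth)
  qed
  finally show ?thesis .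
qed

lemma fps_const_sum': "fps_const (sum f S) = (\<Sum>s\<in>S. fps_const (f s))"
  by (induction S rule: infinite_finite_induct) (simp_all flip: fps_const_add)

lemma geo_mult:
  assumes "a \<noteq> b" "a \<noteq> 0" "b \<noteq> 0"
  shows "geo a * geo b = fps_const (1 / (1 - b / a)) * geo a + fps_const (1 / (1 - a / b)) * geo b"
proof (rule fps_ext)
  fix n
  have ne: "a - b \<noteq> 0" using assms by simp
  have "(a - b) * (\<Sum>i=0..n. a ^ i * b ^ (n - i)) = a ^ Suc n - b ^ Suc n"
    by (subst diff_power_eq_sum) (simp add: atLeast0AtMost lessThan_Suc_atMost)
  then have "(\<Sum>i=0..n. a ^ i * b ^ (n - i)) = (a ^ Suc n - b ^ Suc n) / (a - b)"
    using ne by (simp add: nonzero_eq_divide_eq mult.commute)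
  also have "\<dots> = a ^ Suc n / (a - b) + b ^ Suc n / (b - a)"
    using ne assms(1) by (simp add: divide_simps) (simp add: algebra_simps)
  also have "\<dots> = 1 / (1 - b / a) * a ^ n + 1 / (1 - a / b) * b ^ n"
    using assms ne by (simp add: divide_simps)
  finally show "fps_nth (geo a * geo b) n =
      fps_nth (fps_const (1 / (1 - b / a)) * geo a + fps_const (1 / (1 - a / b)) * geo b) n"
    unfolding fps_mult_nth[of "geo a"] by simp
qed

text \<open>
The coefficient of \<open>1 / (1 - z s * X)\<close> in the partial fraction decomposition of the product of all
\<open>1 / (1 - z t * X)\<close>.
\<close>

definition pfc :: "('a \<Rightarrow> complex) \<Rightarrow> 'a set \<Rightarrow> 'a \<Rightarrow> complex" where
  "pfc z S s = (\<Prod>t\<in>S - {s}. 1 / (1 - z t / z s))"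

lemma pfc_insert_old:
  assumes "finite S" "s0 \<notin> S" "s \<in> S"
  shows "pfc z (insert s0 S) s = pfc z S s / (1 - z s0 / z s)"
proof -
  have "insert s0 S - {s} = insert s0 (S - {s})" using assms by auto
  then show ?thesis using assms by (simp add: pfc_def)
qed

lemma pfc_insert_new:
  assumes "finite S" "s0 \<notin> S"
  shows "pfc z (insert s0 S) s0 = (\<Prod>t\<in>S. 1 / (1 - z t / z s0))"
  using assms by (simp add: pfc_def)

text \<open>
A new factor is split off against each summand by the decomposition for two factors. The coefficient of
the new pole is the old identity evaluated at that pole, which is why the statement is generalised over
the point \<open>x\<close> before it is transferred to formal power series.
\<close>

lemma partial_fractions_value:
  assumes "finite S" "S \<noteq> {}" "inj_on z S" "\<And>s. s \<in> S \<Longrightarrow> z s \<noteq> 0"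
    and "\<And>s. s \<in> S \<Longrightarrow> 1 - x * z s \<noteq> 0"
  shows "(\<Prod>s\<in>S. 1 / (1 - x * z s)) = (\<Sum>s\<in>S. pfc z S s / (1 - x * z s))"
  using assms
proof (induction S arbitrary: x rule: finite_ne_induct)
  case (singleton s)
  then show ?case by (simp add: pfc_def)
next
  case (insert s0 S)
  note IH = insert.IH
  have inj: "inj_on z S" using insert.prems by auto
  have z0: "z s0 \<noteq> 0" using insert.prems by auto
  have ne: "z s \<noteq> z s0" if "s \<in> S" for s
    using insert.prems(1) insert.hyps that by (auto simp: inj_on_def)
  have at0: "(\<Prod>s\<in>S. 1 / (1 - z s / z s0)) = (\<Sum>s\<in>S. pfc z S s / (1 - z s / z s0))"
    using IH[OF inj, of "1 / z s0"] insert.prems ne z0 by (auto simp: divide_eq_eq)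
  have x: "(\<Prod>s\<in>S. 1 / (1 - x * z s)) = (\<Sum>s\<in>S. pfc z S s / (1 - x * z s))"
    using insert.prems by (intro IH inj) auto
  have split: "1 / (1 - x * z s0) * (1 / (1 - x * z s)) =
      (1 / (1 - z s0 / z s)) / (1 - x * z s) + (1 / (1 - z s / z s0)) / (1 - x * z s0)" if "s \<in> S" for s
  proof -
    have "z s \<noteq> 0" "1 - x * z s \<noteq> 0" "1 - x * z s0 \<noteq> 0" "z s - z s0 \<noteq> 0" "z s0 - z s \<noteq> 0"
      using insert.prems that ne[OF that] by auto
    then show ?thesis using z0 by (simp add: divide_simps) (simp add: algebra_simps)
  qed
  have "(\<Prod>s\<in>insert s0 S. 1 / (1 - x * z s)) = 1 / (1 - x * z s0) * (\<Sum>s\<in>S. pfc z S s / (1 - x * z s))"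
    using insert.hyps x by simp
  also have "\<dots> = (\<Sum>s\<in>S. pfc z S s * (1 / (1 - x * z s0) * (1 / (1 - x * z s))))"
    unfolding sum_distrib_left by (rule sum.cong) auto
  also have "\<dots> = (\<Sum>s\<in>S. pfc z (insert s0 S) s / (1 - x * z s) + pfc z S s / (1 - z s / z s0) / (1 - x * z s0))"
  proof (rule sum.cong[OF refl])
    fix s assume s: "s \<in> S"
    show "pfc z S s * (1 / (1 - x * z s0) * (1 / (1 - x * z s))) =
        pfc z (insert s0 S) s / (1 - x * z s) + pfc z S s / (1 - z s / z s0) / (1 - x * z s0)"
      unfolding split[OF s] pfc_insert_old[OF insert.hyps(1,3) s]
      by (simp only: distrib_left times_divide_eq_right mult_1_right)
  qed
  also have "\<dots> = (\<Sum>s\<in>S. pfc z (insert s0 S) s / (1 - x * z s)) + pfc z (insert s0 S) s0 / (1 - x * z s0)"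
    unfolding sum.distrib pfc_insert_new[OF insert.hyps(1,3)] at0 sum_divide_distrib by (rule refl)
  finally show ?case using insert.hyps by simp
qed

lemma partial_fractions_fps:
  assumes "finite S" "S \<noteq> {}" "inj_on z S" "\<And>s. s \<in> S \<Longrightarrow> z s \<noteq> 0"
  shows "(\<Prod>s\<in>S. geo (z s)) = (\<Sum>s\<in>S. fps_const (pfc z S s) * geo (z s))"
  using assms
proof (induction S rule: finite_ne_induct)
  case (singleton s)
  then show ?case by (simp add: pfc_def)
next
  case (insert s0 S)
  have inj: "inj_on z S" using insert.prems by auto
  have z0: "z s0 \<noteq> 0" using insert.prems by auto
  have ne: "z s \<noteq> z s0" if "s \<in> S" for s
    using insert.prems(1) insert.hyps that by (auto simp: inj_on_def)
  have at0: "(\<Prod>s\<in>S. 1 / (1 - z s / z s0)) = (\<Sum>s\<in>S. pfc z S s / (1 - z s / z s0))"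
    using partial_fractions_value[OF insert.hyps(1,2) inj, of "1 / z s0"] insert.prems ne z0
    by (auto simp: divide_eq_eq)
  have "(\<Prod>s\<in>insert s0 S. geo (z s)) = geo (z s0) * (\<Sum>s\<in>S. fps_const (pfc z S s) * geo (z s))"
    using insert inj by simp
  also have "\<dots> = (\<Sum>s\<in>S. fps_const (pfc z S s) * (geo (z s0) * geo (z s)))"
    unfolding sum_distrib_left by (rule sum.cong) (auto simp: mult_ac)
  also have "\<dots> = (\<Sum>s\<in>S. fps_const (pfc z S s / (1 - z s / z s0)) * geo (z s0)
      + fps_const (pfc z (insert s0 S) s) * geo (z s))"
  proof (rule sum.cong[OF refl])
    fix s assume s: "s \<in> S"
    have "geo (z s0) * geo (z s) = fps_const (1 / (1 - z s / z s0)) * geo (z s0) + fps_const (1 / (1 - z s0 / z s)) * geo (z s)"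
      using ne[OF s] z0 insert.prems s by (intro geo_mult) auto
    then show "fps_const (pfc z S s) * (geo (z s0) * geo (z s)) =
        fps_const (pfc z S s / (1 - z s / z s0)) * geo (z s0) + fps_const (pfc z (insert s0 S) s) * geo (z s)"
      using s insert.hyps by (simp add: pfc_insert_old ring_distribs mult.assoc[symmetric])
  qed
  also have "\<dots> = fps_const (\<Sum>s\<in>S. pfc z S s / (1 - z s / z s0)) * geo (z s0)
      + (\<Sum>s\<in>S. fps_const (pfc z (insert s0 S) s) * geo (z s))"
    by (simp add: sum.distrib sum_distrib_right fps_const_sum')
  also have "(\<Sum>s\<in>S. pfc z S s / (1 - z s / z s0)) = pfc z (insert s0 S) s0"
    using at0 insert.hyps by (simp add: pfc_insert_new)
  finally show ?case using insert.hyps by simp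
qed

context q_disc
begin

text \<open>
The generating function \<open>1 / (c X; q)\<^sub>\<infinity>\<close>.
\<close>

definition gen :: "complex \<Rightarrow> complex fps" where "gen c = Abs_fps (\<lambda>k. c ^ k / qp k)"

lemma gen_nth [simp]: "fps_nth (gen c) k = c ^ k / qp k" by (simp add: gen_def)

text \<open>
The complete q-function \<open>g\<^sub>a\<close> in the variables \<open>y i\<close> for \<open>i \<in> I\<close>, with generating function
\<open>\<Prod>\<^sub>i 1 / (y\<^sub>i X; q)\<^sub>\<infinity>\<close>.
\<close>

definition gp :: "nat set \<Rightarrow> nat \<Rightarrow> (nat \<Rightarrow> complex) \<Rightarrow> complex" where
  "gp I a y = fps_nth (\<Prod>i\<in>I. gen (y i)) a"

text \<open>
The Gaussian binomial coefficient of \<open>M + m - 1\<close> over \<open>m\<close>, written as a product so that \<open>M = 0\<close> needs no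
truncated subtraction.
\<close>

definition rq :: "nat \<Rightarrow> nat \<Rightarrow> complex" where
  "rq M m = (\<Prod>r<m. (1 - q ^ (M + r)) / (1 - q ^ Suc r))"

lemma rq_tendsto: "(\<lambda>M. rq M m) \<longlonglongrightarrow> 1 / qp m"
proof -
  have "(\<lambda>M. q ^ (M + r)) \<longlonglongrightarrow> 0" for r
    by (rule LIMSEQ_ignore_initial_segment[OF LIMSEQ_power_zero[OF norm_q]])
  then have "(\<lambda>M. 1 - q ^ (M + r)) \<longlonglongrightarrow> 1 - 0" for r
    by (intro tendsto_diff tendsto_const)
  then have "(\<lambda>M. rq M m) \<longlonglongrightarrow> (\<Prod>r<m. (1 - 0) / (1 - q ^ Suc r))"
    unfolding rq_def using q_power_neq_1[of "Suc _"] by (intro tendsto_prod tendsto_divide tendsto_const) auto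
  also have "(\<Prod>r<m. (1 - 0) / (1 - q ^ Suc r)) = 1 / qp m"
    by (induction m) (auto simp: qp_Suc)
  finally show ?thesis .
qed

lemma rq_pascal: "rq (Suc M) (Suc m) - q ^ M * rq (Suc M) m = rq M (Suc m)"
proof -
  have "rq M (Suc m) = rq (Suc M) m * (1 - q ^ M) / (1 - q ^ Suc m)"
  proof -
    have "(\<Prod>r<Suc m. 1 - q ^ (M + r)) = (1 - q ^ M) * (\<Prod>r<m. 1 - q ^ (Suc M + r))"
      by (subst prod.lessThan_Suc_shift) simp
    then show ?thesis by (simp add: rq_def prod_dividef del: power_Suc)
  qed
  moreover have "rq (Suc M) (Suc m) = rq (Suc M) m * (1 - q ^ M * q ^ Suc m) / (1 - q ^ Suc m)"
    by (simp add: rq_def power_add mult_ac)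
  moreover have "X * (1 - Q * E) / (1 - E) - Q * X = X * (1 - Q) / (1 - E)" if "1 - E \<noteq> 0" for X Q E :: complex
    using that by (simp add: field_simps)
  moreover have "1 - q ^ Suc m \<noteq> 0" by (rule q_power_neq_1) simp
  ultimately show ?thesis by metis
qed

text \<open>
The finite form of Euler's identity; the induction on \<open>M\<close> multiplies back by the last factor, which is
the q-Pascal rule for the coefficients.
\<close>

lemma prod_geo: "(\<Prod>k<M. geo (c * q ^ k)) = Abs_fps (\<lambda>m. c ^ m * rq M m)"
proof (induction M)
  case 0
  show ?case
    by (rule fps_ext) (auto simp: rq_def power_0_left prod_zero_iff gr0_conv_Suc lessThan_Suc_eq_insert_0)
next
  case (Suc M)
  let ?F = "\<lambda>M. Abs_fps (\<lambda>m. c ^ m * rq M m)"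
  have *: "?F (Suc M) * (1 - fps_const (c * q ^ M) * fps_X) = ?F M"
  proof (rule fps_ext)
    fix n
    show "fps_nth (?F (Suc M) * (1 - fps_const (c * q ^ M) * fps_X)) n = fps_nth (?F M) n"
    proof (cases n)
      case 0
      then show ?thesis by (simp add: rq_def ring_distribs mult.assoc[symmetric])
    next
      case (Suc m)
      have "fps_nth (?F (Suc M) * (1 - fps_const (c * q ^ M) * fps_X)) n =
          c ^ Suc m * rq (Suc M) (Suc m) - c ^ m * rq (Suc M) m * (c * q ^ M)"
        unfolding Suc by (simp add: ring_distribs mult.assoc[symmetric] fps_mult_right_const_nth)
      also have "\<dots> = c ^ Suc m * (rq (Suc M) (Suc m) - q ^ M * rq (Suc M) m)"
        by (simp add: algebra_simps)
      finally show ?thesis by (simp only: rq_pascal Suc fps_nth_Abs_fps)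
    qed
  qed
  have "(\<Prod>k<Suc M. geo (c * q ^ k)) = ?F (Suc M) * (geo (c * q ^ M) * (1 - fps_const (c * q ^ M) * fps_X))"
    using Suc * by (simp add: mult_ac)
  then show ?case by (simp only: geo_inverse mult_1_right)
qed

lemma fps_prod_nth_tendsto:
  fixes F :: "nat \<Rightarrow> 'b \<Rightarrow> complex fps"
  assumes "finite I" "\<And>i a. i \<in> I \<Longrightarrow> (\<lambda>M. fps_nth (F M i) a) \<longlonglongrightarrow> fps_nth (G i) a"
  shows "(\<lambda>M. fps_nth (\<Prod>i\<in>I. F M i) a) \<longlonglongrightarrow> fps_nth (\<Prod>i\<in>I. G i) a"
  using assms
proof (induction I arbitrary: a rule: finite_induct)
  case (insert i I)
  then show ?case by (simp add: fps_mult_nth) (intro tendsto_intros, auto)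
qed auto

lemma gp_limit:
  assumes "finite I"
  shows "(\<lambda>M. fps_nth (\<Prod>i\<in>I. \<Prod>k<M. geo (y i * q ^ k)) a) \<longlonglongrightarrow> gp I a y"
  unfolding gp_def prod_geo
  by (rule fps_prod_nth_tendsto[OF assms]) (auto intro!: tendsto_eq_intros rq_tendsto)

text \<open>
The power \<open>q ^ (k * (k + 1) div 2)\<close>.
\<close>

definition qtri :: "nat \<Rightarrow> complex" where "qtri k = (\<Prod>r<k. q ^ Suc r)"

lemma norm_qtri_le: "norm (qtri k) \<le> norm q ^ k"
proof -
  have "norm (qtri k) = (\<Prod>r<k. norm q ^ Suc r)" by (simp add: qtri_def prod_norm[symmetric] norm_mult norm_power)
  also have "\<dots> \<le> (\<Prod>r<k. norm q)"
    using norm_q by (intro prod_mono) (auto simp: mult_left_le power_le_one)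
  finally show ?thesis by simp
qed

text \<open>
Reflection of a finite symbol, \<open>(u q\<^sup>-\<^sup>k; q)\<^sub>k\<close> against \<open>(q / u; q)\<^sub>k\<close>.
\<close>

lemma qprod_shift:
  assumes "q \<noteq> 0" "u \<noteq> 0"
  shows "(\<Prod>m<k. 1 - u * q ^ m / q ^ k) * qtri k = (- u) ^ k * qpoch (q / u) k"
proof -
  have "(\<Prod>m<k. 1 - u * q ^ m / q ^ k) = (\<Prod>r<k. 1 - u / q ^ Suc r)"
  proof (rule prod.reindex_bij_witness[of _ "\<lambda>r. k - Suc r" "\<lambda>m. k - Suc m"])
    fix m assume m: "m \<in> {..<k}"
    have "q ^ k = q ^ m * q ^ Suc (k - Suc m)" using m by (subst power_add[symmetric]) auto
    then show "1 - u / q ^ Suc (k - Suc m) = 1 - u * q ^ m / q ^ k" using assms by simp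
  qed auto
  then have "(\<Prod>m<k. 1 - u * q ^ m / q ^ k) * qtri k = (\<Prod>r<k. (1 - u / q ^ Suc r) * q ^ Suc r)"
    by (simp add: qtri_def prod.distrib)
  also have "\<dots> = (\<Prod>r<k. (- u) * (1 - (q / u) * q ^ r))"
    using assms by (intro prod.cong) (auto simp: field_simps)
  also have "\<dots> = (- u) ^ k * qpoch (q / u) k" by (simp only: prod.distrib qpoch_def prod_constant card_lessThan)
  finally show ?thesis .
qed

lemma qtri_nonzero: "q \<noteq> 0 \<Longrightarrow> qtri k \<noteq> 0" by (simp add: qtri_def)

lemma qpoch_nonzero:
  assumes "norm z \<le> 1" "z \<noteq> 1" shows "qpoch z n \<noteq> 0"
proof -
  have "z * q ^ m \<noteq> 1" for m
  proof (cases m)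
    case (Suc r)
    have "norm q ^ m < 1" using power_decreasing[of 1 m "norm q"] norm_q Suc by simp
    then have "norm (z * q ^ m) < 1"
      using assms(1) mult_left_le_one_le[of "norm q ^ m" "norm z"] by (simp add: norm_mult norm_power)
    then show ?thesis by auto
  qed (use assms in auto)
  then show ?thesis by (simp add: qpoch_def)
qed

lemma einf_nonzero':
  assumes "norm z \<le> 1" "z \<noteq> 1" shows "einf z \<noteq> 0"
proof
  assume "einf z = 0"
  then obtain j where "z * q ^ j = 1" by (auto simp: einf_zero_iff)
  then have "qpoch z (Suc j) = 0" by (simp add: qpoch_def)
  then show False using qpoch_nonzero[OF assms] by blast
qed

lemma inverse_qpoch_bounded:
  assumes "norm z \<le> 1" "z \<noteq> 1"
  shows "\<exists>B>0. \<forall>n. norm (1 / qpoch z n) \<le> B"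
proof -
  have "(\<lambda>k. 1 / qpoch z k) \<longlonglongrightarrow> 1 / einf z"
    using qpoch_tendsto_einf[of z] einf_nonzero'[OF assms] by (intro tendsto_divide tendsto_const)
  then have "Bseq (\<lambda>k. 1 / qpoch z k)" by (intro convergent_imp_Bseq convergentI)
  then obtain B where "B > 0" "\<forall>k. norm (1 / qpoch z k) \<le> B" by (rule BseqE)
  then show ?thesis by blast
qed

text \<open>
The residue factor of the pole \<open>1 / (y\<^sub>j q\<^sup>k)\<close> that comes from the other poles belonging to the same
variable \<open>y\<^sub>j\<close>.
\<close>

definition cc :: "nat \<Rightarrow> complex" where "cc k = (-1) ^ k * qtri k / (qp k * einf q)"

text \<open>
The factor that another variable contributes at such a pole, multiplied by the two weight factors that
link this variable to \<open>y\<^sub>j\<close>. The product is entire in the ratio \<open>u\<close> of the variables.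
\<close>

definition ph :: "nat \<Rightarrow> complex \<Rightarrow> complex" where
  "ph k u = (-1) ^ k * qtri k * u ^ k * (1 - u) * einf (q ^ Suc k * u)"

text \<open>
The sum over all poles belonging to one variable, after multiplication by the weight; \<open>w i\<close> is the
ratio of that variable to \<open>y i\<close>.
\<close>

definition Phi :: "nat set \<Rightarrow> nat \<Rightarrow> (nat \<Rightarrow> complex) \<Rightarrow> complex" where
  "Phi K a w = (\<Sum>k. q ^ (k * a) * cc k * (\<Prod>i\<in>K. ph k (w i)))"

text \<open>
The weight \<open>Delta_dual\<close>, for an arbitrary set of variables so that variables can be removed one by
one.
\<close>

definition Dl :: "nat set \<Rightarrow> (nat \<Rightarrow> complex) \<Rightarrow> complex" where
  "Dl I y = (\<Prod>i\<in>I. \<Prod>j\<in>I - {i}. einf (inverse (y i) * y j))"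

lemma Dl_split:
  assumes "finite I" "j \<in> I"
  shows "Dl I y = Dl (I - {j}) y * (\<Prod>i\<in>I - {j}. einf (inverse (y j) * y i) * einf (inverse (y i) * y j))"
proof -
  have "Dl I y = (\<Prod>i\<in>I - {j}. einf (inverse (y j) * y i)) * (\<Prod>i\<in>I - {j}. \<Prod>k\<in>I - {i}. einf (inverse (y i) * y k))"
    unfolding Dl_def using assms by (subst prod.remove[of I j]) auto
  also have "(\<Prod>i\<in>I - {j}. \<Prod>k\<in>I - {i}. einf (inverse (y i) * y k)) =
      (\<Prod>i\<in>I - {j}. einf (inverse (y i) * y j) * (\<Prod>k\<in>I - {j} - {i}. einf (inverse (y i) * y k)))"
  proof (rule prod.cong[OF refl])
    fix i assume i: "i \<in> I - {j}"
    have "I - {i} - {j} = I - {j} - {i}" by auto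
    then show "(\<Prod>k\<in>I - {i}. einf (inverse (y i) * y k)) =
        einf (inverse (y i) * y j) * (\<Prod>k\<in>I - {j} - {i}. einf (inverse (y i) * y k))"
      using assms i by (subst prod.remove[of "I - {i}" j]) auto
  qed
  finally show ?thesis by (simp add: Dl_def prod.distrib mult_ac)
qed

text \<open>
If two coordinates coincide, every term of the expansion of the weight vanishes, so that partial
fractions are needed only at points with distinct coordinates.
\<close>

lemma star_degenerate:
  assumes I: "finite I" and ij: "i \<in> I" "j \<in> I" "i \<noteq> j" "y i = y j" and y: "unit_on I y"
  shows "Dl I y = 0" "s \<in> I \<Longrightarrow> Phi (I - {s}) a (\<lambda>i. y s / y i) * Dl (I - {s}) y = 0"
proof -
  have Dl0: "Dl K y = 0" if "K \<subseteq> I" "i \<in> K" "j \<in> K" for K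
  proof -
    have "y i \<noteq> 0" using y ij by (auto simp: unit_on_def)
    then have "inverse (y i) * y j = 1" using ij by simp
    then have z: "einf (inverse (y i) * y j) = 0" by (simp only: einf_one)
    have "finite K" using that I finite_subset by auto
    have "(\<Prod>k\<in>K - {i}. einf (inverse (y i) * y k)) = 0"
      using that ij z \<open>finite K\<close> by (intro prod_zero bexI[of _ j]) auto
    then show ?thesis unfolding Dl_def using that \<open>finite K\<close> by (intro prod_zero[of K] bexI[of _ i]) auto
  qed
  show "Dl I y = 0" using Dl0 ij by auto
  have Phi0: "Phi (I - {s}) a (\<lambda>i. y s / y i) = 0" if "s \<in> I" "t \<in> I" "s \<noteq> t" "y s = y t" for s t
  proof -
    have "y t \<noteq> 0" using y that by (auto simp: unit_on_def)
    then have "(\<Prod>i\<in>I - {s}. ph k (y s / y i)) = 0" for k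
      using I that by (intro prod_zero bexI[of _ t]) (auto simp: ph_def)
    then show ?thesis by (simp add: Phi_def)
  qed
  assume s: "s \<in> I"
  consider "s = i" | "s = j" | "s \<noteq> i" "s \<noteq> j" by blast
  then show "Phi (I - {s}) a (\<lambda>i. y s / y i) * Dl (I - {s}) y = 0"
  proof cases
    case 3
    then show ?thesis using Dl0[of "I - {s}"] ij by auto
  qed (use Phi0[of i j] Phi0[of j i] ij in auto)
qed

text \<open>
The weight factors cancel the denominators of the partial fraction coefficient.
\<close>

lemma ph_eq:
  assumes "norm u = 1" "u \<noteq> 1"
  shows "((-1) ^ k * qtri k / (u ^ k * qpoch (q / u) k * einf u)) * (einf u * einf (1 / u)) = ph k (1 / u)"
proof -
  have u: "u \<noteq> 0" using assms by auto
  have e: "einf u \<noteq> 0" using einf_nonzero'[of u] assms by auto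
  have "norm (q / u) < 1" using norm_q assms by (simp add: norm_divide)
  then have "q / u \<noteq> 1" by auto
  then have p: "qpoch (q / u) k \<noteq> 0" using \<open>norm (q / u) < 1\<close> by (intro qpoch_nonzero) auto
  have "einf (1 / u) = (1 - 1 / u) * qpoch (q / u) k * einf (q ^ Suc k * (1 / u))"
    using einf_split_Suc[of "1 / u" k] by simp
  moreover have "s / (U * p * e) * (e * (w * p * E)) = s * (1 / U) * w * E"
    if "U \<noteq> 0" "p \<noteq> 0" "e \<noteq> 0" for s U p e w E :: complex
    using that by simp
  ultimately show ?thesis using u e p unfolding ph_def
    by (simp only: power_one_over power_not_zero[OF u] not_False_eq_True)
qed

end

section \<open>Partial fractions of the generating function\<close>

lemma power_inj_less_one:
  fixes a :: real
  assumes "0 < a" "a < 1" "a ^ k = a ^ k'"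
  shows "k = k'"
proof (cases k k' rule: linorder_cases)
  case less
  then show ?thesis using power_strict_decreasing[OF less, of a] assms by simp
next
  case greater
  then show ?thesis using power_strict_decreasing[OF greater, of a] assms by simp
qed

context q_disc
begin

text \<open>
The truncated generating function \<open>\<Prod>\<^sub>i 1 / (y\<^sub>i X; q)\<^sub>M\<close> has simple poles, indexed by the pairs of a
variable \<open>j\<close> and an exponent \<open>k < M\<close>. Its partial fraction coefficients converge as \<open>M\<close> grows and are
dominated by a geometric series in \<open>k\<close>, because the triangular power of \<open>q\<close> from the poles of the
same variable is at most \<open>\<bar>q\<bar>\<^sup>k\<close>. For \<open>q = 0\<close> the poles are not distinct, and this case is treated
separately.
\<close>

lemma gp_partial_fractions:
  assumes I: "finite I" "I \<noteq> {}" and y: "unit_on I y" "inj_on y I" and q0: "q \<noteq> 0"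
  shows "gp I a y = (\<Sum>j\<in>I. \<Sum>k. y j ^ a * q ^ (k * a) * cc k *
    (\<Prod>i\<in>I - {j}. (-1) ^ k * qtri k / ((y i / y j) ^ k * qpoch (q / (y i / y j)) k * einf (y i / y j))))"
proof -
  have y0: "y i \<noteq> 0" if "i \<in> I" for i using y that by (auto simp: unit_on_def)
  define T where "T M j k = (if k < M then y j ^ a * q ^ (k * a) * ((-1) ^ k * qtri k / (qp k * qp (M - Suc k))) *
    (\<Prod>i\<in>I - {j}. (-1) ^ k * qtri k / ((y i / y j) ^ k * qpoch (q / (y i / y j)) k * qpoch (y i / y j) (M - k))) else 0)" for M j k
  define L where "L j k = y j ^ a * q ^ (k * a) * cc k *
    (\<Prod>i\<in>I - {j}. (-1) ^ k * qtri k / ((y i / y j) ^ k * qpoch (q / (y i / y j)) k * einf (y i / y j)))" for j k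
  have u: "norm (y i / y j) = 1" "y i / y j \<noteq> 1" "y i / y j \<noteq> 0" if "i \<in> I - {j}" "j \<in> I" for i j
  proof -
    have "y i \<noteq> y j" using inj_onD[OF y(2), of i j] that by auto
    then show "y i / y j \<noteq> 1" using y0[OF that(2)] by (simp add: divide_eq_1_iff)
    have "norm (y i) = 1" "norm (y j) = 1" using y(1) that unfolding unit_on_def by blast+
    then show "norm (y i / y j) = 1" by (simp add: norm_divide)
    show "y i / y j \<noteq> 0" using y0[of i] y0[of j] that by simp
  qed
  have qu: "norm (q / (y i / y j)) < 1" "q / (y i / y j) \<noteq> 1" if "i \<in> I - {j}" "j \<in> I" for i j
  proof -
    show *: "norm (q / (y i / y j)) < 1" unfolding norm_divide[of q] u(1)[OF that] using norm_q by simp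
    show "q / (y i / y j) \<noteq> 1" using * by (metis norm_one less_irrefl)
  qed
  \<comment> \<open>For a truncation at \<open>M\<close> factors per variable the decomposition is exact.\<close>
  have fin: "fps_nth (\<Prod>i\<in>I. \<Prod>k<M. geo (y i * q ^ k)) a = (\<Sum>j\<in>I. \<Sum>k<M. T M j k)" if M: "M > 0" for M
  proof -
    define z where "z = (\<lambda>(j, k). y j * q ^ k)"
    define S where "S = I \<times> {..<M}"
    have S: "finite S" "S \<noteq> {}" using I M by (auto simp: S_def)
    have inj: "inj_on z S"
    proof (rule inj_onI, clarsimp simp: S_def z_def)
      fix j k j' k' assume j: "j \<in> I" "j' \<in> I" and eq: "y j * q ^ k = y j' * q ^ k'"
      have "norm q ^ k = norm q ^ k'"
        using arg_cong[OF eq, of norm] j y by (simp add: norm_mult norm_power unit_on_def)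
      then have "k = k'" using q0 norm_q by (intro power_inj_less_one[of "norm q"]) auto
      then show "j = j' \<and> k = k'" using eq q0 j y by (auto dest: inj_onD)
    qed
    have "(\<Prod>i\<in>I. \<Prod>k<M. geo (y i * q ^ k)) = (\<Prod>s\<in>S. geo (z s))"
      unfolding S_def z_def by (subst prod.cartesian_product) (simp only: case_prod_unfold)
    also have "\<dots> = (\<Sum>s\<in>S. fps_const (pfc z S s) * geo (z s))"
      by (rule partial_fractions_fps[OF S inj]) (use y0 q0 in \<open>auto simp: S_def z_def\<close>)
    finally have "fps_nth (\<Prod>i\<in>I. \<Prod>k<M. geo (y i * q ^ k)) a = (\<Sum>s\<in>S. pfc z S s * z s ^ a)"
      by (simp add: fps_sum_nth)
    also have "\<dots> = (\<Sum>(j, k)\<in>S. T M j k)"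
    proof (rule sum.cong[OF refl], clarify)
      fix j k assume "(j, k) \<in> S"
      then have j: "j \<in> I" and k: "k < M" by (auto simp: S_def)
      have eq: "S - {(j, k)} = ({j} \<times> ({..<M} - {k})) \<union> ((I - {j}) \<times> {..<M})"
        using j by (auto simp: S_def)
      have "pfc z S (j, k) = (\<Prod>t\<in>{j} \<times> ({..<M} - {k}). 1 / (1 - z t / z (j, k))) *
          (\<Prod>t\<in>(I - {j}) \<times> {..<M}. 1 / (1 - z t / z (j, k)))"
        unfolding pfc_def eq using I by (intro prod.union_disjoint) auto
      also have "(\<Prod>t\<in>{j} \<times> ({..<M} - {k}). 1 / (1 - z t / z (j, k))) =
          (\<Prod>m\<in>{..<M} - {k}. 1 / (1 - q ^ m / q ^ k))"
        using y0[OF j]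
        by (intro prod.reindex_bij_witness[of _ "\<lambda>m. (j, m)" snd]) (auto simp: z_def)
      also have "\<dots> = (-1) ^ k * qtri k / (qp k * qp (M - Suc k))"
      proof -
        have eq: "{..<M} - {k} = {..<k} \<union> {k<..<M}" using k by auto
        have "(\<Prod>m\<in>{..<M} - {k}. 1 - q ^ m / q ^ k) =
            (\<Prod>m<k. 1 - q ^ m / q ^ k) * (\<Prod>m\<in>{k<..<M}. 1 - q ^ m / q ^ k)"
          unfolding eq by (rule prod.union_disjoint) auto
        also have "(\<Prod>m\<in>{k<..<M}. 1 - q ^ m / q ^ k) = qp (M - Suc k)"
          unfolding qp_def qpoch_def
        proof (rule prod.reindex_bij_witness[of _ "\<lambda>r. k + Suc r" "\<lambda>m. m - Suc k"])
          fix m assume m: "m \<in> {k<..<M}"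
          then have "m = k + Suc (m - Suc k)" by auto
          then have "q ^ m = q ^ k * (q * q ^ (m - Suc k))" by (metis power_add power_Suc)
          then show "1 - q * q ^ (m - Suc k) = 1 - q ^ m / q ^ k" using q0 by simp
        qed (use k in auto)
        also have "(\<Prod>m<k. 1 - q ^ m / q ^ k) = (-1) ^ k * qp k / qtri k"
          using qprod_shift[OF q0, of 1 k] qtri_nonzero[OF q0] by (simp add: field_simps qp_def)
        finally show ?thesis
          by (cases "even k") (simp_all add: prod_dividef)
      qed
      also have "(\<Prod>t\<in>(I - {j}) \<times> {..<M}. 1 / (1 - z t / z (j, k))) =
          (\<Prod>i\<in>I - {j}. \<Prod>m<M. 1 / (1 - (y i / y j) * q ^ m / q ^ k))"
        unfolding prod.cartesian_product
        by (rule prod.cong) (auto simp: z_def)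
      also have "\<dots> = (\<Prod>i\<in>I - {j}. (-1) ^ k * qtri k / ((y i / y j) ^ k * qpoch (q / (y i / y j)) k * qpoch (y i / y j) (M - k)))"
      proof (rule prod.cong[OF refl])
        fix i assume i: "i \<in> I - {j}"
        define v where "v = y i / y j"
        have v: "v \<noteq> 0" using u[OF i j] by (simp add: v_def)
        have eq: "{..<M} = {..<k} \<union> {k..<M}" using k by auto
        have "(\<Prod>m\<in>{..<M}. 1 - v * q ^ m / q ^ k) = (\<Prod>m<k. 1 - v * q ^ m / q ^ k) * (\<Prod>m\<in>{k..<M}. 1 - v * q ^ m / q ^ k)"
          by (subst eq, rule prod.union_disjoint) auto
        also have "(\<Prod>m\<in>{k..<M}. 1 - v * q ^ m / q ^ k) = qpoch v (M - k)"
          unfolding qpoch_def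
          by (rule prod.reindex_bij_witness[of _ "\<lambda>r. k + r" "\<lambda>m. m - k"])
             (use q0 k in \<open>auto simp: power_diff\<close>)
        also have "(\<Prod>m<k. 1 - v * q ^ m / q ^ k) = (- v) ^ k * qpoch (q / v) k / qtri k"
          using qprod_shift[OF q0 v, of k] qtri_nonzero[OF q0] by (simp add: field_simps)
        finally have "(\<Prod>m<M. 1 / (1 - v * q ^ m / q ^ k)) = qtri k / ((-1) ^ k * (v ^ k * qpoch (q / v) k * qpoch v (M - k)))"
          by (simp add: prod_dividef power_minus[of v k] mult_ac)
        also have "\<dots> = (-1) ^ k * qtri k / (v ^ k * qpoch (q / v) k * qpoch v (M - k))"
          by (cases "even k") auto
        finally show "(\<Prod>m<M. 1 / (1 - (y i / y j) * q ^ m / q ^ k)) =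
            (-1) ^ k * qtri k / ((y i / y j) ^ k * qpoch (q / (y i / y j)) k * qpoch (y i / y j) (M - k))"
          by (simp add: v_def)
      qed
      finally show "pfc z S (j, k) * z (j, k) ^ a = T M j k"
        using k by (simp add: T_def z_def power_mult_distrib power_mult[symmetric] mult_ac)
    qed
    finally show ?thesis by (simp add: S_def sum.cartesian_product)
  qed
  \<comment> \<open>All symbols in the denominators are bounded away from zero, which dominates the terms.\<close>
  have lim: "(\<lambda>M. \<Sum>k. T M j k) \<longlonglongrightarrow> (\<Sum>k. L j k)" if j: "j \<in> I" for j
  proof -
    obtain B where B: "B > 0" "\<And>n. norm (1 / qp n) \<le> B" using inverse_qp_bounded by blast
    have "\<forall>i\<in>I - {j}. \<exists>C>0. \<forall>n. norm (1 / qpoch (q / (y i / y j)) n) \<le> C"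
      using qu[OF _ j] by (intro ballI inverse_qpoch_bounded) (auto intro: less_imp_le)
    then obtain C1 where C1: "\<And>i. i \<in> I - {j} \<Longrightarrow> C1 i > 0"
      "\<And>i n. i \<in> I - {j} \<Longrightarrow> norm (1 / qpoch (q / (y i / y j)) n) \<le> C1 i" by (metis (no_types))
    have "\<forall>i\<in>I - {j}. \<exists>C>0. \<forall>n. norm (1 / qpoch (y i / y j) n) \<le> C"
      using u[OF _ j] by (intro ballI inverse_qpoch_bounded) auto
    then obtain C2 where C2: "\<And>i. i \<in> I - {j} \<Longrightarrow> C2 i > 0"
      "\<And>i n. i \<in> I - {j} \<Longrightarrow> norm (1 / qpoch (y i / y j) n) \<le> C2 i" by (metis (no_types))
    define D where "D = B * B * (\<Prod>i\<in>I - {j}. C1 i * C2 i)"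
    have qle: "norm q ^ n \<le> 1" for n using norm_q by (simp add: power_le_one)
    have qt1: "norm (qtri k) \<le> 1" for k using norm_qtri_le[of k] qle[of k] by linarith
    have D0: "0 \<le> D" unfolding D_def using B C1(1) C2(1)
      by (intro mult_nonneg_nonneg prod_nonneg) (auto intro!: mult_nonneg_nonneg less_imp_le)
    have bound: "norm (T M j k) \<le> D * norm q ^ k" for M k
    proof (cases "k < M")
      case True
      have "norm (T M j k) = norm q ^ (k * a) * (norm (qtri k) * (norm (1 / qp k) * norm (1 / qp (M - Suc k)))) *
        (\<Prod>i\<in>I - {j}. norm (qtri k) * (norm (1 / qpoch (q / (y i / y j)) k) * norm (1 / qpoch (y i / y j) (M - k))))"
      proof -
        have "norm (y j) = 1" using y j by (auto simp: unit_on_def)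
        moreover have "(\<Prod>i\<in>I - {j}. norm ((-1) ^ k * qtri k / ((y i / y j) ^ k * qpoch (q / (y i / y j)) k * qpoch (y i / y j) (M - k)))) =
          (\<Prod>i\<in>I - {j}. norm (qtri k) * (norm (1 / qpoch (q / (y i / y j)) k) * norm (1 / qpoch (y i / y j) (M - k))))"
        proof (rule prod.cong[OF refl])
          fix i assume "i \<in> I - {j}"
          then have v: "norm (y i / y j) = 1" using u j by blast
          have "norm ((-1) ^ k * s / (v ^ k * A * C)) = norm s * (norm (1 / A) * norm (1 / C))"
            if "norm v = 1" for v s A C :: complex
            using that by (simp add: norm_mult norm_divide norm_power)
          from this[OF v] show "norm ((-1) ^ k * qtri k / ((y i / y j) ^ k * qpoch (q / (y i / y j)) k * qpoch (y i / y j) (M - k))) =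
            norm (qtri k) * (norm (1 / qpoch (q / (y i / y j)) k) * norm (1 / qpoch (y i / y j) (M - k)))" .
        qed
        ultimately show ?thesis using True
          by (simp add: T_def norm_mult norm_power norm_divide prod_norm[symmetric])
      qed
      also have "\<dots> \<le> 1 * (norm q ^ k * (B * B)) * (\<Prod>i\<in>I - {j}. 1 * (C1 i * C2 i))"
      proof (rule mult_mono)
        show "(\<Prod>i\<in>I - {j}. norm (qtri k) * (norm (1 / qpoch (q / (y i / y j)) k) * norm (1 / qpoch (y i / y j) (M - k))))
            \<le> (\<Prod>i\<in>I - {j}. 1 * (C1 i * C2 i))"
        proof (rule prod_mono, rule conjI)
          fix i assume i: "i \<in> I - {j}"
          have "norm (1 / qpoch (q / (y i / y j)) k) * norm (1 / qpoch (y i / y j) (M - k)) \<le> C1 i * C2 i"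
            using C1[OF i] C2[OF i] by (intro mult_mono) (auto intro: less_imp_le)
          from mult_mono[OF qt1[of k] this]
          show "norm (qtri k) * (norm (1 / qpoch (q / (y i / y j)) k) * norm (1 / qpoch (y i / y j) (M - k))) \<le> 1 * (C1 i * C2 i)"
            by auto
        qed auto
        show "norm q ^ (k * a) * (norm (qtri k) * (norm (1 / qp k) * norm (1 / qp (M - Suc k)))) \<le> 1 * (norm q ^ k * (B * B))"
          by (intro mult_mono qle norm_qtri_le B(2)) (use B(1) in auto)
      qed (use B in \<open>auto intro!: prod_nonneg\<close>)
      finally show ?thesis by (simp add: D_def mult_ac)
    qed (use D0 in \<open>auto simp: T_def\<close>)
    have ptw: "(\<lambda>M. T M j k) \<longlonglongrightarrow> L j k" for k
    proof -
      have s1: "(\<lambda>M. qp (M - Suc k)) \<longlonglongrightarrow> einf q"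
        by (rule LIMSEQ_offset[of _ "Suc k"]) (use qpoch_tendsto_einf[of q] in \<open>simp add: qp_def\<close>)
      have s2: "(\<lambda>M. qpoch v (M - k)) \<longlonglongrightarrow> einf v" for v
        by (rule LIMSEQ_offset[of _ k]) (use qpoch_tendsto_einf[of v] in simp)
      have nz: "einf q \<noteq> 0" using einf_nonzero[OF norm_q] .
      have nz2: "(y i / y j) ^ k * qpoch (q / (y i / y j)) k * einf (y i / y j) \<noteq> 0" if "i \<in> I - {j}" for i
        using u[OF that j] qu[OF that j] qpoch_nonzero[of "q / (y i / y j)" k] einf_nonzero'[of "y i / y j"] by simp
      have "(\<lambda>M. y j ^ a * q ^ (k * a) * ((-1) ^ k * qtri k / (qp k * qp (M - Suc k))) *
        (\<Prod>i\<in>I - {j}. (-1) ^ k * qtri k / ((y i / y j) ^ k * qpoch (q / (y i / y j)) k * qpoch (y i / y j) (M - k)))) \<longlonglongrightarrow> L j k"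
        unfolding L_def cc_def
        by (intro tendsto_mult tendsto_prod tendsto_divide tendsto_const s1 s2) (use nz nz2 in auto)
      moreover have "eventually (\<lambda>M. y j ^ a * q ^ (k * a) * ((-1) ^ k * qtri k / (qp k * qp (M - Suc k))) *
        (\<Prod>i\<in>I - {j}. (-1) ^ k * qtri k / ((y i / y j) ^ k * qpoch (q / (y i / y j)) k * qpoch (y i / y j) (M - k))) = T M j k) sequentially"
        using eventually_gt_at_top[of k] by eventually_elim (simp add: T_def)
      ultimately show ?thesis by (rule Lim_transform_eventually)
    qed
    show ?thesis
    proof (rule tannerys_theorem[of "\<lambda>k M. T M j k" "L j" _ "\<lambda>k. D * norm q ^ k", THEN conjunct2, THEN conjunct2])
      show "summable (\<lambda>k. D * norm q ^ k)" using norm_q by (intro summable_mult summable_geometric) auto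
    qed (use ptw bound in \<open>auto intro: always_eventually\<close>)
  qed
  have "(\<lambda>M. \<Sum>j\<in>I. \<Sum>k. T M j k) \<longlonglongrightarrow> (\<Sum>j\<in>I. \<Sum>k. L j k)"
    by (intro tendsto_sum lim)
  moreover have "eventually (\<lambda>M. (\<Sum>j\<in>I. \<Sum>k. T M j k) = fps_nth (\<Prod>i\<in>I. \<Prod>k<M. geo (y i * q ^ k)) a) sequentially"
    using eventually_gt_at_top[of 0]
  proof eventually_elim
    case (elim M)
    have "(\<Sum>k. T M j k) = (\<Sum>k<M. T M j k)" for j
      by (rule suminf_finite) (auto simp: T_def)
    then show ?case using fin[OF elim] by simp
  qed
  ultimately have "(\<lambda>M. fps_nth (\<Prod>i\<in>I. \<Prod>k<M. geo (y i * q ^ k)) a) \<longlonglongrightarrow> (\<Sum>j\<in>I. \<Sum>k. L j k)"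
    by (rule Lim_transform_eventually)
  with gp_limit[OF I(1)] have "gp I a y = (\<Sum>j\<in>I. \<Sum>k. L j k)" by (rule LIMSEQ_unique)
  then show ?thesis by (simp add: L_def)
qed

end

section \<open>Analyticity of the expansion coefficients\<close>

context q_disc
begin

lemma qtri_power_bounded:
  assumes "R \<ge> 0" shows "\<exists>B. \<forall>k. norm (qtri k) * R ^ k \<le> B"
proof -
  have "(\<lambda>k. norm q ^ Suc k * R) \<longlonglongrightarrow> 0"
    by (rule tendsto_mult_left_zero, rule LIMSEQ_Suc, rule LIMSEQ_power_zero) (use norm_q in simp)
  then have "eventually (\<lambda>k. norm q ^ Suc k * R < 1 / 2) sequentially"
    by (rule order_tendstoD) auto
  then obtain N where N: "\<And>k. k \<ge> N \<Longrightarrow> norm q ^ Suc k * R < 1 / 2" by (auto simp: eventually_sequentially)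
  have "summable (\<lambda>k. norm (qtri k) * R ^ k)"
  proof (rule summable_ratio_test[of "1/2" N])
    fix k assume k: "k \<ge> N"
    have "norm (norm (qtri (Suc k)) * R ^ Suc k) = (norm q ^ Suc k * R) * (norm (qtri k) * R ^ k)"
      using assms by (simp add: qtri_def norm_mult norm_power mult_ac)
    also have "\<dots> \<le> 1 / 2 * (norm (qtri k) * R ^ k)"
      using N[OF k] assms by (intro mult_right_mono) auto
    finally show "norm (norm (qtri (Suc k)) * R ^ Suc k) \<le> 1 / 2 * norm (norm (qtri k) * R ^ k)"
      using assms by simp
  qed simp
  then have "Bseq (\<lambda>k. norm (qtri k) * R ^ k)"
    by (rule convergent_imp_Bseq[OF convergentI[OF summable_LIMSEQ_zero]])
  then obtain B where "\<forall>k. norm (norm (qtri k) * R ^ k) \<le> B" by (auto elim: BseqE)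
  then have "norm (qtri k) * R ^ k \<le> B" for k using assms by (auto simp: abs_mult)
  then show ?thesis by blast
qed

text \<open>
The triangular power of \<open>q\<close> beats the powers \<open>w i ^ k\<close>, which gives locally uniform convergence for
arguments of any size, not only of absolute value one.
\<close>

lemma Phi_bound:
  assumes "finite K" "R \<ge> 0"
  shows "\<exists>C. \<forall>w k. (\<forall>i\<in>K. norm (w i) \<le> R) \<longrightarrow>
    norm (q ^ (k * a) * cc k * (\<Prod>i\<in>K. ph k (w i))) \<le> C * norm q ^ k"
proof -
  obtain B where B: "\<And>k. norm (qtri k) * R ^ k \<le> B" using qtri_power_bounded[OF assms(2)] by blast
  obtain B' where B': "B' > 0" "\<And>n. norm (1 / qp n) \<le> B'" using inverse_qp_bounded by blast
  have "compact (einf ` cball 0 R)" by (intro compact_continuous_image einf_continuous) auto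
  then obtain E where E: "\<And>z. z \<in> einf ` cball 0 R \<Longrightarrow> norm z \<le> E"
    using compact_imp_bounded bounded_iff by metis
  have E0: "0 \<le> E" using order_trans[OF norm_ge_zero E[of "einf 0"]] assms(2) by (auto simp del: einf_0)
  have B0: "0 \<le> B" using B[of 0] by (simp add: qtri_def)
  have ph: "norm (ph k u) \<le> B * (1 + R) * E" if "norm u \<le> R" for k u
  proof -
    have "norm (q ^ Suc k * u) \<le> R"
    proof -
      have "norm q ^ Suc k \<le> 1" using norm_q by (intro power_le_one) auto
      then have "norm q ^ Suc k * norm u \<le> 1 * R" using that by (intro mult_mono) auto
      then show ?thesis by (simp only: norm_mult norm_power mult_1)
    qed
    then have e: "norm (einf (q ^ Suc k * u)) \<le> E" by (intro E imageI) simp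
    have "norm (qtri k) * norm u ^ k \<le> norm (qtri k) * R ^ k"
      using that by (intro mult_left_mono power_mono) auto
    then have b: "norm (qtri k) * norm u ^ k \<le> B" using B[of k] by linarith
    have r: "norm (1 - u) \<le> 1 + R" using norm_triangle_ineq4[of 1 u] that by simp
    have "norm (ph k u) = (norm (qtri k) * norm u ^ k) * norm (1 - u) * norm (einf (q ^ Suc k * u))"
      by (simp add: ph_def norm_mult norm_power)
    also have "\<dots> \<le> B * (1 + R) * E"
      using b r e B0 E0 assms(2) by (intro mult_mono mult_nonneg_nonneg) auto
    finally show ?thesis .
  qed
  define D where "D = (B * (1 + R) * E) ^ card K"
  have D0: "0 \<le> D" unfolding D_def using B0 E0 assms(2) by simp
  define C where "C = B' * norm (1 / einf q) * D"
  have "norm (q ^ (k * a) * cc k * (\<Prod>i\<in>K. ph k (w i))) \<le> C * norm q ^ k"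
    if w: "\<forall>i\<in>K. norm (w i) \<le> R" for w k
  proof -
    have 1: "norm (q ^ (k * a)) \<le> 1" using norm_q by (simp add: norm_power power_le_one)
    have 2: "norm (cc k) \<le> norm q ^ k * (B' * norm (1 / einf q))"
    proof -
      have "norm (cc k) = norm (qtri k) * (norm (1 / qp k) * norm (1 / einf q))"
        by (simp add: cc_def norm_mult norm_divide norm_power)
      also have "\<dots> \<le> norm q ^ k * (B' * norm (1 / einf q))"
        using B' norm_qtri_le by (intro mult_mono mult_right_mono) auto
      finally show ?thesis .
    qed
    have 3: "norm (\<Prod>i\<in>K. ph k (w i)) \<le> D"
    proof -
      have "norm (\<Prod>i\<in>K. ph k (w i)) = (\<Prod>i\<in>K. norm (ph k (w i)))" by (simp add: prod_norm)
      also have "\<dots> \<le> (\<Prod>i\<in>K. B * (1 + R) * E)" using w ph by (intro prod_mono) auto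
      finally show ?thesis by (simp add: D_def)
    qed
    have "norm (q ^ (k * a) * cc k * (\<Prod>i\<in>K. ph k (w i))) \<le> 1 * (norm q ^ k * (B' * norm (1 / einf q))) * D"
      unfolding norm_mult using 1 2 3 B'(1) D0 by (intro mult_mono mult_nonneg_nonneg) auto
    then show ?thesis by (simp add: C_def mult_ac)
  qed
  then show ?thesis by blast
qed

lemma Phi_summable:
  assumes "finite K"
  shows "summable (\<lambda>k. q ^ (k * a) * cc k * (\<Prod>i\<in>K. ph k (w i)))"
proof -
  define R where "R = Max (insert 0 ((\<lambda>i. norm (w i)) ` K))"
  have R: "R \<ge> 0" "\<forall>i\<in>K. norm (w i) \<le> R" using assms by (auto simp: R_def)
  obtain C where C: "\<And>k. norm (q ^ (k * a) * cc k * (\<Prod>i\<in>K. ph k (w i))) \<le> C * norm q ^ k"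
    using Phi_bound[OF assms R(1)] R(2) by blast
  have "summable (\<lambda>k. C * norm q ^ k)" using norm_q by (intro summable_mult summable_geometric) auto
  then show ?thesis by (rule summable_comparison_test') (rule C)
qed

lemma ph_holomorphic: "ph k holomorphic_on UNIV"
proof -
  have "(einf \<circ> (\<lambda>u. q ^ Suc k * u)) holomorphic_on UNIV"
    by (rule holomorphic_on_compose) (auto intro!: holomorphic_intros holomorphic_on_subset[OF einf_holomorphic])
  then show ?thesis unfolding ph_def comp_def by (intro holomorphic_intros)
qed

lemma Phi_holomorphic:
  assumes K: "finite K" and w: "\<And>i. i \<in> K \<Longrightarrow> w i holomorphic_on UNIV"
  shows "(\<lambda>z. Phi K a (\<lambda>i. w i z)) holomorphic_on UNIV"
proof (rule holomorphic_uniform_sequence[OF open_UNIV])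
  define T where "T k z = q ^ (k * a) * cc k * (\<Prod>i\<in>K. ph k (w i z))" for k z
  have hol: "T k holomorphic_on UNIV" for k
  proof -
    have "(ph k \<circ> w i) holomorphic_on UNIV" if "i \<in> K" for i
      using w[OF that] by (rule holomorphic_on_compose) (auto intro: holomorphic_on_subset[OF ph_holomorphic])
    then show ?thesis unfolding T_def comp_def by (intro holomorphic_intros)
  qed
  show "(\<lambda>z. \<Sum>k<n. T k z) holomorphic_on UNIV" for n by (intro holomorphic_intros hol)
  fix x :: complex
  have "\<exists>R. \<forall>i\<in>K. \<forall>z\<in>cball x 1. norm (w i z) \<le> R"
  proof -
    have "bounded (w i ` cball x 1)" if "i \<in> K" for i
      by (intro compact_imp_bounded compact_continuous_image
            continuous_on_subset[OF holomorphic_on_imp_continuous_on[OF w[OF that]]]) auto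
    then have "bounded (\<Union>i\<in>K. w i ` cball x 1)" using K by (intro bounded_UN) auto
    then show ?thesis by (auto simp: bounded_iff)
  qed
  then obtain R0 where R0: "\<And>i z. i \<in> K \<Longrightarrow> z \<in> cball x 1 \<Longrightarrow> norm (w i z) \<le> R0" by blast
  define R where "R = max 0 R0"
  have "R \<ge> 0" by (simp add: R_def)
  obtain C where C: "\<And>k v. (\<forall>i\<in>K. norm (v i) \<le> R) \<Longrightarrow> norm (q ^ (k * a) * cc k * (\<Prod>i\<in>K. ph k (v i))) \<le> C * norm q ^ k"
    using Phi_bound[OF K \<open>R \<ge> 0\<close>, of a] by blast
  have "uniform_limit (cball x 1) (\<lambda>n z. \<Sum>k<n. T k z) (\<lambda>z. \<Sum>k. T k z) sequentially"
  proof (rule Weierstrass_m_test)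
    show "norm (T k z) \<le> C * norm q ^ k" if "z \<in> cball x 1" for k z
      unfolding T_def using R0[OF _ that] by (intro C) (auto simp: R_def le_max_iff_disj)
    show "summable (\<lambda>k. C * norm q ^ k)" using norm_q by (intro summable_mult summable_geometric) auto
  qed
  then show "\<exists>d>0. cball x d \<subseteq> UNIV \<and> uniform_limit (cball x d) (\<lambda>n z. \<Sum>k<n. T k z) (\<lambda>z. Phi K a (\<lambda>i. w i z)) sequentially"
    unfolding Phi_def T_def by (intro exI[of _ 1]) auto
qed

text \<open>
Only the pole with exponent \<open>0\<close> contributes when all ratios vanish.
\<close>

lemma Phi_at_0:
  assumes "finite K" "K \<noteq> {}"
  shows "Phi K a (\<lambda>_. 0) = 1 / einf q"
proof -
  have "Phi K a (\<lambda>_. 0) = (\<Sum>k\<in>{0}. q ^ (k * a) * cc k * (\<Prod>i\<in>K. ph k 0))"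
    unfolding Phi_def
  proof (rule suminf_finite)
    fix k :: nat assume "k \<notin> {0}"
    then have "ph k 0 = 0" by (simp add: ph_def)
    then show "q ^ (k * a) * cc k * (\<Prod>i\<in>K. ph k 0) = 0" using assms by (simp add: card_gt_0_iff)
  qed simp
  then show ?thesis by (simp add: ph_def cc_def qtri_def)
qed

lemma good_Phi:
  assumes K: "finite K" and w: "\<And>i. i \<in> K \<Longrightarrow> good I (w i)"
  shows "good I (\<lambda>y. Phi K a (\<lambda>i. w i y))"
proof -
  have "\<forall>i\<in>K. \<exists>B. \<forall>y. unit_on I y \<longrightarrow> norm (w i y) \<le> B" using w by (auto simp: good_def)
  then obtain B where B: "\<And>i y. i \<in> K \<Longrightarrow> unit_on I y \<Longrightarrow> norm (w i y) \<le> B i" by metis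
  define R where "R = Max (insert 0 (B ` K))"
  have R: "R \<ge> 0" "\<And>i. i \<in> K \<Longrightarrow> B i \<le> R" using K by (auto simp: R_def)
  obtain C where C: "\<And>k v. (\<forall>i\<in>K. norm (v i) \<le> R) \<Longrightarrow> norm (q ^ (k * a) * cc k * (\<Prod>i\<in>K. ph k (v i))) \<le> C * norm q ^ k"
    using Phi_bound[OF K R(1)] by blast
  have sm: "summable (\<lambda>k. C * norm q ^ k)" using norm_q by (intro summable_mult summable_geometric) auto
  show ?thesis
  proof (rule goodI)
    have "good I (\<lambda>y. ph k (w i y))" if "i \<in> K" for i k
      using w[OF that] holomorphic_on_imp_continuous_on[OF ph_holomorphic] by (rule good_cont)
    then have "good I (\<lambda>y. q ^ (k * a) * cc k * (\<Prod>i\<in>K. ph k (w i y)))" for k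
      by (intro good_mult good_const good_prod)
    then show "(\<lambda>y. Phi K a (\<lambda>i. w i y)) \<in> borel_measurable (tor I)"
      unfolding Phi_def by (intro borel_measurable_suminf) (simp add: good_def)
    fix y assume y: "unit_on I y"
    have le: "norm (q ^ (k * a) * cc k * (\<Prod>i\<in>K. ph k (w i y))) \<le> C * norm q ^ k" for k
      using B[OF _ y] R(2) by (intro C) (meson order_trans)
    have "norm (Phi K a (\<lambda>i. w i y)) \<le> (\<Sum>k. C * norm q ^ k)"
      unfolding Phi_def using norm_suminf_le[OF le sm] .
    then show "norm (Phi K a (\<lambda>i. w i y)) \<le> (\<Sum>k. C * norm q ^ k)" .
  qed
qed

end

section \<open>The expansion of the weight\<close>

context q_disc
begin

lemma gp_empty [simp]: "gp {} a y = (if a = 0 then 1 else 0)"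
  by (simp add: gp_def)

lemma Phi_q0:
  assumes "q = 0" "finite K"
  shows "Phi K a w = (\<Prod>i\<in>K. 1 - w i)"
proof -
  have "qtri k = 0" if "k > 0" for k
    unfolding qtri_def using assms(1) that by (cases k) auto
  then have "Phi K a w = (\<Sum>k\<in>{0}. q ^ (k * a) * cc k * (\<Prod>i\<in>K. ph k (w i)))"
    unfolding Phi_def by (intro suminf_finite) (auto simp: cc_def)
  also have "\<dots> = (\<Prod>i\<in>K. 1 - w i)"
  proof -
    have "q ^ Suc 0 * v = 0" for v using assms(1) by simp
    then have "einf q = 1" "einf (q ^ Suc 0 * v) = 1" for v using assms(1) einf_0 by metis+
    then show ?thesis by (simp add: cc_def ph_def qtri_def del: power_Suc)
  qed
  finally show ?thesis .
qed

lemma einf_q0: "q = 0 \<Longrightarrow> einf z = 1 - z"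
  using einf_rec[of z] einf_0 by (metis mult_zero_left mult_1_right)

lemma gp_partial_fractions_q0:
  assumes I: "finite I" "I \<noteq> {}" and y: "unit_on I y" "inj_on y I" and q0: "q = 0"
  shows "gp I a y = (\<Sum>j\<in>I. y j ^ a * (\<Prod>i\<in>I - {j}. 1 / (1 - y i / y j)))"
proof -
  have "qp n = 1" for n
  proof (induction n)
    case (Suc n)
    have "q ^ Suc n = 0" using q0 by simp
    with Suc show ?case by (simp only: qp_Suc) simp
  qed simp
  then have "gen c = geo c" for c by (simp add: gen_def geo_def)
  then have "gp I a y = fps_nth (\<Prod>i\<in>I. geo (y i)) a" by (simp add: gp_def)
  also have "\<dots> = fps_nth (\<Sum>j\<in>I. fps_const (pfc y I j) * geo (y j)) a"
    using y(1) by (subst partial_fractions_fps[OF I y(2)]) (auto simp: unit_on_def)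
  finally show ?thesis by (simp add: fps_sum_nth pfc_def mult.commute)
qed

text \<open>
Multiplying the partial fraction expansion by the weight turns each coefficient into an entire function
of the ratios \<open>y\<^sub>j / y\<^sub>i\<close>, and leaves the weight of the remaining variables as the only other factor.
\<close>

theorem gp_Dl_expansion:
  assumes I: "finite I" "I \<noteq> {}" and y: "unit_on I y"
  shows "gp I a y * Dl I y = (\<Sum>j\<in>I. y j ^ a * Phi (I - {j}) a (\<lambda>i. y j / y i) * Dl (I - {j}) y)"
proof (cases "inj_on y I")
  case False
  then obtain i j where ij: "i \<in> I" "j \<in> I" "i \<noteq> j" "y i = y j" by (auto simp: inj_on_def)
  have "y s ^ a * Phi (I - {s}) a (\<lambda>i. y s / y i) * Dl (I - {s}) y = 0" if "s \<in> I" for s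
    using star_degenerate(2)[OF I(1) ij y that] by (simp only: mult.assoc mult_zero_right)
  then show ?thesis using star_degenerate(1)[OF I(1) ij y] by (simp only: mult_zero_right sum.neutral_const sum.cong)
next
  case inj: True
  have y0: "y i \<noteq> 0" if "i \<in> I" for i using y that by (auto simp: unit_on_def)
  have u: "norm (y i / y j) = 1" "y i / y j \<noteq> 1" if "i \<in> I - {j}" "j \<in> I" for i j
  proof -
    have "y i \<noteq> y j" using inj_onD[OF inj, of i j] that by auto
    then show "y i / y j \<noteq> 1" using y0[OF that(2)] by (simp add: divide_eq_1_iff)
    have "norm (y i) = 1" "norm (y j) = 1" using y(1) that unfolding unit_on_def by blast+
    then show "norm (y i / y j) = 1" by (simp add: norm_divide)
  qed
  have Dl: "Dl I y = Dl (I - {j}) y * (\<Prod>i\<in>I - {j}. einf (y i / y j) * einf (1 / (y i / y j)))" if "j \<in> I" for j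
    unfolding Dl_split[OF I(1) that] by (simp add: divide_inverse mult.commute)
  show ?thesis
  proof (cases "q = 0")
    case True
    have "y j ^ a * (\<Prod>i\<in>I - {j}. 1 / (1 - y i / y j)) * Dl I y =
        y j ^ a * Phi (I - {j}) a (\<lambda>i. y j / y i) * Dl (I - {j}) y" if j: "j \<in> I" for j
    proof -
      have "(\<Prod>i\<in>I - {j}. 1 / (1 - y i / y j)) * (\<Prod>i\<in>I - {j}. einf (y i / y j) * einf (1 / (y i / y j))) =
          (\<Prod>i\<in>I - {j}. 1 - y j / y i)"
        unfolding prod.distrib[symmetric] using u[OF _ j]
        by (intro prod.cong) (auto simp: einf_q0[OF True])
      then show ?thesis unfolding Dl[OF j] using I by (simp add: Phi_q0[OF True] mult_ac)
    qed
    then show ?thesis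
      unfolding gp_partial_fractions_q0[OF I y inj True] sum_distrib_right by (intro sum.cong) auto
  next
    case False
    define L where "L j k = y j ^ a * q ^ (k * a) * cc k *
      (\<Prod>i\<in>I - {j}. (-1) ^ k * qtri k / ((y i / y j) ^ k * qpoch (q / (y i / y j)) k * einf (y i / y j)))" for j k
    have "(\<Sum>k. L j k) * Dl I y = y j ^ a * Phi (I - {j}) a (\<lambda>i. y j / y i) * Dl (I - {j}) y" if j: "j \<in> I" for j
    proof -
      define E where "E = (\<Prod>i\<in>I - {j}. einf (y i / y j) * einf (1 / (y i / y j)))"
      have E0: "E \<noteq> 0"
      proof -
        have "einf (y i / y j) \<noteq> 0 \<and> einf (1 / (y i / y j)) \<noteq> 0" if "i \<in> I - {j}" for i
        proof -
          have "norm (1 / (y i / y j)) = 1" unfolding norm_divide[of 1] u(1)[OF that j] by simp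
          moreover have "1 / (y i / y j) \<noteq> 1" using u(2)[OF that j] by auto
          ultimately show ?thesis using einf_nonzero'[of "y i / y j"] einf_nonzero'[of "1 / (y i / y j)"] u[OF that j]
            by auto
        qed
        then show ?thesis using I by (auto simp: E_def)
      qed
      have "L j k * E = y j ^ a * (q ^ (k * a) * cc k * (\<Prod>i\<in>I - {j}. ph k (y j / y i)))" for k
      proof -
        have "(\<Prod>i\<in>I - {j}. (-1) ^ k * qtri k / ((y i / y j) ^ k * qpoch (q / (y i / y j)) k * einf (y i / y j))) * E =
            (\<Prod>i\<in>I - {j}. ph k (1 / (y i / y j)))"
          unfolding E_def prod.distrib[symmetric] using u[OF _ j] by (intro prod.cong refl ph_eq) auto
        then show ?thesis by (simp add: L_def mult.assoc)
      qed
      then have LE: "L j k = y j ^ a * (q ^ (k * a) * cc k * (\<Prod>i\<in>I - {j}. ph k (y j / y i))) / E" for k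
        using E0 by (simp add: eq_divide_eq)
      have "(\<Sum>k. L j k) = y j ^ a * Phi (I - {j}) a (\<lambda>i. y j / y i) / E"
      proof -
        have "(\<Sum>k. L j k) = (\<Sum>k. (y j ^ a / E) * (q ^ (k * a) * cc k * (\<Prod>i\<in>I - {j}. ph k (y j / y i))))"
          unfolding LE by simp
        also have "\<dots> = (y j ^ a / E) * Phi (I - {j}) a (\<lambda>i. y j / y i)"
          unfolding Phi_def using y j
          by (intro suminf_mult Phi_summable) (use I in auto)
        finally show ?thesis by simp
      qed
      then show ?thesis unfolding Dl[OF j] E_def[symmetric] using E0 by simp
    qed
    then show ?thesis
      unfolding gp_partial_fractions[OF I y inj False] L_def[symmetric] sum_distrib_right by (intro sum.cong) auto
  qed
qed

end

section \<open>Rearrangements\<close>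

definition supp :: "(nat \<Rightarrow> nat) \<Rightarrow> nat set" where "supp \<alpha> = {i. \<alpha> i \<noteq> 0}"

text \<open>
The multiset of nonzero values. Two exponent sequences are rearrangements of each other iff these
multisets agree, which replaces the permutations in the definition of monomial symmetric
functions.
\<close>

definition parts :: "(nat \<Rightarrow> nat) \<Rightarrow> nat multiset" where
  "parts \<alpha> = image_mset \<alpha> (mset_set (supp \<alpha>))"

lemma zero_notin_parts [simp]: "0 \<notin># parts \<alpha>"
  by (cases "finite (supp \<alpha>)") (auto simp: parts_def supp_def)

lemma parts_rearrange:
  assumes "bij \<pi>" "finite (supp \<alpha>)"
  shows "parts (\<alpha> \<circ> \<pi>) = parts \<alpha>" "finite (supp (\<alpha> \<circ> \<pi>))"
proof -
  have s: "supp (\<alpha> \<circ> \<pi>) = \<pi> -` supp \<alpha>" by (auto simp: supp_def)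
  have im: "\<pi> ` (\<pi> -` supp \<alpha>) = supp \<alpha>" using assms(1) by (simp add: surj_image_vimage_eq bij_is_surj)
  have inj: "inj_on \<pi> (\<pi> -` supp \<alpha>)" using assms(1) by (meson bij_is_inj inj_on_subset subset_UNIV)
  show "finite (supp (\<alpha> \<circ> \<pi>))"
    unfolding s using assms by (intro finite_vimageI) (auto simp: bij_is_inj)
  show "parts (\<alpha> \<circ> \<pi>) = parts \<alpha>"
  proof -
    have "image_mset (\<alpha> \<circ> \<pi>) (mset_set (\<pi> -` supp \<alpha>)) = image_mset \<alpha> (image_mset \<pi> (mset_set (\<pi> -` supp \<alpha>)))"
      by (simp add: multiset.map_comp)
    then show ?thesis unfolding parts_def s image_mset_mset_set[OF inj] im .
  qed
qed

lemma size_parts: "finite (supp \<alpha>) \<Longrightarrow> size (parts \<alpha>) = card (supp \<alpha>)"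
  by (simp add: parts_def)

lemma image_mset_superset:
  assumes "finite S" "supp \<alpha> \<subseteq> S"
  shows "image_mset \<alpha> (mset_set S) = parts \<alpha> + replicate_mset (card S - card (supp \<alpha>)) 0"
proof -
  have fin: "finite (supp \<alpha>)" using assms finite_subset by blast
  have "mset_set (supp \<alpha> \<union> (S - supp \<alpha>)) = mset_set (supp \<alpha>) + mset_set (S - supp \<alpha>)"
    using assms fin by (intro mset_set_Union) auto
  moreover have "supp \<alpha> \<union> (S - supp \<alpha>) = S" using assms by auto
  ultimately have "mset_set S = mset_set (supp \<alpha>) + mset_set (S - supp \<alpha>)" by simp
  moreover have "image_mset \<alpha> (mset_set (S - supp \<alpha>)) = image_mset (\<lambda>_. 0) (mset_set (S - supp \<alpha>))"
    using assms by (intro image_mset_cong) (auto simp: supp_def)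
  ultimately show ?thesis
    using assms fin by (simp add: parts_def image_mset_const_eq card_Diff_subset)
qed

text \<open>
Equal multisets give a bijection between the supports; on a finite set containing both supports it
extends to a permutation.
\<close>

lemma same_parts_rearrange:
  assumes "finite (supp \<alpha>)" "finite (supp \<beta>)" "parts \<alpha> = parts \<beta>"
  shows "\<exists>\<pi>. bij \<pi> \<and> \<alpha> = \<beta> \<circ> \<pi>"
proof -
  define S where "S = supp \<alpha> \<union> supp \<beta>"
  have S: "finite S" using assms by (simp add: S_def)
  have "card (supp \<alpha>) = card (supp \<beta>)" using assms size_parts by metis
  then have "image_mset \<alpha> (mset_set S) = image_mset \<beta> (mset_set S)"
    using assms by (subst (1 2) image_mset_superset[OF S]) (auto simp: S_def)
  then obtain p where p: "p permutes S" "\<forall>x\<in>S. \<alpha> x = \<beta> (p x)"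
    by (rule image_mset_eq_implies_permutes[OF S])
  have "\<alpha> x = \<beta> (p x)" for x
  proof (cases "x \<in> S")
    case False
    then have "p x = x" using p(1) by (simp add: permutes_def)
    then show ?thesis using False by (auto simp: S_def supp_def)
  qed (use p in auto)
  then show ?thesis using permutes_bij[OF p(1)] by (intro exI[of _ p]) auto
qed

lemma parts_update:
  assumes "finite (supp \<alpha>)"
  shows "finite (supp (\<alpha>(j := v)))"
    "v \<noteq> 0 \<Longrightarrow> parts (\<alpha>(j := v)) = add_mset v (parts (\<alpha>(j := 0)))"
proof -
  have "supp (\<alpha>(j := v)) \<subseteq> insert j (supp \<alpha>)" by (auto simp: supp_def)
  then show "finite (supp (\<alpha>(j := v)))" using assms finite_subset by blast
  assume v: "v \<noteq> 0"
  have s0: "supp (\<alpha>(j := 0)) = supp \<alpha> - {j}" by (auto simp: supp_def)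
  have sv: "supp (\<alpha>(j := v)) = insert j (supp \<alpha> - {j})" using v by (auto simp: supp_def)
  show "parts (\<alpha>(j := v)) = add_mset v (parts (\<alpha>(j := 0)))"
  proof -
    have "mset_set (insert j (supp \<alpha> - {j})) = add_mset j (mset_set (supp \<alpha> - {j}))"
      using assms by (intro mset_set.insert) auto
    moreover have "image_mset (\<alpha>(j := v)) (mset_set (supp \<alpha> - {j})) = image_mset (\<alpha>(j := 0)) (mset_set (supp \<alpha> - {j}))"
      using assms by (intro image_mset_cong) auto
    ultimately show ?thesis unfolding parts_def s0 sv by simp
  qed
qed

section \<open>Partitions\<close>

lemma partition_fin: "is_partition lam \<Longrightarrow> finite (supp lam)"
  by (simp add: is_partition_def supp_def)

lemma partition_supp:
  assumes "is_partition lam"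
  shows "supp lam = {..<size (parts lam)}"
proof -
  have fin: "finite (supp lam)" using assms by (rule partition_fin)
  have down: "i \<in> supp lam" if "j \<in> supp lam" "i \<le> j" for i j
  proof -
    have "lam j \<le> lam i" using assms that unfolding is_partition_def antimono_def by blast
    then show ?thesis using that by (auto simp: supp_def)
  qed
  have "\<exists>n. supp lam = {..<n}"
  proof (cases "supp lam = {}")
    case False
    have "supp lam = {..<Suc (Max (supp lam))}"
    proof (intro equalityI subsetI)
      fix x assume "x \<in> supp lam"
      then show "x \<in> {..<Suc (Max (supp lam))}" using Max_ge[OF fin] by (auto simp: less_Suc_eq_le)
    next
      fix x assume "x \<in> {..<Suc (Max (supp lam))}"
      then show "x \<in> supp lam" using down[OF Max_in[OF fin False]] by (simp add: less_Suc_eq_le)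
    qed
    then show ?thesis by blast
  qed auto
  then obtain n where "supp lam = {..<n}" by blast
  then show ?thesis using size_parts[OF fin] by simp
qed

lemma partition_list:
  assumes "is_partition lam"
  shows "rev (map lam [0..<size (parts lam)]) = sorted_list_of_multiset (parts lam)"
proof -
  let ?L = "rev (map lam [0..<size (parts lam)])"
  have "mset ?L = parts lam"
  proof -
    define n where "n = size (parts lam)"
    have "mset (rev (map lam [0..<n])) = image_mset lam (mset_set {..<n})"
      by (simp add: lessThan_atLeast0)
    also have "{..<n} = supp lam" using partition_supp[OF assms] by (simp add: n_def)
    finally show ?thesis by (simp add: n_def parts_def)
  qed
  moreover have "sorted ?L"
    using assms by (auto simp: sorted_iff_nth_mono rev_nth is_partition_def antimono_def)
  ultimately have "sort ?L = ?L" "sorted_list_of_multiset (parts lam) = sort ?L"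
    using sorted_list_of_multiset_mset[of ?L] sorted_sort_id[of ?L] by simp_all
  then show ?thesis by simp
qed

lemma partition_unique:
  assumes "is_partition lam" "is_partition \<mu>" "parts lam = parts \<mu>"
  shows "lam = \<mu>"
proof
  fix i
  let ?n = "size (parts lam)"
  have "rev (map lam [0..<?n]) = rev (map \<mu> [0..<?n])"
    using partition_list[OF assms(1)] partition_list[OF assms(2)] unfolding assms(3) by (rule trans[OF _ sym])
  then have "map lam [0..<?n] = map \<mu> [0..<?n]" by (rule rev_is_rev_conv[THEN iffD1])
  from arg_cong[OF this, of "\<lambda>xs. xs ! i"] have "lam i = \<mu> i" if "i < ?n" using that by simp
  moreover have "lam i = 0" "\<mu> i = 0" if "\<not> i < ?n"
  proof -
    have "i \<notin> supp lam" unfolding partition_supp[OF assms(1)] using that by simp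
    then show "lam i = 0" by (simp add: supp_def)
    have "i \<notin> supp \<mu>" unfolding partition_supp[OF assms(2)] using that assms(3) by simp
    then show "\<mu> i = 0" by (simp add: supp_def)
  qed
  ultimately show "lam i = \<mu> i" by (cases "i < ?n") auto
qed

lemma partition_exists:
  assumes "0 \<notin># M"
  shows "\<exists>lam. is_partition lam \<and> parts lam = M"
proof -
  define xs where "xs = rev (sorted_list_of_multiset M)"
  define n where "n = size M"
  have len: "length xs = n" using size_mset[of xs] by (simp add: xs_def n_def)
  define lam where "lam i = (if i < n then xs ! i else 0)" for i
  have ms: "mset xs = M" by (simp add: xs_def)
  have pos: "xs ! i \<noteq> 0" if "i < n" for i
    using nth_mem[of i xs] that len ms assms by (metis set_mset_mset)
  have sup: "supp lam = {..<n}" using pos by (auto simp: supp_def lam_def)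
  have "sorted (rev xs)" by (simp add: xs_def)
  then have dec: "xs ! j \<le> xs ! i" if "i \<le> j" "j < n" for i j
    using that len sorted_rev_nth_mono[of xs i j] by auto
  have "is_partition lam"
    unfolding is_partition_def antimono_def using sup dec by (auto simp: lam_def supp_def)
  moreover have "parts lam = M"
  proof -
    have "image_mset lam (mset_set {..<n}) = image_mset (\<lambda>i. xs ! i) (mset_set {..<n})"
      by (rule image_mset_cong) (auto simp: lam_def)
    also have "\<dots> = mset (map ((!) xs) [0..<n])"
      by (simp add: atLeast0LessThan)
    also have "map ((!) xs) [0..<n] = xs" using len map_nth by blast
    finally show ?thesis by (simp add: parts_def sup ms)
  qed
  ultimately show ?thesis by blast
qed

definition ptn :: "(nat \<Rightarrow> nat) \<Rightarrow> nat \<Rightarrow> nat" where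
  "ptn \<alpha> = (SOME lam. is_partition lam \<and> parts lam = parts \<alpha>)"

lemma ptn: "is_partition (ptn \<alpha>)" "parts (ptn \<alpha>) = parts \<alpha>"
  using someI_ex[OF partition_exists[OF zero_notin_parts[of \<alpha>]]] by (auto simp: ptn_def)

lemma ptn_eq_iff: "is_partition \<kappa> \<Longrightarrow> ptn \<alpha> = \<kappa> \<longleftrightarrow> parts \<alpha> = parts \<kappa>"
  using ptn partition_unique by metis

lemma part_size_eq: "part_size lam = sum_mset (parts lam)"
  by (simp add: part_size_def parts_def supp_def sum_unfold_sum_mset)

lemma sum_parts:
  assumes "finite S" "supp \<alpha> \<subseteq> S"
  shows "sum_mset (parts \<alpha>) = (\<Sum>i\<in>S. \<alpha> i)"
proof -
  have "sum_mset (parts \<alpha>) = (\<Sum>i\<in>supp \<alpha>. \<alpha> i)" by (simp add: parts_def sum_unfold_sum_mset)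
  also have "\<dots> = (\<Sum>i\<in>S. \<alpha> i)" using assms by (intro sum.mono_neutral_left) (auto simp: supp_def)
  finally show ?thesis .
qed

definition Par :: "nat \<Rightarrow> (nat \<Rightarrow> nat) set" where
  "Par d = {lam. is_partition lam \<and> part_size lam = d}"

text \<open>
The exponents of the monomials of degree \<open>d\<close> in the variables \<open>x i\<close> with \<open>i \<in> S\<close>.
\<close>

definition Comp :: "nat set \<Rightarrow> nat \<Rightarrow> (nat \<Rightarrow> nat) set" where
  "Comp S d = {\<alpha>. supp \<alpha> \<subseteq> S \<and> (\<Sum>i\<in>S. \<alpha> i) = d}"

text \<open>
The rearrangements of \<open>\<kappa>\<close> that are supported in \<open>S\<close>.
\<close>

definition Orb :: "(nat \<Rightarrow> nat) \<Rightarrow> nat set \<Rightarrow> (nat \<Rightarrow> nat) set" where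
  "Orb \<kappa> S = {\<alpha>. supp \<alpha> \<subseteq> S \<and> parts \<alpha> = parts \<kappa>}"

lemma finite_Comp: assumes "finite S" shows "finite (Comp S d)"
proof (rule finite_subset)
  show "Comp S d \<subseteq> {f. \<forall>x. (x \<in> S \<longrightarrow> f x \<in> {..d}) \<and> (x \<notin> S \<longrightarrow> f x = 0)}"
    using assms by (auto simp: Comp_def supp_def intro: member_le_sum)
  show "finite \<dots>" by (rule finite_set_of_finite_funs) (use assms in auto)
qed

lemma size_le_sum_mset: "0 \<notin># M \<Longrightarrow> size M \<le> sum_mset (M :: nat multiset)"
  by (induction M) auto

lemma Par_subset_Comp: "Par d \<subseteq> Comp {..<d} d"
proof
  fix lam assume lam: "lam \<in> Par d"
  then have p: "is_partition lam" "sum_mset (parts lam) = d" by (auto simp: Par_def part_size_eq)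
  have "supp lam \<subseteq> {..<d}"
    using partition_supp[OF p(1)] size_le_sum_mset[of "parts lam"] p(2) by auto
  then show "lam \<in> Comp {..<d} d" using sum_parts[of "{..<d}" lam] p(2) by (simp add: Comp_def)
qed

lemma finite_Par: "finite (Par d)"
  using Par_subset_Comp finite_Comp finite_subset by blast

lemma Orb_subset_Comp:
  assumes "finite S" "is_partition \<kappa>" shows "Orb \<kappa> S \<subseteq> Comp S (part_size \<kappa>)"
proof
  fix \<alpha> assume "\<alpha> \<in> Orb \<kappa> S"
  then have *: "supp \<alpha> \<subseteq> S" "parts \<alpha> = parts \<kappa>" by (auto simp: Orb_def)
  then show "\<alpha> \<in> Comp S (part_size \<kappa>)"
    using sum_parts[OF assms(1) *(1)] by (simp add: Comp_def part_size_eq)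
qed

lemma finite_Orb: "finite S \<Longrightarrow> is_partition \<kappa> \<Longrightarrow> finite (Orb \<kappa> S)"
  by (rule finite_subset[OF Orb_subset_Comp finite_Comp])

lemma sum_Comp_Orb:
  assumes "finite S"
  shows "(\<Sum>\<alpha>\<in>Comp S d. F \<alpha>) = (\<Sum>\<kappa>\<in>Par d. \<Sum>\<alpha>\<in>Orb \<kappa> S. F \<alpha>)"
proof -
  have "(\<Sum>\<alpha>\<in>Comp S d. F \<alpha>) = (\<Sum>\<kappa>\<in>Par d. \<Sum>\<alpha>\<in>{\<alpha> \<in> Comp S d. ptn \<alpha> = \<kappa>}. F \<alpha>)"
  proof (rule sum.group[symmetric])
    show "ptn ` Comp S d \<subseteq> Par d"
    proof
      fix \<kappa> assume "\<kappa> \<in> ptn ` Comp S d"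
      then obtain \<alpha> where \<alpha>: "\<kappa> = ptn \<alpha>" "supp \<alpha> \<subseteq> S" "sum \<alpha> S = d" by (auto simp: Comp_def)
      have "part_size \<kappa> = d" unfolding part_size_eq \<alpha>(1) ptn(2) sum_parts[OF assms \<alpha>(2)] by (rule \<alpha>(3))
      then show "\<kappa> \<in> Par d" by (simp add: Par_def \<alpha>(1) ptn(1))
    qed
  qed (use assms finite_Comp finite_Par in auto)
  also have "\<dots> = (\<Sum>\<kappa>\<in>Par d. \<Sum>\<alpha>\<in>Orb \<kappa> S. F \<alpha>)"
  proof (intro sum.cong refl)
    fix \<kappa> assume \<kappa>: "\<kappa> \<in> Par d"
    have "sum \<alpha> S = part_size \<kappa>" if "supp \<alpha> \<subseteq> S" "parts \<alpha> = parts \<kappa>" for \<alpha>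
      using sum_parts[OF assms that(1)] that(2) by (simp add: part_size_eq)
    then show "{\<alpha> \<in> Comp S d. ptn \<alpha> = \<kappa>} = Orb \<kappa> S"
      using ptn_eq_iff[of \<kappa>] \<kappa> by (auto simp: Orb_def Comp_def Par_def)
  qed
  finally show ?thesis .
qed

section \<open>Monomial symmetric functions\<close>

definition xmon :: "nat set \<Rightarrow> (nat \<Rightarrow> complex) \<Rightarrow> (nat \<Rightarrow> nat) \<Rightarrow> complex" where
  "xmon S x \<alpha> = (\<Prod>i\<in>S. x i ^ \<alpha> i)"

text \<open>
Rearrangements that leave \<open>S\<close> contribute zero, because then some variable with positive exponent
vanishes; so the infinite sum is a finite one.
\<close>

lemma monomial_sf_eq:
  assumes S: "finite S" "\<And>i. i \<notin> S \<Longrightarrow> x i = 0" and \<mu>: "is_partition \<mu>"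
  shows "monomial_sf \<mu> x = (\<Sum>\<alpha>\<in>Orb \<mu> S. xmon S x \<alpha>)"
proof -
  let ?A = "{\<alpha>. \<exists>\<pi>. bij \<pi> \<and> \<alpha> = \<mu> \<circ> \<pi>}"
  have fin: "finite (supp \<mu>)" using \<mu> by (rule partition_fin)
  have A: "\<alpha> \<in> ?A \<longleftrightarrow> finite (supp \<alpha>) \<and> parts \<alpha> = parts \<mu>" for \<alpha>
    using same_parts_rearrange[OF _ fin, of \<alpha>] parts_rearrange[OF _ fin] by auto
  have "monomial_sf \<mu> x = (\<Sum>\<^sub>\<infinity>\<alpha>\<in>Orb \<mu> S. xmon S x \<alpha>)"
    unfolding monomial_sf_def
  proof (rule infsum_cong_neutral)
    fix \<alpha> assume "\<alpha> \<in> Orb \<mu> S - ?A"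
    moreover have "Orb \<mu> S \<subseteq> ?A" using A S(1) finite_subset unfolding Orb_def by blast
    ultimately show "xmon S x \<alpha> = 0" by blast
  next
    fix \<alpha> assume "\<alpha> \<in> ?A - Orb \<mu> S"
    then have "finite (supp \<alpha>)" "\<not> supp \<alpha> \<subseteq> S" using A[of \<alpha>] by (auto simp: Orb_def)
    then obtain i where i: "i \<in> supp \<alpha>" "i \<notin> S" by auto
    then show "(\<Prod>i | \<alpha> i \<noteq> 0. x i ^ \<alpha> i) = 0"
      using S(2)[OF i(2)] \<open>finite (supp \<alpha>)\<close> by (intro prod_zero bexI[of _ i]) (auto simp: supp_def)
  next
    fix \<alpha> assume "\<alpha> \<in> ?A \<inter> Orb \<mu> S"
    then have "supp \<alpha> \<subseteq> S" by (simp add: Orb_def)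
    then show "(\<Prod>i | \<alpha> i \<noteq> 0. x i ^ \<alpha> i) = xmon S x \<alpha>"
      unfolding xmon_def using S(1) by (intro prod.mono_neutral_left) (auto simp: supp_def)
  qed
  then show ?thesis using finite_Orb[OF S(1) \<mu>] by simp
qed

text \<open>
The coefficient of a monomial is extracted by integration over the torus.
\<close>

lemma monomial_sf_indep:
  assumes A: "finite A" "\<And>\<mu>. \<mu> \<in> A \<Longrightarrow> is_partition \<mu>"
    and zero: "\<And>x. fin_supp x \<Longrightarrow> (\<Sum>\<mu>\<in>A. b \<mu> * monomial_sf \<mu> x) = 0"
    and \<nu>: "\<nu> \<in> A"
  shows "b \<nu> = 0"
proof -
  define S where "S = supp \<nu>"
  have S: "finite S" using A \<nu> partition_fin by (auto simp: S_def)
  have eq: "(\<Sum>\<mu>\<in>A. b \<mu> * (\<Sum>\<alpha>\<in>Orb \<mu> S. xmon S y \<alpha>)) = 0" for y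
  proof -
    define x where "x i = (if i \<in> S then y i else 0)" for i
    have "{i. x i \<noteq> 0} \<subseteq> S" by (auto simp: x_def)
    then have "fin_supp x" using S by (auto simp: fin_supp_def intro: finite_subset)
    from zero[OF this] have "(\<Sum>\<mu>\<in>A. b \<mu> * (\<Sum>\<alpha>\<in>Orb \<mu> S. xmon S x \<alpha>)) = 0"
      using A(2) monomial_sf_eq[OF S, of x] by (simp add: x_def)
    then show ?thesis by (simp add: xmon_def x_def)
  qed
  define m where "m \<alpha> i = int (\<alpha> i) - int (\<nu> i)" for \<alpha> :: "nat \<Rightarrow> nat" and i
  have good: "good S (\<lambda>y. \<Prod>i\<in>S. y i powi m \<alpha> i)" for \<alpha>
    by (intro good_prod good_powi_coord)
  have int: "(LINT y|tor S. (\<Prod>i\<in>S. y i powi m \<alpha> i)) = (if \<alpha> = \<nu> then 1 else 0)" if "supp \<alpha> \<subseteq> S" for \<alpha>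
  proof -
    have "\<alpha> i = 0 \<and> \<nu> i = 0" if "i \<notin> S" for i
      using that \<open>supp \<alpha> \<subseteq> S\<close> by (auto simp: S_def supp_def)
    then have "(\<forall>i\<in>S. m \<alpha> i = 0) \<longleftrightarrow> \<alpha> = \<nu>"
      unfolding m_def fun_eq_iff by (metis eq_iff_diff_eq_0 of_nat_eq_iff)
    then show ?thesis by (simp add: tor_monomial[OF S])
  qed
  have "0 = (LINT y|tor S. (\<Sum>\<mu>\<in>A. b \<mu> * (\<Sum>\<alpha>\<in>Orb \<mu> S. xmon S y \<alpha>)) * (\<Prod>i\<in>S. y i powi (- int (\<nu> i))))"
    by (simp add: eq)
  also have "\<dots> = (LINT y|tor S. (\<Sum>\<mu>\<in>A. b \<mu> * (\<Sum>\<alpha>\<in>Orb \<mu> S. \<Prod>i\<in>S. y i powi m \<alpha> i)))"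
  proof (rule integral_cong_AE)
    show "AE y in tor S. (\<Sum>\<mu>\<in>A. b \<mu> * (\<Sum>\<alpha>\<in>Orb \<mu> S. xmon S y \<alpha>)) * (\<Prod>i\<in>S. y i powi (- int (\<nu> i))) =
        (\<Sum>\<mu>\<in>A. b \<mu> * (\<Sum>\<alpha>\<in>Orb \<mu> S. \<Prod>i\<in>S. y i powi m \<alpha> i))"
      using AE_tor_unit[OF S]
    proof eventually_elim
      case (elim y)
      have "xmon S y \<alpha> * (\<Prod>i\<in>S. y i powi (- int (\<nu> i))) = (\<Prod>i\<in>S. y i powi m \<alpha> i)" for \<alpha>
        unfolding xmon_def prod.distrib[symmetric]
      proof (rule prod.cong[OF refl])
        fix i assume "i \<in> S"
        then have "y i \<noteq> 0" using elim by (auto simp: unit_on_def)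
        then show "y i ^ \<alpha> i * y i powi (- int (\<nu> i)) = y i powi m \<alpha> i"
          unfolding m_def diff_conv_add_uminus by (subst power_int_add) auto
      qed
      then show ?case by (simp add: sum_distrib_right mult.assoc)
    qed
    show "(\<lambda>y. (\<Sum>\<mu>\<in>A. b \<mu> * (\<Sum>\<alpha>\<in>Orb \<mu> S. xmon S y \<alpha>)) * (\<Prod>i\<in>S. y i powi (- int (\<nu> i)))) \<in> borel_measurable (tor S)"
      unfolding xmon_def
      by (rule good_measurable, intro good_mult good_sum good_const good_prod good_power good_coord good_powi_coord)
    show "(\<lambda>y. (\<Sum>\<mu>\<in>A. b \<mu> * (\<Sum>\<alpha>\<in>Orb \<mu> S. \<Prod>i\<in>S. y i powi m \<alpha> i))) \<in> borel_measurable (tor S)"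
      by (rule good_measurable, intro good_mult good_sum good_const good)
  qed
  also have "\<dots> = (\<Sum>\<mu>\<in>A. b \<mu> * (\<Sum>\<alpha>\<in>Orb \<mu> S. (LINT y|tor S. (\<Prod>i\<in>S. y i powi m \<alpha> i))))"
    by (subst tor_integral_sum[OF S], intro good_mult good_sum good_const good)
       (simp add: tor_integral_sum[OF S good])
  also have "\<dots> = (\<Sum>\<mu>\<in>A. b \<mu> * (\<Sum>\<alpha>\<in>Orb \<mu> S. (if \<alpha> = \<nu> then 1 else 0)))"
    by (intro sum.cong arg_cong2[of _ _ _ _ "(*)"] refl int) (auto simp: Orb_def)
  also have "\<dots> = (\<Sum>\<mu>\<in>A. if \<mu> = \<nu> then b \<mu> else 0)"
  proof (intro sum.cong refl)
    fix \<mu> assume \<mu>: "\<mu> \<in> A"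
    have "\<nu> \<in> Orb \<mu> S \<longleftrightarrow> \<mu> = \<nu>"
      using partition_unique[of \<mu> \<nu>] A(2) \<mu> \<nu> by (auto simp: Orb_def S_def)
    then show "b \<mu> * (\<Sum>\<alpha>\<in>Orb \<mu> S. (if \<alpha> = \<nu> then 1 else 0)) = (if \<mu> = \<nu> then b \<mu> else 0)"
      using finite_Orb[OF S A(2)[OF \<mu>]] by (simp add: sum.delta')
  qed
  also have "\<dots> = b \<nu>" using A \<nu> by simp
  finally show ?thesis by simp
qed

section \<open>Power sums in terms of monomial symmetric functions\<close>

text \<open>
A symmetric function of degree \<open>d\<close> given by the coefficients of all its monomials. They are natural
numbers, so that the coefficients of products of power sums cannot cancel.
\<close>

definition sf_rep :: "nat \<Rightarrow> ((nat \<Rightarrow> complex) \<Rightarrow> complex) \<Rightarrow> ((nat \<Rightarrow> nat) \<Rightarrow> nat) \<Rightarrow> bool" where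
  "sf_rep d f c \<longleftrightarrow>
     (\<forall>S x. finite S \<longrightarrow> (\<forall>i. i \<notin> S \<longrightarrow> x i = 0) \<longrightarrow> f x = (\<Sum>\<alpha>\<in>Comp S d. of_nat (c \<alpha>) * xmon S x \<alpha>)) \<and>
     (\<forall>\<alpha> \<pi>. finite (supp \<alpha>) \<longrightarrow> bij \<pi> \<longrightarrow> c (\<alpha> \<circ> \<pi>) = c \<alpha>)"

lemma sf_rep_monomial:
  assumes f: "sf_rep d f c" and x: "fin_supp x"
  shows "f x = (\<Sum>\<kappa>\<in>Par d. of_nat (c \<kappa>) * monomial_sf \<kappa> x)"
proof -
  define S where "S = {i. x i \<noteq> 0}"
  have S: "finite S" "\<And>i. i \<notin> S \<Longrightarrow> x i = 0" using x by (auto simp: S_def fin_supp_def)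
  have "f x = (\<Sum>\<kappa>\<in>Par d. \<Sum>\<alpha>\<in>Orb \<kappa> S. of_nat (c \<alpha>) * xmon S x \<alpha>)"
    using f S unfolding sf_rep_def by (subst sum_Comp_Orb[OF S(1), symmetric]) blast
  also have "\<dots> = (\<Sum>\<kappa>\<in>Par d. of_nat (c \<kappa>) * monomial_sf \<kappa> x)"
  proof (intro sum.cong refl)
    fix \<kappa> assume "\<kappa> \<in> Par d"
    then have \<kappa>: "is_partition \<kappa>" by (simp add: Par_def)
    have "c \<alpha> = c \<kappa>" if "\<alpha> \<in> Orb \<kappa> S" for \<alpha>
    proof -
      have "finite (supp \<alpha>)" "parts \<alpha> = parts \<kappa>" using that S finite_subset by (auto simp: Orb_def)
      then obtain \<pi> where "bij \<pi>" "\<alpha> = \<kappa> \<circ> \<pi>" using same_parts_rearrange partition_fin[OF \<kappa>] by blast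
      then show ?thesis using f partition_fin[OF \<kappa>] unfolding sf_rep_def by blast
    qed
    then have "(\<Sum>\<alpha>\<in>Orb \<kappa> S. of_nat (c \<alpha>) * xmon S x \<alpha>) = (\<Sum>\<alpha>\<in>Orb \<kappa> S. of_nat (c \<kappa>) * xmon S x \<alpha>)"
      by (intro sum.cong) auto
    then show "(\<Sum>\<alpha>\<in>Orb \<kappa> S. of_nat (c \<alpha>) * xmon S x \<alpha>) = of_nat (c \<kappa>) * monomial_sf \<kappa> x"
      using monomial_sf_eq[of S x \<kappa>] S \<kappa> by (simp add: sum_distrib_left)
  qed
  finally show ?thesis .
qed

lemma power_sum_eq:
  assumes "finite S" "\<And>i. i \<notin> S \<Longrightarrow> x i = 0" "n > 0"
  shows "power_sum n x = (\<Sum>i\<in>S. x i ^ n)"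
proof -
  have "power_sum n x = (\<Sum>\<^sub>\<infinity>i\<in>S. x i ^ n)"
    unfolding power_sum_def by (rule infsum_cong_neutral) (use assms in auto)
  then show ?thesis using assms(1) by simp
qed

definition pms :: "nat multiset \<Rightarrow> (nat \<Rightarrow> complex) \<Rightarrow> complex" where
  "pms M x = (\<Prod>n\<in>#M. power_sum n x)"

lemma power_sum_part_eq: "power_sum_part lam x = pms (parts lam) x"
  by (simp add: power_sum_part_def pms_def parts_def supp_def prod_unfold_prod_mset image_mset.compositionality comp_def)

text \<open>
The coefficients after multiplication by a power sum: one exponent loses \<open>n\<close>.
\<close>

definition add_part :: "nat \<Rightarrow> ((nat \<Rightarrow> nat) \<Rightarrow> nat) \<Rightarrow> (nat \<Rightarrow> nat) \<Rightarrow> nat" where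
  "add_part n c \<alpha> = (\<Sum>j | n \<le> \<alpha> j. c (\<alpha>(j := \<alpha> j - n)))"

lemma sf_rep_add_part:
  assumes f: "sf_rep d f c" and n: "n > 0"
  shows "sf_rep (d + n) (\<lambda>x. power_sum n x * f x) (add_part n c)"
  unfolding sf_rep_def
proof (intro conjI allI impI)
  fix S :: "nat set" and x :: "nat \<Rightarrow> complex"
  assume S: "finite S" and x: "\<forall>i. i \<notin> S \<longrightarrow> x i = 0"
  have "power_sum n x * f x = (\<Sum>j\<in>S. x j ^ n) * (\<Sum>\<alpha>\<in>Comp S d. of_nat (c \<alpha>) * xmon S x \<alpha>)"
    using f S x n power_sum_eq[of S x n] unfolding sf_rep_def by auto
  also have "\<dots> = (\<Sum>(j, \<alpha>)\<in>S \<times> Comp S d. x j ^ n * (of_nat (c \<alpha>) * xmon S x \<alpha>))"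
    by (simp add: sum_product sum.cartesian_product)
  also have "\<dots> = (\<Sum>(\<beta>, j)\<in>Sigma (Comp S (d + n)) (\<lambda>\<beta>. {j. n \<le> \<beta> j}). of_nat (c (\<beta>(j := \<beta> j - n))) * xmon S x \<beta>)"
  proof (rule sum.reindex_bij_witness[of _ "\<lambda>(\<beta>, j). (j, \<beta>(j := \<beta> j - n))" "\<lambda>(j, \<alpha>). (\<alpha>(j := \<alpha> j + n), j)"], goal_cases)
    case (1 p)
    then show ?case by (auto simp: fun_eq_iff)
  next
    case (2 p)
    then obtain j \<alpha> where p: "p = (j, \<alpha>)" "j \<in> S" "\<alpha> \<in> Comp S d" by auto
    have "(\<Sum>i\<in>S. (\<alpha>(j := \<alpha> j + n)) i) = (\<Sum>i\<in>S. \<alpha> i) + n"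
      using S p(2) by (simp add: sum.remove[of S j])
    then show ?case using p by (auto simp: Comp_def supp_def split: if_splits)
  next
    case (3 p)
    then show ?case by (auto simp: fun_eq_iff)
  next
    case (4 p)
    then obtain \<beta> j where p: "p = (\<beta>, j)" "\<beta> \<in> Comp S (d + n)" "n \<le> \<beta> j" by auto
    have j: "j \<in> S" using p n by (auto simp: Comp_def supp_def)
    have "(\<Sum>i\<in>S. \<beta> i) = (\<Sum>i\<in>S. (\<beta>(j := \<beta> j - n)) i) + n"
      using S j p(3) by (simp add: sum.remove[of S j])
    then show ?case using p j by (auto simp: Comp_def supp_def split: if_splits)
  next
    case (5 p)
    then obtain j \<alpha> where p: "p = (j, \<alpha>)" "j \<in> S" by auto
    have "xmon S x (\<alpha>(j := \<alpha> j + n)) = x j ^ n * xmon S x \<alpha>"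
      using S p(2) by (simp add: xmon_def prod.remove[of S j] power_add mult_ac)
    then show ?case using p by (simp add: mult_ac)
  qed
  also have "\<dots> = (\<Sum>\<beta>\<in>Comp S (d + n). \<Sum>j | n \<le> \<beta> j. of_nat (c (\<beta>(j := \<beta> j - n))) * xmon S x \<beta>)"
  proof (rule sum.Sigma[symmetric])
    show "finite (Comp S (d + n))" using S by (rule finite_Comp)
    show "\<forall>\<beta>\<in>Comp S (d + n). finite {j. n \<le> \<beta> j}"
    proof
      fix \<beta> assume "\<beta> \<in> Comp S (d + n)"
      then have "{j. n \<le> \<beta> j} \<subseteq> S" using n by (auto simp: Comp_def supp_def)
      then show "finite {j. n \<le> \<beta> j}" using S finite_subset by blast
    qed
  qed
  finally show "power_sum n x * f x = (\<Sum>\<alpha>\<in>Comp S (d + n). of_nat (add_part n c \<alpha>) * xmon S x \<alpha>)"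
    by (simp add: add_part_def sum_distrib_right)
next
  fix \<alpha> \<pi> :: "nat \<Rightarrow> nat" assume fin: "finite (supp \<alpha>)" and \<pi>: "bij \<pi>"
  have "add_part n c (\<alpha> \<circ> \<pi>) = (\<Sum>j | n \<le> \<alpha> (\<pi> j). c ((\<alpha> \<circ> \<pi>)(j := \<alpha> (\<pi> j) - n)))"
    by (simp add: add_part_def)
  also have "\<dots> = (\<Sum>j | n \<le> \<alpha> (\<pi> j). c (\<alpha>(\<pi> j := \<alpha> (\<pi> j) - n)))"
  proof (rule sum.cong[OF refl])
    fix j
    have "(\<alpha> \<circ> \<pi>)(j := \<alpha> (\<pi> j) - n) = \<alpha>(\<pi> j := \<alpha> (\<pi> j) - n) \<circ> \<pi>"
      using \<pi> by (auto simp: fun_eq_iff bij_def inj_eq)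
    then show "c ((\<alpha> \<circ> \<pi>)(j := \<alpha> (\<pi> j) - n)) = c (\<alpha>(\<pi> j := \<alpha> (\<pi> j) - n))"
      using f \<pi> parts_update(1)[OF fin] unfolding sf_rep_def by auto
  qed
  also have "\<dots> = add_part n c \<alpha>"
    unfolding add_part_def
    by (rule sum.reindex_bij_witness[of _ "inv \<pi>" \<pi>]) (use \<pi> in \<open>auto simp: bij_is_inj bij_is_surj surj_f_inv_f\<close>)
  finally show "add_part n c (\<alpha> \<circ> \<pi>) = add_part n c \<alpha>" .
qed

text \<open>
In a product of power sums each exponent of a monomial is a sum of parts. So a monomial has at most as
many nonzero exponents as there are parts, with equality only if its exponents are the parts
themselves; that coefficient is positive because nothing cancels.
\<close>

lemma pms_rep:
  assumes "0 \<notin># M"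
  shows "\<exists>c. sf_rep (sum_mset M) (pms M) c \<and>
    (\<forall>\<alpha>. finite (supp \<alpha>) \<longrightarrow> c \<alpha> \<noteq> 0 \<longrightarrow> size (parts \<alpha>) \<le> size M \<and> (size (parts \<alpha>) = size M \<longrightarrow> parts \<alpha> = M)) \<and>
    (\<forall>\<alpha>. finite (supp \<alpha>) \<longrightarrow> parts \<alpha> = M \<longrightarrow> c \<alpha> \<noteq> 0)"
  using assms
proof (induction M)
  case empty
  have Comp0: "Comp S 0 = {\<lambda>_. 0}" if "finite S" for S
  proof (intro equalityI subsetI)
    fix \<alpha> assume \<alpha>: "\<alpha> \<in> Comp S 0"
    have "\<alpha> i = 0" for i
      using \<alpha> that by (cases "i \<in> S") (auto simp: Comp_def supp_def)
    then show "\<alpha> \<in> {\<lambda>_. 0}" by auto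
  qed (auto simp: Comp_def supp_def)
  have p0: "parts (\<lambda>_. 0) = {#}" by (simp add: parts_def supp_def)
  show ?case
  proof (intro exI[of _ "\<lambda>\<alpha>. if parts \<alpha> = {#} then 1 else 0"] conjI)
    show "sf_rep (sum_mset {#}) (pms {#}) (\<lambda>\<alpha>. if parts \<alpha> = {#} then 1 else 0)"
      by (simp add: sf_rep_def Comp0 pms_def xmon_def p0 parts_rearrange(1))
  qed auto
next
  case (add n M)
  have n: "n > 0" using add.prems by auto
  obtain c where c: "sf_rep (sum_mset M) (pms M) c"
    "\<And>\<alpha>. finite (supp \<alpha>) \<Longrightarrow> c \<alpha> \<noteq> 0 \<Longrightarrow> size (parts \<alpha>) \<le> size M"
    "\<And>\<alpha>. finite (supp \<alpha>) \<Longrightarrow> c \<alpha> \<noteq> 0 \<Longrightarrow> size (parts \<alpha>) = size M \<Longrightarrow> parts \<alpha> = M"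
    "\<And>\<alpha>. finite (supp \<alpha>) \<Longrightarrow> parts \<alpha> = M \<Longrightarrow> c \<alpha> \<noteq> 0"
    using add by auto
  have "sf_rep (sum_mset (add_mset n M)) (pms (add_mset n M)) (add_part n c)"
  proof -
    have "pms (add_mset n M) = (\<lambda>x. power_sum n x * pms M x)" by (simp add: pms_def fun_eq_iff)
    then show ?thesis using sf_rep_add_part[OF c(1) n] by (simp add: add.commute)
  qed
  moreover have "size (parts \<alpha>) \<le> size (add_mset n M) \<and>
      (size (parts \<alpha>) = size (add_mset n M) \<longrightarrow> parts \<alpha> = add_mset n M)"
    if fin: "finite (supp \<alpha>)" and ne: "add_part n c \<alpha> \<noteq> 0" for \<alpha>
  proof -
    from ne obtain j where j: "n \<le> \<alpha> j" "c (\<alpha>(j := \<alpha> j - n)) \<noteq> 0"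
      unfolding add_part_def by (metis (mono_tags, lifting) mem_Collect_eq sum.neutral)
    define \<beta> where "\<beta> = \<alpha>(j := \<alpha> j - n)"
    have fin\<beta>: "finite (supp \<beta>)" unfolding \<beta>_def using parts_update(1)[OF fin] .
    have pa: "parts \<alpha> = add_mset (\<alpha> j) (parts (\<alpha>(j := 0)))"
      using parts_update(2)[OF fin, of "\<alpha> j" j] j(1) n by simp
    show ?thesis
    proof (cases "\<alpha> j = n")
      case True
      then have "\<beta> = \<alpha>(j := 0)" by (simp add: \<beta>_def)
      then show ?thesis using c(2,3)[OF fin\<beta>] j(2) pa True by (auto simp: \<beta>_def[symmetric])
    next
      case False
      then have "parts \<beta> = add_mset (\<alpha> j - n) (parts (\<alpha>(j := 0)))"
        unfolding \<beta>_def using j(1) by (intro parts_update(2)[OF fin]) auto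
      then have "size (parts \<alpha>) = size (parts \<beta>)" using pa by simp
      then show ?thesis using c(2)[OF fin\<beta>] j(2) by (auto simp: \<beta>_def[symmetric])
    qed
  qed
  moreover have "add_part n c \<alpha> \<noteq> 0" if fin: "finite (supp \<alpha>)" and pa: "parts \<alpha> = add_mset n M" for \<alpha>
  proof -
    have "n \<in># parts \<alpha>" using pa by simp
    then obtain j where j: "\<alpha> j = n" using fin by (auto simp: parts_def)
    have "\<alpha>(j := n) = \<alpha>" using j by auto
    then have "add_mset n (parts (\<alpha>(j := 0))) = add_mset n M"
      using parts_update(2)[OF fin, of n j] n pa by simp
    then have "c (\<alpha>(j := \<alpha> j - n)) \<noteq> 0"
      using j by (intro c(4) parts_update(1)[OF fin]) simp
    moreover have "finite {j. n \<le> \<alpha> j}"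
      by (rule finite_subset[OF _ fin]) (use n in \<open>auto simp: supp_def\<close>)
    ultimately show ?thesis unfolding add_part_def using j by (auto simp: sum_eq_0_iff)
  qed
  ultimately show ?case by blast
qed

section \<open>The power sum basis\<close>

lemma Par_D: "lam \<in> Par d \<Longrightarrow> is_partition lam" "lam \<in> Par d \<Longrightarrow> sum_mset (parts lam) = d"
  by (auto simp: Par_def part_size_eq)

lemma Par_self: "is_partition lam \<Longrightarrow> lam \<in> Par (part_size lam)"
  by (simp add: Par_def)

text \<open>
The transition matrix from power sums to monomial symmetric functions is triangular with respect to the
number of parts.
\<close>

lemma power_sum_part_monomial:
  "\<exists>L :: (nat \<Rightarrow> nat) \<Rightarrow> (nat \<Rightarrow> nat) \<Rightarrow> nat.
     (\<forall>lam x. is_partition lam \<longrightarrow> fin_supp x \<longrightarrow>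
        power_sum_part lam x = (\<Sum>\<kappa>\<in>Par (part_size lam). of_nat (L lam \<kappa>) * monomial_sf \<kappa> x)) \<and>
     (\<forall>lam \<kappa>. is_partition lam \<longrightarrow> is_partition \<kappa> \<longrightarrow> L lam \<kappa> \<noteq> 0 \<longrightarrow> \<kappa> = lam \<or> size (parts \<kappa>) < size (parts lam)) \<and>
     (\<forall>lam. is_partition lam \<longrightarrow> L lam lam \<noteq> 0)"
proof -
  have "\<forall>lam. \<exists>c. sf_rep (sum_mset (parts lam)) (pms (parts lam)) c \<and>
    (\<forall>\<alpha>. finite (supp \<alpha>) \<longrightarrow> c \<alpha> \<noteq> 0 \<longrightarrow> size (parts \<alpha>) \<le> size (parts lam) \<and> (size (parts \<alpha>) = size (parts lam) \<longrightarrow> parts \<alpha> = parts lam)) \<and>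
    (\<forall>\<alpha>. finite (supp \<alpha>) \<longrightarrow> parts \<alpha> = parts lam \<longrightarrow> c \<alpha> \<noteq> 0)"
    using pms_rep[OF zero_notin_parts] by blast
  from choice[OF this] obtain L where L: "\<And>lam. sf_rep (sum_mset (parts lam)) (pms (parts lam)) (L lam)"
    "\<And>lam \<alpha>. finite (supp \<alpha>) \<Longrightarrow> L lam \<alpha> \<noteq> 0 \<Longrightarrow> size (parts \<alpha>) \<le> size (parts lam)"
    "\<And>lam \<alpha>. finite (supp \<alpha>) \<Longrightarrow> L lam \<alpha> \<noteq> 0 \<Longrightarrow> size (parts \<alpha>) = size (parts lam) \<Longrightarrow> parts \<alpha> = parts lam"
    "\<And>lam \<alpha>. finite (supp \<alpha>) \<Longrightarrow> parts \<alpha> = parts lam \<Longrightarrow> L lam \<alpha> \<noteq> 0"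
    by blast
  show ?thesis
  proof (intro exI[of _ L] conjI allI impI)
    fix lam x assume "is_partition lam" "fin_supp x"
    then show "power_sum_part lam x = (\<Sum>\<kappa>\<in>Par (part_size lam). of_nat (L lam \<kappa>) * monomial_sf \<kappa> x)"
      unfolding power_sum_part_eq part_size_eq by (intro sf_rep_monomial L)
  next
    fix lam \<kappa> assume *: "is_partition lam" "is_partition \<kappa>" "L lam \<kappa> \<noteq> 0"
    show "\<kappa> = lam \<or> size (parts \<kappa>) < size (parts lam)"
    proof (cases "size (parts \<kappa>) = size (parts lam)")
      case True
      then have "parts \<kappa> = parts lam" using L(3) * partition_fin by blast
      then show ?thesis using partition_unique * by blast
    next
      case False
      then show ?thesis using L(2)[OF partition_fin[OF *(2)] *(3)] by linarith
    qed
  next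
    fix lam assume "is_partition lam"
    then show "L lam lam \<noteq> 0" by (intro L(4) partition_fin) auto
  qed
qed

text \<open>
Among the partitions with nonzero coefficient choose one, \<open>\<nu>\<close>, with the largest number of parts. By
triangularity no other partition contributes to the coefficient of the monomial function of \<open>\<nu>\<close>.
\<close>

lemma power_sum_indep:
  assumes fin: "finite A" and A: "\<And>lam. lam \<in> A \<Longrightarrow> is_partition lam"
    and zero: "\<And>x. fin_supp x \<Longrightarrow> (\<Sum>lam\<in>A. d lam * power_sum_part lam x) = 0"
    and lam: "lam \<in> A"
  shows "d lam = 0"
proof (rule ccontr)
  obtain L :: "(nat \<Rightarrow> nat) \<Rightarrow> (nat \<Rightarrow> nat) \<Rightarrow> nat" where L:
    "\<And>lam x. is_partition lam \<Longrightarrow> fin_supp x \<Longrightarrow>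
        power_sum_part lam x = (\<Sum>\<kappa>\<in>Par (part_size lam). of_nat (L lam \<kappa>) * monomial_sf \<kappa> x)"
    "\<And>lam \<kappa>. is_partition lam \<Longrightarrow> is_partition \<kappa> \<Longrightarrow> L lam \<kappa> \<noteq> 0 \<Longrightarrow> \<kappa> = lam \<or> size (parts \<kappa>) < size (parts lam)"
    "\<And>lam. is_partition lam \<Longrightarrow> L lam lam \<noteq> 0"
    using power_sum_part_monomial by blast
  assume "d lam \<noteq> 0"
  define B where "B = {lam \<in> A. d lam \<noteq> 0}"
  have B: "finite B" "B \<noteq> {}" using fin lam \<open>d lam \<noteq> 0\<close> by (auto simp: B_def)
  define s where "s = Max ((\<lambda>lam. size (parts lam)) ` B)"
  have "s \<in> (\<lambda>lam. size (parts lam)) ` B" unfolding s_def using B by (intro Max_in) auto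
  then obtain \<nu> where \<nu>: "\<nu> \<in> B" "size (parts \<nu>) = s" by auto
  have smax: "size (parts \<kappa>) \<le> s" if "\<kappa> \<in> B" for \<kappa>
    using that B by (auto simp: s_def)
  define C where "C = (\<Union>lam\<in>B. Par (part_size lam))"
  have C: "finite C" using B finite_Par by (auto simp: C_def)
  have "(\<Sum>\<kappa>\<in>C. (\<Sum>lam\<in>B. d lam * (if \<kappa> \<in> Par (part_size lam) then of_nat (L lam \<kappa>) else 0)) * monomial_sf \<kappa> x) = 0"
    if x: "fin_supp x" for x
  proof -
    have "0 = (\<Sum>lam\<in>B. d lam * power_sum_part lam x)"
      using zero[OF x] sum.mono_neutral_right[of A B "\<lambda>lam. d lam * power_sum_part lam x"] fin
      by (auto simp: B_def)
    also have "\<dots> = (\<Sum>lam\<in>B. d lam * (\<Sum>\<kappa>\<in>C. (if \<kappa> \<in> Par (part_size lam) then of_nat (L lam \<kappa>) else 0) * monomial_sf \<kappa> x))"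
    proof (intro sum.cong arg_cong2[of _ _ _ _ "(*)"] refl)
      fix lam assume lam: "lam \<in> B"
      then have "Par (part_size lam) \<subseteq> C" by (auto simp: C_def)
      then have "(\<Sum>\<kappa>\<in>C. (if \<kappa> \<in> Par (part_size lam) then of_nat (L lam \<kappa>) else 0) * monomial_sf \<kappa> x) =
          (\<Sum>\<kappa>\<in>Par (part_size lam). of_nat (L lam \<kappa>) * monomial_sf \<kappa> x)"
        using C by (intro sum.mono_neutral_cong_right) auto
      then show "power_sum_part lam x = (\<Sum>\<kappa>\<in>C. (if \<kappa> \<in> Par (part_size lam) then of_nat (L lam \<kappa>) else 0) * monomial_sf \<kappa> x)"
        using L(1)[of lam x] x lam A by (simp add: B_def)
    qed
    also have "\<dots> = (\<Sum>\<kappa>\<in>C. (\<Sum>lam\<in>B. d lam * (if \<kappa> \<in> Par (part_size lam) then of_nat (L lam \<kappa>) else 0)) * monomial_sf \<kappa> x)"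
      unfolding sum_distrib_left sum_distrib_right by (subst sum.swap) (simp add: mult.assoc)
    finally show ?thesis by simp
  qed
  then have "(\<Sum>lam\<in>B. d lam * (if \<nu> \<in> Par (part_size lam) then of_nat (L lam \<nu>) else 0)) = 0"
    by (rule monomial_sf_indep[OF C, rotated 1])
       (use \<nu> A in \<open>auto simp: C_def B_def Par_def\<close>)
  moreover have "d lam * (if \<nu> \<in> Par (part_size lam) then of_nat (L lam \<nu>) else 0) = 0" if "lam \<in> B" "lam \<noteq> \<nu>" for lam
    using L(2)[of lam \<nu>] smax[OF that(1)] \<nu> A that by (auto simp: B_def)
  then have "(\<Sum>lam\<in>B. d lam * (if \<nu> \<in> Par (part_size lam) then of_nat (L lam \<nu>) else 0)) =
      (\<Sum>lam\<in>{\<nu>}. d lam * (if \<nu> \<in> Par (part_size lam) then of_nat (L lam \<nu>) else 0))"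
    using B \<nu>(1) by (intro sum.mono_neutral_right) auto
  ultimately have "d \<nu> * of_nat (L \<nu> \<nu>) = 0"
    using \<nu> A Par_self by (auto simp: B_def)
  then show False using L(3)[of \<nu>] \<nu> A by (auto simp: B_def)
qed

lemma power_sum_coeff_eq:
  assumes c: "power_sum_expansion f c"
  shows "power_sum_coeff f = c"
  unfolding power_sum_coeff_def
proof (rule the_equality[of _ c])
  show "power_sum_expansion f c" by (rule c)
  fix c' assume c': "power_sum_expansion f c'"
  define A where "A = {lam. c lam \<noteq> 0} \<union> {lam. c' lam \<noteq> 0}"
  have A: "finite A" "\<And>lam. lam \<in> A \<Longrightarrow> is_partition lam"
    using c c' by (auto simp: A_def power_sum_expansion_def)
  have zero: "(\<Sum>lam\<in>A. (c' lam - c lam) * power_sum_part lam x) = 0" if "fin_supp x" for x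
  proof -
    have "f x = (\<Sum>lam\<in>A. c lam * power_sum_part lam x)"
      using c that A(1) unfolding power_sum_expansion_def A_def
      by (subst sum.mono_neutral_left[of A "{lam. c lam \<noteq> 0}", unfolded A_def, symmetric]) auto
    moreover have "f x = (\<Sum>lam\<in>A. c' lam * power_sum_part lam x)"
      using c' that A(1) unfolding power_sum_expansion_def A_def
      by (subst sum.mono_neutral_left[of A "{lam. c' lam \<noteq> 0}", unfolded A_def, symmetric]) auto
    ultimately show ?thesis by (simp add: left_diff_distrib sum_subtractf)
  qed
  have "c' lam - c lam = 0" if "lam \<in> A" for lam
    by (rule power_sum_indep[OF A zero that])
  moreover have "c' lam - c lam = 0" if "lam \<notin> A" for lam using that by (simp add: A_def)
  ultimately have "c' lam - c lam = 0" for lam by blast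
  then show "c' = c" by (simp add: fun_eq_iff)
qed

text \<open>
Inversion of the triangular transition matrix, by induction on the number of parts.
\<close>

lemma monomial_power_sum:
  assumes "\<mu> \<in> Par d"
  shows "\<exists>c. \<forall>x. fin_supp x \<longrightarrow> monomial_sf \<mu> x = (\<Sum>lam\<in>Par d. c lam * power_sum_part lam x)"
  using assms
proof (induction "size (parts \<mu>)" arbitrary: \<mu> rule: less_induct)
  case less
  obtain L :: "(nat \<Rightarrow> nat) \<Rightarrow> (nat \<Rightarrow> nat) \<Rightarrow> nat" where L:
    "\<And>lam x. is_partition lam \<Longrightarrow> fin_supp x \<Longrightarrow>
        power_sum_part lam x = (\<Sum>\<kappa>\<in>Par (part_size lam). of_nat (L lam \<kappa>) * monomial_sf \<kappa> x)"
    "\<And>lam \<kappa>. is_partition lam \<Longrightarrow> is_partition \<kappa> \<Longrightarrow> L lam \<kappa> \<noteq> 0 \<Longrightarrow> \<kappa> = lam \<or> size (parts \<kappa>) < size (parts lam)"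
    "\<And>lam. is_partition lam \<Longrightarrow> L lam lam \<noteq> 0"
    using power_sum_part_monomial by blast
  have \<mu>: "is_partition \<mu>" "part_size \<mu> = d" using less.prems by (auto simp: Par_def)
  define B where "B = {\<kappa> \<in> Par d - {\<mu>}. L \<mu> \<kappa> \<noteq> 0}"
  have "\<forall>\<kappa>\<in>B. \<exists>c. \<forall>x. fin_supp x \<longrightarrow> monomial_sf \<kappa> x = (\<Sum>lam\<in>Par d. c lam * power_sum_part lam x)"
  proof
    fix \<kappa> assume "\<kappa> \<in> B"
    then have \<kappa>: "\<kappa> \<in> Par d" "\<kappa> \<noteq> \<mu>" "L \<mu> \<kappa> \<noteq> 0" by (auto simp: B_def)
    then have "size (parts \<kappa>) < size (parts \<mu>)" using L(2)[OF \<mu>(1) Par_D(1)] by blast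
    then show "\<exists>c. \<forall>x. fin_supp x \<longrightarrow> monomial_sf \<kappa> x = (\<Sum>lam\<in>Par d. c lam * power_sum_part lam x)"
      using \<kappa>(1) by (rule less.hyps)
  qed
  then obtain c where c: "\<And>\<kappa> x. \<kappa> \<in> B \<Longrightarrow> fin_supp x \<Longrightarrow> monomial_sf \<kappa> x = (\<Sum>lam\<in>Par d. c \<kappa> lam * power_sum_part lam x)"
    by metis
  define e where "e lam = ((if lam = \<mu> then 1 else 0) - (\<Sum>\<kappa>\<in>B. of_nat (L \<mu> \<kappa>) * c \<kappa> lam)) / of_nat (L \<mu> \<mu>)" for lam
  have "monomial_sf \<mu> x = (\<Sum>lam\<in>Par d. e lam * power_sum_part lam x)" if x: "fin_supp x" for x
  proof -
    have fin: "finite B" "finite (Par d)" using finite_Par by (auto simp: B_def)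
    have "power_sum_part \<mu> x = (\<Sum>\<kappa>\<in>Par d. of_nat (L \<mu> \<kappa>) * monomial_sf \<kappa> x)"
      using L(1)[OF \<mu>(1) x] \<mu>(2) by simp
    also have "\<dots> = of_nat (L \<mu> \<mu>) * monomial_sf \<mu> x + (\<Sum>\<kappa>\<in>Par d - {\<mu>}. of_nat (L \<mu> \<kappa>) * monomial_sf \<kappa> x)"
      using less.prems fin by (subst sum.remove[of _ \<mu>]) auto
    also have "(\<Sum>\<kappa>\<in>Par d - {\<mu>}. of_nat (L \<mu> \<kappa>) * monomial_sf \<kappa> x) = (\<Sum>\<kappa>\<in>B. of_nat (L \<mu> \<kappa>) * monomial_sf \<kappa> x)"
      using fin by (intro sum.mono_neutral_right) (auto simp: B_def)
    also have "\<dots> = (\<Sum>\<kappa>\<in>B. \<Sum>lam\<in>Par d. of_nat (L \<mu> \<kappa>) * c \<kappa> lam * power_sum_part lam x)"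
      using c[OF _ x] by (simp add: sum_distrib_left mult.assoc)
    also have "\<dots> = (\<Sum>lam\<in>Par d. (\<Sum>\<kappa>\<in>B. of_nat (L \<mu> \<kappa>) * c \<kappa> lam) * power_sum_part lam x)"
      by (subst sum.swap) (simp add: sum_distrib_right)
    finally have "of_nat (L \<mu> \<mu>) * monomial_sf \<mu> x =
        power_sum_part \<mu> x - (\<Sum>lam\<in>Par d. (\<Sum>\<kappa>\<in>B. of_nat (L \<mu> \<kappa>) * c \<kappa> lam) * power_sum_part lam x)"
      by simp
    also have "power_sum_part \<mu> x = (\<Sum>lam\<in>Par d. (if lam = \<mu> then 1 else 0) * power_sum_part lam x)"
      using less.prems fin by (simp add: if_distrib[of "\<lambda>t. t * _"] sum.delta cong: if_cong)
    also have "\<dots> - (\<Sum>lam\<in>Par d. (\<Sum>\<kappa>\<in>B. of_nat (L \<mu> \<kappa>) * c \<kappa> lam) * power_sum_part lam x) =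
        of_nat (L \<mu> \<mu>) * (\<Sum>lam\<in>Par d. e lam * power_sum_part lam x)"
      using L(3)[OF \<mu>(1)]
      by (simp add: e_def sum_subtractf[symmetric] sum_distrib_left left_diff_distrib[symmetric])
    finally show ?thesis using L(3)[OF \<mu>(1)] by simp
  qed
  then show ?case by blast
qed

section \<open>The Cauchy kernel in terms of power sums\<close>

text \<open>
Partitions of \<open>d\<close> as multisets of parts.
\<close>

definition Mul :: "nat \<Rightarrow> nat multiset set" where
  "Mul d = {M. 0 \<notin># M \<and> sum_mset M = d}"

lemma bij_Par_Mul: "bij_betw parts (Par d) (Mul d)"
proof (rule bij_betwI')
  fix lam \<mu> assume "lam \<in> Par d" "\<mu> \<in> Par d"
  then show "parts lam = parts \<mu> \<longleftrightarrow> lam = \<mu>" using partition_unique Par_D(1) by blast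
next
  fix lam assume "lam \<in> Par d"
  then show "parts lam \<in> Mul d" using Par_D(2) by (simp add: Mul_def)
next
  fix M assume "M \<in> Mul d"
  then show "\<exists>lam\<in>Par d. M = parts lam"
    using partition_exists[of M] by (auto simp: Mul_def Par_def part_size_eq)
qed

lemma finite_Mul: "finite (Mul d)"
  using bij_Par_Mul finite_Par bij_betw_finite by blast

text \<open>
The squared norm of the power sum product with parts \<open>M\<close> for the inner product at \<open>t = 0\<close>.
\<close>

definition zw :: "complex \<Rightarrow> nat multiset \<Rightarrow> complex" where
  "zw q M = (\<Prod>n\<in>set_mset M. of_nat n ^ count M n * fact (count M n)) * (\<Prod>n\<in>#M. 1 - q ^ n)"

lemma zw_add:
  assumes "n > 0"
  shows "zw q (add_mset n M) = zw q M * (of_nat n * of_nat (count M n + 1) * (1 - q ^ n))"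
proof -
  define F where "F k m = (of_nat k ^ m * fact m :: complex)" for k m :: nat
  have "(\<Prod>k\<in>set_mset (add_mset n M). F k (count (add_mset n M) k)) =
      F n (Suc (count M n)) * (\<Prod>k\<in>set_mset M - {n}. F k (count M k))"
    by (subst prod.remove[of _ n]) (auto intro!: prod.cong)
  moreover have "(\<Prod>k\<in>set_mset M. F k (count M k)) = F n (count M n) * (\<Prod>k\<in>set_mset M - {n}. F k (count M k))"
  proof (cases "n \<in># M")
    case False
    then show ?thesis by (simp add: F_def not_in_iff)
  qed (simp add: prod.remove)
  ultimately have "(\<Prod>k\<in>set_mset (add_mset n M). F k (count (add_mset n M) k)) =
      (\<Prod>k\<in>set_mset M. F k (count M k)) * (of_nat n * of_nat (count M n + 1))"
    by (simp add: F_def algebra_simps)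
  moreover have "zw q N = (\<Prod>k\<in>set_mset N. F k (count N k)) * (\<Prod>n\<in>#N. 1 - q ^ n)" for N
    by (simp add: zw_def F_def)
  ultimately show ?thesis by (simp only: image_mset_add_mset prod_mset.add_mset mult_ac)
qed

text \<open>
At \<open>t = 0\<close> every denominator \<open>1 - t ^ lam i\<close> is \<open>1\<close>, because only nonzero parts occur.
\<close>

lemma z_part_weight:
  assumes "is_partition lam"
  shows "of_nat (z_part lam) * (\<Prod>i | lam i \<noteq> 0. (1 - q ^ lam i) / (1 - 0 ^ lam i)) = zw q (parts lam)"
proof -
  have fin: "finite (supp lam)" using assms by (rule partition_fin)
  have c: "count (parts lam) n = card {k. lam k = n}" if "n \<noteq> 0" for n
  proof -
    have "{k. lam k = n} = {k \<in> supp lam. lam k = n}" using that by (auto simp: supp_def)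
    moreover have "count (parts lam) n = (\<Sum>y\<in>{k \<in> supp lam. lam k = n}. 1)"
      unfolding parts_def count_image_mset using fin by (intro sum.cong) auto
    ultimately show ?thesis by (simp only: card_eq_sum)
  qed
  have s: "set_mset (parts lam) = range lam - {0}"
    using fin by (auto simp: parts_def supp_def)
  have "of_nat (z_part lam) = (\<Prod>n\<in>set_mset (parts lam). of_nat n ^ count (parts lam) n * fact (count (parts lam) n) :: complex)"
    unfolding z_part_def s of_nat_prod by (intro prod.cong) (auto simp: c)
  moreover have "(\<Prod>i | lam i \<noteq> 0. (1 - q ^ lam i) / (1 - 0 ^ lam i)) = (\<Prod>n\<in>#parts lam. 1 - q ^ n)"
  proof -
    have "(\<Prod>i | lam i \<noteq> 0. (1 - q ^ lam i) / (1 - 0 ^ lam i)) = (\<Prod>i\<in>supp lam. 1 - q ^ lam i)"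
      unfolding supp_def by (intro prod.cong) (auto simp: power_0_left)
    also have "\<dots> = (\<Prod>n\<in>#parts lam. 1 - q ^ n)"
      by (simp add: parts_def prod_unfold_prod_mset image_mset.compositionality comp_def)
    finally show ?thesis .
  qed
  ultimately show ?thesis by (simp add: zw_def)
qed

context
  fixes q :: complex
  assumes q: "norm q < 1"
begin

lemma one_minus_q_power: "n > 0 \<Longrightarrow> 1 - q ^ n \<noteq> 0"
proof -
  assume "n > 0"
  then have "norm (q ^ n) < 1" using q by (simp add: norm_power power_less_one_iff)
  then show ?thesis by auto
qed

lemma zw_nonzero: "0 \<notin># M \<Longrightarrow> zw q M \<noteq> 0"
proof (induction M)
  case (add n M)
  then have "n > 0" by auto
  then show ?case using add one_minus_q_power[of n] by (simp add: zw_add del: of_nat_add of_nat_Suc)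
qed (simp add: zw_def)

text \<open>
The part of degree \<open>d\<close> of the reproducing kernel, in the orthogonal basis of power sums.
\<close>

definition Kp :: "(nat \<Rightarrow> complex) \<Rightarrow> (nat \<Rightarrow> complex) \<Rightarrow> nat \<Rightarrow> complex" where
  "Kp x y d = (\<Sum>M\<in>Mul d. pms M x * pms M y / zw q M)"

lemma sum_mset_count: "sum_mset (M :: nat multiset) = (\<Sum>n\<in>set_mset M. n * count M n)"
proof (induction M)
  case (add k M)
  have "(\<Sum>n\<in>set_mset (add_mset k M). n * count (add_mset k M) n) =
      (\<Sum>n\<in>insert k (set_mset M). n * count M n + (if n = k then k else 0))"
    by (intro sum.cong) auto
  also have "\<dots> = (\<Sum>n\<in>insert k (set_mset M). n * count M n) + k"
    by (simp add: sum.distrib)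
  also have "(\<Sum>n\<in>insert k (set_mset M). n * count M n) = (\<Sum>n\<in>set_mset M. n * count M n)"
    by (rule sum.mono_neutral_right) (auto simp: not_in_iff)
  finally show ?case using add by simp
qed simp

text \<open>
Removing a part \<open>n\<close> from a multiset changes the norm by a factor that contains \<open>n\<close> times the
multiplicity of \<open>n\<close>, and these weights add up to \<open>d\<close>. This is the recursion satisfied by
the coefficients of the exponential of \<open>\<Sum>\<^sub>n p\<^sub>n(x) p\<^sub>n(y) X\<^sup>n / (n (1 - q\<^sup>n))\<close>.
\<close>

lemma Kp_rec:
  "of_nat d * Kp x y d = (\<Sum>n=1..d. power_sum n x * power_sum n y / (1 - q ^ n) * Kp x y (d - n))"
proof -
  define F where "F M = pms M x * pms M y / zw q M" for M
  have "of_nat d * Kp x y d = (\<Sum>M\<in>Mul d. of_nat (\<Sum>n\<in>set_mset M. n * count M n) * F M)"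
    unfolding Kp_def sum_distrib_left F_def by (intro sum.cong refl) (simp add: Mul_def sum_mset_count[symmetric])
  also have "\<dots> = (\<Sum>M\<in>Mul d. \<Sum>n\<in>set_mset M. of_nat (n * count M n) * F M)"
    by (simp add: sum_distrib_right)
  also have "\<dots> = (\<Sum>(M, n)\<in>Sigma (Mul d) set_mset. of_nat (n * count M n) * F M)"
    by (rule sum.Sigma) (auto simp: finite_Mul)
  also have "\<dots> = (\<Sum>(n, N)\<in>Sigma {1..d} (\<lambda>n. Mul (d - n)). power_sum n x * power_sum n y / (1 - q ^ n) * F N)"
  proof (rule sum.reindex_bij_witness[of _ "\<lambda>(n, N). (add_mset n N, n)" "\<lambda>(M, n). (n, M - {#n#})"], goal_cases)
    case (2 p)
    then obtain M n where p: "p = (M, n)" "M \<in> Mul d" "n \<in># M" by auto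
    then obtain N where N: "M = add_mset n N" by (metis insert_DiffM)
    then show ?case using p by (auto simp: Mul_def)
  next
    case (4 p)
    then show ?case by (auto simp: Mul_def)
  next
    case (5 p)
    then obtain M n where p: "p = (M, n)" "M \<in> Mul d" "n \<in># M" by auto
    then obtain N where N: "M = add_mset n N" by (metis insert_DiffM)
    have n: "n > 0" and N0: "0 \<notin># N" using p N by (auto simp: Mul_def)
    have nz: "zw q N \<noteq> 0" "(1 - q ^ n) \<noteq> 0" "(of_nat n :: complex) \<noteq> 0" "(of_nat (count N n + 1) :: complex) \<noteq> 0"
      using zw_nonzero[OF N0] one_minus_q_power[OF n] n by (auto simp del: of_nat_add of_nat_Suc)
    have "of_nat (n * count M n) * F M = of_nat n * of_nat (count N n + 1) *
        (power_sum n x * pms N x * (power_sum n y * pms N y) / (zw q N * (of_nat n * of_nat (count N n + 1) * (1 - q ^ n))))"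
    proof -
      have "of_nat (n * count (add_mset n N) n) = (of_nat n * of_nat (count N n + 1) :: complex)"
        by (simp add: algebra_simps)
      moreover have "pms (add_mset n N) z = power_sum n z * pms N z" for z by (simp add: pms_def)
      ultimately show ?thesis by (simp only: F_def N zw_add[OF n])
    qed
    also have "\<dots> = power_sum n x * power_sum n y / (1 - q ^ n) * F N"
    proof -
      have "a * b * (p * X * (r * Y) / (z * (a * b * w))) = p * r / w * (X * Y / z)"
        if "z \<noteq> 0" "w \<noteq> 0" "a \<noteq> 0" "b \<noteq> 0" for a b p X r Y z w :: complex
        using that by (simp add: field_simps)
      from this[OF nz] show ?thesis unfolding F_def .
    qed
    finally have *: "of_nat (n * count M n) * F M = power_sum n x * power_sum n y / (1 - q ^ n) * F N" .
    have "M - {#n#} = N" using N by simp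
    then show ?case by (simp only: p(1) prod.case *)
  qed auto
  also have "\<dots> = (\<Sum>n=1..d. \<Sum>N\<in>Mul (d - n). power_sum n x * power_sum n y / (1 - q ^ n) * F N)"
    by (rule sum.Sigma[symmetric]) (auto simp: finite_Mul)
  finally show ?thesis by (simp add: Kp_def F_def sum_distrib_left)
qed

lemma Kp_0: "Kp x y 0 = 1"
proof -
  have "Mul 0 = {{#}}" by (auto simp: Mul_def) (metis multiset_nonemptyE)
  then show ?thesis by (simp add: Kp_def pms_def zw_def)
qed

end

section \<open>Vanishing of torus integrals\<close>

context q_disc
begin

lemma gp_insert:
  assumes "finite K" "i \<notin> K"
  shows "gp (insert i K) a y = (\<Sum>b=0..a. y i ^ b / qp b * gp K (a - b) y)"
  using assms by (simp add: gp_def fps_mult_nth)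

lemma gp_insert_fun:
  assumes "finite K" "i \<notin> K"
  shows "gp (insert i K) a = (\<lambda>y. \<Sum>b=0..a. 1 / qp b * (y i ^ b * gp K (a - b) y))"
  using gp_insert[OF assms] by (simp add: fun_eq_iff)

lemma gp_split:
  assumes "finite I" "K \<subseteq> I"
  shows "gp I a y = (\<Sum>b=0..a. gp K b y * gp (I - K) (a - b) y)"
proof -
  have "(\<Prod>i\<in>I. gen (y i)) = (\<Prod>i\<in>K. gen (y i)) * (\<Prod>i\<in>I - K. gen (y i))"
    using prod.subset_diff[OF assms(2,1), of "\<lambda>i. gen (y i)"] by (simp add: mult.commute)
  then show ?thesis by (simp add: gp_def fps_mult_nth)
qed

lemma gp_cong: "(\<And>i. i \<in> K \<Longrightarrow> y i = y' i) \<Longrightarrow> gp K a y = gp K a y'"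
  unfolding gp_def by (intro arg_cong2[of _ _ _ _ fps_nth] prod.cong) auto

lemma gp_0 [simp]: "finite K \<Longrightarrow> gp K 0 y = 1"
  by (induction K rule: finite_induct) (auto simp: gp_insert)

lemma good_gp:
  assumes "finite K" "K \<subseteq> I"
  shows "good I (gp K a)"
  using assms
proof (induction K arbitrary: a rule: finite_induct)
  case empty
  then show ?case by (simp only: gp_empty good_const)
next
  case (insert i K)
  have "good I (\<lambda>y. \<Sum>b=0..a. 1 / qp b * (y i ^ b * gp K (a - b) y))"
    using insert by (intro good_sum good_mult good_power good_coord good_const) auto
  then show ?case unfolding gp_insert_fun[OF insert.hyps(1,2)] .
qed

lemma deg_ge_power_in: "i \<in> J \<Longrightarrow> deg_ge I J (int b) (\<lambda>y. y i ^ b)"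
  by (rule deg_geI, rule_tac x = "\<lambda>_. y i ^ b" in exI) (auto simp: scl_def power_mult_distrib)

lemma deg_ge_power:  "deg_ge I J 0 (\<lambda>y. y i ^ b)"
  by (rule deg_geI, rule_tac x = "\<lambda>z. if i \<in> J then (z * y i) ^ b else y i ^ b" in exI)
     (cases "i \<in> J"; auto simp: scl_def intro!: holomorphic_intros)

lemma deg_ge_cmult: "deg_ge I J D f \<Longrightarrow> deg_ge I J D (\<lambda>y. c * f y)"
  using deg_ge_mult[OF deg_ge_const[of I J c], of D f] by simp

lemma gp_deg_0:
  assumes "finite K"
  shows "deg_ge I J 0 (gp K a)"
  using assms
proof (induction K arbitrary: a rule: finite_induct)
  case empty
  then show ?case by (simp only: gp_empty deg_ge_const)
next
  case (insert i K)
  have "deg_ge I J (0 + 0) (\<lambda>y. y i ^ b * gp K (a - b) y)" for b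
    by (intro deg_ge_mult deg_ge_power insert.IH)
  then have "deg_ge I J 0 (\<lambda>y. \<Sum>b=0..a. 1 / qp b * (y i ^ b * gp K (a - b) y))"
    by (intro deg_ge_sum deg_ge_cmult) simp
  then show ?case unfolding gp_insert_fun[OF insert.hyps(1,2)] .
qed

lemma gp_deg:
  assumes "finite K" "K \<subseteq> J"
  shows "deg_ge I J (int a) (gp K a)"
  using assms
proof (induction K arbitrary: a rule: finite_induct)
  case empty
  show ?case
    by (rule deg_geI, rule_tac x = "\<lambda>_. if a = 0 then 1 else 0" in exI) auto
next
  case (insert i K)
  have "deg_ge I J (int a) (\<lambda>y. y i ^ b * gp K (a - b) y)" if "b \<in> {0..a}" for b
  proof -
    have "deg_ge I J (int b + int (a - b)) (\<lambda>y. y i ^ b * gp K (a - b) y)"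
      using insert.prems by (intro deg_ge_mult deg_ge_power_in insert.IH) auto
    moreover have "int b + int (a - b) = int a" using that by simp
    ultimately show ?thesis by simp
  qed
  then have "deg_ge I J (int a) (\<lambda>y. \<Sum>b=0..a. 1 / qp b * (y i ^ b * gp K (a - b) y))"
    by (intro deg_ge_sum deg_ge_cmult)
  then show ?case unfolding gp_insert_fun[OF insert.hyps(1,2)] .
qed

lemma good_Dl: "K \<subseteq> I \<Longrightarrow> good I (Dl K)"
  unfolding Dl_def by (intro good_prod good_cont[OF good_ratio einf_continuous]) auto

lemma Dl_cong: "(\<And>i. i \<in> K \<Longrightarrow> y i = y' i) \<Longrightarrow> Dl K y = Dl K y'"
  unfolding Dl_def by (intro prod.cong) auto

lemma deg_Dl: "deg_ge I J 0 (Dl (I - J))"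
proof (rule deg_geI)
  fix y
  have "Dl (I - J) (scl J z y) = Dl (I - J) y" for z
    by (rule Dl_cong) (auto simp: scl_def)
  then show "\<exists>h. h holomorphic_on UNIV \<and> (\<forall>z. norm z = 1 \<longrightarrow> Dl (I - J) (scl J z y) = z powi 0 * h z)"
    by (intro exI[of _ "\<lambda>_. Dl (I - J) y"]) auto
qed

lemma good_Phi_ratio:
  assumes "finite K" "K \<subseteq> I" "j \<in> I"
  shows "good I (\<lambda>y. Phi K a (\<lambda>i. y j / y i))"
proof -
  have "good I (\<lambda>y. Phi K a (\<lambda>i. inverse (y i) * y j))"
    using assms by (intro good_Phi good_ratio) auto
  then show ?thesis by (simp add: divide_inverse mult.commute)
qed

lemma deg_Phi_ratio:
  assumes "finite K" "j \<in> J"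
  shows "deg_ge I J 0 (\<lambda>y. Phi K a (\<lambda>i. y j / y i))"
proof (rule deg_geI)
  fix y
  define w :: "nat \<Rightarrow> complex \<Rightarrow> complex" where "w i z = (if i \<in> J then y j / y i else z * (y j / y i))" for i z
  have "(\<lambda>z. w i z) holomorphic_on UNIV" for i
    unfolding w_def by (cases "i \<in> J") (auto intro!: holomorphic_intros)
  then have "(\<lambda>z. Phi K a (\<lambda>i. w i z)) holomorphic_on UNIV"
    using assms(1) by (intro Phi_holomorphic)
  moreover have "(\<lambda>i. scl J z y j / scl J z y i) = (\<lambda>i. w i z)" if "norm z = 1" for z
  proof -
    have "z \<noteq> 0" using that by auto
    then show ?thesis using assms(2) by (auto simp: scl_def w_def fun_eq_iff)
  qed
  ultimately show "\<exists>h. h holomorphic_on UNIV \<and>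
      (\<forall>z. norm z = 1 \<longrightarrow> Phi K a (\<lambda>i. scl J z y j / scl J z y i) = z powi 0 * h z)"
    by (intro exI[of _ "\<lambda>z. Phi K a (\<lambda>i. w i z)"]) auto
qed

text \<open>
Iteration of the expansion of the weight. After \<open>k\<close> steps the set \<open>J\<close> of removed variables has \<open>k\<close>
elements, and the coefficient \<open>C J\<close> depends on the other variables only through ratios with numerators
in \<open>J\<close>, in which it is entire. Its degree is controlled in every larger group \<open>J'\<close> as well, since
in the next step a removed variable joins \<open>J\<close>.
\<close>

lemma peel:
  assumes I: "finite I" and k: "k \<le> card I"
  shows "\<exists>C. (\<forall>y. unit_on I y \<longrightarrow>
      (\<Prod>r<k. gp I (a r) y) * Dl I y = (\<Sum>J | J \<subseteq> I \<and> card J = k. C J y * Dl (I - J) y)) \<and>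
    (\<forall>J. J \<subseteq> I \<longrightarrow> card J = k \<longrightarrow> good I (C J) \<and>
      (\<forall>J'. J \<subseteq> J' \<longrightarrow> J' \<subseteq> I \<longrightarrow> deg_ge I J' (int (\<Sum>r<k. a r)) (C J)))"
  using k
proof (induction k)
  case 0
  have eq: "{J. J \<subseteq> I \<and> card J = 0} = {{}}" using I finite_subset by (auto simp: card_eq_0_iff)
  show ?case
  proof (intro exI[of _ "\<lambda>_ _. 1"] conjI allI impI)
    fix y show "(\<Prod>r<0. gp I (a r) y) * Dl I y = (\<Sum>J | J \<subseteq> I \<and> card J = 0. 1 * Dl (I - J) y)"
      unfolding eq by simp
  next
    fix J' show "deg_ge I J' (int (\<Sum>r<0. a r)) (\<lambda>_. 1)" using deg_ge_const[of I J' 1] by simp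
  next
    show "good I (\<lambda>_. 1)" by (rule good_const)
  qed
next
  case (Suc k)
  have "k \<le> card I" using Suc.prems by simp
  from Suc.IH[OF this] obtain C where C0: "(\<forall>y. unit_on I y \<longrightarrow>
      (\<Prod>r<k. gp I (a r) y) * Dl I y = (\<Sum>J | J \<subseteq> I \<and> card J = k. C J y * Dl (I - J) y)) \<and>
    (\<forall>J. J \<subseteq> I \<longrightarrow> card J = k \<longrightarrow> good I (C J) \<and>
      (\<forall>J'. J \<subseteq> J' \<longrightarrow> J' \<subseteq> I \<longrightarrow> deg_ge I J' (int (\<Sum>r<k. a r)) (C J)))"
    ..
  then have C: "\<And>y. unit_on I y \<Longrightarrow> (\<Prod>r<k. gp I (a r) y) * Dl I y = (\<Sum>J | J \<subseteq> I \<and> card J = k. C J y * Dl (I - J) y)"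
    "\<And>J. J \<subseteq> I \<Longrightarrow> card J = k \<Longrightarrow> good I (C J)"
    "\<And>J J'. J \<subseteq> I \<Longrightarrow> card J = k \<Longrightarrow> J \<subseteq> J' \<Longrightarrow> J' \<subseteq> I \<Longrightarrow> deg_ge I J' (int (\<Sum>r<k. a r)) (C J)"
    by blast+
  define \<Psi> where "\<Psi> J j y = (\<Sum>b=0..a k. gp J b y * (y j ^ (a k - b) * Phi (I - J - {j}) (a k - b) (\<lambda>i. y j / y i)))" for J j y
  define C' where "C' J y = (\<Sum>j\<in>J. C (J - {j}) y * \<Psi> (J - {j}) j y)" for J y
  have step: "gp I (a k) y * Dl (I - J) y = (\<Sum>j\<in>I - J. \<Psi> J j y * Dl (I - J - {j}) y)"
    if y: "unit_on I y" and J: "J \<subseteq> I" "card J = k" for y J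
  proof -
    have ne: "I - J \<noteq> {}" using J Suc.prems I by (metis Diff_eq_empty_iff card_mono finite_subset not_less_eq_eq)
    have y': "unit_on (I - J) y" using y by (auto simp: unit_on_def)
    have "gp I (a k) y * Dl (I - J) y = (\<Sum>b=0..a k. gp J b y * (gp (I - J) (a k - b) y * Dl (I - J) y))"
      by (simp add: gp_split[OF I J(1)] sum_distrib_right mult.assoc)
    also have "\<dots> = (\<Sum>b=0..a k. gp J b y * (\<Sum>j\<in>I - J. y j ^ (a k - b) * Phi (I - J - {j}) (a k - b) (\<lambda>i. y j / y i) * Dl (I - J - {j}) y))"
      using I ne y' by (subst gp_Dl_expansion) auto
    also have "\<dots> = (\<Sum>j\<in>I - J. \<Psi> J j y * Dl (I - J - {j}) y)"
      unfolding \<Psi>_def sum_distrib_left sum_distrib_right by (subst sum.swap) (simp add: mult.assoc)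
    finally show ?thesis .
  qed
  have fin: "finite {J. J \<subseteq> I \<and> card J = m}" for m using I by simp
  have "(\<Prod>r<Suc k. gp I (a r) y) * Dl I y = (\<Sum>J | J \<subseteq> I \<and> card J = Suc k. C' J y * Dl (I - J) y)"
    if y: "unit_on I y" for y
  proof -
    have "(\<Prod>r<Suc k. gp I (a r) y) * Dl I y = (\<Sum>J | J \<subseteq> I \<and> card J = k. C J y * (gp I (a k) y * Dl (I - J) y))"
    proof -
      have "(\<Prod>r<Suc k. gp I (a r) y) * Dl I y = gp I (a k) y * ((\<Prod>r<k. gp I (a r) y) * Dl I y)" by simp
      also have "\<dots> = (\<Sum>J | J \<subseteq> I \<and> card J = k. C J y * (gp I (a k) y * Dl (I - J) y))"
        unfolding C(1)[OF y] sum_distrib_left by (intro sum.cong) auto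
      finally show ?thesis .
    qed
    also have "\<dots> = (\<Sum>J | J \<subseteq> I \<and> card J = k. \<Sum>j\<in>I - J. C J y * \<Psi> J j y * Dl (I - J - {j}) y)"
      using step[OF y] by (intro sum.cong) (auto simp: sum_distrib_left mult.assoc)
    also have "\<dots> = (\<Sum>(J, j)\<in>Sigma {J. J \<subseteq> I \<and> card J = k} (\<lambda>J. I - J). C J y * \<Psi> J j y * Dl (I - J - {j}) y)"
      using I fin by (intro sum.Sigma) auto
    also have "\<dots> = (\<Sum>(J, j)\<in>Sigma {J. J \<subseteq> I \<and> card J = Suc k} (\<lambda>J. J). C (J - {j}) y * \<Psi> (J - {j}) j y * Dl (I - J) y)"
    proof (rule sum.reindex_bij_witness[of _ "\<lambda>(J, j). (J - {j}, j)" "\<lambda>(J, j). (insert j J, j)"], goal_cases)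
      case (2 p)
      then show ?case using I finite_subset by (fastforce simp: card_insert_if)
    next
      case (4 p)
      then show ?case by (auto simp: card_Diff_singleton)
    next
      case (5 p)
      then obtain J j where p: "p = (J, j)" "j \<in> I - J" by auto
      have "I - insert j J = I - J - {j}" "insert j J - {j} = J" using p by auto
      then show ?case by (simp add: p)
    qed auto
    also have "\<dots> = (\<Sum>J | J \<subseteq> I \<and> card J = Suc k. \<Sum>j\<in>J. C (J - {j}) y * \<Psi> (J - {j}) j y * Dl (I - J) y)"
      using I fin finite_subset by (intro sum.Sigma[symmetric]) auto
    finally show ?thesis by (simp add: C'_def sum_distrib_right)
  qed
  moreover have "good I (C' J)" "\<And>J'. J \<subseteq> J' \<Longrightarrow> J' \<subseteq> I \<Longrightarrow> deg_ge I J' (int (\<Sum>r<Suc k. a r)) (C' J)"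
    if J: "J \<subseteq> I" "card J = Suc k" for J
  proof -
    have finJ: "finite J" using J I finite_subset by blast
    have J1: "J - {j} \<subseteq> I" "card (J - {j}) = k" if "j \<in> J" for j using J that by auto
    show "good I (C' J)"
      unfolding C'_def \<Psi>_def using J I finJ
      by (intro good_sum good_mult C(2) J1 good_gp good_power good_coord good_Phi_ratio) auto
    fix J' assume J': "J \<subseteq> J'" "J' \<subseteq> I"
    have "deg_ge I J' (int (a k)) (\<lambda>y. gp (J - {j}) b y * (y j ^ (a k - b) * Phi (I - (J - {j}) - {j}) (a k - b) (\<lambda>i. y j / y i)))"
      if "j \<in> J" "b \<in> {0..a k}" for b j
    proof -
      have "deg_ge I J' (int b + (int (a k - b) + 0)) (\<lambda>y. gp (J - {j}) b y * (y j ^ (a k - b) * Phi (I - (J - {j}) - {j}) (a k - b) (\<lambda>i. y j / y i)))"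
        using that J' I finJ by (intro deg_ge_mult gp_deg deg_ge_power_in deg_Phi_ratio) auto
      moreover have "int b + (int (a k - b) + 0) = int (a k)" using that by simp
      ultimately show ?thesis by simp
    qed
    then have "deg_ge I J' (int (a k)) (\<lambda>y. \<Psi> (J - {j}) j y)" if "j \<in> J" for j
      unfolding \<Psi>_def using that by (intro deg_ge_sum)
    then have "deg_ge I J' (int (\<Sum>r<k. a r) + int (a k)) (\<lambda>y. C (J - {j}) y * \<Psi> (J - {j}) j y)" if "j \<in> J" for j
      using that J' J1[OF that] by (intro deg_ge_mult C(3)) auto
    then show "deg_ge I J' (int (\<Sum>r<Suc k. a r)) (C' J)"
      unfolding C'_def by (intro deg_ge_sum) simp
  qed
  ultimately show ?case by blast
qed

text \<open>
After \<open>k\<close> peeling steps the weight that remains does not involve the variables in \<open>J\<close>, so every term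
has positive degree in \<open>J\<close>.
\<close>

theorem gp_integral_zero:
  assumes I: "finite I" and k: "k \<le> card I" and E: "good I E"
    and deg: "\<And>J. J \<subseteq> I \<Longrightarrow> card J = k \<Longrightarrow> deg_ge I J (D J) E"
    and pos: "\<And>J. J \<subseteq> I \<Longrightarrow> card J = k \<Longrightarrow> int (\<Sum>r<k. a r) + D J > 0"
  shows "(LINT y|tor I. (\<Prod>r<k. gp I (a r) y) * E y * Dl I y) = 0"
proof -
  from peel[OF I k, of a] obtain C where "(\<forall>y. unit_on I y \<longrightarrow>
      (\<Prod>r<k. gp I (a r) y) * Dl I y = (\<Sum>J | J \<subseteq> I \<and> card J = k. C J y * Dl (I - J) y)) \<and>
    (\<forall>J. J \<subseteq> I \<longrightarrow> card J = k \<longrightarrow> good I (C J) \<and>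
      (\<forall>J'. J \<subseteq> J' \<longrightarrow> J' \<subseteq> I \<longrightarrow> deg_ge I J' (int (\<Sum>r<k. a r)) (C J)))" ..
  then have C: "\<And>y. unit_on I y \<Longrightarrow> (\<Prod>r<k. gp I (a r) y) * Dl I y = (\<Sum>J | J \<subseteq> I \<and> card J = k. C J y * Dl (I - J) y)"
    "\<And>J. J \<subseteq> I \<Longrightarrow> card J = k \<Longrightarrow> good I (C J)"
    "\<And>J J'. J \<subseteq> I \<Longrightarrow> card J = k \<Longrightarrow> J \<subseteq> J' \<Longrightarrow> J' \<subseteq> I \<Longrightarrow> deg_ge I J' (int (\<Sum>r<k. a r)) (C J)"
    by blast+
  have good1: "good I (\<lambda>y. C J y * E y * Dl (I - J) y)" if "J \<subseteq> I" "card J = k" for J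
    using that by (intro good_mult C(2) E good_Dl) auto
  have good2: "good I (\<lambda>y. (\<Prod>r<k. gp I (a r) y) * E y * Dl I y)"
    using I by (intro good_mult good_prod good_gp E good_Dl) auto
  have "(LINT y|tor I. (\<Prod>r<k. gp I (a r) y) * E y * Dl I y) =
      (LINT y|tor I. (\<Sum>J | J \<subseteq> I \<and> card J = k. C J y * E y * Dl (I - J) y))"
  proof (rule integral_cong_AE)
    show "AE y in tor I. (\<Prod>r<k. gp I (a r) y) * E y * Dl I y = (\<Sum>J | J \<subseteq> I \<and> card J = k. C J y * E y * Dl (I - J) y)"
      using AE_tor_unit[OF I]
    proof eventually_elim
      case (elim y)
      have "(\<Prod>r<k. gp I (a r) y) * E y * Dl I y = E y * ((\<Prod>r<k. gp I (a r) y) * Dl I y)" by simp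
      also have "\<dots> = (\<Sum>J | J \<subseteq> I \<and> card J = k. C J y * E y * Dl (I - J) y)"
        unfolding C(1)[OF elim] sum_distrib_left by (intro sum.cong) auto
      finally show ?case .
    qed
    show "(\<lambda>y. (\<Prod>r<k. gp I (a r) y) * E y * Dl I y) \<in> borel_measurable (tor I)"
      by (rule good_measurable[OF good2])
    show "(\<lambda>y. (\<Sum>J | J \<subseteq> I \<and> card J = k. C J y * E y * Dl (I - J) y)) \<in> borel_measurable (tor I)"
      by (rule good_measurable, rule good_sum) (auto intro: good1)
  qed
  also have "\<dots> = (\<Sum>J | J \<subseteq> I \<and> card J = k. (LINT y|tor I. C J y * E y * Dl (I - J) y))"
    using I by (intro tor_integral_sum good1) auto
  also have "\<dots> = 0"
  proof (rule sum.neutral, rule ballI)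
    fix J assume "J \<in> {J. J \<subseteq> I \<and> card J = k}"
    then have J: "J \<subseteq> I" "card J = k" by auto
    have "deg_ge I J (int (\<Sum>r<k. a r) + D J + 0) (\<lambda>y. C J y * E y * Dl (I - J) y)"
      using J by (intro deg_ge_mult C(3) deg deg_Dl) auto
    then show "(LINT y|tor I. C J y * E y * Dl (I - J) y) = 0"
      using pos[OF J] by (intro tor_integral_deg_pos[OF I J(1) good1[OF J]]) auto
  qed
  finally show ?thesis .
qed

end

section \<open>The diagonal torus integrals\<close>

text \<open>
Integrating out one variable by the mean value property.
\<close>

lemma tor_integral_mean:
  assumes I: "finite I" "j \<notin> I" and f: "good (insert j I) f" and g: "good I g"
    and h: "\<And>y. unit_on I y \<Longrightarrow> \<exists>h. h holomorphic_on UNIV \<and> h 0 = g y \<and> (\<forall>z. norm z = 1 \<longrightarrow> f (y(j := z)) = h z)"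
  shows "integral\<^sup>L (tor (insert j I)) f = integral\<^sup>L (tor I) g"
proof -
  have meas: "(\<lambda>(y, z). f (y(j := z))) \<in> borel_measurable (tor I \<Otimes>\<^sub>M circle_haar)"
    using measurable_compose[OF measurable_add_dim[of j I "\<lambda>_. circle_haar"], of f borel] good_measurable[OF f]
    by (simp add: tor_def case_prod_unfold)
  have "integral\<^sup>L (tor (insert j I)) f = (LINT y|tor I. LINT z|circle_haar. f (y(j := z)))"
    by (rule tor_integral_insert[OF I f])
  also have "\<dots> = integral\<^sup>L (tor I) g"
  proof (rule integral_cong_AE)
    show "(\<lambda>y. LINT z|circle_haar. f (y(j := z))) \<in> borel_measurable (tor I)"
      by (rule circle.borel_measurable_lebesgue_integral) (rule meas)
    show "g \<in> borel_measurable (tor I)" by (rule good_measurable[OF g])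
    show "AE y in tor I. (LINT z|circle_haar. f (y(j := z))) = g y"
      using AE_tor_unit[OF I(1)] AE_space
    proof eventually_elim
      case (elim y)
      obtain h where h: "h holomorphic_on UNIV" "h 0 = g y" "\<And>z. norm z = 1 \<Longrightarrow> f (y(j := z)) = h z"
        using h[OF elim(1)] by blast
      have "(LINT z|circle_haar. f (y(j := z))) = integral\<^sup>L circle_haar h"
      proof (rule integral_cong_AE)
        show "(\<lambda>z. f (y(j := z))) \<in> borel_measurable circle_haar"
          using measurable_compose[OF measurable_Pair1'[OF elim(2)] meas] by simp
        show "h \<in> borel_measurable circle_haar"
          using borel_measurable_continuous_onI[OF holomorphic_on_imp_continuous_on[OF h(1)]]
          by (simp add: measurable_cong_sets[OF sets_circle_haar refl])
        show "AE z in circle_haar. f (y(j := z)) = h z"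
          using AE_circle_norm by eventually_elim (rule h(3))
      qed
      then show ?case using circle_mean[OF h(1)] h(2) by simp
    qed
  qed
  finally show ?thesis .
qed

text \<open>
Rearrangements of a multiset in which, in contrast to \<open>Orb\<close>, zeros are counted.
\<close>

definition RA :: "nat set \<Rightarrow> nat multiset \<Rightarrow> (nat \<Rightarrow> nat) set" where
  "RA I M = {\<alpha>. (\<forall>i. i \<notin> I \<longrightarrow> \<alpha> i = 0) \<and> image_mset \<alpha> (mset_set I) = M}"

lemma finite_RA: assumes "finite I" shows "finite (RA I M)"
proof (rule finite_subset)
  show "RA I M \<subseteq> {f. \<forall>x. (x \<in> I \<longrightarrow> f x \<in> set_mset M) \<and> (x \<notin> I \<longrightarrow> f x = 0)}"
    using assms by (auto simp: RA_def)
  show "finite \<dots>" by (rule finite_set_of_finite_funs) (use assms in auto)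
qed

lemma RA_insert_update:
  assumes "finite I" "j \<notin> I"
  shows "\<beta> \<in> RA I M \<Longrightarrow> \<beta>(j := v) \<in> RA (insert j I) (add_mset v M)"
    and "\<alpha> \<in> RA (insert j I) (add_mset (\<alpha> j) M) \<Longrightarrow> \<alpha>(j := 0) \<in> RA I M"
proof -
  have *: "image_mset (\<beta>(j := v)) (mset_set I) = image_mset \<beta> (mset_set I)" for \<beta> :: "nat \<Rightarrow> nat" and v
    using assms by (intro image_mset_cong) auto
  show "\<beta> \<in> RA I M \<Longrightarrow> \<beta>(j := v) \<in> RA (insert j I) (add_mset v M)"
    using assms by (auto simp: RA_def *)
  show "\<alpha> \<in> RA (insert j I) (add_mset (\<alpha> j) M) \<Longrightarrow> \<alpha>(j := 0) \<in> RA I M"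
    using assms by (auto simp: RA_def *)
qed

context q_disc
begin

lemma gp_single: "gp {j} a y = y j ^ a / qp a"
proof -
  have "gp {j} a y = (\<Sum>b=0..a. y j ^ b / qp b * gp {} (a - b) y)"
    using gp_insert[of "{}" j a y] by (simp only: finite.emptyI empty_iff not_False_eq_True)
  also have "\<dots> = (\<Sum>b\<in>{a}. y j ^ b / qp b * gp {} (a - b) y)"
    by (rule sum.mono_neutral_right) auto
  finally show ?thesis by simp
qed

lemma gp_update_holomorphic:
  assumes "finite I" "j \<notin> I"
  shows "(\<lambda>z. gp (insert j I) b (y(j := z))) holomorphic_on UNIV"
    and "gp (insert j I) b (y(j := 0)) = gp I b y"
proof -
  have *: "gp (insert j I) b (y(j := z)) = (\<Sum>c=0..b. z ^ c / qp c * gp I (b - c) y)" for z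
    unfolding gp_insert[OF assms] using assms(2) by (intro sum.cong refl arg_cong2[of _ _ _ _ "(*)"] gp_cong) auto
  show "(\<lambda>z. gp (insert j I) b (y(j := z))) holomorphic_on UNIV"
    unfolding * by (intro holomorphic_intros) auto
  have "(\<Sum>c=0..b. 0 ^ c / qp c * gp I (b - c) y) = (\<Sum>c\<in>{0}. 0 ^ c / qp c * gp I (b - c) y)"
    by (rule sum.mono_neutral_right) auto
  then show "gp (insert j I) b (y(j := 0)) = gp I b y" unfolding * by simp
qed

text \<open>
Expand the weight against the largest part \<open>lam 0\<close>. In the term of \<open>j\<close> the variable \<open>y\<^sub>j\<close> occurs with
exponents \<open>lam 0 - \<alpha> j \<ge> 0\<close>, so the integral over \<open>y\<^sub>j\<close> is the value at \<open>y\<^sub>j = 0\<close>: only \<open>\<alpha> j = lam 0\<close>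
survives, the factor \<open>Phi\<close> becomes \<open>1 / einf q\<close>, and what remains is the same integral for the
remaining parts in one variable less. Summing over \<open>j\<close> produces the factorial, and the last
variable contributes \<open>1 / qp (lam m)\<close>.
\<close>

theorem gp_integral_diag:
  assumes "finite I" "card I = Suc m" "\<And>r s. r \<le> s \<Longrightarrow> s \<le> m \<Longrightarrow> lam s \<le> lam r"
  shows "(LINT y|tor I. (\<Prod>r<Suc m. gp I (lam r) y) *
      (\<Sum>\<alpha>\<in>RA I (image_mset lam (mset_set {..<Suc m})). \<Prod>i\<in>I. y i powi (- int (\<alpha> i))) * Dl I y) =
    fact (Suc m) / (einf q ^ m * qp (lam m))"
  using assms
proof (induction m arbitrary: I lam)
  case 0
  then obtain j where I: "I = {j}" by (auto simp: card_1_singleton_iff)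
  have RA: "RA {j} {#lam 0#} = {(\<lambda>_. 0)(j := lam 0)}"
    by (auto simp: RA_def fun_eq_iff)
  interpret prob_space "tor I" by (rule prob_space_tor)
  have "(LINT y|tor I. (\<Prod>r<Suc 0. gp I (lam r) y) *
      (\<Sum>\<alpha>\<in>RA I (image_mset lam (mset_set {..<Suc 0})). \<Prod>i\<in>I. y i powi (- int (\<alpha> i))) * Dl I y) =
      (LINT y|tor I. 1 / qp (lam 0))"
  proof (rule integral_cong_AE)
    show "AE y in tor I. (\<Prod>r<Suc 0. gp I (lam r) y) *
      (\<Sum>\<alpha>\<in>RA I (image_mset lam (mset_set {..<Suc 0})). \<Prod>i\<in>I. y i powi (- int (\<alpha> i))) * Dl I y = 1 / qp (lam 0)"
      using AE_tor_unit[OF 0(1)]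
    proof eventually_elim
      case (elim y)
      then have "y j \<noteq> 0" by (auto simp: unit_on_def I)
      then show ?case by (simp add: I RA gp_single Dl_def power_int_minus lessThan_Suc)
    qed
    show "(\<lambda>y. (\<Prod>r<Suc 0. gp I (lam r) y) *
      (\<Sum>\<alpha>\<in>RA I (image_mset lam (mset_set {..<Suc 0})). \<Prod>i\<in>I. y i powi (- int (\<alpha> i))) * Dl I y) \<in> borel_measurable (tor I)"
      using 0(1) by (intro good_measurable good_mult good_prod good_sum good_gp good_powi_coord good_Dl) auto
  qed auto
  then show ?case using prob_space by simp
next
  case (Suc m)
  note I = Suc.prems(1,2)
  define lam' where "lam' = (\<lambda>r. lam (Suc r))"
  define M where "M = image_mset lam (mset_set {..<Suc (Suc m)})"
  define M' where "M' = image_mset lam' (mset_set {..<Suc m})"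
  have MM': "M = add_mset (lam 0) M'"
  proof -
    have "mset_set {..<Suc (Suc m)} = add_mset 0 (image_mset Suc (mset_set {..<Suc m}))"
      by (subst lessThan_Suc_eq_insert_0) (simp add: image_mset_mset_set)
    then show ?thesis by (simp add: M_def M'_def lam'_def image_mset.compositionality comp_def)
  qed
  have Mmax: "v \<le> lam 0" if "v \<in># M" for v
    using that Suc.prems(3)[of 0] by (auto simp: M_def)
  define G where "G y = (\<Prod>r<Suc m. gp I (lam' r) y)" for y
  define A where "A y = (\<Sum>\<alpha>\<in>RA I M. \<Prod>i\<in>I. y i powi (- int (\<alpha> i)))" for y :: "nat \<Rightarrow> complex"
  define F where "F j y = y j ^ lam 0 * Phi (I - {j}) (lam 0) (\<lambda>i. y j / y i) * Dl (I - {j}) y * (G y * A y)" for j y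
  have goodG: "good I G" unfolding G_def using I by (intro good_prod good_gp) auto
  have goodA: "good I A" unfolding A_def by (intro good_sum good_prod good_powi_coord)
  have goodF: "good I (F j)" if "j \<in> I" for j
    unfolding F_def using I that by (intro good_mult good_power good_coord good_Phi_ratio good_Dl goodG goodA) auto
  have "(LINT y|tor I. (\<Prod>r<Suc (Suc m). gp I (lam r) y) * A y * Dl I y) = (LINT y|tor I. (\<Sum>j\<in>I. F j y))"
  proof (rule integral_cong_AE)
    show "AE y in tor I. (\<Prod>r<Suc (Suc m). gp I (lam r) y) * A y * Dl I y = (\<Sum>j\<in>I. F j y)"
      using AE_tor_unit[OF I(1)]
    proof eventually_elim
      case (elim y)
      have "(\<Prod>r<Suc (Suc m). gp I (lam r) y) = gp I (lam 0) y * G y"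
        by (subst prod.lessThan_Suc_shift) (simp add: G_def lam'_def)
      then have "(\<Prod>r<Suc (Suc m). gp I (lam r) y) * A y * Dl I y = (gp I (lam 0) y * Dl I y) * (G y * A y)"
        by (simp add: mult_ac)
      also have "gp I (lam 0) y * Dl I y = (\<Sum>j\<in>I. y j ^ lam 0 * Phi (I - {j}) (lam 0) (\<lambda>i. y j / y i) * Dl (I - {j}) y)"
        using I elim by (intro gp_Dl_expansion) auto
      finally show ?case by (simp add: F_def sum_distrib_right)
    qed
    show "(\<lambda>y. (\<Prod>r<Suc (Suc m). gp I (lam r) y) * A y * Dl I y) \<in> borel_measurable (tor I)"
      using I(1) by (intro good_measurable good_mult good_prod good_gp goodA good_Dl) auto
    show "(\<lambda>y. \<Sum>j\<in>I. F j y) \<in> borel_measurable (tor I)"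
      by (intro good_measurable good_sum goodF)
  qed
  also have "\<dots> = (\<Sum>j\<in>I. integral\<^sup>L (tor I) (F j))"
    using I(1) goodF by (rule tor_integral_sum)
  also have "\<dots> = (\<Sum>j\<in>I. 1 / einf q * (fact (Suc m) / (einf q ^ m * qp (lam' m))))"
  proof (rule sum.cong[OF refl])
    fix j assume j: "j \<in> I"
    define I' where "I' = I - {j}"
    have "card I' = Suc m" using I j by (simp add: I'_def)
    then have "I' \<noteq> {}" by auto
    with \<open>card I' = Suc m\<close>
    have I': "finite I'" "j \<notin> I'" "insert j I' = I" "card I' = Suc m" "I' \<noteq> {}"
      using I j by (auto simp: I'_def)
    define G' where "G' y = (\<Prod>r<Suc m. gp I' (lam' r) y)" for y
    define A' where "A' y = (\<Sum>\<beta>\<in>RA I' M'. \<Prod>i\<in>I'. y i powi (- int (\<beta> i)))" for y :: "nat \<Rightarrow> complex"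
    have goodG': "good I' G'" unfolding G'_def using I' by (intro good_prod good_gp) auto
    have goodA': "good I' A'" unfolding A'_def by (intro good_sum good_prod good_powi_coord)
    have "integral\<^sup>L (tor (insert j I')) (F j) = (LINT y|tor I'. 1 / einf q * (G' y * A' y * Dl I' y))"
    proof (rule tor_integral_mean[OF I'(1,2)])
      show "good (insert j I') (F j)" using goodF[OF j] I'(3) by simp
      show "good I' (\<lambda>y. 1 / einf q * (G' y * A' y * Dl I' y))"
        by (intro good_mult good_const goodG' goodA' good_Dl) auto
      fix y assume y: "unit_on I' y"
      have \<alpha>le: "\<alpha> j \<le> lam 0" if "\<alpha> \<in> RA I M" for \<alpha>
        using that I j by (intro Mmax) (auto simp: RA_def)
      define B where "B \<alpha> = (\<Prod>i\<in>I'. y i powi (- int (\<alpha> i)))" for \<alpha>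
      define h where "h z = Phi I' (lam 0) (\<lambda>i. z / y i) * Dl I' y * (G (y(j := z)) * (\<Sum>\<alpha>\<in>RA I M. z ^ (lam 0 - \<alpha> j) * B \<alpha>))" for z
      have "h holomorphic_on UNIV"
      proof -
        have "(\<lambda>z. Phi I' (lam 0) (\<lambda>i. z / y i)) holomorphic_on UNIV"
          using I'(1) y by (intro Phi_holomorphic holomorphic_intros) (auto simp: unit_on_def)
        moreover have "(\<lambda>z. G (y(j := z))) holomorphic_on UNIV"
          unfolding G_def I'(3)[symmetric] by (intro holomorphic_intros gp_update_holomorphic(1) I')
        ultimately show ?thesis unfolding h_def by (intro holomorphic_intros)
      qed
      moreover have "h 0 = 1 / einf q * (G' y * A' y * Dl I' y)"
      proof -
        have 1: "Phi I' (lam 0) (\<lambda>i. 0 / y i) = 1 / einf q"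
          using Phi_at_0[OF I'(1,5)] by simp
        have 2: "G (y(j := 0)) = G' y"
          unfolding G_def G'_def I'(3)[symmetric] by (simp only: gp_update_holomorphic(2)[OF I'(1,2)])
        have "(\<Sum>\<alpha>\<in>RA I M. 0 ^ (lam 0 - \<alpha> j) * B \<alpha>) = (\<Sum>\<alpha> | \<alpha> \<in> RA I M \<and> \<alpha> j = lam 0. B \<alpha>)"
        proof -
          have "0 ^ (lam 0 - \<alpha> j) * B \<alpha> = (if \<alpha> j = lam 0 then B \<alpha> else 0)" if "\<alpha> \<in> RA I M" for \<alpha>
            using \<alpha>le[OF that] by (simp add: power_0_left)
          then have "(\<Sum>\<alpha>\<in>RA I M. 0 ^ (lam 0 - \<alpha> j) * B \<alpha>) = (\<Sum>\<alpha>\<in>RA I M. if \<alpha> j = lam 0 then B \<alpha> else 0)"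
            by (intro sum.cong) auto
          then show ?thesis by (simp only: sum.inter_filter[OF finite_RA[OF I(1)]])
        qed
        also have "\<dots> = A' y"
          unfolding A'_def
        proof (rule sum.reindex_bij_witness[of _ "\<lambda>\<beta>. \<beta>(j := lam 0)" "\<lambda>\<alpha>. \<alpha>(j := 0)"], goal_cases)
          case (1 \<alpha>)
          then show ?case by auto
        next
          case (2 \<alpha>)
          then show ?case using RA_insert_update(2)[OF I'(1,2), of \<alpha> M'] I'(3) MM' by auto
        next
          case (3 \<beta>)
          then show ?case using I'(2) by (auto simp: RA_def fun_eq_iff)
        next
          case (4 \<beta>)
          then show ?case using RA_insert_update(1)[OF I'(1,2), of \<beta> M' "lam 0"] I'(3) MM' by auto
        next
          case (5 \<alpha>)
          then show ?case unfolding B_def using I'(2) by (intro prod.cong) auto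
        qed
        finally show ?thesis unfolding h_def 1 2 by simp
      qed
      moreover have "F j (y(j := z)) = h z" if z: "norm z = 1" for z
      proof -
        have z0: "z \<noteq> 0" using z by auto
        have 1: "Phi (I - {j}) (lam 0) (\<lambda>i. (y(j := z)) j / (y(j := z)) i) = Phi I' (lam 0) (\<lambda>i. z / y i)"
          unfolding Phi_def I'_def by simp
        have 2: "Dl (I - {j}) (y(j := z)) = Dl I' y"
          unfolding I'_def by (rule Dl_cong) auto
        have "z ^ lam 0 * A (y(j := z)) = (\<Sum>\<alpha>\<in>RA I M. z ^ (lam 0 - \<alpha> j) * B \<alpha>)"
          unfolding A_def sum_distrib_left
        proof (rule sum.cong[OF refl])
          fix \<alpha> assume \<alpha>: "\<alpha> \<in> RA I M"
          have "(\<Prod>i\<in>I. (y(j := z)) i powi (- int (\<alpha> i))) = z powi (- int (\<alpha> j)) * B \<alpha>"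
            unfolding B_def I'_def using I(1) j by (subst prod.remove[of I j]) (auto intro!: prod.cong)
          moreover have "z ^ lam 0 * z powi (- int (\<alpha> j)) = z ^ (lam 0 - \<alpha> j)"
            using z0 \<alpha>le[OF \<alpha>] by (simp add: power_int_minus power_diff divide_inverse)
          ultimately show "z ^ lam 0 * (\<Prod>i\<in>I. (y(j := z)) i powi (- int (\<alpha> i))) = z ^ (lam 0 - \<alpha> j) * B \<alpha>"
            by (simp add: mult.assoc[symmetric])
        qed
        then show ?thesis unfolding F_def h_def 1 2 by (simp add: mult_ac)
      qed
      ultimately show "\<exists>h. h holomorphic_on UNIV \<and> h 0 = 1 / einf q * (G' y * A' y * Dl I' y) \<and>
          (\<forall>z. norm z = 1 \<longrightarrow> F j (y(j := z)) = h z)" by blast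
    qed
    also have "\<dots> = 1 / einf q * (LINT y|tor I'. G' y * A' y * Dl I' y)" by simp
    also have "(LINT y|tor I'. G' y * A' y * Dl I' y) = fact (Suc m) / (einf q ^ m * qp (lam' m))"
      unfolding G'_def A'_def M'_def
      by (rule Suc.IH[OF I'(1,4)]) (use Suc.prems(3) in \<open>auto simp: lam'_def\<close>)
    finally show "integral\<^sup>L (tor I) (F j) = 1 / einf q * (fact (Suc m) / (einf q ^ m * qp (lam' m)))"
      using I'(3) by simp
  qed
  also have "\<dots> = fact (Suc (Suc m)) / (einf q ^ Suc m * qp (lam (Suc m)))"
    using I(2) by (simp add: lam'_def)
  finally show ?case unfolding A_def M_def .
qed

end

section \<open>The Cauchy kernel and its expansions\<close>

text \<open>
Coefficients of a product are bounded by those of the product of the majorants, which is again summable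
by the Cauchy product. The majorant is chosen before the series, and so is uniform over the
torus.
\<close>

lemma fps_prod_nth_bound:
  fixes b :: "'a \<Rightarrow> nat \<Rightarrow> real"
  assumes "finite T" "\<And>s. s \<in> T \<Longrightarrow> summable (b s)" "\<And>s k. s \<in> T \<Longrightarrow> b s k \<ge> 0"
  shows "\<exists>B. summable B \<and> (\<forall>d. B d \<ge> 0) \<and>
    (\<forall>F :: 'a \<Rightarrow> complex fps. (\<forall>s\<in>T. \<forall>k. norm (fps_nth (F s) k) \<le> b s k) \<longrightarrow>
      (\<forall>d. norm (fps_nth (\<Prod>s\<in>T. F s) d) \<le> B d))"
  using assms
proof (induction T rule: finite_induct)
  case empty
  show ?case by (intro exI[of _ "\<lambda>d. if d = 0 then 1 else 0"]) auto
next
  case (insert t T)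
  then obtain B where B: "summable B" "\<And>d. B d \<ge> 0"
    "\<And>F :: 'a \<Rightarrow> complex fps. \<forall>s\<in>T. \<forall>k. norm (fps_nth (F s) k) \<le> b s k \<Longrightarrow> \<forall>d. norm (fps_nth (\<Prod>s\<in>T. F s) d) \<le> B d"
    by (metis insertCI)
  define B' where "B' d = (\<Sum>i\<le>d. b t i * B (d - i))" for d
  have "summable B'"
    unfolding B'_def using insert.prems B by (intro summable_Cauchy_product) auto
  moreover have "B' d \<ge> 0" for d
    unfolding B'_def using insert.prems B(2) by (intro sum_nonneg mult_nonneg_nonneg) auto
  moreover have "norm (fps_nth (\<Prod>s\<in>insert t T. F s) d) \<le> B' d"
    if F: "\<forall>s\<in>insert t T. \<forall>k. norm (fps_nth (F s) k) \<le> b s k" for F :: "'a \<Rightarrow> complex fps" and d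
  proof -
    have "norm (fps_nth (\<Prod>s\<in>insert t T. F s) d) = norm (\<Sum>i\<le>d. fps_nth (F t) i * fps_nth (\<Prod>s\<in>T. F s) (d - i))"
      using insert.hyps by (simp add: fps_mult_nth atLeast0AtMost)
    also have "\<dots> \<le> (\<Sum>i\<le>d. norm (fps_nth (F t) i) * norm (fps_nth (\<Prod>s\<in>T. F s) (d - i)))"
      by (rule order_trans[OF norm_sum]) (simp add: norm_mult)
    also have "\<dots> \<le> B' d"
      unfolding B'_def using F B(3)[of F] insert.prems B(2) by (intro sum_mono mult_mono) auto
    finally show ?thesis .
  qed
  ultimately show ?case by (intro exI[of _ B']) auto
qed

lemma fps_prod_sums:
  fixes F :: "'a \<Rightarrow> complex fps"
  assumes "finite T" "\<And>s. s \<in> T \<Longrightarrow> summable (\<lambda>k. norm (fps_nth (F s) k))"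
  shows "summable (\<lambda>d. norm (fps_nth (\<Prod>s\<in>T. F s) d)) \<and>
    (\<lambda>d. fps_nth (\<Prod>s\<in>T. F s) d) sums (\<Prod>s\<in>T. \<Sum>k. fps_nth (F s) k)"
  using assms
proof (induction T rule: finite_induct)
  case empty
  have "(\<lambda>d. fps_nth 1 d) sums (\<Sum>d\<in>{0}. fps_nth (1 :: complex fps) d)"
    by (rule sums_finite) auto
  moreover have "summable (\<lambda>d. norm (fps_nth (1 :: complex fps) d))"
    by (rule summable_finite[of "{0}"]) auto
  ultimately show ?case by simp
next
  case (insert t T)
  let ?P = "\<Prod>s\<in>T. F s"
  have IH: "summable (\<lambda>d. norm (fps_nth ?P d))" "(\<lambda>d. fps_nth ?P d) sums (\<Prod>s\<in>T. \<Sum>k. fps_nth (F s) k)"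
    using insert by auto
  have t: "summable (\<lambda>k. norm (fps_nth (F t) k))" using insert by auto
  have eq: "fps_nth (\<Prod>s\<in>insert t T. F s) d = (\<Sum>i\<le>d. fps_nth (F t) i * fps_nth ?P (d - i))" for d
    using insert.hyps by (simp add: fps_mult_nth atLeast0AtMost)
  have "(\<lambda>d. \<Sum>i\<le>d. fps_nth (F t) i * fps_nth ?P (d - i)) sums ((\<Sum>k. fps_nth (F t) k) * (\<Sum>k. fps_nth ?P k))"
    by (rule Cauchy_product_sums[OF t IH(1)])
  moreover have "summable (\<lambda>d. norm (\<Sum>i\<le>d. fps_nth (F t) i * fps_nth ?P (d - i)))"
  proof (rule summable_comparison_test'[where N = 0])
    show "summable (\<lambda>d. \<Sum>i\<le>d. norm (fps_nth (F t) i) * norm (fps_nth ?P (d - i)))"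
      using t IH(1) by (intro summable_Cauchy_product) auto
    show "norm (norm (\<Sum>i\<le>d. fps_nth (F t) i * fps_nth ?P (d - i))) \<le>
        (\<Sum>i\<le>d. norm (fps_nth (F t) i) * norm (fps_nth ?P (d - i)))" for d
      using norm_sum[of "\<lambda>i. fps_nth (F t) i * fps_nth ?P (d - i)" "{..d}"] by (simp add: norm_mult)
  qed
  moreover have "(\<Prod>s\<in>insert t T. \<Sum>k. fps_nth (F s) k) = (\<Sum>k. fps_nth (F t) k) * (\<Sum>k. fps_nth ?P k)"
    using insert.hyps sums_unique[OF IH(2)] by simp
  ultimately show ?case by (simp only: eq)
qed

lemma fps_prod_nth_Comp:
  fixes F :: "nat \<Rightarrow> complex fps"
  assumes "finite S"
  shows "fps_nth (\<Prod>i\<in>S. F i) d = (\<Sum>\<alpha>\<in>Comp S d. \<Prod>i\<in>S. fps_nth (F i) (\<alpha> i))"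
  using assms
proof (induction S arbitrary: d rule: finite_induct)
  case empty
  have "Comp {} d = (if d = 0 then {\<lambda>_. 0} else {})"
    by (auto simp: Comp_def supp_def fun_eq_iff)
  then show ?case by simp
next
  case (insert s S)
  have "fps_nth (\<Prod>i\<in>insert s S. F i) d = (\<Sum>b=0..d. \<Sum>\<alpha>\<in>Comp S (d - b). fps_nth (F s) b * (\<Prod>i\<in>S. fps_nth (F i) (\<alpha> i)))"
    using insert by (simp add: fps_mult_nth sum_distrib_left)
  also have "\<dots> = (\<Sum>(b, \<alpha>)\<in>Sigma {0..d} (\<lambda>b. Comp S (d - b)). fps_nth (F s) b * (\<Prod>i\<in>S. fps_nth (F i) (\<alpha> i)))"
    using insert.hyps finite_Comp by (intro sum.Sigma) auto
  also have "\<dots> = (\<Sum>\<alpha>\<in>Comp (insert s S) d. \<Prod>i\<in>insert s S. fps_nth (F i) (\<alpha> i))"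
  proof (rule sum.reindex_bij_witness[of _ "\<lambda>\<alpha>. (\<alpha> s, \<alpha>(s := 0))" "\<lambda>(b, \<alpha>). \<alpha>(s := b)"], goal_cases)
    case (1 p)
    then show ?case using insert.hyps by (auto simp: Comp_def supp_def fun_eq_iff)
  next
    case (2 p)
    then obtain b \<alpha> where p: "p = (b, \<alpha>)" "b \<le> d" "\<alpha> \<in> Comp S (d - b)" by auto
    have "(\<Sum>i\<in>insert s S. (\<alpha>(s := b)) i) = b + (\<Sum>i\<in>S. \<alpha> i)"
      using insert.hyps by (simp add: sum.insert) (intro sum.cong, auto)
    then show ?case using p by (auto simp: Comp_def supp_def split: if_splits)
  next
    case (3 \<alpha>)
    then show ?case by auto
  next
    case (4 \<alpha>)
    have "(\<Sum>i\<in>insert s S. \<alpha> i) = \<alpha> s + (\<Sum>i\<in>S. (\<alpha>(s := 0)) i)"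
      using insert.hyps by (simp add: sum.insert) (intro sum.cong, auto)
    then show ?case using 4 by (auto simp: Comp_def supp_def)
  next
    case (5 p)
    then obtain b \<alpha> where p: "p = (b, \<alpha>)" by (cases p)
    have "(\<Prod>i\<in>S. fps_nth (F i) ((\<alpha>(s := b)) i)) = (\<Prod>i\<in>S. fps_nth (F i) (\<alpha> i))"
      using insert.hyps by (intro prod.cong) auto
    then show ?case using insert.hyps by (simp add: p)
  qed
  finally show ?case .
qed

context q_disc
begin

lemma inverse_qp_telescope: "(\<Sum>m\<le>k. q ^ m / qp m) = 1 / qp k"
proof (induction k)
  case (Suc k)
  have "1 / qp k + q ^ Suc k / qp (Suc k) = 1 / qp (Suc k)"
    using q_power_neq_1[of "Suc k"] qp_nonzero[of k] by (simp add: qp_Suc field_simps del: power_Suc qp_nonzero)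
  then show ?case using Suc by simp
qed simp

text \<open>
The coefficient form of the logarithmic derivative
\<open>X G' = (\<Sum>\<^sub>n X\<^sup>n / (1 - q\<^sup>n)) G\<close> of the generating function \<open>G\<close> of \<open>1 / (q; q)\<^sub>k\<close>.
\<close>

lemma qp_log_derivative: "of_nat k / qp k = (\<Sum>n=1..k. 1 / ((1 - q ^ n) * qp (k - n)))"
proof (induction k)
  case (Suc k)
  have ne: "1 - q ^ Suc k \<noteq> 0" by (rule q_power_neq_1) simp
  have "(1 - q ^ Suc k) * (\<Sum>n=1..Suc k. 1 / ((1 - q ^ n) * qp (Suc k - n))) =
      (\<Sum>n=1..Suc k. (1 - q ^ (Suc k - n)) / ((1 - q ^ n) * qp (Suc k - n)) + q ^ (Suc k - n) / qp (Suc k - n))"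
    unfolding sum_distrib_left
  proof (rule sum.cong[OF refl])
    fix n assume n: "n \<in> {1..Suc k}"
    have "1 - q ^ n \<noteq> 0" using n by (intro q_power_neq_1) auto
    moreover have "q ^ Suc k = q ^ n * q ^ (Suc k - n)" using n by (subst power_add[symmetric]) auto
    moreover have "(1 - a * b) * (1 / ((1 - a) * c)) = (1 - b) / ((1 - a) * c) + b / c"
      if "1 - a \<noteq> 0" "c \<noteq> 0" for a b c :: complex
      using that by (simp add: divide_simps) (simp add: algebra_simps)
    ultimately show "(1 - q ^ Suc k) * (1 / ((1 - q ^ n) * qp (Suc k - n))) =
        (1 - q ^ (Suc k - n)) / ((1 - q ^ n) * qp (Suc k - n)) + q ^ (Suc k - n) / qp (Suc k - n)"
      using qp_nonzero by metis
  qed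
  also have "\<dots> = (\<Sum>n=1..Suc k. (1 - q ^ (Suc k - n)) / ((1 - q ^ n) * qp (Suc k - n))) + (\<Sum>n=1..Suc k. q ^ (Suc k - n) / qp (Suc k - n))"
    by (rule sum.distrib)
  also have "(\<Sum>n=1..Suc k. (1 - q ^ (Suc k - n)) / ((1 - q ^ n) * qp (Suc k - n))) = (\<Sum>n=1..k. 1 / ((1 - q ^ n) * qp (k - n)))"
  proof -
    have "(1 - q ^ (Suc k - n)) / ((1 - q ^ n) * qp (Suc k - n)) = 1 / ((1 - q ^ n) * qp (k - n))" if "n \<in> {1..k}" for n
    proof -
      have "Suc k - n = Suc (k - n)" using that by auto
      then show ?thesis using q_power_neq_1[of "Suc (k - n)"] by (simp add: qp_Suc del: power_Suc)
    qed
    then show ?thesis by simp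
  qed
  also have "(\<Sum>n=1..Suc k. q ^ (Suc k - n) / qp (Suc k - n)) = (\<Sum>m\<le>k. q ^ m / qp m)"
    by (rule sum.reindex_bij_witness[of _ "\<lambda>m. Suc k - m" "\<lambda>n. Suc k - n"]) auto
  finally have "(1 - q ^ Suc k) * (\<Sum>n=1..Suc k. 1 / ((1 - q ^ n) * qp (Suc k - n))) = of_nat k / qp k + 1 / qp k"
    by (simp only: Suc.IH[symmetric] inverse_qp_telescope)
  also have "\<dots> = (1 - q ^ Suc k) * (of_nat (Suc k) / qp (Suc k))"
    using ne by (simp add: qp_Suc add_divide_distrib[symmetric] del: power_Suc)
  finally show ?case unfolding mult_left_cancel[OF ne] by (rule sym)
qed simp

definition lgen :: "complex \<Rightarrow> complex fps" where
  "lgen c = Abs_fps (\<lambda>n. if n = 0 then 0 else c ^ n / (1 - q ^ n))"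

lemma gen_deriv: "fps_X * fps_deriv (gen c) = lgen c * gen c"
proof (rule fps_ext)
  fix k
  have "fps_nth (lgen c * gen c) k = (\<Sum>n=0..k. fps_nth (lgen c) n * (c ^ (k - n) / qp (k - n)))"
    by (simp add: fps_mult_nth)
  also have "\<dots> = (\<Sum>n=1..k. fps_nth (lgen c) n * (c ^ (k - n) / qp (k - n)))"
    by (rule sum.mono_neutral_right) (auto simp: lgen_def)
  also have "\<dots> = (\<Sum>n=1..k. c ^ k * (1 / ((1 - q ^ n) * qp (k - n))))"
  proof (rule sum.cong[OF refl])
    fix n assume n: "n \<in> {1..k}"
    then have "c ^ k = c ^ n * c ^ (k - n)" by (subst power_add[symmetric]) auto
    then show "fps_nth (lgen c) n * (c ^ (k - n) / qp (k - n)) = c ^ k * (1 / ((1 - q ^ n) * qp (k - n)))"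
      using n by (simp add: lgen_def)
  qed
  also have "\<dots> = c ^ k * (of_nat k / qp k)" by (simp only: sum_distrib_left[symmetric] qp_log_derivative)
  finally show "fps_nth (fps_X * fps_deriv (gen c)) k = fps_nth (lgen c * gen c) k"
    by (cases k) (auto simp: mult_ac)
qed

lemma prod_gen_deriv:
  assumes "finite T"
  shows "fps_X * fps_deriv (\<Prod>s\<in>T. gen (c s)) = (\<Sum>s\<in>T. lgen (c s)) * (\<Prod>s\<in>T. gen (c s))"
  using assms
proof (induction T rule: finite_induct)
  case (insert t T)
  have "fps_X * fps_deriv (gen (c t) * (\<Prod>s\<in>T. gen (c s))) =
      (fps_X * fps_deriv (gen (c t))) * (\<Prod>s\<in>T. gen (c s)) + gen (c t) * (fps_X * fps_deriv (\<Prod>s\<in>T. gen (c s)))"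
    by (simp add: algebra_simps)
  also have "\<dots> = (\<Sum>s\<in>insert t T. lgen (c s)) * (gen (c t) * (\<Prod>s\<in>T. gen (c s)))"
    unfolding gen_deriv insert.IH using insert.hyps by (simp add: algebra_simps)
  finally show ?case using insert.hyps by simp
qed simp

lemma prod_gen_0: "finite T \<Longrightarrow> fps_nth (\<Prod>s\<in>T. gen (c s)) 0 = 1"
  by (induction T rule: finite_induct) simp_all

text \<open>
By logarithmic differentiation the coefficients of the product satisfy the recursion of \<open>Kp\<close>.
\<close>

lemma kernel_eq_Kp:
  assumes S: "finite S" "\<And>i. i \<notin> S \<Longrightarrow> x i = 0" and I: "finite I" "\<And>i. i \<notin> I \<Longrightarrow> y i = 0"
  shows "fps_nth (\<Prod>s\<in>S \<times> I. gen (x (fst s) * y (snd s))) d = Kp q x y d"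
proof (induction d rule: less_induct)
  case (less d)
  let ?P = "\<Prod>s\<in>S \<times> I. gen (x (fst s) * y (snd s))"
  have P0: "fps_nth ?P 0 = 1"
    by (rule prod_gen_0) (use S(1) I(1) in simp)
  show ?case
  proof (cases "d = 0")
    case True
    then show ?thesis using P0 Kp_0[OF norm_q] by simp
  next
    case False
    let ?L = "\<Sum>s\<in>S \<times> I. lgen (x (fst s) * y (snd s))"
    have L: "fps_nth ?L n = (if n = 0 then 0 else power_sum n x * power_sum n y / (1 - q ^ n))" for n
    proof (cases "n = 0")
      case n: False
      have "fps_nth ?L n = (\<Sum>s\<in>S \<times> I. x (fst s) ^ n * y (snd s) ^ n) / (1 - q ^ n)"
        using n by (simp add: fps_sum_nth lgen_def power_mult_distrib sum_divide_distrib)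
      also have "(\<Sum>s\<in>S \<times> I. x (fst s) ^ n * y (snd s) ^ n) = power_sum n x * power_sum n y"
        using n S I by (simp add: power_sum_eq[of S x] power_sum_eq[of I y] sum_product sum.cartesian_product case_prod_unfold)
      finally show ?thesis using n by simp
    qed (simp add: fps_sum_nth lgen_def)
    have "of_nat d * fps_nth ?P d = fps_nth (fps_X * fps_deriv ?P) d"
      using False by (cases d) auto
    also have "\<dots> = fps_nth (?L * ?P) d"
      using prod_gen_deriv[of "S \<times> I" "\<lambda>s. x (fst s) * y (snd s)"] S(1) I(1) by simp
    also have "\<dots> = (\<Sum>n=0..d. fps_nth ?L n * fps_nth ?P (d - n))" by (rule fps_mult_nth)
    also have "\<dots> = (\<Sum>n=1..d. fps_nth ?L n * fps_nth ?P (d - n))"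
      by (rule sum.mono_neutral_right) (auto simp: L)
    also have "\<dots> = (\<Sum>n=1..d. power_sum n x * power_sum n y / (1 - q ^ n) * Kp q x y (d - n))"
      using less by (intro sum.cong) (auto simp: L)
    also have "\<dots> = of_nat d * Kp q x y d" by (rule Kp_rec[OF norm_q, symmetric])
    finally show ?thesis using False by simp
  qed
qed

lemma gp_scaled: "finite I \<Longrightarrow> fps_nth (\<Prod>j\<in>I. gen (c * y j)) a = c ^ a * gp I a y"
proof (induction I arbitrary: a rule: finite_induct)
  case (insert i I)
  have "fps_nth (\<Prod>j\<in>insert i I. gen (c * y j)) a = (\<Sum>b=0..a. (c * y i) ^ b / qp b * (c ^ (a - b) * gp I (a - b) y))"
    using insert by (simp add: fps_mult_nth)
  also have "\<dots> = c ^ a * gp (insert i I) a y"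
    unfolding gp_insert[OF insert.hyps(1,2)] sum_distrib_left
  proof (rule sum.cong[OF refl])
    fix b assume "b \<in> {0..a}"
    then have "c ^ a = c ^ b * c ^ (a - b)" by (subst power_add[symmetric]) auto
    then show "(c * y i) ^ b / qp b * (c ^ (a - b) * gp I (a - b) y) = c ^ a * (y i ^ b / qp b * gp I (a - b) y)"
      by (simp add: power_mult_distrib)
  qed
  finally show ?case .
qed (auto simp: power_0_left)

text \<open>
The product of complete q-functions over the parts of \<open>\<kappa>\<close>, dual to the monomial functions.
\<close>

definition gm :: "nat set \<Rightarrow> (nat \<Rightarrow> nat) \<Rightarrow> (nat \<Rightarrow> complex) \<Rightarrow> complex" where
  "gm I \<kappa> y = (\<Prod>n\<in>#parts \<kappa>. gp I n y)"

lemma gm_eq: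
  assumes "finite I" "finite S" "supp \<alpha> \<subseteq> S"
  shows "gm I \<alpha> y = (\<Prod>i\<in>S. gp I (\<alpha> i) y)"
proof -
  have "gm I \<alpha> y = (\<Prod>i\<in>supp \<alpha>. gp I (\<alpha> i) y)"
    by (simp add: gm_def parts_def prod_unfold_prod_mset image_mset.compositionality comp_def)
  also have "\<dots> = (\<Prod>i\<in>S. gp I (\<alpha> i) y)"
    using assms by (intro prod.mono_neutral_left) (auto simp: supp_def)
  finally show ?thesis .
qed

text \<open>
Expand the product over the variables \<open>x\<close> first: the coefficient of a monomial in \<open>x\<close> is a product of
complete q-functions in \<open>y\<close> that depends only on the parts of the exponent.
\<close>

theorem Kp_monomial:
  assumes x: "fin_supp x" and I: "finite I" "\<And>i. i \<notin> I \<Longrightarrow> y i = 0"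
  shows "Kp q x y d = (\<Sum>\<kappa>\<in>Par d. monomial_sf \<kappa> x * gm I \<kappa> y)"
proof -
  define S where "S = {i. x i \<noteq> 0}"
  have S: "finite S" "\<And>i. i \<notin> S \<Longrightarrow> x i = 0" using x by (auto simp: S_def fin_supp_def)
  have "Kp q x y d = fps_nth (\<Prod>s\<in>S \<times> I. gen (x (fst s) * y (snd s))) d"
    using kernel_eq_Kp[of S x I y d] S I by simp
  also have "(\<Prod>s\<in>S \<times> I. gen (x (fst s) * y (snd s))) = (\<Prod>i\<in>S. \<Prod>j\<in>I. gen (x i * y j))"
    by (simp add: prod.cartesian_product case_prod_unfold)
  also have "fps_nth \<dots> d = (\<Sum>\<alpha>\<in>Comp S d. \<Prod>i\<in>S. x i ^ \<alpha> i * gp I (\<alpha> i) y)"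
    by (simp add: fps_prod_nth_Comp[OF S(1)] gp_scaled[OF I(1)])
  also have "\<dots> = (\<Sum>\<alpha>\<in>Comp S d. xmon S x \<alpha> * gm I \<alpha> y)"
    by (intro sum.cong refl) (simp add: xmon_def prod.distrib gm_eq[OF I(1) S(1)] Comp_def)
  also have "\<dots> = (\<Sum>\<kappa>\<in>Par d. \<Sum>\<alpha>\<in>Orb \<kappa> S. xmon S x \<alpha> * gm I \<alpha> y)"
    by (rule sum_Comp_Orb[OF S(1)])
  also have "\<dots> = (\<Sum>\<kappa>\<in>Par d. monomial_sf \<kappa> x * gm I \<kappa> y)"
  proof (rule sum.cong[OF refl])
    fix \<kappa> assume \<kappa>: "\<kappa> \<in> Par d"
    have "(\<Sum>\<alpha>\<in>Orb \<kappa> S. xmon S x \<alpha> * gm I \<alpha> y) = (\<Sum>\<alpha>\<in>Orb \<kappa> S. xmon S x \<alpha> * gm I \<kappa> y)"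
      by (intro sum.cong) (auto simp: Orb_def gm_def)
    then show "(\<Sum>\<alpha>\<in>Orb \<kappa> S. xmon S x \<alpha> * gm I \<alpha> y) = monomial_sf \<kappa> x * gm I \<kappa> y"
      using monomial_sf_eq[OF S Par_D(1)[OF \<kappa>]] by (simp add: sum_distrib_right)
  qed
  finally show ?thesis .
qed

lemma kernel_sums:
  assumes S: "finite S" "\<And>i. i \<in> S \<Longrightarrow> norm (x i) < 1" "\<And>i. i \<notin> S \<Longrightarrow> x i = 0"
    and I: "finite I" "unit_on I y" "\<And>i. i \<notin> I \<Longrightarrow> y i = 0"
  shows "(\<lambda>d. Kp q x y d) sums (\<Prod>i\<in>S. \<Prod>j\<in>I. Gamma_q q (x i * y j))"
proof -
  have lt: "norm (x (fst s) * y (snd s)) < 1" if "s \<in> S \<times> I" for s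
    using that S(2) I(2) by (auto simp: norm_mult unit_on_def)
  have "(\<lambda>d. fps_nth (\<Prod>s\<in>S \<times> I. gen (x (fst s) * y (snd s))) d) sums
      (\<Prod>s\<in>S \<times> I. \<Sum>k. fps_nth (gen (x (fst s) * y (snd s))) k)"
    using S(1) I(1) euler_summable[OF lt] by (intro fps_prod_sums[THEN conjunct2]) auto
  also have "(\<Prod>s\<in>S \<times> I. \<Sum>k. fps_nth (gen (x (fst s) * y (snd s))) k) = (\<Prod>s\<in>S \<times> I. Gamma_q q (x (fst s) * y (snd s)))"
    using sums_unique[OF Gamma_q_sums[OF lt]] by (intro prod.cong) auto
  also have "\<dots> = (\<Prod>i\<in>S. \<Prod>j\<in>I. Gamma_q q (x i * y j))"
    by (simp add: prod.cartesian_product case_prod_unfold)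
  moreover have "fps_nth (\<Prod>s\<in>S \<times> I. gen (x (fst s) * y (snd s))) d = Kp q x y d" for d
    using S I by (intro kernel_eq_Kp) auto
  ultimately show ?thesis by simp
qed

lemma Kp_bound:
  assumes S: "finite S" "\<And>i. i \<in> S \<Longrightarrow> norm (x i) < 1" "\<And>i. i \<notin> S \<Longrightarrow> x i = 0"
    and I: "finite I"
  shows "\<exists>B. summable B \<and> (\<forall>d. B d \<ge> 0) \<and>
    (\<forall>y d. unit_on I y \<longrightarrow> (\<forall>i. i \<notin> I \<longrightarrow> y i = 0) \<longrightarrow> norm (Kp q x y d) \<le> B d)"
proof -
  have "summable (\<lambda>k. norm (x (fst s) ^ k / qp k))" if "s \<in> S \<times> I" for s
    using that S(2) by (intro euler_summable) auto
  from fps_prod_nth_bound[of "S \<times> I" "\<lambda>s k. norm (x (fst s) ^ k / qp k)"] this S(1) I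
  obtain B where B: "summable B" "\<And>d. B d \<ge> 0"
    "\<And>F :: nat \<times> nat \<Rightarrow> complex fps. \<forall>s\<in>S \<times> I. \<forall>k. norm (fps_nth (F s) k) \<le> norm (x (fst s) ^ k / qp k) \<Longrightarrow>
      \<forall>d. norm (fps_nth (\<Prod>s\<in>S \<times> I. F s) d) \<le> B d"
    by auto
  have "norm (Kp q x y d) \<le> B d" if y: "unit_on I y" "\<forall>i. i \<notin> I \<longrightarrow> y i = 0" for y d
  proof -
    have "\<forall>s\<in>S \<times> I. \<forall>k. norm (fps_nth (gen (x (fst s) * y (snd s))) k) \<le> norm (x (fst s) ^ k / qp k)"
      using y(1) by (auto simp: unit_on_def norm_divide norm_mult norm_power power_mult_distrib)
    from B(3)[OF this] have "norm (fps_nth (\<Prod>s\<in>S \<times> I. gen (x (fst s) * y (snd s))) d) \<le> B d" by blast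
    moreover have "fps_nth (\<Prod>s\<in>S \<times> I. gen (x (fst s) * y (snd s))) d = Kp q x y d"
      using S I y(2) by (intro kernel_eq_Kp) auto
    ultimately show ?thesis by simp
  qed
  then show ?thesis using B(1,2) by blast
qed

end

section \<open>Dominance order\<close>

text \<open>
The reflexive dominance order.
\<close>

definition dle :: "(nat \<Rightarrow> nat) \<Rightarrow> (nat \<Rightarrow> nat) \<Rightarrow> bool" where
  "dle \<mu> lam \<longleftrightarrow> part_size \<mu> = part_size lam \<and> (\<forall>k. (\<Sum>i<k. \<mu> i) \<le> (\<Sum>i<k. lam i))"

lemma dominance_less_iff: "dominance_less \<mu> lam \<longleftrightarrow> \<mu> \<noteq> lam \<and> dle \<mu> lam"
  by (simp add: dominance_less_def dle_def)

lemma dle_trans: "dle \<kappa> \<mu> \<Longrightarrow> dle \<mu> lam \<Longrightarrow> dle \<kappa> lam"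
  unfolding dle_def by (metis order_trans)

lemma partial_sums_eq:
  fixes \<mu> lam :: "nat \<Rightarrow> nat"
  assumes "\<And>k. k \<le> Suc i \<Longrightarrow> (\<Sum>j<k. \<mu> j) = (\<Sum>j<k. lam j)"
  shows "\<mu> i = lam i"
  using assms[of "Suc i"] assms[of i] by simp

lemma dle_antisym: "dle \<mu> lam \<Longrightarrow> dle lam \<mu> \<Longrightarrow> \<mu> = lam"
  by (rule ext, rule partial_sums_eq) (simp add: dle_def order_antisym)

lemma dominance_less_trans: "dominance_less \<kappa> \<mu> \<Longrightarrow> dominance_less \<mu> lam \<Longrightarrow> dominance_less \<kappa> lam"
  unfolding dominance_less_iff using dle_trans dle_antisym by metis

text \<open>
A number that increases strictly along dominance, for inductions. It sums all relevant partial
sums.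
\<close>

definition hgt :: "(nat \<Rightarrow> nat) \<Rightarrow> nat" where
  "hgt lam = (\<Sum>k\<le>part_size lam. \<Sum>i<k. lam i)"

lemma Par_zero_beyond: "lam \<in> Par d \<Longrightarrow> d \<le> i \<Longrightarrow> lam i = 0"
proof -
  assume "lam \<in> Par d" "d \<le> i"
  then have "supp lam \<subseteq> {..<d}" using Par_subset_Comp[of d] by (auto simp: Comp_def)
  then have "i \<notin> supp lam" using \<open>d \<le> i\<close> by auto
  then show "lam i = 0" by (simp add: supp_def)
qed

lemma hgt_strict:
  assumes "\<mu> \<in> Par d" "lam \<in> Par d" "dominance_less \<mu> lam"
  shows "hgt \<mu> < hgt lam"
proof -
  have le: "(\<Sum>i<k. \<mu> i) \<le> (\<Sum>i<k. lam i)" for k using assms(3) by (simp add: dominance_less_def)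
  have "\<exists>k\<le>d. (\<Sum>i<k. \<mu> i) < (\<Sum>i<k. lam i)"
  proof (rule ccontr)
    assume no: "\<not> ?thesis"
    have eq: "(\<Sum>i<k. \<mu> i) = (\<Sum>i<k. lam i)" if "k \<le> d" for k
    proof -
      have "\<not> (\<Sum>i<k. \<mu> i) < (\<Sum>i<k. lam i)" using no that by blast
      then show ?thesis using le[of k] by linarith
    qed
    have "\<mu> i = lam i" for i
    proof (cases "i < d")
      case True
      show ?thesis by (rule partial_sums_eq, rule eq) (use True in simp)
    next
      case False
      then show ?thesis using Par_zero_beyond[OF assms(1), of i] Par_zero_beyond[OF assms(2), of i] by simp
    qed
    then show False using assms(3) by (auto simp: dominance_less_def)
  qed
  then obtain k where "k \<le> d" "(\<Sum>i<k. \<mu> i) < (\<Sum>i<k. lam i)" by blast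
  then have "(\<Sum>k\<le>d. \<Sum>i<k. \<mu> i) < (\<Sum>k\<le>d. \<Sum>i<k. lam i)"
    by - (rule sum_strict_mono_ex1, simp, use le in blast, blast)
  then show ?thesis using assms(1,2) by (simp add: hgt_def Par_def)
qed

definition Dn :: "(nat \<Rightarrow> nat) \<Rightarrow> (nat \<Rightarrow> nat) set" where
  "Dn lam = {\<mu>. is_partition \<mu> \<and> dominance_less \<mu> lam}"

lemma Dn_subset: "lam \<in> Par d \<Longrightarrow> Dn lam \<subseteq> Par d"
  by (auto simp: Dn_def Par_def dominance_less_def)

lemma finite_Dn: "is_partition lam \<Longrightarrow> finite (Dn lam)"
  using Dn_subset[OF Par_self] finite_Par finite_subset by blast

lemma Dn_down: "\<kappa> \<in> Dn lam \<Longrightarrow> Dn \<kappa> \<subseteq> Dn lam"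
  by (auto simp: Dn_def intro: dominance_less_trans)

lemma Dn_irrefl: "lam \<notin> Dn lam" by (simp add: Dn_def dominance_less_def)

text \<open>
A partition has its largest entries in front.
\<close>

lemma sum_le_top:
  fixes \<mu> :: "nat \<Rightarrow> nat"
  assumes "antimono \<mu>" "finite K"
  shows "(\<Sum>j\<in>K. \<mu> j) \<le> (\<Sum>i<card K. \<mu> i)"
  using assms(2)
proof (induction "card K" arbitrary: K)
  case (Suc n)
  then have ne: "K \<noteq> {}" by auto
  let ?m = "Max K"
  have m: "?m \<in> K" using Suc ne by simp
  have "K \<subseteq> {..?m}" using Suc by auto
  then have "card K \<le> Suc ?m" using card_mono[of "{..?m}" K] by simp
  then have "n \<le> ?m" using Suc.hyps(2) by simp
  then have "\<mu> ?m \<le> \<mu> n" by (rule antimonoD[OF assms(1)])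
  moreover have "(\<Sum>j\<in>K - {?m}. \<mu> j) \<le> (\<Sum>i<n. \<mu> i)"
  proof -
    have c: "card (K - {?m}) = n" using Suc.hyps(2) Suc.prems m by simp
    show ?thesis using Suc.hyps(1)[OF c[symmetric]] Suc.prems unfolding c by simp
  qed
  moreover have "(\<Sum>j\<in>K. \<mu> j) = \<mu> ?m + (\<Sum>j\<in>K - {?m}. \<mu> j)"
    using Suc.prems m by (simp add: sum.remove)
  moreover have "(\<Sum>i<card K. \<mu> i) = (\<Sum>i<n. \<mu> i) + \<mu> n" using Suc.hyps(2)[symmetric] by simp
  ultimately show ?case by linarith
qed simp

lemma Orb_sum_le:
  assumes "is_partition \<mu>" "\<alpha> \<in> Orb \<mu> S" "finite S" "finite J"
  shows "(\<Sum>i\<in>J. \<alpha> i) \<le> (\<Sum>i<card J. \<mu> i)"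
proof -
  have "finite (supp \<alpha>)" "parts \<alpha> = parts \<mu>" using assms finite_subset by (auto simp: Orb_def)
  then obtain \<pi> where \<pi>: "bij \<pi>" "\<alpha> = \<mu> \<circ> \<pi>" using same_parts_rearrange partition_fin[OF assms(1)] by blast
  have inj: "inj_on \<pi> J" using \<pi>(1) by (meson bij_is_inj inj_on_subset subset_UNIV)
  have "(\<Sum>i\<in>J. \<alpha> i) = (\<Sum>j\<in>\<pi> ` J. \<mu> j)" using inj by (simp add: sum.reindex \<pi>(2))
  also have "\<dots> \<le> (\<Sum>i<card (\<pi> ` J). \<mu> i)"
    using assms by (intro sum_le_top) (auto simp: is_partition_def)
  finally show ?thesis using card_image[OF inj] by simp
qed

lemma filter_nonzero: "0 \<notin># M \<Longrightarrow> filter_mset (\<lambda>n. n \<noteq> 0) M = M"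
  by (induction M) auto

lemma filter_nonzero_replicate: "filter_mset (\<lambda>n. n \<noteq> 0) (replicate_mset m (0::nat)) = {#}"
  by (rule multiset_eqI) simp

text \<open>
With the index set fixed, the number of zeros is determined by the nonzero parts.
\<close>

lemma Orb_eq_RA:
  assumes "finite I" "supp \<kappa> \<subseteq> I"
  shows "Orb \<kappa> I = RA I (image_mset \<kappa> (mset_set I))"
proof -
  have fin: "finite (supp \<alpha>)" if "supp \<alpha> \<subseteq> I" for \<alpha> using that assms finite_subset by blast
  have "parts \<alpha> = parts \<kappa> \<longleftrightarrow> image_mset \<alpha> (mset_set I) = image_mset \<kappa> (mset_set I)" if s: "supp \<alpha> \<subseteq> I" for \<alpha>
  proof
    assume "parts \<alpha> = parts \<kappa>"
    moreover from this have "card (supp \<alpha>) = card (supp \<kappa>)"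
      using size_parts[OF fin[OF s]] size_parts[OF fin[OF assms(2)]] by simp
    ultimately show "image_mset \<alpha> (mset_set I) = image_mset \<kappa> (mset_set I)"
      by (simp add: image_mset_superset[OF assms(1) s] image_mset_superset[OF assms])
  next
    assume eq: "image_mset \<alpha> (mset_set I) = image_mset \<kappa> (mset_set I)"
    have f: "filter_mset (\<lambda>n. n \<noteq> 0) (M + replicate_mset m 0) = M" if "0 \<notin># M" for M :: "nat multiset" and m
      using filter_nonzero[OF that] filter_nonzero_replicate[of m] by (simp only: filter_union_mset add_0_right)
    have "filter_mset (\<lambda>n. n \<noteq> 0) (image_mset \<alpha> (mset_set I)) = parts \<alpha>"
      unfolding image_mset_superset[OF assms(1) s] by (rule f[OF zero_notin_parts])
    moreover have "filter_mset (\<lambda>n. n \<noteq> 0) (image_mset \<kappa> (mset_set I)) = parts \<kappa>"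
      unfolding image_mset_superset[OF assms] by (rule f[OF zero_notin_parts])
    ultimately show "parts \<alpha> = parts \<kappa>" unfolding eq by (rule trans[OF sym])
  qed
  moreover have "supp \<alpha> \<subseteq> I \<longleftrightarrow> (\<forall>i. i \<notin> I \<longrightarrow> \<alpha> i = 0)" for \<alpha> by (auto simp: supp_def)
  ultimately show ?thesis unfolding Orb_def RA_def by blast
qed

section \<open>Macdonald functions at t = 0\<close>

locale macdonald_q = q_disc +
  fixes P :: "(nat \<Rightarrow> nat) \<Rightarrow> (nat \<Rightarrow> complex) \<Rightarrow> complex"
  assumes fam: "macdonald_family q 0 P"
begin

text \<open>
The coefficients of the subleading monomial functions in \<open>P lam\<close>.
\<close>

definition u :: "(nat \<Rightarrow> nat) \<Rightarrow> (nat \<Rightarrow> nat) \<Rightarrow> complex" where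
  "u lam = (SOME u. \<forall>x. fin_supp x \<longrightarrow>
     P lam x = monomial_sf lam x + (\<Sum>\<mu> | is_partition \<mu> \<and> dominance_less \<mu> lam. u \<mu> * monomial_sf \<mu> x))"

lemma P_triangular:
  assumes "is_partition lam" "fin_supp x"
  shows "P lam x = monomial_sf lam x + (\<Sum>\<mu>\<in>Dn lam. u lam \<mu> * monomial_sf \<mu> x)"
proof -
  have "\<exists>u. \<forall>x. fin_supp x \<longrightarrow>
     P lam x = monomial_sf lam x + (\<Sum>\<mu> | is_partition \<mu> \<and> dominance_less \<mu> lam. u \<mu> * monomial_sf \<mu> x)"
    using fam assms(1) unfolding macdonald_family_def by blast
  from someI_ex[OF this] assms(2) show ?thesis unfolding u_def[symmetric] Dn_def by blast
qed

text \<open>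
Unitriangularity is inverted by removing maximal elements of \<open>A\<close>; since \<open>A\<close> is closed downwards the
correction terms stay in \<open>A\<close>.
\<close>

lemma span_P:
  assumes "A \<subseteq> Par d" "\<And>\<kappa>. \<kappa> \<in> A \<Longrightarrow> Dn \<kappa> \<subseteq> A"
  shows "\<exists>e. \<forall>x. fin_supp x \<longrightarrow> (\<Sum>\<kappa>\<in>A. c \<kappa> * monomial_sf \<kappa> x) = (\<Sum>\<kappa>\<in>A. e \<kappa> * P \<kappa> x)"
  using assms
proof (induction "card A" arbitrary: A c)
  case 0
  then have "finite A" using finite_subset[OF _ finite_Par] by blast
  with 0 have "A = {}" by simp
  then show ?case by simp
next
  case (Suc n)
  have fin: "finite A" using Suc.prems(1) finite_Par finite_subset by blast
  have ne: "A \<noteq> {}" using Suc.hyps(2) by auto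
  have "Max (hgt ` A) \<in> hgt ` A" using fin ne by (intro Max_in) auto
  then obtain \<mu> where \<mu>: "\<mu> \<in> A" "hgt \<mu> = Max (hgt ` A)" by auto
  have max: "hgt \<kappa> \<le> hgt \<mu>" if "\<kappa> \<in> A" for \<kappa> using fin that \<mu>(2) by simp
  have top: "\<mu> \<notin> Dn \<kappa>" if "\<kappa> \<in> A" for \<kappa>
  proof
    assume "\<mu> \<in> Dn \<kappa>"
    then have "hgt \<mu> < hgt \<kappa>" using Suc.prems(1) \<mu>(1) that by (intro hgt_strict) (auto simp: Dn_def)
    then show False using max[OF that] by simp
  qed
  define c' where "c' \<kappa> = c \<kappa> - (if \<kappa> \<in> Dn \<mu> then c \<mu> * u \<mu> \<kappa> else 0)" for \<kappa>
  have "\<exists>e. \<forall>x. fin_supp x \<longrightarrow> (\<Sum>\<kappa>\<in>A - {\<mu>}. c' \<kappa> * monomial_sf \<kappa> x) = (\<Sum>\<kappa>\<in>A - {\<mu>}. e \<kappa> * P \<kappa> x)"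
  proof (rule Suc.hyps(1))
    show "n = card (A - {\<mu>})" using Suc.hyps(2) fin \<mu> by simp
    show "A - {\<mu>} \<subseteq> Par d" using Suc.prems by auto
    show "Dn \<kappa> \<subseteq> A - {\<mu>}" if "\<kappa> \<in> A - {\<mu>}" for \<kappa> using Suc.prems(2)[of \<kappa>] top[of \<kappa>] that by auto
  qed
  then obtain e where e: "\<And>x. fin_supp x \<Longrightarrow> (\<Sum>\<kappa>\<in>A - {\<mu>}. c' \<kappa> * monomial_sf \<kappa> x) = (\<Sum>\<kappa>\<in>A - {\<mu>}. e \<kappa> * P \<kappa> x)"
    by blast
  have "(\<Sum>\<kappa>\<in>A. c \<kappa> * monomial_sf \<kappa> x) = (\<Sum>\<kappa>\<in>A. (e(\<mu> := c \<mu>)) \<kappa> * P \<kappa> x)" if x: "fin_supp x" for x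
  proof -
    have pm: "is_partition \<mu>" using \<mu> Suc.prems by (auto simp: Par_def)
    have sub: "Dn \<mu> \<subseteq> A - {\<mu>}" using Suc.prems(2)[OF \<mu>(1)] Dn_irrefl by auto
    have m: "monomial_sf \<mu> x = P \<mu> x - (\<Sum>\<kappa>\<in>Dn \<mu>. u \<mu> \<kappa> * monomial_sf \<kappa> x)"
      using P_triangular[OF pm x] by simp
    have "(\<Sum>\<kappa>\<in>A. c \<kappa> * monomial_sf \<kappa> x) = c \<mu> * monomial_sf \<mu> x + (\<Sum>\<kappa>\<in>A - {\<mu>}. c \<kappa> * monomial_sf \<kappa> x)"
      using fin \<mu>(1) by (simp add: sum.remove)
    also have "c \<mu> * monomial_sf \<mu> x = c \<mu> * P \<mu> x - (\<Sum>\<kappa>\<in>A - {\<mu>}. (if \<kappa> \<in> Dn \<mu> then c \<mu> * u \<mu> \<kappa> else 0) * monomial_sf \<kappa> x)"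
    proof -
      have "(\<Sum>\<kappa>\<in>A - {\<mu>}. (if \<kappa> \<in> Dn \<mu> then c \<mu> * u \<mu> \<kappa> else 0) * monomial_sf \<kappa> x) =
          (\<Sum>\<kappa>\<in>Dn \<mu>. c \<mu> * (u \<mu> \<kappa> * monomial_sf \<kappa> x))"
        using fin sub by (intro sum.mono_neutral_cong_right) (auto simp: mult.assoc)
      then show ?thesis unfolding m by (simp add: right_diff_distrib sum_distrib_left)
    qed
    also have "c \<mu> * P \<mu> x - (\<Sum>\<kappa>\<in>A - {\<mu>}. (if \<kappa> \<in> Dn \<mu> then c \<mu> * u \<mu> \<kappa> else 0) * monomial_sf \<kappa> x) +
        (\<Sum>\<kappa>\<in>A - {\<mu>}. c \<kappa> * monomial_sf \<kappa> x) = c \<mu> * P \<mu> x + (\<Sum>\<kappa>\<in>A - {\<mu>}. c' \<kappa> * monomial_sf \<kappa> x)"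
      by (simp add: c'_def left_diff_distrib sum_subtractf)
    also have "\<dots> = (\<Sum>\<kappa>\<in>A. (e(\<mu> := c \<mu>)) \<kappa> * P \<kappa> x)"
      unfolding e[OF x] using fin \<mu>(1) by (subst sum.remove[of A \<mu>]) (auto intro!: sum.cong)
    finally show ?thesis .
  qed
  then show ?case by blast
qed

text \<open>
Coordinates of \<open>P \<nu>\<close> in the power sum basis.
\<close>

definition C :: "(nat \<Rightarrow> nat) \<Rightarrow> (nat \<Rightarrow> nat) \<Rightarrow> complex" where
  "C \<nu> = power_sum_coeff (P \<nu>)"

lemma power_sum_expansion_Par:
  assumes "\<And>x. fin_supp x \<Longrightarrow> f x = (\<Sum>lam\<in>Par d. c lam * power_sum_part lam x)"
  shows "power_sum_expansion f (\<lambda>lam. if lam \<in> Par d then c lam else 0)"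
proof -
  let ?c = "\<lambda>lam. if lam \<in> Par d then c lam else 0"
  have sub: "{lam. ?c lam \<noteq> 0} \<subseteq> Par d" by auto
  have fin: "finite {lam. ?c lam \<noteq> 0}" using sub finite_Par finite_subset by blast
  have "f x = (\<Sum>lam | ?c lam \<noteq> 0. ?c lam * power_sum_part lam x)" if "fin_supp x" for x
    unfolding assms[OF that] using sub finite_Par[of d]
    by (intro sum.mono_neutral_cong_right) auto
  then show ?thesis unfolding power_sum_expansion_def using fin by (auto simp: Par_D(1))
qed

lemma P_power_sum:
  assumes "\<nu> \<in> Par d"
  shows "\<And>x. fin_supp x \<Longrightarrow> P \<nu> x = (\<Sum>lam\<in>Par d. C \<nu> lam * power_sum_part lam x)"
    and "\<And>lam. lam \<notin> Par d \<Longrightarrow> C \<nu> lam = 0"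
proof -
  have "\<forall>\<mu>\<in>Par d. \<exists>c. \<forall>x. fin_supp x \<longrightarrow> monomial_sf \<mu> x = (\<Sum>lam\<in>Par d. c lam * power_sum_part lam x)"
    using monomial_power_sum by blast
  then obtain c where c: "\<And>\<mu> x. \<mu> \<in> Par d \<Longrightarrow> fin_supp x \<Longrightarrow> monomial_sf \<mu> x = (\<Sum>lam\<in>Par d. c \<mu> lam * power_sum_part lam x)"
    by metis
  define e where "e lam = c \<nu> lam + (\<Sum>\<mu>\<in>Dn \<nu>. u \<nu> \<mu> * c \<mu> lam)" for lam
  have Pe: "P \<nu> x = (\<Sum>lam\<in>Par d. e lam * power_sum_part lam x)" if x: "fin_supp x" for x
  proof -
    have "P \<nu> x = monomial_sf \<nu> x + (\<Sum>\<mu>\<in>Dn \<nu>. u \<nu> \<mu> * monomial_sf \<mu> x)"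
      using P_triangular Par_D(1)[OF assms] x by blast
    also have "(\<Sum>\<mu>\<in>Dn \<nu>. u \<nu> \<mu> * monomial_sf \<mu> x) = (\<Sum>\<mu>\<in>Dn \<nu>. \<Sum>lam\<in>Par d. u \<nu> \<mu> * c \<mu> lam * power_sum_part lam x)"
      using c[OF _ x] Dn_subset[OF assms] by (intro sum.cong) (auto simp: sum_distrib_left mult.assoc)
    also have "\<dots> = (\<Sum>lam\<in>Par d. (\<Sum>\<mu>\<in>Dn \<nu>. u \<nu> \<mu> * c \<mu> lam) * power_sum_part lam x)"
      by (subst sum.swap) (simp add: sum_distrib_right)
    also have "monomial_sf \<nu> x + \<dots> = (\<Sum>lam\<in>Par d. e lam * power_sum_part lam x)"
      unfolding c[OF assms x] e_def by (simp add: sum.distrib[symmetric] distrib_right)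
    finally show ?thesis .
  qed
  have Ceq: "C \<nu> = (\<lambda>lam. if lam \<in> Par d then e lam else 0)"
    unfolding C_def by (rule power_sum_coeff_eq, rule power_sum_expansion_Par, rule Pe)
  show "P \<nu> x = (\<Sum>lam\<in>Par d. C \<nu> lam * power_sum_part lam x)" if "fin_supp x" for x
    unfolding Pe[OF that] by (intro sum.cong) (auto simp: Ceq)
  show "C \<nu> lam = 0" if "lam \<notin> Par d" for lam using that by (simp add: Ceq)
qed

text \<open>
The inner product that defines the Macdonald functions, not the one on the torus.
\<close>

definition ip :: "(nat \<Rightarrow> nat) \<Rightarrow> (nat \<Rightarrow> nat) \<Rightarrow> complex" where
  "ip \<nu> \<kappa> = macdonald_inner q 0 (P \<nu>) (P \<kappa>)"

lemma ip_eq: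
  assumes "\<nu> \<in> Par d"
  shows "ip \<nu> \<kappa> = (\<Sum>lam\<in>Par d. C \<nu> lam * C \<kappa> lam * zw q (parts lam))"
proof -
  have "ip \<nu> \<kappa> = (\<Sum>lam | C \<nu> lam \<noteq> 0. C \<nu> lam * C \<kappa> lam * of_nat (z_part lam) *
        (\<Prod>i | lam i \<noteq> 0. (1 - q ^ lam i) / (1 - 0 ^ lam i)))"
    by (simp add: ip_def macdonald_inner_def C_def)
  also have "\<dots> = (\<Sum>lam\<in>Par d. C \<nu> lam * C \<kappa> lam * zw q (parts lam))"
  proof (rule sum.mono_neutral_cong_left)
    show "{lam. C \<nu> lam \<noteq> 0} \<subseteq> Par d" using P_power_sum(2)[OF assms] by auto
    fix lam assume "lam \<in> {lam. C \<nu> lam \<noteq> 0}"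
    then have "is_partition lam" using P_power_sum(2)[OF assms] Par_D(1) by auto
    from z_part_weight[OF this, of q]
    show "C \<nu> lam * C \<kappa> lam * of_nat (z_part lam) * (\<Prod>i | lam i \<noteq> 0. (1 - q ^ lam i) / (1 - 0 ^ lam i)) =
        C \<nu> lam * C \<kappa> lam * zw q (parts lam)" by (simp only: mult.assoc)
  qed (auto simp: finite_Par)
  finally show ?thesis .
qed

lemma ip_orthogonal: "is_partition \<nu> \<Longrightarrow> is_partition \<kappa> \<Longrightarrow> \<nu> \<noteq> \<kappa> \<Longrightarrow> ip \<nu> \<kappa> = 0"
  using fam by (simp add: macdonald_family_def ip_def)

text \<open>
The functions \<open>P \<nu>\<close> span, so a power sum product has coordinates \<open>D\<close>; pairing it with \<open>P \<kappa>\<close> in two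
ways, by orthogonality of the power sums and of the \<open>P \<nu>\<close>, relates \<open>D\<close> to \<open>C\<close>.
\<close>

lemma power_sum_in_P:
  assumes lam: "lam \<in> Par d"
  shows "\<exists>D. (\<forall>x. fin_supp x \<longrightarrow> power_sum_part lam x = (\<Sum>\<nu>\<in>Par d. D \<nu> * P \<nu> x)) \<and>
    (\<forall>\<kappa>\<in>Par d. zw q (parts lam) * C \<kappa> lam = D \<kappa> * ip \<kappa> \<kappa>)"
proof -
  obtain L0 :: "(nat \<Rightarrow> nat) \<Rightarrow> (nat \<Rightarrow> nat) \<Rightarrow> nat" where L0:
    "\<forall>lam x. is_partition lam \<longrightarrow> fin_supp x \<longrightarrow>
        power_sum_part lam x = (\<Sum>\<kappa>\<in>Par (part_size lam). of_nat (L0 lam \<kappa>) * monomial_sf \<kappa> x)"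
    using power_sum_part_monomial by (elim exE conjE)
  define L where "L = L0 lam"
  have L: "power_sum_part lam x = (\<Sum>\<kappa>\<in>Par (part_size lam). of_nat (L \<kappa>) * monomial_sf \<kappa> x)" if "fin_supp x" for x
    using L0[rule_format, OF Par_D(1)[OF lam] that] unfolding L_def .
  have d: "part_size lam = d" using lam by (simp add: Par_def)
  obtain D where D: "\<And>x. fin_supp x \<Longrightarrow> (\<Sum>\<kappa>\<in>Par d. of_nat (L \<kappa>) * monomial_sf \<kappa> x) = (\<Sum>\<kappa>\<in>Par d. D \<kappa> * P \<kappa> x)"
    using span_P[of "Par d" d "\<lambda>\<kappa>. of_nat (L \<kappa>)"] Dn_subset by blast
  have pD: "power_sum_part lam x = (\<Sum>\<nu>\<in>Par d. D \<nu> * P \<nu> x)" if "fin_supp x" for x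
    using L[OF that] D[OF that] d by simp
  have delta: "(\<Sum>\<nu>\<in>Par d. D \<nu> * C \<nu> \<mu>) = (if \<mu> = lam then 1 else 0)" if \<mu>: "\<mu> \<in> Par d" for \<mu>
  proof -
    have "(\<Sum>\<mu>\<in>Par d. ((\<Sum>\<nu>\<in>Par d. D \<nu> * C \<nu> \<mu>) - (if \<mu> = lam then 1 else 0)) * power_sum_part \<mu> x) = 0"
      if x: "fin_supp x" for x
    proof -
      have "(\<Sum>\<mu>\<in>Par d. (\<Sum>\<nu>\<in>Par d. D \<nu> * C \<nu> \<mu>) * power_sum_part \<mu> x) = (\<Sum>\<nu>\<in>Par d. D \<nu> * P \<nu> x)"
        unfolding sum_distrib_right by (subst sum.swap) (simp add: P_power_sum(1)[OF _ x] sum_distrib_left mult.assoc)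
      moreover have "(\<Sum>\<mu>\<in>Par d. (if \<mu> = lam then 1 else 0) * power_sum_part \<mu> x) = power_sum_part lam x"
        using finite_Par[of d] lam by (simp add: if_distrib[of "\<lambda>t. t * _"] sum.delta cong: if_cong)
      ultimately show ?thesis using pD[OF x] by (simp add: left_diff_distrib sum_subtractf)
    qed
    from power_sum_indep[OF finite_Par Par_D(1) this \<mu>] show ?thesis by simp
  qed
  have "zw q (parts lam) * C \<kappa> lam = D \<kappa> * ip \<kappa> \<kappa>" if \<kappa>: "\<kappa> \<in> Par d" for \<kappa>
  proof -
    have "zw q (parts lam) * C \<kappa> lam = (\<Sum>\<mu>\<in>Par d. (if \<mu> = lam then 1 else 0) * (C \<kappa> \<mu> * zw q (parts \<mu>)))"
      using finite_Par[of d] lam by (simp add: if_distrib[of "\<lambda>t. t * _"] sum.delta mult.commute cong: if_cong)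
    also have "\<dots> = (\<Sum>\<mu>\<in>Par d. (\<Sum>\<nu>\<in>Par d. D \<nu> * C \<nu> \<mu>) * (C \<kappa> \<mu> * zw q (parts \<mu>)))"
      using delta by (intro sum.cong) auto
    also have "\<dots> = (\<Sum>\<nu>\<in>Par d. D \<nu> * ip \<nu> \<kappa>)"
      unfolding sum_distrib_right by (subst sum.swap) (simp add: ip_eq sum_distrib_left mult.assoc)
    also have "\<dots> = (\<Sum>\<nu>\<in>{\<kappa>}. D \<nu> * ip \<nu> \<kappa>)"
      using \<kappa> finite_Par ip_orthogonal Par_D(1) by (intro sum.mono_neutral_right) auto
    finally show ?thesis by simp
  qed
  then show ?thesis using pD by blast
qed

text \<open>
A function orthogonal to all power sum products has vanishing coordinates, whereas \<open>P \<kappa>\<close> has leading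
coefficient one.
\<close>

lemma ip_nonzero:
  assumes \<kappa>: "\<kappa> \<in> Par d" shows "ip \<kappa> \<kappa> \<noteq> 0"
proof
  assume z: "ip \<kappa> \<kappa> = 0"
  have "C \<kappa> lam = 0" if "lam \<in> Par d" for lam
    using power_sum_in_P[OF that] \<kappa> z zw_nonzero[OF norm_q zero_notin_parts] by auto
  then have P0: "P \<kappa> x = 0" if "fin_supp x" for x using P_power_sum(1)[OF \<kappa> that] by simp
  have pk: "is_partition \<kappa>" using \<kappa> by (rule Par_D(1))
  define b where "b \<mu> = (if \<mu> = \<kappa> then 1 else u \<kappa> \<mu>)" for \<mu>
  have "(\<Sum>\<mu>\<in>insert \<kappa> (Dn \<kappa>). b \<mu> * monomial_sf \<mu> x) = 0" if x: "fin_supp x" for x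
  proof -
    have "(\<Sum>\<mu>\<in>Dn \<kappa>. b \<mu> * monomial_sf \<mu> x) = (\<Sum>\<mu>\<in>Dn \<kappa>. u \<kappa> \<mu> * monomial_sf \<mu> x)"
      using Dn_irrefl by (intro sum.cong) (auto simp: b_def)
    then show ?thesis using P_triangular[OF pk x] P0[OF x] finite_Dn[OF pk] Dn_irrefl by (simp add: b_def)
  qed
  then have "b \<kappa> = 0"
    by (rule monomial_sf_indep[rotated 2]) (use finite_Dn[OF pk] pk in \<open>auto simp: Dn_def\<close>)
  then show False by (simp add: b_def)
qed

text \<open>
The reproducing kernel has the same form in every orthogonal basis.
\<close>

theorem cauchy_identity:
  assumes x: "fin_supp x" and y: "fin_supp y"
  shows "Kp q x y d = (\<Sum>\<nu>\<in>Par d. P \<nu> x * P \<nu> y / ip \<nu> \<nu>)"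
proof -
  have "Kp q x y d = (\<Sum>lam\<in>Par d. power_sum_part lam x * power_sum_part lam y / zw q (parts lam))"
    unfolding Kp_def[OF norm_q] power_sum_part_eq
    by (rule sum.reindex_bij_betw[OF bij_Par_Mul, symmetric])
  also have "\<dots> = (\<Sum>lam\<in>Par d. \<Sum>\<nu>\<in>Par d. P \<nu> x * (C \<nu> lam * power_sum_part lam y) / ip \<nu> \<nu>)"
  proof (rule sum.cong[OF refl])
    fix lam assume lam: "lam \<in> Par d"
    obtain D where D: "\<And>x. fin_supp x \<Longrightarrow> power_sum_part lam x = (\<Sum>\<nu>\<in>Par d. D \<nu> * P \<nu> x)"
      "\<And>\<kappa>. \<kappa> \<in> Par d \<Longrightarrow> zw q (parts lam) * C \<kappa> lam = D \<kappa> * ip \<kappa> \<kappa>"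
      using power_sum_in_P[OF lam] by blast
    have nz: "zw q (parts lam) \<noteq> 0" by (rule zw_nonzero[OF norm_q zero_notin_parts])
    have "D \<nu> / zw q (parts lam) = C \<nu> lam / ip \<nu> \<nu>" if "\<nu> \<in> Par d" for \<nu>
      using D(2)[OF that] nz ip_nonzero[OF that] by (simp add: field_simps)
    moreover have "D \<nu> * P \<nu> x * power_sum_part lam y / zw q (parts lam) =
        (D \<nu> / zw q (parts lam)) * (P \<nu> x * power_sum_part lam y)" for \<nu> by simp
    moreover have "(C \<nu> lam / ip \<nu> \<nu>) * (P \<nu> x * power_sum_part lam y) = P \<nu> x * (C \<nu> lam * power_sum_part lam y) / ip \<nu> \<nu>" for \<nu> by simp
    ultimately have "D \<nu> * P \<nu> x * power_sum_part lam y / zw q (parts lam) = P \<nu> x * (C \<nu> lam * power_sum_part lam y) / ip \<nu> \<nu>"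
      if "\<nu> \<in> Par d" for \<nu> using that by (simp only:)
    then show "power_sum_part lam x * power_sum_part lam y / zw q (parts lam) =
        (\<Sum>\<nu>\<in>Par d. P \<nu> x * (C \<nu> lam * power_sum_part lam y) / ip \<nu> \<nu>)"
      unfolding D(1)[OF x] sum_distrib_right sum_divide_distrib by (intro sum.cong) auto
  qed
  also have "\<dots> = (\<Sum>\<nu>\<in>Par d. P \<nu> x * P \<nu> y / ip \<nu> \<nu>)"
    by (subst sum.swap) (simp add: P_power_sum(1)[OF _ y] sum_distrib_left sum_divide_distrib)
  finally show ?thesis .
qed

end

section \<open>The difference equation\<close>

text \<open>
The coefficients of \<open>H1_dual\<close>: the values at \<open>0\<close> of the Lagrange basis polynomials for the nodes
\<open>x i\<close>.
\<close>

definition lag :: "(nat \<Rightarrow> complex) \<Rightarrow> nat set \<Rightarrow> nat \<Rightarrow> complex" where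
  "lag x X i = (\<Prod>j\<in>X - {i}. x j / (x j - x i))"

text \<open>
The factor \<open>x b - x i\<close> annihilates the term of \<open>b\<close>, and in the other terms it cancels the factor of
\<open>b\<close>.
\<close>

lemma sum_lag_remove:
  assumes "finite X" "inj_on x X" "b \<in> X"
  shows "(\<Sum>i\<in>X. lag x X i * ((x b - x i) * f i)) = x b * (\<Sum>i\<in>X - {b}. lag x (X - {b}) i * f i)"
proof -
  have "lag x X i * ((x b - x i) * f i) = x b * (lag x (X - {b}) i * f i)" if i: "i \<in> X - {b}" for i
  proof -
    have ne: "x b - x i \<noteq> 0" using assms i by (auto simp: inj_on_def)
    have "X - {i} = insert b (X - {b} - {i})" using i assms(3) by auto
    then have "lag x X i = x b / (x b - x i) * lag x (X - {b}) i" using assms(1) by (simp add: lag_def)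
    then show ?thesis using ne by simp
  qed
  then have "(\<Sum>i\<in>X - {b}. lag x X i * ((x b - x i) * f i)) = x b * (\<Sum>i\<in>X - {b}. lag x (X - {b}) i * f i)"
    unfolding sum_distrib_left by (rule sum.cong[OF refl])
  then show ?thesis using assms by (simp add: sum.remove)
qed

text \<open>
Interpolation of the constant \<open>1\<close>. For distinct \<open>a\<close> and \<open>b\<close> the difference of the factors \<open>x b - x i\<close> and
\<open>x a - x i\<close> does not depend on \<open>i\<close>, which reduces the identity to the sets without \<open>b\<close> and without
\<open>a\<close>.
\<close>

lemma sum_lag:
  assumes "finite X" "X \<noteq> {}" "inj_on x X"
  shows "(\<Sum>i\<in>X. lag x X i) = 1"
  using assms
proof (induction "card X" arbitrary: X rule: less_induct)
  case less
  show ?case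
  proof (cases "\<exists>a\<in>X. \<exists>b\<in>X. a \<noteq> b")
    case False
    then obtain a where "X = {a}" using less.prems by blast
    then show ?thesis by (simp add: lag_def)
  next
    case True
    then obtain a b where ab: "a \<in> X" "b \<in> X" "a \<noteq> b" by blast
    have rem: "(\<Sum>i\<in>X. lag x X i * (x c - x i)) = x c" if "c \<in> X" "d \<in> X" "d \<noteq> c" for c d
    proof -
      have "(\<Sum>i\<in>X - {c}. lag x (X - {c}) i) = 1"
        using less.prems that by (intro less.hyps) (auto simp: card_gt_0_iff inj_on_diff intro: psubset_card_mono)
      then show ?thesis using sum_lag_remove[OF less.prems(1,3) that(1), of "\<lambda>_. 1"] by simp
    qed
    have "(x b - x a) * (\<Sum>i\<in>X. lag x X i) = (\<Sum>i\<in>X. lag x X i * (x b - x i)) - (\<Sum>i\<in>X. lag x X i * (x a - x i))"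
      by (simp add: sum_distrib_left sum_subtractf[symmetric] algebra_simps)
    also have "\<dots> = (x b - x a) * 1" using rem[of b a] rem[of a b] ab by simp
    finally show ?thesis using ab less.prems(3) by (auto simp: inj_on_def)
  qed
qed

text \<open>
Write a new factor as \<open>1 - x i * y k = (1 - x b * y k) + y k * (x b - x i)\<close>: the first part keeps the set
of nodes and the second one removes \<open>b\<close>. The correction term appears exactly when nodes and factors
are exhausted simultaneously; for empty \<open>X\<close> the statement reads \<open>0 = 1 - 1\<close>.
\<close>

theorem sum_lag_prod:
  assumes "finite Y" "finite X" "inj_on x X" "card Y \<le> card X"
  shows "(\<Sum>i\<in>X. lag x X i * (\<Prod>j\<in>Y. 1 - x i * y j)) =
    1 - (if card Y = card X then (\<Prod>i\<in>X. x i) * (\<Prod>j\<in>Y. y j) else 0)"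
  using assms
proof (induction Y arbitrary: X rule: finite_induct)
  case empty
  then show ?case using sum_lag[of X x] by (cases "X = {}") (auto simp: card_gt_0_iff)
next
  case (insert k Y)
  have cX: "card Y < card X" using insert by simp
  then obtain b where b: "b \<in> X" by fastforce
  let ?p = "\<lambda>i. \<Prod>j\<in>Y. 1 - x i * y j"
  have "(\<Sum>i\<in>X. lag x X i * (\<Prod>j\<in>insert k Y. 1 - x i * y j)) =
      (\<Sum>i\<in>X. (1 - x b * y k) * (lag x X i * ?p i) + y k * (lag x X i * ((x b - x i) * ?p i)))"
    using insert.hyps by (intro sum.cong refl) (simp add: algebra_simps)
  also have "\<dots> = (1 - x b * y k) * (\<Sum>i\<in>X. lag x X i * ?p i) + y k * (\<Sum>i\<in>X. lag x X i * ((x b - x i) * ?p i))"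
    by (simp only: sum.distrib sum_distrib_left)
  also have "(\<Sum>i\<in>X. lag x X i * ?p i) = 1"
    using insert.IH[OF insert.prems(1,2)] cX by simp
  also have "(\<Sum>i\<in>X. lag x X i * ((x b - x i) * ?p i)) = x b * (\<Sum>i\<in>X - {b}. lag x (X - {b}) i * ?p i)"
    by (rule sum_lag_remove[OF insert.prems(1,2) b])
  also have "(\<Sum>i\<in>X - {b}. lag x (X - {b}) i * ?p i) =
      1 - (if card Y = card X - 1 then (\<Prod>i\<in>X - {b}. x i) * (\<Prod>j\<in>Y. y j) else 0)"
  proof -
    have c: "card (X - {b}) = card X - 1" using insert.prems(1) b by simp
    have "(\<Sum>i\<in>X - {b}. lag x (X - {b}) i * ?p i) =
        1 - (if card Y = card (X - {b}) then (\<Prod>i\<in>X - {b}. x i) * (\<Prod>j\<in>Y. y j) else 0)"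
      by (rule insert.IH) (use insert.prems cX c in \<open>auto simp: inj_on_diff\<close>)
    then show ?thesis unfolding c .
  qed
  also have "(1 - x b * y k) * 1 + y k * (x b * (1 - (if card Y = card X - 1 then (\<Prod>i\<in>X - {b}. x i) * (\<Prod>j\<in>Y. y j) else 0))) =
      1 - (if card (insert k Y) = card X then (\<Prod>i\<in>X. x i) * (\<Prod>j\<in>insert k Y. y j) else 0)"
  proof (cases "Suc (card Y) = card X")
    case True
    have "(\<Prod>i\<in>X. x i) = x b * (\<Prod>i\<in>X - {b}. x i)" using insert.prems(1) b by (simp add: prod.remove)
    moreover have "card Y = card X - 1" using True by simp
    ultimately show ?thesis using True insert.hyps by (simp add: algebra_simps)
  next
    case False
    then have "card Y \<noteq> card X - 1" using cX by linarith
    then show ?thesis using False insert.hyps by (simp add: algebra_simps)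
  qed
  finally show ?case .
qed

lemma prod_powi: "(\<Prod>i\<in>A. f i powi m) = (\<Prod>i\<in>A. f i) powi (m :: int)" for f :: "'a \<Rightarrow> complex"
  by (induction A rule: infinite_finite_induct) (simp_all add: power_int_mult_distrib)

context q_disc
begin

lemma Delta_dual_eq: "Delta_dual l q y = Dl {..l} y"
  by (simp add: Delta_dual_def Dl_def inverse_Gamma_q)

text \<open>
For \<open>\<bar>c\<bar> < 1\<close> the argument stays in a compact disc without poles.
\<close>

lemma good_Gamma:
  assumes "norm c < 1" "j \<in> I" shows "good I (\<lambda>y. Gamma_q q (c * y j))"
proof -
  have "continuous_on (cball 0 (norm c)) (\<lambda>z. 1 / einf z)"
    using assms(1) by (intro continuous_intros einf_continuous) (auto intro!: einf_nonzero)
  then have "bounded ((\<lambda>z. 1 / einf z) ` cball 0 (norm c))"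
    by (intro compact_imp_bounded compact_continuous_image) auto
  then obtain B where B: "\<And>z. z \<in> cball 0 (norm c) \<Longrightarrow> norm (1 / einf z) \<le> B"
    unfolding bounded_iff by blast
  show ?thesis unfolding Gamma_q_eq
  proof (rule goodI[of _ _ B])
    have [measurable]: "(\<lambda>y. y j) \<in> borel_measurable (tor I)" using assms(2) by (rule coord_measurable)
    show "(\<lambda>y. 1 / einf (c * y j)) \<in> borel_measurable (tor I)" by measurable
    show "norm (1 / einf (c * y j)) \<le> B" if "unit_on I y" for y
      using that assms by (intro B) (auto simp: unit_on_def norm_mult)
  qed
qed

lemma Gamma_q_shift: "norm z < 1 \<Longrightarrow> Gamma_q q (q * z) = (1 - z) * Gamma_q q z"
  using einf_rec[of z] einf_nonzero[of z] by (auto simp: Gamma_q_eq)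

lemma good_baxter_kernel:
  assumes "\<forall>i\<le>l. norm (x i) < 1"
  shows "good {..l} (\<lambda>y. (\<Prod>i\<le>l. (x i * y i) powi \<gamma>) * (\<Prod>i\<le>l. \<Prod>j\<le>l. Gamma_q q (x i * y j)) * Dl {..l} y)"
  unfolding power_int_mult_distrib using assms
  by (intro good_mult good_prod good_const good_powi_coord good_Gamma good_Dl) auto

lemma good_symmetric_poly:
  assumes "symmetric_poly l F" shows "good {..l} (\<lambda>y. F (\<lambda>i. inverse (y i)))"
proof -
  obtain A c where "\<And>x. F x = (\<Sum>\<alpha>\<in>A. c \<alpha> * (\<Prod>i\<le>l. x i ^ (\<alpha> i :: nat)))"
    using assms unfolding symmetric_poly_def by blast
  then show ?thesis
    by (simp only:) (intro good_sum good_mult good_const good_prod good_power good_inverse_coord)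
qed

lemma prod_update:
  fixes f :: "nat \<Rightarrow> complex \<Rightarrow> complex"
  assumes "finite A" "i \<in> A" "f i (q * x i) = c * f i (x i)"
  shows "(\<Prod>k\<in>A. f k ((x(i := q * x i)) k)) = c * (\<Prod>k\<in>A. f k (x k))"
proof -
  have "(\<Prod>k\<in>A - {i}. f k ((x(i := q * x i)) k)) = (\<Prod>k\<in>A - {i}. f k (x k))"
    by (intro prod.cong) auto
  then show ?thesis using assms by (simp add: prod.remove)
qed

text \<open>
The shift of \<open>x\<^sub>i\<close> acts on the integrand as multiplication by \<open>q\<^sup>\<gamma> \<Prod>\<^sub>j (1 - x\<^sub>i y\<^sub>j)\<close>, and the Lagrange type
identity evaluates the resulting sum over \<open>i\<close>.
\<close>

theorem dual_baxter_difference_equation: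
  assumes q: "q \<noteq> 0" and F: "symmetric_poly l F"
    and x: "\<forall>i\<le>l. 0 < norm (x i) \<and> norm (x i) < 1" and inj: "inj_on x {..l}"
  shows "dual_baxter l q \<gamma> F x - q powi (- \<gamma>) * H1_dual l q (dual_baxter l q \<gamma> F) x = dual_baxter l q (\<gamma> + 1) F x"
proof -
  let ?I = "{..l}"
  define W where "W m x y = (\<Prod>i\<le>l. (x i * y i) powi m) * (\<Prod>i\<le>l. \<Prod>j\<le>l. Gamma_q q (x i * y j)) *
      Dl ?I y * F (\<lambda>i. inverse (y i))" for m and x y :: "nat \<Rightarrow> complex"
  have bax: "dual_baxter l q m F z = (LINT y|tor ?I. W m z y)" for m z
    by (simp add: dual_baxter_def W_def torus_haar_eq Delta_dual_eq)
  have goodW: "good ?I (W m z)" if "\<forall>i\<le>l. norm (z i) < 1" for m z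
    unfolding W_def using good_mult[OF good_baxter_kernel[OF that] good_symmetric_poly[OF F]] .
  have x1: "\<forall>i\<le>l. norm (x i) < 1" using x by blast
  note goodG = goodW[OF x1]
  have gp1: "good ?I (\<lambda>y. (\<Prod>j\<le>l. 1 - x i * y j) * W \<gamma> x y)" for i
  proof -
    have "good ?I (\<lambda>y. 1 + (- x i) * y j)" if "j \<in> ?I" for j
      using that by (intro good_add good_mult good_const good_coord)
    then have "good ?I (\<lambda>y. 1 - x i * y j)" if "j \<in> ?I" for j using that by simp
    then show ?thesis by (intro good_mult good_prod goodG) auto
  qed
  have shift: "dual_baxter l q \<gamma> F (x(i := q * x i)) = q powi \<gamma> * (LINT y|tor ?I. (\<Prod>j\<le>l. 1 - x i * y j) * W \<gamma> x y)"
    if i: "i \<in> ?I" for i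
  proof -
    have "\<forall>k\<le>l. norm ((x(i := q * x i)) k) < 1" using x1 norm_q_mult i by auto
    note g1 = goodW[OF this]
    have "dual_baxter l q \<gamma> F (x(i := q * x i)) = (LINT y|tor ?I. q powi \<gamma> * ((\<Prod>j\<le>l. 1 - x i * y j) * W \<gamma> x y))"
      unfolding bax
    proof (rule tor_integral_cong[OF finite_atMost g1])
      show "good ?I (\<lambda>y. q powi \<gamma> * ((\<Prod>j\<le>l. 1 - x i * y j) * W \<gamma> x y))"
        by (intro good_mult good_const gp1)
      fix y assume y: "unit_on ?I y"
      have 1: "(\<Prod>k\<le>l. ((x(i := q * x i)) k * y k) powi \<gamma>) = q powi \<gamma> * (\<Prod>k\<le>l. (x k * y k) powi \<gamma>)"
        by (rule prod_update[where f = "\<lambda>k t. (t * y k) powi \<gamma>"]) (use i in \<open>auto simp: power_int_mult_distrib\<close>)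
      have "(\<Prod>j\<le>l. Gamma_q q (q * x i * y j)) = (\<Prod>j\<le>l. (1 - x i * y j) * Gamma_q q (x i * y j))"
      proof (rule prod.cong[OF refl])
        fix j assume "j \<in> ?I"
        then have "norm (x i * y j) < 1" using y x1 i by (auto simp: norm_mult unit_on_def)
        from Gamma_q_shift[OF this] show "Gamma_q q (q * x i * y j) = (1 - x i * y j) * Gamma_q q (x i * y j)"
          by (simp only: mult.assoc)
      qed
      then have "(\<Prod>k\<le>l. \<Prod>j\<le>l. Gamma_q q ((x(i := q * x i)) k * y j)) =
          (\<Prod>j\<le>l. 1 - x i * y j) * (\<Prod>k\<le>l. \<Prod>j\<le>l. Gamma_q q (x k * y j))"
        by (intro prod_update[where f = "\<lambda>k t. \<Prod>j\<le>l. Gamma_q q (t * y j)"]) (use i in \<open>auto simp: prod.distrib\<close>)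
      then show "W \<gamma> (x(i := q * x i)) y = q powi \<gamma> * ((\<Prod>j\<le>l. 1 - x i * y j) * W \<gamma> x y)"
        unfolding W_def 1 by (simp only: mult_ac)
    qed
    then show ?thesis by simp
  qed
  have qq: "q powi (- \<gamma>) * (a * (q powi \<gamma> * c)) = a * c" for a c
    using q by (simp add: power_int_minus)
  have "q powi (- \<gamma>) * H1_dual l q (dual_baxter l q \<gamma> F) x =
      (\<Sum>i\<in>?I. lag x ?I i * (LINT y|tor ?I. (\<Prod>j\<le>l. 1 - x i * y j) * W \<gamma> x y))"
    unfolding H1_dual_def lag_def[symmetric] sum_distrib_left
    by (intro sum.cong refl) (simp only: shift qq)
  also have "\<dots> = (LINT y|tor ?I. (\<Sum>i\<in>?I. lag x ?I i * ((\<Prod>j\<le>l. 1 - x i * y j) * W \<gamma> x y)))"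
    by (subst tor_integral_sum) ((intro finite_atMost good_mult[OF good_const gp1])+, simp)
  also have "dual_baxter l q \<gamma> F x - \<dots> = (LINT y|tor ?I. W \<gamma> x y - (\<Sum>i\<in>?I. lag x ?I i * ((\<Prod>j\<le>l. 1 - x i * y j) * W \<gamma> x y)))"
    unfolding bax
    by (intro Bochner_Integration.integral_diff[symmetric] good_integrable finite_atMost goodG good_sum good_mult[OF good_const gp1])
  also have "\<dots> = dual_baxter l q (\<gamma> + 1) F x"
    unfolding bax
  proof (rule integral_cong_AE)
    show "(\<lambda>y. W \<gamma> x y - (\<Sum>i\<in>?I. lag x ?I i * ((\<Prod>j\<le>l. 1 - x i * y j) * W \<gamma> x y))) \<in> borel_measurable (tor ?I)"
      by (intro borel_measurable_diff good_measurable goodG good_sum good_mult[OF good_const gp1])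
    show "W (\<gamma> + 1) x \<in> borel_measurable (tor ?I)" by (rule good_measurable[OF goodG])
    have "W \<gamma> x y - (\<Sum>i\<in>?I. lag x ?I i * ((\<Prod>j\<le>l. 1 - x i * y j) * W \<gamma> x y)) = W (\<gamma> + 1) x y" if y: "unit_on ?I y" for y
    proof -
      have "(\<Sum>i\<in>?I. lag x ?I i * ((\<Prod>j\<le>l. 1 - x i * y j) * W \<gamma> x y)) =
          (\<Sum>i\<in>?I. lag x ?I i * (\<Prod>j\<in>?I. 1 - x i * y j)) * W \<gamma> x y"
        by (simp add: sum_distrib_right mult.assoc)
      also have "(\<Sum>i\<in>?I. lag x ?I i * (\<Prod>j\<in>?I. 1 - x i * y j)) = 1 - (\<Prod>i\<le>l. x i) * (\<Prod>j\<le>l. y j)"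
        using sum_lag_prod[OF finite_atMost finite_atMost inj, of l y] by simp
      finally have "W \<gamma> x y - (\<Sum>i\<in>?I. lag x ?I i * ((\<Prod>j\<le>l. 1 - x i * y j) * W \<gamma> x y)) =
          (\<Prod>i\<le>l. x i * y i) * W \<gamma> x y"
        by (simp add: algebra_simps prod.distrib)
      also have "(\<Prod>i\<le>l. (x i * y i) powi (\<gamma> + 1)) = (\<Prod>i\<le>l. x i * y i) * (\<Prod>i\<le>l. (x i * y i) powi \<gamma>)"
      proof -
        have "x i * y i \<noteq> 0" if "i \<in> ?I" for i
        proof -
          have "norm (x i) > 0" "norm (y i) = 1" using x y that by (auto simp: unit_on_def)
          then show ?thesis by auto
        qed
        then show ?thesis unfolding prod.distrib[symmetric]
          by (intro prod.cong refl) (simp add: power_int_add mult.commute)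
      qed
      then have "(\<Prod>i\<le>l. x i * y i) * W \<gamma> x y = W (\<gamma> + 1) x y"
        by (simp only: W_def mult.assoc)
      finally show ?thesis .
    qed
    then show "AE y in tor ?I. W \<gamma> x y - (\<Sum>i\<in>?I. lag x ?I i * ((\<Prod>j\<le>l. 1 - x i * y j) * W \<gamma> x y)) = W (\<gamma> + 1) x y"
      using AE_tor_unit[OF finite_atMost[of l]] by (auto elim!: eventually_mono)
  qed
  finally show ?thesis .
qed

end

section \<open>Torus orthogonality\<close>

text \<open>
A larger partition in dominance has at most as many parts.
\<close>

lemma supp_dle:
  assumes "dle \<mu> \<nu>" "supp \<mu> \<subseteq> {..l}" "is_partition \<nu>"
  shows "supp \<nu> \<subseteq> {..l}"
proof (rule ccontr)
  assume "\<not> ?thesis"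
  then obtain i where i: "i \<in> supp \<nu>" "i \<notin> {..l}" by auto
  have fin: "finite (supp \<nu>)" using assms(3) by (rule partition_fin)
  have "part_size \<nu> = (\<Sum>j\<in>{..l} \<union> supp \<nu>. \<nu> j)"
    unfolding part_size_eq using fin by (intro sum_parts) auto
  also have "\<dots> \<ge> (\<Sum>j\<in>insert i {..l}. \<nu> j)" using fin i by (intro sum_mono2) auto
  also have "(\<Sum>j\<in>insert i {..l}. \<nu> j) = \<nu> i + (\<Sum>j\<le>l. \<nu> j)" using i by simp
  finally have "\<nu> i + (\<Sum>j\<le>l. \<nu> j) \<le> part_size \<nu>" .
  moreover have "(\<Sum>j\<le>l. \<mu> j) = part_size \<mu>"
    unfolding part_size_eq using assms(2) by (intro sum_parts[symmetric]) auto
  moreover have "part_size \<mu> = part_size \<nu>" using assms(1) by (simp add: dle_def)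
  moreover have "(\<Sum>j<Suc l. \<mu> j) \<le> (\<Sum>j<Suc l. \<nu> j)" using assms(1) unfolding dle_def by blast
  then have "(\<Sum>j\<le>l. \<mu> j) \<le> (\<Sum>j\<le>l. \<nu> j)" by (simp only: lessThan_Suc_atMost)
  ultimately show False using i(1) by (simp add: supp_def)
qed

lemma Orb_empty:
  assumes "is_partition \<kappa>" "\<not> supp \<kappa> \<subseteq> {..l}"
  shows "Orb \<kappa> {..l} = {}"
proof (rule ccontr)
  assume "Orb \<kappa> {..l} \<noteq> {}"
  then obtain \<alpha> where \<alpha>: "supp \<alpha> \<subseteq> {..l}" "parts \<alpha> = parts \<kappa>" by (auto simp: Orb_def)
  have "finite (supp \<alpha>)" using \<alpha>(1) finite_subset by blast
  then have "size (parts \<kappa>) = card (supp \<alpha>)" using size_parts[of \<alpha>] \<alpha>(2) by simp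
  also have "\<dots> \<le> Suc l" using card_mono[OF _ \<alpha>(1)] by simp
  finally have "supp \<kappa> \<subseteq> {..l}" unfolding partition_supp[OF assms(1)] by auto
  then show False using assms(2) by simp
qed

context q_disc
begin

lemma gm_cong: "(\<And>i. i \<in> I \<Longrightarrow> y i = y' i) \<Longrightarrow> gm I \<kappa> y = gm I \<kappa> y'"
  using gp_cong[of I y y'] by (simp add: gm_def)

text \<open>
The weight depends on ratios of variables only.
\<close>

lemma Dl_scale: "deg_ge I I 0 (Dl I)"
proof (rule deg_geI)
  fix y
  have "Dl I (scl I z y) = Dl I y" if "norm z = 1" for z
  proof -
    have "z \<noteq> 0" using that by auto
    then have "inverse (scl I z y i) * scl I z y j = inverse (y i) * y j" if "i \<in> I" "j \<in> I" for i j
      using that by (simp add: scl_def)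
    then show ?thesis unfolding Dl_def by (intro prod.cong refl arg_cong[of _ _ einf]) auto
  qed
  then show "\<exists>h. h holomorphic_on UNIV \<and> (\<forall>z. norm z = 1 \<longrightarrow> Dl I (scl I z y) = z powi 0 * h z)"
    by (intro exI[of _ "\<lambda>_. Dl I y"]) auto
qed

lemma Dl_inverse:
  assumes "finite I"
  shows "Dl I (\<lambda>i\<in>I. inverse (y i)) = Dl I y"
proof -
  have *: "Dl I v = (\<Prod>i\<in>I. \<Prod>j\<in>I. if i = j then 1 else einf (inverse (v i) * v j))" for v
    unfolding Dl_def using assms
    by (intro prod.cong refl prod.mono_neutral_cong_left) auto
  have "Dl I (\<lambda>i\<in>I. inverse (y i)) = (\<Prod>i\<in>I. \<Prod>j\<in>I. if i = j then 1 else einf (inverse (y j) * y i))"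
    unfolding * by (intro prod.cong refl) (auto simp: mult.commute)
  also have "\<dots> = (\<Prod>j\<in>I. \<Prod>i\<in>I. if i = j then 1 else einf (inverse (y j) * y i))"
    by (rule prod.swap)
  also have "\<dots> = Dl I y" unfolding * by (intro prod.cong refl) auto
  finally show ?thesis .
qed

end

text \<open>
The number \<open>l + 1\<close> of variables is fixed from here on.
\<close>

locale macdonald_torus = macdonald_q + fixes l :: nat
begin

abbreviation "I \<equiv> {..l}"

text \<open>
Extension by zero of a vector of \<open>l + 1\<close> variables, the form in which \<open>P\<close> expects its argument.
\<close>

definition ry :: "(nat \<Rightarrow> complex) \<Rightarrow> nat \<Rightarrow> complex" where
  "ry y = (\<lambda>i. if i \<le> l then y i else 0)"

definition inv :: "(nat \<Rightarrow> complex) \<Rightarrow> nat \<Rightarrow> complex" where "inv y = (\<lambda>i. inverse (y i))"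

text \<open>
The monomial symmetric polynomial in \<open>l + 1\<close> variables, which makes sense also for negative powers of
the variables after inversion.
\<close>

definition mP :: "(nat \<Rightarrow> nat) \<Rightarrow> (nat \<Rightarrow> complex) \<Rightarrow> complex" where
  "mP \<kappa> y = (\<Sum>\<alpha>\<in>Orb \<kappa> I. xmon I y \<alpha>)"

definition pv :: "(nat \<Rightarrow> nat) \<Rightarrow> (nat \<Rightarrow> complex) \<Rightarrow> complex" where "pv \<nu> y = P \<nu> (ry y)"

text \<open>
Partitions with at most \<open>l + 1\<close> parts; for all others the polynomials vanish.
\<close>

definition part :: "(nat \<Rightarrow> nat) \<Rightarrow> bool" where
  "part \<nu> \<longleftrightarrow> is_partition \<nu> \<and> supp \<nu> \<subseteq> I"

lemma ry_fin: "fin_supp (ry y)"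
  unfolding fin_supp_def by (rule finite_subset[of _ I]) (auto simp: ry_def)

lemma ry_zero: "i \<notin> I \<Longrightarrow> ry y i = 0" by (simp add: ry_def)

lemma xmon_ry: "xmon I (ry y) \<alpha> = xmon I y \<alpha>"
  unfolding xmon_def by (intro prod.cong) (auto simp: ry_def)

lemma monomial_ry: "is_partition \<kappa> \<Longrightarrow> monomial_sf \<kappa> (ry y) = mP \<kappa> y"
  unfolding mP_def using monomial_sf_eq[of I "ry y" \<kappa>] ry_zero by (simp add: xmon_ry)

lemma pv_eq: "is_partition \<nu> \<Longrightarrow> pv \<nu> y = mP \<nu> y + (\<Sum>\<mu>\<in>Dn \<nu>. u \<nu> \<mu> * mP \<mu> y)"
  unfolding pv_def P_triangular[OF _ ry_fin] using monomial_ry by (simp add: Dn_def)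

lemma mP_inv: "mP \<kappa> (inv y) = (\<Sum>\<alpha>\<in>Orb \<kappa> I. \<Prod>i\<in>I. y i powi (- int (\<alpha> i)))"
  unfolding mP_def xmon_def inv_def by (intro sum.cong prod.cong refl) (simp add: power_int_minus power_inverse)

lemma mP_zero: "is_partition \<kappa> \<Longrightarrow> \<not> supp \<kappa> \<subseteq> I \<Longrightarrow> mP \<kappa> y = 0"
  by (simp add: mP_def Orb_empty)

text \<open>
All monomial functions that occur in \<open>P \<nu>\<close> have at least as many parts as \<open>\<nu>\<close>, hence too many.
\<close>

lemma pv_zero:
  assumes "is_partition \<nu>" "\<not> supp \<nu> \<subseteq> I" shows "pv \<nu> y = 0"
proof -
  have "mP \<mu> y = 0" if "\<mu> \<in> Dn \<nu>" for \<mu>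
    using that supp_dle[of \<mu> \<nu> l] assms by (intro mP_zero) (auto simp: Dn_def dominance_less_iff)
  then show ?thesis using pv_eq[OF assms(1)] mP_zero[OF assms] by simp
qed

lemma good_mP: "good I (mP \<kappa>)"
  unfolding mP_def xmon_def by (intro good_sum good_prod good_power good_coord)

lemma good_mP_inv: "good I (\<lambda>y. mP \<kappa> (inv y))"
  unfolding mP_inv by (intro good_sum good_prod good_powi_coord)

lemma good_pv: "is_partition \<nu> \<Longrightarrow> good I (pv \<nu>)"
proof -
  assume "is_partition \<nu>"
  then have "pv \<nu> = (\<lambda>y. mP \<nu> y + (\<Sum>\<mu>\<in>Dn \<nu>. u \<nu> \<mu> * mP \<mu> y))" using pv_eq by blast
  then show ?thesis by (simp only:) (intro good_add good_sum good_mult good_const good_mP)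
qed

lemma good_pv_inv: "is_partition \<nu> \<Longrightarrow> good I (\<lambda>y. pv \<nu> (inv y))"
  unfolding pv_eq by (intro good_add good_sum good_mult good_const good_mP_inv)

lemma deg_mP: "is_partition \<kappa> \<Longrightarrow> deg_ge I I (int (part_size \<kappa>)) (mP \<kappa>)"
  unfolding mP_def xmon_def
proof (rule deg_ge_sum)
  fix \<alpha> assume \<kappa>: "is_partition \<kappa>" "\<alpha> \<in> Orb \<kappa> I"
  have "deg_ge I I (\<Sum>i\<in>I. int (\<alpha> i)) (\<lambda>y. \<Prod>i\<in>I. y i ^ \<alpha> i)"
    by (intro deg_ge_prod deg_ge_power_in) auto
  moreover have "(\<Sum>i\<in>I. int (\<alpha> i)) = int (part_size \<kappa>)"
    using Orb_subset_Comp[of I \<kappa>] \<kappa> by (auto simp: Comp_def simp flip: of_nat_sum)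
  ultimately show "deg_ge I I (int (part_size \<kappa>)) (\<lambda>y. \<Prod>i\<in>I. y i ^ \<alpha> i)" by simp
qed

lemma deg_mP_inv: "is_partition \<kappa> \<Longrightarrow> deg_ge I I (- int (part_size \<kappa>)) (\<lambda>y. mP \<kappa> (inv y))"
  unfolding mP_inv
proof (rule deg_ge_sum)
  fix \<alpha> assume \<kappa>: "is_partition \<kappa>" "\<alpha> \<in> Orb \<kappa> I"
  have "deg_ge I I (\<Sum>i\<in>I. if i \<in> I then - int (\<alpha> i) else 0) (\<lambda>y. \<Prod>i\<in>I. y i powi (- int (\<alpha> i)))"
    by (intro deg_ge_prod deg_ge_powi_coord) auto
  moreover have "(\<Sum>i\<in>I. if i \<in> I then - int (\<alpha> i) else 0) = - int (part_size \<kappa>)"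
    using Orb_subset_Comp[of I \<kappa>] \<kappa> by (auto simp: Comp_def sum_negf simp flip: of_nat_sum)
  ultimately show "deg_ge I I (- int (part_size \<kappa>)) (\<lambda>y. \<Prod>i\<in>I. y i powi (- int (\<alpha> i)))" by simp
qed

lemma deg_pv: assumes "is_partition \<nu>" shows "deg_ge I I (int (part_size \<nu>)) (pv \<nu>)"
proof -
  have "pv \<nu> = (\<lambda>y. mP \<nu> y + (\<Sum>\<mu>\<in>Dn \<nu>. u \<nu> \<mu> * mP \<mu> y))" using pv_eq[OF assms] by blast
  moreover have "deg_ge I I (int (part_size \<nu>)) (mP \<mu>)" if "\<mu> \<in> Dn \<nu>" for \<mu>
    using deg_mP[of \<mu>] that by (simp add: Dn_def dominance_less_def)
  ultimately show ?thesis using deg_mP[OF assms]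
    by (simp only:) (intro deg_ge_add deg_ge_sum deg_ge_cmult, auto)
qed

lemma deg_pv_inv: assumes "is_partition \<nu>" shows "deg_ge I I (- int (part_size \<nu>)) (\<lambda>y. pv \<nu> (inv y))"
proof -
  have "deg_ge I I (- int (part_size \<nu>)) (\<lambda>y. mP \<mu> (inv y))" if "\<mu> \<in> Dn \<nu>" for \<mu>
    using deg_mP_inv[of \<mu>] that by (simp add: Dn_def dominance_less_def)
  then show ?thesis unfolding pv_eq[OF assms] using deg_mP_inv[OF assms]
    by (intro deg_ge_add deg_ge_sum deg_ge_cmult) auto
qed

lemma good_gm: "good I (gm I \<kappa>)"
proof -
  have "gm I \<kappa> = (\<lambda>y. \<Prod>i\<in>supp \<kappa>. gp I (\<kappa> i) y)"
    by (simp add: gm_def parts_def prod_unfold_prod_mset image_mset.compositionality comp_def fun_eq_iff)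
  then show ?thesis by (simp only:) (intro good_prod good_gp, auto)
qed

definition t1 :: "(nat \<Rightarrow> nat) \<Rightarrow> (nat \<Rightarrow> nat) \<Rightarrow> complex" where
  "t1 \<kappa> \<mu> = (LINT y|tor I. gm I \<kappa> y * mP \<mu> (inv y) * Dl I y)"

text \<open>
The ratio of the torus norm of \<open>P lam\<close> to its Macdonald norm.
\<close>

definition cst :: "(nat \<Rightarrow> nat) \<Rightarrow> complex" where
  "cst lam = fact (Suc l) / (einf q ^ l * qp (lam l))"

lemma cst_nonzero: "cst lam \<noteq> 0"
  using einf_nonzero[OF norm_q] by (simp add: cst_def del: fact_Suc)

text \<open>
If \<open>\<kappa>\<close> is not below \<open>\<mu>\<close>, for some \<open>k\<close> the \<open>k\<close> largest parts of \<open>\<kappa>\<close> have a larger sum than those of \<open>\<mu>\<close>.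
Peeling these parts of \<open>\<kappa>\<close> gives terms whose degree in \<open>k\<close> variables is at least their sum, whereas an
inverted monomial of \<open>\<mu>\<close> lowers the degree by at most the sum of the \<open>k\<close> largest parts of \<open>\<mu>\<close>.
\<close>

lemma t1_zero:
  assumes \<kappa>: "\<kappa> \<in> Par d" and \<mu>: "\<mu> \<in> Par d" and nle: "\<not> dle \<kappa> \<mu>"
  shows "t1 \<kappa> \<mu> = 0"
proof (cases "supp \<mu> \<subseteq> I")
  case False
  then show ?thesis using mP_zero[OF Par_D(1)[OF \<mu>]] by (simp add: t1_def)
next
  case True
  have sz: "part_size \<kappa> = d" "part_size \<mu> = d" using \<kappa> \<mu> by (auto simp: Par_def)
  obtain k where k: "(\<Sum>i<k. \<mu> i) < (\<Sum>i<k. \<kappa> i)"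
    using nle sz by (auto simp: dle_def not_le)
  define S where "S = {..<k} \<union> supp \<kappa>"
  have S: "finite S" "supp \<kappa> \<subseteq> S" "{..<k} \<subseteq> S" using partition_fin[OF Par_D(1)[OF \<kappa>]] by (auto simp: S_def)
  have kle: "k \<le> card I"
  proof (rule ccontr)
    assume "\<not> k \<le> card I"
    then have "(\<Sum>i\<in>I. \<mu> i) \<le> (\<Sum>i<k. \<mu> i)" by (intro sum_mono2) auto
    moreover have "(\<Sum>i\<in>I. \<mu> i) = d" using sum_parts[of I \<mu>] True sz by (simp add: part_size_eq)
    moreover have "(\<Sum>i<k. \<kappa> i) \<le> (\<Sum>i\<in>S. \<kappa> i)" using S by (intro sum_mono2) auto
    moreover have "(\<Sum>i\<in>S. \<kappa> i) = d" using sum_parts[OF S(1,2)] sz by (simp add: part_size_eq)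
    ultimately show False using k by linarith
  qed
  define R where "R y = (\<Prod>i\<in>S - {..<k}. gp I (\<kappa> i) y)" for y
  define E where "E \<alpha> y = R y * (\<Prod>i\<in>I. y i powi (- int (\<alpha> i)))" for \<alpha> :: "nat \<Rightarrow> nat" and y
  have gmk: "gm I \<kappa> y = (\<Prod>r<k. gp I (\<kappa> r) y) * R y" for y
    using gm_eq[OF _ S(1,2), of I y] S prod.subset_diff[OF S(3,1), of "\<lambda>i. gp I (\<kappa> i) y"]
    by (simp add: R_def mult.commute)
  have goodE: "good I (E \<alpha>)" for \<alpha>
    unfolding E_def R_def by (intro good_mult good_prod good_gp good_powi_coord) auto
  have "t1 \<kappa> \<mu> = (LINT y|tor I. (\<Sum>\<alpha>\<in>Orb \<mu> I. (\<Prod>r<k. gp I (\<kappa> r) y) * E \<alpha> y * Dl I y))"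
    unfolding t1_def gmk mP_inv E_def by (simp add: sum_distrib_left sum_distrib_right mult.assoc)
  also have "\<dots> = (\<Sum>\<alpha>\<in>Orb \<mu> I. (LINT y|tor I. (\<Prod>r<k. gp I (\<kappa> r) y) * E \<alpha> y * Dl I y))"
    by (intro tor_integral_sum good_mult goodE good_Dl good_prod good_gp) auto
  also have "\<dots> = 0"
  proof (rule sum.neutral, rule ballI)
    fix \<alpha> assume \<alpha>: "\<alpha> \<in> Orb \<mu> I"
    show "(LINT y|tor I. (\<Prod>r<k. gp I (\<kappa> r) y) * E \<alpha> y * Dl I y) = 0"
    proof (rule gp_integral_zero[OF _ kle goodE, where D = "\<lambda>J. 0 + (\<Sum>i\<in>I. if i \<in> J then - int (\<alpha> i) else 0)"])
      fix J assume J: "J \<subseteq> I" "card J = k"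
      have "deg_ge I J (\<Sum>i\<in>S - {..<k}. 0) R"
        unfolding R_def by (rule deg_ge_prod) (use S gp_deg_0 in auto)
      then show "deg_ge I J (0 + (\<Sum>i\<in>I. if i \<in> J then - int (\<alpha> i) else 0)) (E \<alpha>)"
        unfolding E_def by (intro deg_ge_mult deg_ge_prod deg_ge_powi_coord) auto
      have "(\<Sum>i\<in>I. if i \<in> J then - int (\<alpha> i) else 0) = - int (\<Sum>i\<in>J. \<alpha> i)"
      proof -
        have "{i \<in> I. i \<in> J} = J" using J by auto
        then show ?thesis using sum.inter_filter[of I "\<lambda>i. - int (\<alpha> i)" "\<lambda>i. i \<in> J"] by (simp add: sum_negf)
      qed
      moreover have "(\<Sum>i\<in>J. \<alpha> i) \<le> (\<Sum>i<k. \<mu> i)"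
        using Orb_sum_le[OF Par_D(1)[OF \<mu>] \<alpha>, of J] J finite_subset[OF J(1)] by auto
      ultimately show "0 < int (\<Sum>r<k. \<kappa> r) + (0 + (\<Sum>i\<in>I. if i \<in> J then - int (\<alpha> i) else 0))"
        using k by linarith
    qed simp
  qed
  finally show ?thesis .
qed

lemma t1_diag:
  assumes "part lam" shows "t1 lam lam = cst lam"
proof -
  have p: "is_partition lam" "supp lam \<subseteq> I" using assms by (auto simp: part_def)
  have "t1 lam lam = (LINT y|tor I. (\<Prod>r<Suc l. gp I (lam r) y) *
      (\<Sum>\<alpha>\<in>RA I (image_mset lam (mset_set {..<Suc l})). \<Prod>i\<in>I. y i powi (- int (\<alpha> i))) * Dl I y)"
    unfolding t1_def mP_inv Orb_eq_RA[OF finite_atMost p(2)] gm_eq[OF finite_atMost finite_atMost p(2)]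
      lessThan_Suc_atMost by (rule refl)
  also have "\<dots> = cst lam"
    unfolding cst_def using p(1)
    by (intro gp_integral_diag) (auto simp: is_partition_def antimono_def)
  finally show ?thesis .
qed

definition b :: "(nat \<Rightarrow> nat) \<Rightarrow> (nat \<Rightarrow> nat) \<Rightarrow> complex" where
  "b \<nu> lam = (LINT y|tor I. pv \<nu> y * pv lam (inv y) * Dl I y)"

lemma Kp_gm:
  assumes x: "fin_supp x"
  shows "Kp q x (ry y) d = (\<Sum>\<kappa>\<in>Par d. monomial_sf \<kappa> x * gm I \<kappa> y)"
proof -
  have g: "gm I \<kappa> (ry y) = gm I \<kappa> y" for \<kappa> by (rule gm_cong) (simp add: ry_def)
  have "Kp q x (ry y) d = (\<Sum>\<kappa>\<in>Par d. monomial_sf \<kappa> x * gm I \<kappa> (ry y))"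
    by (rule Kp_monomial[OF x finite_atMost]) (rule ry_zero)
  then show ?thesis unfolding g .
qed

lemma good_Kp: "fin_supp x \<Longrightarrow> good I (\<lambda>y. Kp q x (ry y) d)"
proof -
  assume x: "fin_supp x"
  have "Kp q x (ry y) d = (\<Sum>\<kappa>\<in>Par d. monomial_sf \<kappa> x * gm I \<kappa> y)" for y
    by (rule Kp_gm[OF x])
  then show ?thesis by (simp only:) (intro good_sum good_mult good_const good_gm)
qed

text \<open>
Both sides are the torus pairing of \<open>P lam\<close> with the kernel of degree \<open>d\<close>, evaluated by the Cauchy
identity and by the expansion in monomial functions.
\<close>

lemma b_expansion:
  assumes lam: "part lam" and x: "fin_supp x"
  defines "d \<equiv> part_size lam"
  shows "(\<Sum>\<nu>\<in>Par d. b \<nu> lam / ip \<nu> \<nu> * P \<nu> x) =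
    (\<Sum>\<kappa>\<in>Par d. (t1 \<kappa> lam + (\<Sum>\<mu>\<in>Dn lam. u lam \<mu> * t1 \<kappa> \<mu>)) * monomial_sf \<kappa> x)"
proof -
  have pl: "is_partition lam" using lam by (simp add: part_def)
  have gpv: "good I (pv \<nu>)" if "\<nu> \<in> Par d" for \<nu> using that good_pv Par_D(1) by blast
  note goods = good_mult good_const good_pv_inv[OF pl] good_Dl[OF subset_refl]
  have gP: "good I (\<lambda>y. (P \<nu> x / ip \<nu> \<nu>) * (pv \<nu> y * pv lam (inv y) * Dl I y))" if "\<nu> \<in> Par d" for \<nu>
    using gpv[OF that] by (intro goods)
  have "(LINT y|tor I. Kp q x (ry y) d * pv lam (inv y) * Dl I y) =
      (LINT y|tor I. (\<Sum>\<nu>\<in>Par d. (P \<nu> x / ip \<nu> \<nu>) * (pv \<nu> y * pv lam (inv y) * Dl I y)))"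
    unfolding cauchy_identity[OF x ry_fin] pv_def[symmetric] sum_distrib_right
    by (intro Bochner_Integration.integral_cong refl sum.cong) auto
  also have "\<dots> = (\<Sum>\<nu>\<in>Par d. P \<nu> x / ip \<nu> \<nu> * b \<nu> lam)"
    unfolding b_def by (subst tor_integral_sum[OF finite_atMost gP], assumption, simp)
  finally have 1: "(LINT y|tor I. Kp q x (ry y) d * pv lam (inv y) * Dl I y) = (\<Sum>\<nu>\<in>Par d. P \<nu> x / ip \<nu> \<nu> * b \<nu> lam)" .
  have Km: "Kp q x (ry y) d = (\<Sum>\<kappa>\<in>Par d. monomial_sf \<kappa> x * gm I \<kappa> y)" for y
    by (rule Kp_gm[OF x])
  have "(LINT y|tor I. Kp q x (ry y) d * pv lam (inv y) * Dl I y) =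
      (LINT y|tor I. (\<Sum>\<kappa>\<in>Par d. monomial_sf \<kappa> x * (gm I \<kappa> y * pv lam (inv y) * Dl I y)))"
    unfolding Km sum_distrib_right by (intro Bochner_Integration.integral_cong refl sum.cong) auto
  also have "\<dots> = (\<Sum>\<kappa>\<in>Par d. monomial_sf \<kappa> x * (LINT y|tor I. gm I \<kappa> y * pv lam (inv y) * Dl I y))"
    by (subst tor_integral_sum) ((intro finite_atMost finite_Par goods good_gm)+, simp)
  also have "\<dots> = (\<Sum>\<kappa>\<in>Par d. monomial_sf \<kappa> x * (t1 \<kappa> lam + (\<Sum>\<mu>\<in>Dn lam. u lam \<mu> * t1 \<kappa> \<mu>)))"
  proof (intro sum.cong refl arg_cong2[of _ _ _ _ "(*)"])
    fix \<kappa>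
    have "(LINT y|tor I. gm I \<kappa> y * pv lam (inv y) * Dl I y) =
        (LINT y|tor I. gm I \<kappa> y * mP lam (inv y) * Dl I y + (\<Sum>\<mu>\<in>Dn lam. u lam \<mu> * (gm I \<kappa> y * mP \<mu> (inv y) * Dl I y)))"
      unfolding pv_eq[OF pl] by (simp add: algebra_simps sum_distrib_left sum_distrib_right)
    also have "\<dots> = t1 \<kappa> lam + (LINT y|tor I. (\<Sum>\<mu>\<in>Dn lam. u lam \<mu> * (gm I \<kappa> y * mP \<mu> (inv y) * Dl I y)))"
      unfolding t1_def
      by (rule Bochner_Integration.integral_add; rule good_integrable)
         (auto intro!: goods good_gm good_mP_inv good_sum)
    also have "(LINT y|tor I. (\<Sum>\<mu>\<in>Dn lam. u lam \<mu> * (gm I \<kappa> y * mP \<mu> (inv y) * Dl I y))) = (\<Sum>\<mu>\<in>Dn lam. u lam \<mu> * t1 \<kappa> \<mu>)"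
      unfolding t1_def by (subst tor_integral_sum) ((intro finite_atMost finite_Dn[OF pl] goods good_gm good_mP_inv)+, simp)
    finally show "(LINT y|tor I. gm I \<kappa> y * pv lam (inv y) * Dl I y) = t1 \<kappa> lam + (\<Sum>\<mu>\<in>Dn lam. u lam \<mu> * t1 \<kappa> \<mu>)" .
  qed
  finally show ?thesis using 1 by (simp add: mult.commute)
qed

text \<open>
Compare coefficients of monomial functions of \<open>x\<close> in the two expansions. On the right they vanish unless
\<open>\<kappa>\<close> is below \<open>lam\<close>. A partition of maximal height that violates the claim receives no contribution from
partitions above it, so its coefficient on the left is its own, a contradiction. The same argument at
\<open>\<kappa> = lam\<close> isolates the norm.
\<close>

lemma b_triangular:
  assumes lam: "part lam" and d: "d = part_size lam"
  shows "\<nu> \<in> Par d \<Longrightarrow> b \<nu> lam \<noteq> 0 \<Longrightarrow> dle \<nu> lam" and "b lam lam = ip lam lam * cst lam"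
proof -
  have pl: "is_partition lam" "lam \<in> Par d" using lam Par_self d by (auto simp: part_def)
  define \<beta> where "\<beta> \<nu> = b \<nu> lam / ip \<nu> \<nu>" for \<nu>
  define t where "t \<kappa> = t1 \<kappa> lam + (\<Sum>\<mu>\<in>Dn lam. u lam \<mu> * t1 \<kappa> \<mu>)" for \<kappa>
  have t0: "t \<kappa> = 0" if "\<kappa> \<in> Par d" "\<not> dle \<kappa> lam" for \<kappa>
  proof -
    have "t1 \<kappa> \<mu> = 0" if "\<mu> \<in> Dn lam" for \<mu>
      using \<open>\<not> dle \<kappa> lam\<close> that Dn_subset[OF pl(2)] dle_trans[of \<kappa> \<mu> lam]
      by (intro t1_zero[OF \<open>\<kappa> \<in> Par d\<close>]) (auto simp: Dn_def dominance_less_iff)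
    then show ?thesis using t1_zero[OF that(1) pl(2) that(2)] by (simp add: t_def)
  qed
  have tl: "t lam = cst lam"
  proof -
    have "t1 lam \<mu> = 0" if "\<mu> \<in> Dn lam" for \<mu>
      using that Dn_subset[OF pl(2)] dle_antisym[of \<mu> lam]
      by (intro t1_zero[OF pl(2)]) (auto simp: Dn_def dominance_less_iff)
    then show ?thesis using t1_diag[OF lam] by (simp add: t_def)
  qed
  have coeff: "\<beta> \<kappa> + (\<Sum>\<nu>\<in>Par d. \<beta> \<nu> * (if \<kappa> \<in> Dn \<nu> then u \<nu> \<kappa> else 0)) = t \<kappa>" if \<kappa>: "\<kappa> \<in> Par d" for \<kappa>
  proof -
    have "(\<Sum>\<kappa>\<in>Par d. (\<beta> \<kappa> + (\<Sum>\<nu>\<in>Par d. \<beta> \<nu> * (if \<kappa> \<in> Dn \<nu> then u \<nu> \<kappa> else 0)) - t \<kappa>) * monomial_sf \<kappa> x) = 0"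
      if x: "fin_supp x" for x
    proof -
      have "P \<nu> x = monomial_sf \<nu> x + (\<Sum>\<kappa>\<in>Par d. (if \<kappa> \<in> Dn \<nu> then u \<nu> \<kappa> else 0) * monomial_sf \<kappa> x)" if \<nu>: "\<nu> \<in> Par d" for \<nu>
      proof -
        have "(\<Sum>\<kappa>\<in>Par d. (if \<kappa> \<in> Dn \<nu> then u \<nu> \<kappa> else 0) * monomial_sf \<kappa> x) = (\<Sum>\<kappa>\<in>Dn \<nu>. u \<nu> \<kappa> * monomial_sf \<kappa> x)"
          using Dn_subset[OF \<nu>] finite_Par by (intro sum.mono_neutral_cong_right) auto
        then show ?thesis using P_triangular[OF Par_D(1)[OF \<nu>] x] by simp
      qed
      then have "(\<Sum>\<nu>\<in>Par d. \<beta> \<nu> * P \<nu> x) = (\<Sum>\<nu>\<in>Par d. \<beta> \<nu> * monomial_sf \<nu> x) +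
          (\<Sum>\<nu>\<in>Par d. \<Sum>\<kappa>\<in>Par d. \<beta> \<nu> * (if \<kappa> \<in> Dn \<nu> then u \<nu> \<kappa> else 0) * monomial_sf \<kappa> x)"
        by (simp add: distrib_left sum.distrib sum_distrib_left mult.assoc)
      also have "(\<Sum>\<nu>\<in>Par d. \<Sum>\<kappa>\<in>Par d. \<beta> \<nu> * (if \<kappa> \<in> Dn \<nu> then u \<nu> \<kappa> else 0) * monomial_sf \<kappa> x) =
          (\<Sum>\<kappa>\<in>Par d. (\<Sum>\<nu>\<in>Par d. \<beta> \<nu> * (if \<kappa> \<in> Dn \<nu> then u \<nu> \<kappa> else 0)) * monomial_sf \<kappa> x)"
        by (subst sum.swap) (simp only: sum_distrib_right)
      finally have "(\<Sum>\<nu>\<in>Par d. \<beta> \<nu> * P \<nu> x) = (\<Sum>\<kappa>\<in>Par d. (\<beta> \<kappa> + (\<Sum>\<nu>\<in>Par d. \<beta> \<nu> * (if \<kappa> \<in> Dn \<nu> then u \<nu> \<kappa> else 0))) * monomial_sf \<kappa> x)"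
        by (simp only: sum.distrib distrib_right)
      moreover have "(\<Sum>\<nu>\<in>Par d. \<beta> \<nu> * P \<nu> x) = (\<Sum>\<kappa>\<in>Par d. t \<kappa> * monomial_sf \<kappa> x)"
        using b_expansion[OF lam x] d by (simp only: \<beta>_def t_def)
      ultimately show ?thesis by (simp only: left_diff_distrib sum_subtractf diff_self)
    qed
    from monomial_sf_indep[OF finite_Par Par_D(1) this \<kappa>] show ?thesis by simp
  qed
  have \<beta>0: "\<beta> \<nu> = 0" if "\<nu> \<in> Par d" "\<not> dle \<nu> lam" for \<nu>
  proof (rule ccontr)
    assume ne: "\<beta> \<nu> \<noteq> 0"
    define B where "B = {\<nu> \<in> Par d. \<not> dle \<nu> lam \<and> \<beta> \<nu> \<noteq> 0}"
    have B: "finite B" "B \<noteq> {}" using finite_Par that ne by (auto simp: B_def)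
    have "Max (hgt ` B) \<in> hgt ` B" using B by (intro Max_in) auto
    then obtain \<mu> where \<mu>: "\<mu> \<in> B" "hgt \<mu> = Max (hgt ` B)" by auto
    have "\<beta> \<kappa> * (if \<mu> \<in> Dn \<kappa> then u \<kappa> \<mu> else 0) = 0" if \<kappa>: "\<kappa> \<in> Par d" for \<kappa>
    proof (cases "\<mu> \<in> Dn \<kappa>")
      case True
      then have dom: "dominance_less \<mu> \<kappa>" by (simp add: Dn_def)
      have "hgt \<mu> < hgt \<kappa>" using \<mu> \<kappa> dom by (intro hgt_strict) (auto simp: B_def)
      then have "\<kappa> \<notin> B" using \<mu>(2) B(1) by (metis Max_ge finite_imageI imageI not_le)
      moreover have "\<not> dle \<kappa> lam" using dom \<mu>(1) dle_trans[of \<mu> \<kappa> lam] by (auto simp: B_def dominance_less_iff)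
      ultimately show ?thesis using \<kappa> by (simp add: B_def)
    qed simp
    then have "(\<Sum>\<kappa>\<in>Par d. \<beta> \<kappa> * (if \<mu> \<in> Dn \<kappa> then u \<kappa> \<mu> else 0)) = 0" by (rule sum.neutral[rule_format])
    then have "\<beta> \<mu> = t \<mu>" using coeff[of \<mu>] \<mu>(1) by (simp add: B_def)
    then show False using t0[of \<mu>] \<mu>(1) by (simp add: B_def)
  qed
  show "dle \<nu> lam" if "\<nu> \<in> Par d" "b \<nu> lam \<noteq> 0"
    using \<beta>0[OF that(1)] that ip_nonzero[OF that(1)] by (auto simp: \<beta>_def)
  have "\<beta> \<kappa> * (if lam \<in> Dn \<kappa> then u \<kappa> lam else 0) = 0" if \<kappa>: "\<kappa> \<in> Par d" for \<kappa>
    using \<beta>0[OF \<kappa>] dle_antisym[of \<kappa> lam] by (auto simp: Dn_def dominance_less_iff)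
  then have "(\<Sum>\<kappa>\<in>Par d. \<beta> \<kappa> * (if lam \<in> Dn \<kappa> then u \<kappa> lam else 0)) = 0" by (rule sum.neutral[rule_format])
  then have "\<beta> lam = cst lam" using coeff[OF pl(2)] tl by simp
  then show "b lam lam = ip lam lam * cst lam" using ip_nonzero[OF pl(2)] by (simp add: \<beta>_def field_simps)
qed

lemma b_sym:
  assumes "is_partition \<nu>" "is_partition lam"
  shows "b \<nu> lam = b lam \<nu>"
proof -
  have ri: "pv \<kappa> (\<lambda>i\<in>I. inverse (y i)) = pv \<kappa> (inv y)" for \<kappa> y
    unfolding pv_def by (intro arg_cong[of _ _ "P \<kappa>"]) (auto simp: ry_def inv_def)
  have rii: "pv \<kappa> (inv (\<lambda>i\<in>I. inverse (y i))) = pv \<kappa> y" for \<kappa> y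
    unfolding pv_def by (intro arg_cong[of _ _ "P \<kappa>"]) (auto simp: ry_def inv_def)
  have "good I (\<lambda>y. pv \<nu> y * pv lam (inv y) * Dl I y)"
    using assms by (intro good_mult good_pv good_pv_inv good_Dl) auto
  from tor_integral_inverse[OF finite_atMost this]
  have "b \<nu> lam = (LINT y|tor I. pv \<nu> (inv y) * pv lam y * Dl I y)"
    unfolding b_def ri rii Dl_inverse[OF finite_atMost] by simp
  then show ?thesis by (simp add: b_def mult_ac)
qed

text \<open>
For equal degrees triangularity together with symmetry leaves only the diagonal. For different degrees
the integrand is homogeneous of nonzero degree.
\<close>

theorem b_orthogonal:
  assumes "part \<nu>" "part lam" "\<nu> \<noteq> lam"
  shows "b \<nu> lam = 0"
proof -
  have p: "is_partition \<nu>" "is_partition lam" using assms by (auto simp: part_def)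
  have big: "b \<nu> lam = 0" if "part_size lam < part_size \<nu>" "is_partition \<nu>" "is_partition lam" for \<nu> lam
  proof -
    have "deg_ge I I (int (part_size \<nu>) + - int (part_size lam) + 0) (\<lambda>y. pv \<nu> y * pv lam (inv y) * Dl I y)"
      using that by (intro deg_ge_mult deg_pv deg_pv_inv Dl_scale)
    moreover have "good I (\<lambda>y. pv \<nu> y * pv lam (inv y) * Dl I y)"
      using that by (intro good_mult good_pv good_pv_inv good_Dl) auto
    ultimately show ?thesis
      unfolding b_def using that(1) by (intro tor_integral_deg_pos[of I I]) auto
  qed
  show ?thesis
  proof (cases "part_size \<nu>" "part_size lam" rule: linorder_cases)
    case less
    then show ?thesis using big[OF less p(2) p(1)] b_sym[OF p] by simp
  next
    case greater
    then show ?thesis using big p by simp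
  next
    case equal
    show ?thesis
    proof (rule ccontr)
      assume ne: "b \<nu> lam \<noteq> 0"
      have "dle \<nu> lam" using b_triangular(1)[OF assms(2) refl, of \<nu>] ne p(1) equal by (simp add: Par_def)
      moreover have "dle lam \<nu>"
        using b_triangular(1)[OF assms(1) refl, of lam] ne b_sym[OF p] p(2) equal by (simp add: Par_def)
      ultimately show False using dle_antisym assms(3) by blast
    qed
  qed
qed

lemma b_norm: "part lam \<Longrightarrow> b lam lam = ip lam lam * cst lam"
  using b_triangular(2) by blast

lemma b_norm_nonzero: "part lam \<Longrightarrow> b lam lam \<noteq> 0"
  using b_norm ip_nonzero[OF Par_self] cst_nonzero by (simp add: part_def)

end

section \<open>Eigenvalues of the dual Baxter operator\<close>

context macdonald_torus
begin

text \<open>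
Adds \<open>g\<close> full columns of height \<open>l + 1\<close> to a diagram.
\<close>

definition sh :: "nat \<Rightarrow> (nat \<Rightarrow> nat) \<Rightarrow> nat \<Rightarrow> nat" where
  "sh g \<nu> = (\<lambda>i. \<nu> i + (if i \<le> l then g else 0))"

lemma sh_Suc: "sh (Suc g) \<nu> = sh 1 (sh g \<nu>)" by (simp add: sh_def fun_eq_iff)

lemma sh_0: "sh 0 \<nu> = \<nu>" by (simp add: sh_def fun_eq_iff)

lemma sh_inj: "sh g \<mu> = sh g \<nu> \<Longrightarrow> \<mu> = \<nu>" by (simp add: sh_def fun_eq_iff)

lemma part_iff: "part \<nu> \<longleftrightarrow> antimono \<nu> \<and> (\<forall>i>l. \<nu> i = 0)"
proof -
  have eq: "supp \<nu> \<subseteq> I \<longleftrightarrow> (\<forall>i>l. \<nu> i = 0)"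
  proof
    assume a: "supp \<nu> \<subseteq> I"
    show "\<forall>i>l. \<nu> i = 0"
    proof (intro allI impI)
      fix i assume "l < i"
      then have "i \<notin> supp \<nu>" using a by auto
      then show "\<nu> i = 0" by (simp add: supp_def)
    qed
  next
    assume a: "\<forall>i>l. \<nu> i = 0"
    show "supp \<nu> \<subseteq> I"
    proof
      fix i assume "i \<in> supp \<nu>"
      then have "\<not> l < i" using a by (auto simp: supp_def)
      then show "i \<in> I" by simp
    qed
  qed
  have "finite (supp \<nu>)" if "supp \<nu> \<subseteq> I" using that finite_subset by blast
  then show ?thesis using eq unfolding part_def is_partition_def supp_def[symmetric] by blast
qed

lemma part_sh: "part \<nu> \<Longrightarrow> part (sh g \<nu>)"
  unfolding part_iff by (auto simp: sh_def antimono_def add_mono)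

lemma part_size_I: "part \<nu> \<Longrightarrow> part_size \<nu> = (\<Sum>i<Suc l. \<nu> i)"
  unfolding part_size_eq lessThan_Suc_atMost by (rule sum_parts) (auto simp: part_def)

lemma dle_sh: assumes "part \<mu>" "part \<nu>" shows "dle (sh g \<mu>) (sh g \<nu>) \<longleftrightarrow> dle \<mu> \<nu>"
  unfolding dle_def part_size_I[OF assms(1)] part_size_I[OF assms(2)]
    part_size_I[OF part_sh[OF assms(1)]] part_size_I[OF part_sh[OF assms(2)]]
  by (simp only: sh_def sum.distrib add_le_cancel_right add_right_cancel)

lemma unshift:
  assumes "part lam" "g \<le> lam l"
  obtains \<nu> where "part \<nu>" "lam = sh g \<nu>"
proof
  have ge: "g \<le> lam i" if "i \<le> l" for i
    using assms that unfolding part_iff antimono_def by (meson order_trans)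
  show "lam = sh g (\<lambda>i. if i \<le> l then lam i - g else 0)"
    using assms(1) ge by (auto simp: sh_def part_iff fun_eq_iff)
  show "part (\<lambda>i. if i \<le> l then lam i - g else 0)"
    using assms(1) by (auto simp: part_iff antimono_def diff_le_mono)
qed

text \<open>
Comparing the partial sums of lengths \<open>l\<close> and \<open>l + 1\<close>, a partition below one with a full first column has
itself a full first column.
\<close>

lemma Dn_sh:
  assumes \<nu>: "part \<nu>" and \<kappa>: "\<kappa> \<in> Dn (sh 1 \<nu>)" "part \<kappa>"
  obtains \<kappa>' where "part \<kappa>'" "\<kappa> = sh 1 \<kappa>'" "\<kappa>' \<in> Dn \<nu>"
proof -
  have d: "dle \<kappa> (sh 1 \<nu>)" "\<kappa> \<noteq> sh 1 \<nu>" using \<kappa> by (auto simp: Dn_def dominance_less_iff)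
  have "(\<Sum>i<Suc l. \<kappa> i) = (\<Sum>i<Suc l. sh 1 \<nu> i)"
    using d(1) part_size_I[OF \<kappa>(2)] part_size_I[OF part_sh[OF \<nu>]] by (simp only: dle_def)
  moreover have "(\<Sum>i<l. \<kappa> i) \<le> (\<Sum>i<l. sh 1 \<nu> i)" using d(1) unfolding dle_def by blast
  moreover have "sh 1 \<nu> l \<ge> 1" by (simp add: sh_def)
  ultimately have "1 \<le> \<kappa> l" by simp
  from unshift[OF \<kappa>(2) this] obtain \<kappa>' where k: "part \<kappa>'" "\<kappa> = sh 1 \<kappa>'" .
  have "dle \<kappa>' \<nu>" using d(1) dle_sh[OF k(1) \<nu>] k(2) by simp
  then have "\<kappa>' \<in> Dn \<nu>" using d(2) k by (auto simp: Dn_def dominance_less_iff part_def)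
  with k show ?thesis by (rule that)
qed

lemma sh_Dn: "part \<mu> \<Longrightarrow> part \<nu> \<Longrightarrow> \<mu> \<in> Dn \<nu> \<Longrightarrow> sh 1 \<mu> \<in> Dn (sh 1 \<nu>)"
  using dle_sh[of \<mu> \<nu> 1] part_sh[of \<mu> 1] sh_inj[of 1 \<mu> \<nu>] by (auto simp: Dn_def dominance_less_iff part_def)

definition Y :: "(nat \<Rightarrow> complex) \<Rightarrow> complex" where "Y y = (\<Prod>i\<in>I. y i)"

lemma Y_nonzero: "(\<And>i. i \<le> l \<Longrightarrow> y i \<noteq> 0) \<Longrightarrow> Y y \<noteq> 0" by (simp add: Y_def)

lemma Y_inv: "Y (inv y) = inverse (Y y)" by (simp add: Y_def inv_def prod_inversef[symmetric] comp_def)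

lemma good_Y_powi: "good I (\<lambda>y. Y y powi m)"
  unfolding Y_def prod_powi[symmetric] by (intro good_prod good_powi_coord)

lemma good_Y: "good I Y" unfolding Y_def by (intro good_prod good_coord)

lemma unit_nonzero: "unit_on I y \<Longrightarrow> Y y \<noteq> 0"
proof (rule Y_nonzero)
  fix i assume "unit_on I y" "i \<le> l"
  then have "norm (y i) = 1" by (simp add: unit_on_def)
  then show "y i \<noteq> 0" by auto
qed

lemma Y_mP:
  assumes "part \<nu>" shows "Y y * mP \<nu> y = mP (sh 1 \<nu>) y"
proof -
  have s: "supp \<nu> \<subseteq> I" "supp (sh 1 \<nu>) \<subseteq> I" using assms part_sh[OF assms, of 1] by (auto simp: part_def)
  let ?M = "image_mset \<nu> (mset_set I)"
  have shM: "image_mset (sh 1 \<alpha>) (mset_set I) = image_mset Suc (image_mset \<alpha> (mset_set I))" for \<alpha>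
    unfolding image_mset.compositionality by (rule image_mset_cong) (simp add: sh_def)
  have "(\<Sum>\<alpha>\<in>RA I ?M. Y y * xmon I y \<alpha>) = (\<Sum>\<beta>\<in>RA I (image_mset Suc ?M). xmon I y \<beta>)"
  proof (rule sum.reindex_bij_witness[of _ "\<lambda>\<beta> i. \<beta> i - 1" "sh 1"], goal_cases)
    case (1 \<alpha>)
    then show ?case by (auto simp: RA_def sh_def fun_eq_iff)
  next
    case (2 \<alpha>)
    then show ?case using shM[of \<alpha>] by (auto simp: RA_def sh_def)
  next
    case (3 \<beta>)
    have "\<beta> i \<noteq> 0" if "i \<in> I" for i
    proof -
      have "\<beta> i \<in># image_mset \<beta> (mset_set I)" using that by simp
      then have "\<beta> i \<in># image_mset Suc ?M" using 3 by (simp only: RA_def mem_Collect_eq)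
      then show ?thesis by auto
    qed
    then show ?case using 3 by (auto simp: RA_def sh_def fun_eq_iff)
  next
    case (4 \<beta>)
    have "image_mset (\<lambda>i. \<beta> i - 1) (mset_set I) = image_mset (\<lambda>n. n - 1) (image_mset \<beta> (mset_set I))"
      by (simp add: image_mset.compositionality comp_def)
    also have "\<dots> = image_mset (\<lambda>n. n - 1) (image_mset Suc ?M)" using 4 by (simp only: RA_def mem_Collect_eq)
    also have "\<dots> = ?M" unfolding image_mset.compositionality by (simp add: comp_def)
    finally show ?case using 4 by (simp add: RA_def)
  next
    case (5 \<alpha>)
    show ?case unfolding Y_def xmon_def prod.distrib[symmetric]
      by (intro prod.cong refl) (simp add: sh_def)
  qed
  then show ?thesis unfolding mP_def Orb_eq_RA[OF finite_atMost s(1)] Orb_eq_RA[OF finite_atMost s(2)] shM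
    by (simp only: sum_distrib_left)
qed

lemma b_zero_left: "is_partition \<nu> \<Longrightarrow> \<not> part \<nu> \<Longrightarrow> b \<nu> lam = 0"
  using pv_zero[of \<nu>] by (simp add: b_def part_def)

text \<open>
By triangularity the difference of the two sides is a combination of \<open>P \<kappa>\<close> for \<open>\<kappa>\<close> below the shifted partition,
and such \<open>\<kappa>\<close> are shifts of smaller partitions \<open>\<kappa>'\<close>. Pairing with \<open>P \<kappa>\<close>, which by induction is \<open>P \<kappa>'\<close> times
the product of the variables, the product cancels against its inverse, and torus orthogonality
shows that every coefficient is zero.
\<close>

theorem Y_pv:
  assumes "part \<nu>" shows "Y y * pv \<nu> y = pv (sh 1 \<nu>) y"
  using assms
proof (induction "hgt \<nu>" arbitrary: \<nu> y rule: less_induct)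
  case less
  note \<nu> = less.prems
  have p: "is_partition \<nu>" "is_partition (sh 1 \<nu>)" using \<nu> part_sh[OF \<nu>] by (auto simp: part_def)
  let ?A = "Dn (sh 1 \<nu>)"
  define D0 where "D0 = {\<mu> \<in> Dn \<nu>. part \<mu>}"
  have fin: "finite ?A" "finite D0" using finite_Dn[OF p(2)] finite_Dn[OF p(1)] by (auto simp: D0_def)
  define c where "c \<kappa> = (\<Sum>\<mu>\<in>D0. if sh 1 \<mu> = \<kappa> then u \<nu> \<mu> else 0) - u (sh 1 \<nu>) \<kappa>" for \<kappa>
  have D: "Y y * pv \<nu> y - pv (sh 1 \<nu>) y = (\<Sum>\<kappa>\<in>?A. c \<kappa> * monomial_sf \<kappa> (ry y))" for y
  proof -
    have "(\<Sum>\<mu>\<in>Dn \<nu>. u \<nu> \<mu> * mP \<mu> y) = (\<Sum>\<mu>\<in>D0. u \<nu> \<mu> * mP \<mu> y)"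
      using finite_Dn[OF p(1)] by (intro sum.mono_neutral_right) (auto simp: D0_def Dn_def part_def mP_zero)
    then have "Y y * pv \<nu> y = Y y * mP \<nu> y + (\<Sum>\<mu>\<in>D0. u \<nu> \<mu> * (Y y * mP \<mu> y))"
      unfolding pv_eq[OF p(1)] by (simp add: distrib_left sum_distrib_left mult_ac)
    also have "\<dots> = mP (sh 1 \<nu>) y + (\<Sum>\<mu>\<in>D0. u \<nu> \<mu> * mP (sh 1 \<mu>) y)"
      using Y_mP[OF \<nu>] Y_mP by (simp add: D0_def)
    also have "(\<Sum>\<mu>\<in>D0. u \<nu> \<mu> * mP (sh 1 \<mu>) y) = (\<Sum>\<mu>\<in>D0. \<Sum>\<kappa>\<in>?A. if sh 1 \<mu> = \<kappa> then u \<nu> \<mu> * mP \<kappa> y else 0)"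
    proof (rule sum.cong[OF refl])
      fix \<mu> assume "\<mu> \<in> D0"
      then have "sh 1 \<mu> \<in> ?A" using sh_Dn \<nu> by (auto simp: D0_def)
      then show "u \<nu> \<mu> * mP (sh 1 \<mu>) y = (\<Sum>\<kappa>\<in>?A. if sh 1 \<mu> = \<kappa> then u \<nu> \<mu> * mP \<kappa> y else 0)"
        using fin(1) by simp
    qed
    also have "\<dots> = (\<Sum>\<kappa>\<in>?A. (\<Sum>\<mu>\<in>D0. if sh 1 \<mu> = \<kappa> then u \<nu> \<mu> else 0) * mP \<kappa> y)"
      by (subst sum.swap) (auto simp: sum_distrib_right intro!: sum.cong)
    finally have "Y y * pv \<nu> y - pv (sh 1 \<nu>) y = (\<Sum>\<kappa>\<in>?A. c \<kappa> * mP \<kappa> y)"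
      unfolding pv_eq[OF p(2)] by (simp add: c_def left_diff_distrib sum_subtractf)
    then show ?thesis using monomial_ry by (simp add: Dn_def)
  qed
  have "\<exists>e. \<forall>x. fin_supp x \<longrightarrow> (\<Sum>\<kappa>\<in>?A. c \<kappa> * monomial_sf \<kappa> x) = (\<Sum>\<kappa>\<in>?A. e \<kappa> * P \<kappa> x)"
    by (rule span_P[OF Dn_subset[OF Par_self[OF p(2)]] Dn_down])
  then obtain e where e: "\<And>x. fin_supp x \<Longrightarrow> (\<Sum>\<kappa>\<in>?A. c \<kappa> * monomial_sf \<kappa> x) = (\<Sum>\<kappa>\<in>?A. e \<kappa> * P \<kappa> x)"
    by blast
  have De: "Y y * pv \<nu> y - pv (sh 1 \<nu>) y = (\<Sum>\<kappa>\<in>?A. e \<kappa> * pv \<kappa> y)" for y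
  proof -
    have "Y y * pv \<nu> y - pv (sh 1 \<nu>) y = (\<Sum>\<kappa>\<in>?A. e \<kappa> * P \<kappa> (ry y))"
      unfolding D by (rule e[OF ry_fin])
    then show ?thesis by (simp only: pv_def)
  qed
  have pA: "is_partition \<kappa>" if "\<kappa> \<in> ?A" for \<kappa> using that by (simp add: Dn_def)
  have e0: "e \<kappa> = 0" if \<kappa>: "\<kappa> \<in> ?A" "part \<kappa>" for \<kappa>
  proof -
    obtain \<kappa>' where k: "part \<kappa>'" "\<kappa> = sh 1 \<kappa>'" "\<kappa>' \<in> Dn \<nu>" using Dn_sh[OF \<nu> \<kappa>] .
    have pk: "is_partition \<kappa>'" using k by (simp add: part_def)
    have "hgt \<kappa>' < hgt \<nu>"
      using k(3) Dn_subset[OF Par_self[OF p(1)]] by (intro hgt_strict[OF _ Par_self[OF p(1)]]) (auto simp: Dn_def)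
    note IH = less.hyps[OF this k(1)]
    let ?w = "\<lambda>y. pv \<kappa> (inv y) * Dl I y"
    have gw: "good I ?w" using pA[OF \<kappa>(1)] by (intro good_mult good_pv_inv good_Dl) auto
    have bw: "b \<mu> \<kappa> = (LINT y|tor I. pv \<mu> y * ?w y)" for \<mu> by (simp add: b_def mult.assoc)
    have g2: "good I (\<lambda>y. e \<mu> * (pv \<mu> y * ?w y))" if "\<mu> \<in> ?A" for \<mu>
      by (intro good_mult good_const good_pv pA that gw)
    have "(LINT y|tor I. (Y y * pv \<nu> y - pv (sh 1 \<nu>) y) * ?w y) = (LINT y|tor I. (\<Sum>\<mu>\<in>?A. e \<mu> * (pv \<mu> y * ?w y)))"
      unfolding De sum_distrib_right by (simp only: mult.assoc)
    also have "\<dots> = (\<Sum>\<mu>\<in>?A. e \<mu> * b \<mu> \<kappa>)"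
      unfolding bw by (subst tor_integral_sum[OF finite_atMost g2], assumption, simp)
    also have "\<dots> = (\<Sum>\<mu>\<in>{\<kappa>}. e \<mu> * b \<mu> \<kappa>)"
    proof (rule sum.mono_neutral_right[OF fin(1)])
      show "\<forall>\<mu>\<in>?A - {\<kappa>}. e \<mu> * b \<mu> \<kappa> = 0"
      proof
        fix \<mu> assume \<mu>: "\<mu> \<in> ?A - {\<kappa>}"
        have "b \<mu> \<kappa> = 0"
          using b_zero_left[of \<mu> \<kappa>] b_orthogonal[of \<mu> \<kappa>] pA[of \<mu>] \<mu> \<kappa>(2) by (cases "part \<mu>") auto
        then show "e \<mu> * b \<mu> \<kappa> = 0" by simp
      qed
    qed (use \<kappa> in auto)
    finally have 1: "(LINT y|tor I. (Y y * pv \<nu> y - pv (sh 1 \<nu>) y) * ?w y) = e \<kappa> * b \<kappa> \<kappa>" by simp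
    have "(LINT y|tor I. (Y y * pv \<nu> y - pv (sh 1 \<nu>) y) * ?w y) =
        (LINT y|tor I. pv \<nu> y * pv \<kappa>' (inv y) * Dl I y - pv (sh 1 \<nu>) y * ?w y)"
    proof (rule tor_integral_cong[OF finite_atMost])
      have "good I (\<lambda>y. Y y * pv \<nu> y + (-1) * pv (sh 1 \<nu>) y)"
        by (intro good_add good_mult good_const good_Y good_pv p)
      then show "good I (\<lambda>y. (Y y * pv \<nu> y - pv (sh 1 \<nu>) y) * ?w y)" by (intro good_mult gw) simp
      have "good I (\<lambda>y. pv \<nu> y * pv \<kappa>' (inv y) * Dl I y + (-1) * (pv (sh 1 \<nu>) y * ?w y))"
        by (intro good_add good_mult[OF good_const] good_mult[OF good_pv gw] good_mult good_pv good_pv_inv p pk good_Dl subset_refl)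
      then show "good I (\<lambda>y. pv \<nu> y * pv \<kappa>' (inv y) * Dl I y - pv (sh 1 \<nu>) y * ?w y)" by simp
      fix y assume "unit_on I y"
      then have "Y y * pv \<kappa> (inv y) = pv \<kappa>' (inv y)"
        using IH[of "inv y"] unit_nonzero[of y] by (simp add: Y_inv k(2) field_simps)
      then have "(Y y * pv \<nu> y) * (pv \<kappa> (inv y) * Dl I y) = pv \<nu> y * pv \<kappa>' (inv y) * Dl I y"
        by (metis mult.assoc mult.commute)
      then show "(Y y * pv \<nu> y - pv (sh 1 \<nu>) y) * ?w y = pv \<nu> y * pv \<kappa>' (inv y) * Dl I y - pv (sh 1 \<nu>) y * ?w y"
        by (simp only: left_diff_distrib)
    qed
    also have "\<dots> = b \<nu> \<kappa>' - b (sh 1 \<nu>) \<kappa>"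
      unfolding bw unfolding b_def
      by (rule Bochner_Integration.integral_diff; rule good_integrable[OF finite_atMost])
         (intro good_mult[OF good_pv gw] good_mult good_pv good_pv_inv p pk good_Dl subset_refl)+
    also have "\<dots> = 0"
      using b_orthogonal[OF \<nu> k(1)] b_orthogonal[OF part_sh[OF \<nu>] \<kappa>(2)] k(3) \<kappa>(1)
        Dn_irrefl[of \<nu>] Dn_irrefl[of "sh 1 \<nu>"] by fastforce
    finally show "e \<kappa> = 0" using 1 b_norm_nonzero[OF \<kappa>(2)] by simp
  qed
  have "(\<Sum>\<kappa>\<in>?A. e \<kappa> * pv \<kappa> y) = 0"
  proof (rule sum.neutral, rule ballI)
    fix \<kappa> assume \<kappa>: "\<kappa> \<in> ?A"
    show "e \<kappa> * pv \<kappa> y = 0"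
      using e0[OF \<kappa>] pv_zero[OF pA[OF \<kappa>]] pA[OF \<kappa>] by (cases "part \<kappa>") (auto simp: part_def)
  qed
  then show ?case using De[of y] by simp
qed

lemma Y_power_pv: "part \<nu> \<Longrightarrow> Y y ^ g * pv \<nu> y = pv (sh g \<nu>) y"
proof (induction g)
  case (Suc g)
  have "Y y ^ Suc g * pv \<nu> y = Y y * pv (sh g \<nu>) y" using Suc by (simp add: mult.assoc)
  also have "\<dots> = pv (sh 1 (sh g \<nu>)) y" by (rule Y_pv[OF part_sh[OF Suc.prems]])
  finally show ?case unfolding sh_Suc[of g \<nu>] .
qed (simp add: sh_0)

text \<open>
The partition \<open>lam - \<gamma>\<close>; for negative \<open>\<gamma>\<close> columns are added.
\<close>

lemma shift_by_int:
  assumes "part lam" "\<gamma> \<le> int (lam l)"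
  shows "\<exists>\<nu>. part \<nu> \<and> \<nu> l = nat (int (lam l) - \<gamma>) \<and>
    (\<forall>y. Y y \<noteq> 0 \<longrightarrow> Y y powi \<gamma> * pv \<nu> y = pv lam y)"
proof (cases "0 \<le> \<gamma>")
  case True
  then have "nat \<gamma> \<le> lam l" using assms(2) by simp
  from unshift[OF assms(1) this] obtain \<nu> where \<nu>: "part \<nu>" "lam = sh (nat \<gamma>) \<nu>" .
  show ?thesis
  proof (intro exI conjI allI impI)
    show "part \<nu>" by (rule \<nu>)
    show "\<nu> l = nat (int (lam l) - \<gamma>)" using \<nu>(2) True by (simp add: sh_def)
    show "Y y powi \<gamma> * pv \<nu> y = pv lam y" for y
      using Y_power_pv[OF \<nu>(1), of y "nat \<gamma>"] True \<nu>(2) by (simp add: power_int_def)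
  qed
next
  case False
  show ?thesis
  proof (intro exI conjI allI impI)
    show "part (sh (nat (- \<gamma>)) lam)" by (rule part_sh[OF assms(1)])
    show "sh (nat (- \<gamma>)) lam l = nat (int (lam l) - \<gamma>)" using False by (simp add: sh_def)
    show "Y y powi \<gamma> * pv (sh (nat (- \<gamma>)) lam) y = pv lam y" if "Y y \<noteq> 0" for y
      using Y_power_pv[OF assms(1), of y "nat (- \<gamma>)", symmetric] False that
      by (simp add: power_int_def field_simps)
  qed
qed

definition bg :: "int \<Rightarrow> (nat \<Rightarrow> nat) \<Rightarrow> (nat \<Rightarrow> nat) \<Rightarrow> complex" where
  "bg \<gamma> \<nu> lam = (LINT y|tor I. pv \<nu> y * (Y y powi \<gamma> * pv lam (inv y) * Dl I y))"

lemma bg_zero_left: "is_partition \<nu> \<Longrightarrow> \<not> part \<nu> \<Longrightarrow> bg \<gamma> \<nu> lam = 0"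
  using pv_zero[of \<nu>] by (simp add: bg_def part_def)

lemma good_weight: "part lam \<Longrightarrow> good I (\<lambda>y. Y y powi \<gamma> * pv lam (inv y) * Dl I y)"
  by (intro good_mult good_Y_powi good_pv_inv good_Dl) (auto simp: part_def)

lemma bg_value:
  assumes lam: "part lam" and \<nu>0: "part \<nu>0" "\<And>y. Y y \<noteq> 0 \<Longrightarrow> Y y powi \<gamma> * pv \<nu>0 y = pv lam y"
    and \<nu>: "is_partition \<nu>"
  shows "bg \<gamma> \<nu> lam = (if \<nu> = \<nu>0 then ip \<nu>0 \<nu>0 * cst \<nu>0 else 0)"
proof -
  have p: "is_partition \<nu>0" using \<nu>0 by (simp add: part_def)
  have "bg \<gamma> \<nu> lam = b \<nu> \<nu>0"
    unfolding bg_def b_def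
  proof (rule tor_integral_cong[OF finite_atMost])
    show "good I (\<lambda>y. pv \<nu> y * (Y y powi \<gamma> * pv lam (inv y) * Dl I y))"
      by (rule good_mult[OF good_pv[OF \<nu>] good_weight[OF lam]])
    show "good I (\<lambda>y. pv \<nu> y * pv \<nu>0 (inv y) * Dl I y)"
      by (intro good_mult good_pv good_pv_inv good_Dl \<nu> p subset_refl)
    fix y assume "unit_on I y"
    then have y: "Y y \<noteq> 0" by (rule unit_nonzero)
    then have "Y y powi \<gamma> * pv lam (inv y) = pv \<nu>0 (inv y)"
      using \<nu>0(2)[of "inv y", symmetric] by (simp add: Y_inv power_int_inverse)
    then show "pv \<nu> y * (Y y powi \<gamma> * pv lam (inv y) * Dl I y) = pv \<nu> y * pv \<nu>0 (inv y) * Dl I y" by simp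
  qed
  then show ?thesis using b_norm[OF \<nu>0(1)] b_orthogonal[OF _ \<nu>0(1), of \<nu>] b_zero_left[OF \<nu>, of \<nu>0]
    by (cases "part \<nu>") auto
qed

text \<open>
Here \<open>\<gamma> > 0\<close>, and the shift of \<open>\<nu>\<close> has last part at least \<open>\<gamma>\<close>, which \<open>lam\<close> does not have.
\<close>

lemma bg_zero:
  assumes lam: "part lam" and \<gamma>: "int (lam l) < \<gamma>" and \<nu>: "is_partition \<nu>"
  shows "bg \<gamma> \<nu> lam = 0"
proof (cases "part \<nu>")
  case True
  have "pv \<nu> y * (Y y powi \<gamma> * pv lam (inv y) * Dl I y) = pv (sh (nat \<gamma>) \<nu>) y * pv lam (inv y) * Dl I y" for y
  proof -
    have "Y y powi \<gamma> = Y y ^ nat \<gamma>" using \<gamma> by (simp add: power_int_def)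
    then show ?thesis by (simp add: Y_power_pv[OF True, symmetric] mult_ac)
  qed
  then have "bg \<gamma> \<nu> lam = b (sh (nat \<gamma>) \<nu>) lam" by (simp only: bg_def b_def)
  also have "\<dots> = 0"
  proof (rule b_orthogonal[OF part_sh[OF True] lam])
    have "lam l < sh (nat \<gamma>) \<nu> l" using \<gamma> by (simp add: sh_def)
    then show "sh (nat \<gamma>) \<nu> \<noteq> lam" by auto
  qed
  finally show ?thesis .
qed (rule bg_zero_left[OF \<nu>])

definition Ker :: "(nat \<Rightarrow> complex) \<Rightarrow> (nat \<Rightarrow> complex) \<Rightarrow> complex" where
  "Ker x y = (\<Prod>i\<le>l. \<Prod>j\<le>l. Gamma_q q (x i * y j))"

text \<open>
The Cauchy series is integrated term by term; the bound on its homogeneous parts is uniform over the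
torus because \<open>\<bar>x\<^sub>i\<bar> < 1\<close>.
\<close>

lemma kernel_integral_sums:
  assumes x: "\<forall>i\<le>l. norm (x i) < 1" and lam: "part lam"
  shows "(\<lambda>d. \<Sum>\<nu>\<in>Par d. pv \<nu> x / ip \<nu> \<nu> * bg \<gamma> \<nu> lam) sums
    (LINT y|tor I. Ker x y * (Y y powi \<gamma> * pv lam (inv y) * Dl I y))"
proof -
  let ?h = "\<lambda>y. Y y powi \<gamma> * pv lam (inv y) * Dl I y"
  note gh = good_weight[OF lam, of \<gamma>]
  obtain H where "\<forall>y. unit_on I y \<longrightarrow> norm (?h y) \<le> H" using gh unfolding good_def by blast
  note H = this[rule_format]
  have rx: "\<And>i. i \<in> I \<Longrightarrow> norm (ry x i) < 1" "\<And>i. i \<notin> I \<Longrightarrow> ry x i = 0" using x by (auto simp: ry_def)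
  from Kp_bound[OF finite_atMost rx finite_atMost[of l]] obtain B where B0: "summable B \<and> (\<forall>d. B d \<ge> 0) \<and>
      (\<forall>y d. unit_on I y \<longrightarrow> (\<forall>i. i \<notin> I \<longrightarrow> y i = 0) \<longrightarrow> norm (Kp q (ry x) y d) \<le> B d)" ..
  then have B: "summable B" "\<And>d. B d \<ge> 0" by simp_all
  have un: "unit_on I (ry y)" if "unit_on I y" for y using that by (simp add: unit_on_def ry_def)
  have gK: "good I (\<lambda>y. Ker x y)" unfolding Ker_def using x by (intro good_prod good_Gamma) auto
  have "(\<lambda>d. LINT y|tor I. Kp q (ry x) (ry y) d * ?h y) sums (LINT y|tor I. Ker x y * ?h y)"
  proof (rule tor_integral_series[OF finite_atMost])
    show "good I (\<lambda>y. Kp q (ry x) (ry y) d * ?h y)" for d by (rule good_mult[OF good_Kp[OF ry_fin] gh])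
    show "good I (\<lambda>y. Ker x y * ?h y)" by (rule good_mult[OF gK gh])
    show "summable (\<lambda>d. B d * H)" using B(1) by (rule summable_mult2)
    fix y assume y: "unit_on I y"
    have "norm (Kp q (ry x) (ry y) d) \<le> B d" for d 
      by (rule B0[THEN conjunct2, THEN conjunct2, rule_format, OF un[OF y] ry_zero])
    then show "norm (Kp q (ry x) (ry y) d * ?h y) \<le> B d * H" for d
      unfolding norm_mult[of "Kp q (ry x) (ry y) d"] by (rule mult_mono[OF _ H[OF y] B(2) norm_ge_zero])
    have "(\<lambda>d. Kp q (ry x) (ry y) d) sums (\<Prod>i\<in>I. \<Prod>j\<in>I. Gamma_q q (ry x i * ry y j))"
      by (rule kernel_sums[OF finite_atMost rx finite_atMost un[OF y] ry_zero])
    also have "(\<Prod>i\<in>I. \<Prod>j\<in>I. Gamma_q q (ry x i * ry y j)) = Ker x y"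
      unfolding Ker_def by (intro prod.cong refl) (simp add: ry_def)
    finally show "(\<lambda>d. Kp q (ry x) (ry y) d * ?h y) sums (Ker x y * ?h y)" by (rule sums_mult2)
  qed
  moreover have "(LINT y|tor I. Kp q (ry x) (ry y) d * ?h y) = (\<Sum>\<nu>\<in>Par d. pv \<nu> x / ip \<nu> \<nu> * bg \<gamma> \<nu> lam)" for d
  proof -
    have g: "good I (\<lambda>y. (pv \<nu> x / ip \<nu> \<nu>) * (pv \<nu> y * ?h y))" if "\<nu> \<in> Par d" for \<nu>
      by (intro good_mult[OF good_const] good_mult[OF good_pv gh] Par_D(1)[OF that])
    have "(LINT y|tor I. Kp q (ry x) (ry y) d * ?h y) = (LINT y|tor I. (\<Sum>\<nu>\<in>Par d. (pv \<nu> x / ip \<nu> \<nu>) * (pv \<nu> y * ?h y)))"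
      unfolding cauchy_identity[OF ry_fin ry_fin] pv_def[symmetric] sum_distrib_right
      by (intro Bochner_Integration.integral_cong refl sum.cong) simp
    also have "\<dots> = (\<Sum>\<nu>\<in>Par d. pv \<nu> x / ip \<nu> \<nu> * bg \<gamma> \<nu> lam)"
      unfolding bg_def by (subst tor_integral_sum[OF finite_atMost g], assumption, simp)
    finally show ?thesis .
  qed
  ultimately show ?thesis by simp
qed

lemma dual_baxter_eq:
  "dual_baxter l q \<gamma> (q_whittaker l q P lam) x =
    (\<Prod>i\<le>l. x i) powi \<gamma> / Delta_q l q lam * (LINT y|tor I. Ker x y * (Y y powi \<gamma> * pv lam (inv y) * Dl I y))"
proof -
  have "dual_baxter l q \<gamma> (q_whittaker l q P lam) x =
      (LINT y|tor I. ((\<Prod>i\<le>l. x i) powi \<gamma> / Delta_q l q lam) * (Ker x y * (Y y powi \<gamma> * pv lam (inv y) * Dl I y)))"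
    unfolding dual_baxter_def torus_haar_eq
  proof (rule Bochner_Integration.integral_cong[OF refl])
    fix y
    have "(\<Prod>i\<le>l. (x i * y i) powi \<gamma>) = (\<Prod>i\<le>l. x i) powi \<gamma> * Y y powi \<gamma>"
      by (simp add: prod_powi prod.distrib power_int_mult_distrib Y_def)
    moreover have "q_whittaker l q P lam (\<lambda>i. inverse (y i)) = pv lam (inv y) / Delta_q l q lam"
      by (simp add: q_whittaker_def pv_def ry_def inv_def)
    ultimately show "(\<Prod>i\<le>l. (x i * y i) powi \<gamma>) * (\<Prod>i\<le>l. \<Prod>j\<le>l. Gamma_q q (x i * y j)) *
        Delta_dual l q y * q_whittaker l q P lam (\<lambda>i. inverse (y i)) =
      ((\<Prod>i\<le>l. x i) powi \<gamma> / Delta_q l q lam) * (Ker x y * (Y y powi \<gamma> * pv lam (inv y) * Dl I y))"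
      unfolding Ker_def Delta_dual_eq by (simp only: times_divide_eq_left times_divide_eq_right mult_ac)
  qed
  then show ?thesis by simp
qed

text \<open>
Exactly one partition contributes to the Cauchy series, the shift of \<open>lam\<close> by \<open>- \<gamma>\<close>. Its Macdonald norm
cancels, and \<open>cst\<close> of the shifted partition is the eigenvalue.
\<close>

theorem dual_baxter_eigenvalue:
  assumes lam: "part lam" and x: "\<forall>i\<le>l. 0 < norm (x i) \<and> norm (x i) < 1"
  shows "\<gamma> \<le> int (lam l) \<Longrightarrow> dual_baxter l q \<gamma> (q_whittaker l q P lam) x =
      fact (Suc l) * Gamma_q q q ^ l * L_dual l q \<gamma> lam * q_whittaker l q P lam x"
    and "int (lam l) < \<gamma> \<Longrightarrow> dual_baxter l q \<gamma> (q_whittaker l q P lam) x = 0"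
proof -
  have x1: "\<forall>i\<le>l. norm (x i) < 1" using x by blast
  note S = kernel_integral_sums[OF x1 lam, of \<gamma>]
  {
    assume \<gamma>: "\<gamma> \<le> int (lam l)"
    from shift_by_int[OF lam \<gamma>] obtain \<nu>0 where n0: "part \<nu>0 \<and> \<nu>0 l = nat (int (lam l) - \<gamma>) \<and>
        (\<forall>y. Y y \<noteq> 0 \<longrightarrow> Y y powi \<gamma> * pv \<nu>0 y = pv lam y)" ..
    have \<nu>0: "part \<nu>0" "\<nu>0 l = nat (int (lam l) - \<gamma>)" using n0 by simp_all
    have shift: "Y y powi \<gamma> * pv \<nu>0 y = pv lam y" if "Y y \<noteq> 0" for y
      by (rule n0[THEN conjunct2, THEN conjunct2, rule_format, OF that])
    let ?d = "part_size \<nu>0"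
    have p0: "is_partition \<nu>0" using \<nu>0(1) by (simp add: part_def)
    have m0: "\<nu>0 \<in> Par ?d" by (rule Par_self[OF p0])
    have v: "(\<Sum>\<nu>\<in>Par d. pv \<nu> x / ip \<nu> \<nu> * bg \<gamma> \<nu> lam) = (if d = ?d then pv \<nu>0 x * cst \<nu>0 else 0)" for d
    proof -
      have "(\<Sum>\<nu>\<in>Par d. pv \<nu> x / ip \<nu> \<nu> * bg \<gamma> \<nu> lam) = (\<Sum>\<nu>\<in>Par d. if \<nu> = \<nu>0 then pv \<nu>0 x * cst \<nu>0 else 0)"
      proof (rule sum.cong[OF refl])
        fix \<nu> assume "\<nu> \<in> Par d"
        then have "is_partition \<nu>" by (rule Par_D(1))
        from bg_value[OF lam \<nu>0(1) shift this]
        show "pv \<nu> x / ip \<nu> \<nu> * bg \<gamma> \<nu> lam = (if \<nu> = \<nu>0 then pv \<nu>0 x * cst \<nu>0 else 0)"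
          using ip_nonzero[OF m0] by (cases "\<nu> = \<nu>0") simp_all
      qed
      also have "\<dots> = (if \<nu>0 \<in> Par d then pv \<nu>0 x * cst \<nu>0 else 0)" using finite_Par[of d] by simp
      also have "\<nu>0 \<in> Par d \<longleftrightarrow> d = ?d" using p0 by (auto simp: Par_def)
      finally show ?thesis .
    qed
    have int: "(LINT y|tor I. Ker x y * (Y y powi \<gamma> * pv lam (inv y) * Dl I y)) = pv \<nu>0 x * cst \<nu>0"
    proof (rule sums_unique2[OF S])
      show "(\<lambda>d. \<Sum>\<nu>\<in>Par d. pv \<nu> x / ip \<nu> \<nu> * bg \<gamma> \<nu> lam) sums (pv \<nu>0 x * cst \<nu>0)"
        unfolding v by (rule sums_single)
    qed
    have "Y x \<noteq> 0" using x by (intro Y_nonzero) auto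
    then have px: "Y x powi \<gamma> * pv \<nu>0 x = pv lam x" by (rule shift)
    have c: "cst \<nu>0 = fact (Suc l) * Gamma_q q q ^ l * L_dual l q \<gamma> lam"
      by (simp add: cst_def L_dual_def q_fact_eq_qp \<nu>0(2) Gamma_q_eq power_divide del: fact_Suc)
    have "dual_baxter l q \<gamma> (q_whittaker l q P lam) x = (Y x powi \<gamma> * pv \<nu>0 x) / Delta_q l q lam * cst \<nu>0"
      unfolding dual_baxter_eq Y_def[of x, symmetric] int by simp
    also have "\<dots> = cst \<nu>0 * q_whittaker l q P lam x"
      unfolding px by (simp add: q_whittaker_def pv_def ry_def)
    finally show "dual_baxter l q \<gamma> (q_whittaker l q P lam) x =
        fact (Suc l) * Gamma_q q q ^ l * L_dual l q \<gamma> lam * q_whittaker l q P lam x" unfolding c .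
  next
    assume \<gamma>: "int (lam l) < \<gamma>"
    have "(\<Sum>\<nu>\<in>Par d. pv \<nu> x / ip \<nu> \<nu> * bg \<gamma> \<nu> lam) = 0" for d
      using bg_zero[OF lam \<gamma> Par_D(1)] by (intro sum.neutral) auto
    then have "(\<lambda>d. 0) sums (LINT y|tor I. Ker x y * (Y y powi \<gamma> * pv lam (inv y) * Dl I y))" using S by simp
    then have "(LINT y|tor I. Ker x y * (Y y powi \<gamma> * pv lam (inv y) * Dl I y)) = 0" by (simp add: sums_iff)
    then show "dual_baxter l q \<gamma> (q_whittaker l q P lam) x = 0" unfolding dual_baxter_eq by simp
  }
qed

end

theorem theorem2p4:
  fixes l :: nat and q :: complex and \<gamma> :: int
  assumes "norm q < 1"
  shows
    "(\<forall>P lam x. macdonald_family q 0 P \<longrightarrow>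
        is_partition lam \<longrightarrow> (\<forall>i>l. lam i = 0) \<longrightarrow>
        (\<forall>i\<le>l. 0 < norm (x i) \<and> norm (x i) < 1) \<longrightarrow>
        (\<gamma> \<le> int (lam l) \<longrightarrow>
           dual_baxter l q \<gamma> (q_whittaker l q P lam) x =
             fact (Suc l) * Gamma_q q q ^ l * L_dual l q \<gamma> lam * q_whittaker l q P lam x) \<and>
        (\<gamma> > int (lam l) \<longrightarrow>
           dual_baxter l q \<gamma> (q_whittaker l q P lam) x = 0))
     \<and>
     (q \<noteq> 0 \<longrightarrow>
        (\<forall>F x. symmetric_poly l F \<longrightarrow>
           (\<forall>i\<le>l. 0 < norm (x i) \<and> norm (x i) < 1) \<longrightarrow> inj_on x {..l} \<longrightarrow>
           dual_baxter l q \<gamma> F x - q powi (- \<gamma>) * H1_dual l q (dual_baxter l q \<gamma> F) x =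
             dual_baxter l q (\<gamma> + 1) F x))"
proof -
  interpret q_disc q by unfold_locales (rule assms)
  have "(\<gamma> \<le> int (lam l) \<longrightarrow> dual_baxter l q \<gamma> (q_whittaker l q P lam) x =
          fact (Suc l) * Gamma_q q q ^ l * L_dual l q \<gamma> lam * q_whittaker l q P lam x) \<and>
        (\<gamma> > int (lam l) \<longrightarrow> dual_baxter l q \<gamma> (q_whittaker l q P lam) x = 0)"
    if "macdonald_family q 0 P" "is_partition lam" "\<forall>i>l. lam i = 0"
      "\<forall>i\<le>l. 0 < norm (x i) \<and> norm (x i) < 1" for P lam x
  proof -
    interpret macdonald_torus q P l by unfold_locales (rule that(1))
    have "part lam" using that(2,3) by (simp add: part_iff is_partition_def)
    from dual_baxter_eigenvalue[OF this that(4), of \<gamma>] show ?thesis by blast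
  qed
  then show ?thesis using dual_baxter_difference_equation by blast
qed

end
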